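(* Let $\mathfrak{I}:\mathbb{X}_n\times\mathbb{X}_n\to\mathbb{R}$ be a continuous $n$-symmetric $\mathrm{PDI}_n$ kernel that is zero on the extended diagonal $\Delta^n_{n-1}$. Then for every $\lambda\in\mathfrak{M}_n[\mathfrak{I}]$ and for whichever $x_{\vec 0}\in\mathbb{X}_n$ is used to define $K^{\mathfrak{I}}$, $$\int_{\mathbb{X}_n}\int_{\mathbb{X}_n}(-1)^n\mathfrak{I}(u,v)\,d\lambda(u)d\lambda(v)=\int_{\mathbb{X}_n}\int_{\mathbb{X}_n}K^{\mathfrak{I}}(u,v)\,d\lambda(u)d\lambda(v)=\langle K^{\mathfrak{I}}_\lambda,K^{\mathfrak{I}}_\lambda\rangle_{\mathcal{H}_{\mathfrak{I}}}\ge0.$$ In particular, for any fixed $P\in\mathcal{P}[\mathfrak{I}]$ the bilinear function $$(\lambda,\eta)\in\mathfrak{M}_n[\mathfrak{I},P]\times\mathfrak{M}_n[\mathfrak{I},P]\mapsto\int_{\mathbb{X}_n}\int_{\mathbb{X}_n}(-1)^n\mathfrak{I}(u,v)\,d\lambda(u)d\eta(v)\in\mathbb{R}$$ is well defined and is a semi-inner product, because $$\int_{\mathbb{X}_n}\int_{\mathbb{X}_n}(-1)^n\mathfrak{I}(u,v)\,d\lambda(u)d\eta(v)=\int_{\mathbb{X}_n}\int_{\mathbb{X}_n}K^{\mathfrak{I}}(u,v)\,d\lambda(u)d\eta(v)=\langle K^{\mathfrak{I}}_\lambda,K^{\mathfrak{I}}_\eta\rangle_{\mathcal{H}_{\mathfrak{I}}}$$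 for whichever $x_{\vec 0}\in\mathbb{X}_n$ is used to define $K^{\mathfrak{I}}$.
   Context: $X_1,\dots,X_n$ are nonempty Hausdorff spaces, $\mathbb{X}_n=\prod_{i=1}^nX_i$, $\mathbb{X}_F=\prod_{i\in F}X_i$. For points $x_{\vec a}=(x_1^a,\dots,x_n^a)$ and a multi-index $\alpha$, $x_\alpha=(x_1^{\alpha_1},\dots,x_n^{\alpha_n})$; for $F\subset\{1,\dots,n\}$, $x_{\vec a_F+\vec b_{F^c}}$ is the point with coordinates $x_i^a$ for $i\in F$ and $x_i^b$ for $i\notin F$. $\mathfrak{M}(\mathbb{X}_n)$: real signed regular Radon measures of finite variation. $\mathcal{M}(\mathbb{X}_n)$: finitely supported real signed measures. $\mathcal{M}_n(\mathbb{X}_n)$ and $\mathfrak{M}_n(\mathbb{X}_n)$ are the subspaces of those $\mu$ with $\mu(\prod_iA_i)=0$ for all (measurable) $A_i\subset X_i$ with $A_i=X_i$ for at least one $i$. A kernel $\mathfrak{I}$ is $n$-symmetric if $\mathfrak{I}(x_{\vec 1},x_{\vec 2})=\mathfrak{I}(x_\alpha,x_{\vec 3-\alpha})$ for all $\alpha\in\{1,2\}^n$ and all points, where $\vec 3-\alpha=(3-\alpha_i)_i$. It is $\mathrm{PDI}_n$ if it is $n$-symmetric and $\iint(-1)^n\mathfrak{I}\,d\mu\,d\mu\ge0$ for all $\mu\in\mathcal{M}_n(\mathbb{X}_n)$. $\Delta^n_{n-1}$ is the set of pairs of points of $\mathbb{X}_n$ agreeing in at least one coordinate. For fixed $x_{\vec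 0}\in\mathbb{X}_n$, $\mu_n^n[x,x_{\vec 0}]=\bigotimes_{i=1}^n(\delta_{x_i}-\delta_{x_i^0})$ and $K^{\mathfrak{I}}(x,y)=\iint(-1)^n\mathfrak{I}(u,v)\,d\mu_n^n[x,x_{\vec 0}](u)\,d\mu_n^n[y,x_{\vec 0}](v)$; this is a positive definite kernel with reproducing kernel Hilbert space $\mathcal{H}_{\mathfrak{I}}$. Put $K^{\mathfrak{I}}_\lambda(z)=\int K^{\mathfrak{I}}(x,z)\,d\lambda(x)$, an element of $\mathcal{H}_{\mathfrak{I}}$ when $\sqrt{K^{\mathfrak{I}}(x,x)}\in L^1(|\lambda|)$. For a partition $\pi=\{F_1,\dots,F_\ell\}$ of a set $G\subset\{1,\dots,n\}$ and a nonnegative measure $\nu$, $\nu_F$ denotes the marginal of $\nu$ on $\mathbb{X}_F$ and $\nu_\pi=\bigotimes_j\nu_{F_j}$. A function $T:\mathbb{X}_n\times\mathbb{X}_n\to\mathbb{R}$ is FIP (fully integrable by partitions) with respect to $\mu\times\mu$ if $\int|T(x_{\vec 1_F+\vec 2_{F^c}},y_{\vec 1_G+\vec 2_{G^c}})|\,d|\mu|_\pi(x_{\vec 1})\,d|\mu|_\sigma(y_{\vec 1})<\infty$ for all $x_{\vec 2},y_{\vec 2}\in\mathbb{X}_n$, all subsets $F,G$ and all partitions $\pi,\sigma$ of $\{1,\dots,n\}$. $\mathfrak{M}[\mathfrak{I}]$ is the set of $\mu\in\mathfrak{M}(\mathbb{X}_n)$ such that $\mathfrak{I}$ is FIP with respect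 to $\mu\times\mu$; $\mathcal{P}[\mathfrak{I}]$ is the set of probabilities in $\mathfrak{M}[\mathfrak{I}]$; $\mathfrak{M}_n[\mathfrak{I}]=\mathfrak{M}[\mathfrak{I}]\cap\mathfrak{M}_n(\mathbb{X}_n)$. A measure $\mu$ is marginally delimited by a probability $P$ if there is $M\ge1$ such that for every $F\subset\{1,\dots,n\}$ with $|F|\le n-1$ the measure $M\sum_{\pi}(P_F)_\pi-|\mu|_F$ (sum over all partitions $\pi$ of $F$) is nonnegative. For $P\in\mathcal{P}[\mathfrak{I}]$, $\mathfrak{M}_n[\mathfrak{I},P]$ is the set of $\mu\in\mathfrak{M}_n[\mathfrak{I}]$ that are marginally delimited by $P$ (it is a vector space). A semi-inner product is a symmetric positive semidefinite bilinear form. *)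

theory Defs
  imports "HOL-Analysis.Analysis"
begin

text \<open>
  The spaces are abstract topologies \<open>X i\<close> for \<open>i \<in> {1..n}\<close>, all carried by subsets of one type
  (harmless: a family of sets embeds into its disjoint union). A point of a product over a set
  \<open>F\<close> of indices is an extensional function on \<open>F\<close>.
\<close>

definition borel_alg :: "'p topology \<Rightarrow> 'p measure" where
  "borel_alg T = sigma (topspace T) {U. openin T U}"

definition radon_measure :: "'p topology \<Rightarrow> 'p measure \<Rightarrow> bool" where
  "radon_measure T M \<longleftrightarrow>
     sets M = sets (borel_alg T) \<and>
     (\<forall>C. compactin T C \<longrightarrow> emeasure M C < \<infinity>) \<and>
     (\<forall>A\<in>sets (borel_alg T). emeasure M A = (SUP C\<in>{C. compactin T C \<and> C \<subseteq> A}. emeasure M C)) \<and>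
     (\<forall>A\<in>sets (borel_alg T). emeasure M A = (INF U\<in>{U. openin T U \<and> A \<subseteq> U}. emeasure M U))"


section \<open>Signed measures\<close>

text \<open>
  A signed measure is a set function, normalised to be 0 on sets that are not Borel, so that
  signed measures form a vector space under pointwise operations.
\<close>

definition signed_measure :: "'p topology \<Rightarrow> ('p set \<Rightarrow> real) \<Rightarrow> bool" where
  "signed_measure T \<mu> \<longleftrightarrow>
     \<mu> {} = 0 \<and>
     (\<forall>A. range A \<subseteq> sets (borel_alg T) \<and> disjoint_family A \<longrightarrow>
        (\<lambda>k::nat. \<mu> (A k)) sums \<mu> (\<Union>k. A k)) \<and>
     (\<forall>A. A \<notin> sets (borel_alg T) \<longrightarrow> \<mu> A = 0)"

definition variation :: "'p topology \<Rightarrow> ('p set \<Rightarrow> real) \<Rightarrow> 'p measure" where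
  "variation T \<mu> = measure_of (topspace T) (sets (borel_alg T))
     (\<lambda>A. SUP C\<in>{C. finite C \<and> C \<subseteq> sets (borel_alg T) \<and> partition_on A C}.
            \<Sum>B\<in>C. ennreal \<bar>\<mu> B\<bar>)"

definition pos_part :: "'p topology \<Rightarrow> ('p set \<Rightarrow> real) \<Rightarrow> 'p measure" where
  "pos_part T \<mu> = measure_of (topspace T) (sets (borel_alg T))
     (\<lambda>A. ennreal ((measure (variation T \<mu>) A + \<mu> A) / 2))"

definition neg_part :: "'p topology \<Rightarrow> ('p set \<Rightarrow> real) \<Rightarrow> 'p measure" where
  "neg_part T \<mu> = measure_of (topspace T) (sets (borel_alg T))
     (\<lambda>A. ennreal ((measure (variation T \<mu>) A - \<mu> A) / 2))"

definition signed_integral :: "'p topology \<Rightarrow> ('p set \<Rightarrow> real) \<Rightarrow> ('p \<Rightarrow> real) \<Rightarrow> real" where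
  "signed_integral T \<mu> f = integral\<^sup>L (pos_part T \<mu>) f - integral\<^sup>L (neg_part T \<mu>) f"

text \<open>\<open>double_integral T f \<mu> \<eta>\<close> integrates the first argument of \<open>f\<close> against \<open>\<mu>\<close>, the second against \<open>\<eta>\<close>.\<close>

definition double_integral ::
  "'p topology \<Rightarrow> ('p \<Rightarrow> 'p \<Rightarrow> real) \<Rightarrow> ('p set \<Rightarrow> real) \<Rightarrow> ('p set \<Rightarrow> real) \<Rightarrow> real" where
  "double_integral T f \<mu> \<eta> = signed_integral T \<eta> (\<lambda>v. signed_integral T \<mu> (\<lambda>u. f u v))"

text \<open>
  Measurability refers to the Borel sets of the product topology, which may be more than the
  product of the Borel algebras.
\<close>

definition double_integrable ::
  "'p topology \<Rightarrow> ('p \<Rightarrow> 'p \<Rightarrow> real) \<Rightarrow> ('p set \<Rightarrow> real) \<Rightarrow> ('p set \<Rightarrow> real) \<Rightarrow> bool" where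
  "double_integrable T f \<mu> \<eta> \<longleftrightarrow>
     (\<lambda>(u, v). f u v) \<in> borel_measurable (borel_alg (prod_topology T T)) \<and>
     (\<integral>\<^sup>+v. (\<integral>\<^sup>+u. ennreal \<bar>f u v\<bar> \<partial>variation T \<mu>) \<partial>variation T \<eta>) < \<infinity>"

definition radon_signed :: "'p topology \<Rightarrow> ('p set \<Rightarrow> real) set" where
  "radon_signed T = {\<mu>. signed_measure T \<mu> \<and>
     emeasure (variation T \<mu>) (topspace T) < \<infinity> \<and> radon_measure T (variation T \<mu>)}"


section \<open>Product spaces, marginals and products of marginals\<close>

abbreviation prod_space :: "(nat \<Rightarrow> 'a topology) \<Rightarrow> nat \<Rightarrow> (nat \<Rightarrow> 'a) topology" where
  "prod_space X n \<equiv> product_topology X {1..n}"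

text \<open>The point with the coordinates of \<open>a\<close> on \<open>F\<close> and those of \<open>b\<close> elsewhere.\<close>

definition mix :: "nat set \<Rightarrow> (nat \<Rightarrow> 'a) \<Rightarrow> (nat \<Rightarrow> 'a) \<Rightarrow> nat \<Rightarrow> 'a" where
  "mix F a b = (\<lambda>i. if i \<in> F then a i else b i)"

definition marginal :: "(nat \<Rightarrow> 'a topology) \<Rightarrow> nat set \<Rightarrow> (nat \<Rightarrow> 'a) measure \<Rightarrow> (nat \<Rightarrow> 'a) measure" where
  "marginal X F \<nu> = distr \<nu> (borel_alg (product_topology X F)) (\<lambda>x. restrict x F)"

text \<open>
  The product of finite Radon measures \<open>N F\<close> (\<open>F \<in> \<pi>\<close>, pairwise disjoint) is the unique Radon
  measure on the Borel sets of the product topology with the prescribed values on boxes. The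
  library's \<open>PiM\<close> lives only on the product of the Borel algebras, which in general is too small
  for continuous functions to be measurable.
\<close>

definition radon_product ::
  "(nat \<Rightarrow> 'a topology) \<Rightarrow> nat set set \<Rightarrow> (nat set \<Rightarrow> (nat \<Rightarrow> 'a) measure) \<Rightarrow> (nat \<Rightarrow> 'a) measure" where
  "radon_product X \<pi> N = (THE Q.
     radon_measure (product_topology X (\<Union>\<pi>)) Q \<and>
     (\<forall>B. (\<forall>F\<in>\<pi>. B F \<in> sets (borel_alg (product_topology X F))) \<longrightarrow>
        emeasure Q {x \<in> topspace (product_topology X (\<Union>\<pi>)). \<forall>F\<in>\<pi>. restrict x F \<in> B F} =
        (\<Prod>F\<in>\<pi>. emeasure (N F) (B F))))"

definition marginal_product ::
  "(nat \<Rightarrow> 'a topology) \<Rightarrow> nat set set \<Rightarrow> (nat \<Rightarrow> 'a) measure \<Rightarrow> (nat \<Rightarrow> 'a) measure" where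
  "marginal_product X \<pi> \<nu> = radon_product X \<pi> (\<lambda>F. marginal X F \<nu>)"


section \<open>Kernels\<close>

text \<open>
  A multi-index \<open>\<alpha> \<in> {1,2}\<^sup>n\<close> is encoded by \<open>F = {i. \<alpha>\<^sub>i = 1}\<close>; then \<open>x\<^sub>\<alpha> = mix F x y\<close> and
  \<open>x\<^sub>3\<^sub>-\<^sub>\<alpha> = mix F y x\<close> for the pair of points \<open>(x, y)\<close>.
\<close>

definition n_symmetric ::
  "(nat \<Rightarrow> 'a topology) \<Rightarrow> nat \<Rightarrow> ((nat \<Rightarrow> 'a) \<Rightarrow> (nat \<Rightarrow> 'a) \<Rightarrow> real) \<Rightarrow> bool" where
  "n_symmetric X n J \<longleftrightarrow>
     (\<forall>x\<in>topspace (prod_space X n). \<forall>y\<in>topspace (prod_space X n). \<forall>F\<subseteq>{1..n}.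
        J x y = J (mix F x y) (mix F y x))"

text \<open>
  A finitely supported signed measure is given by its point masses, i.e. by a real function of
  finite support.
\<close>

definition fin_Mn :: "(nat \<Rightarrow> 'a topology) \<Rightarrow> nat \<Rightarrow> ((nat \<Rightarrow> 'a) \<Rightarrow> real) set" where
  "fin_Mn X n = {c. finite {x. c x \<noteq> 0} \<and> {x. c x \<noteq> 0} \<subseteq> topspace (prod_space X n) \<and>
     (\<forall>A. (\<forall>i\<in>{1..n}. A i \<subseteq> topspace (X i)) \<and> (\<exists>i\<in>{1..n}. A i = topspace (X i)) \<longrightarrow>
        (\<Sum>x | c x \<noteq> 0 \<and> x \<in> PiE {1..n} A. c x) = 0)}"

definition fin_double_integral :: "('p \<Rightarrow> 'p \<Rightarrow> real) \<Rightarrow> ('p \<Rightarrow> real) \<Rightarrow> ('p \<Rightarrow> real) \<Rightarrow> real" where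
  "fin_double_integral f c d = (\<Sum>v | d v \<noteq> 0. (\<Sum>u | c u \<noteq> 0. f u v * c u) * d v)"

definition PDI ::
  "(nat \<Rightarrow> 'a topology) \<Rightarrow> nat \<Rightarrow> ((nat \<Rightarrow> 'a) \<Rightarrow> (nat \<Rightarrow> 'a) \<Rightarrow> real) \<Rightarrow> bool" where
  "PDI X n J \<longleftrightarrow> n_symmetric X n J \<and>
     (\<forall>c\<in>fin_Mn X n. fin_double_integral (\<lambda>u v. (-1) ^ n * J u v) c c \<ge> 0)"

text \<open>Point masses of the product over \<open>i\<close> of \<open>\<delta>\<^bsub>x i\<^esub> - \<delta>\<^bsub>x0 i\<^esub>\<close>.\<close>

definition delta_product :: "nat \<Rightarrow> (nat \<Rightarrow> 'a) \<Rightarrow> (nat \<Rightarrow> 'a) \<Rightarrow> (nat \<Rightarrow> 'a) \<Rightarrow> real" where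
  "delta_product n x x0 = (\<lambda>u. if u \<in> extensional {1..n}
     then \<Prod>i=1..n. of_bool (u i = x i) - of_bool (u i = x0 i) else 0)"

definition kernel_K ::
  "nat \<Rightarrow> ((nat \<Rightarrow> 'a) \<Rightarrow> (nat \<Rightarrow> 'a) \<Rightarrow> real) \<Rightarrow> (nat \<Rightarrow> 'a) \<Rightarrow> (nat \<Rightarrow> 'a) \<Rightarrow> (nat \<Rightarrow> 'a) \<Rightarrow> real" where
  "kernel_K n J x0 x y =
     fin_double_integral (\<lambda>u v. (-1) ^ n * J u v) (delta_product n x x0) (delta_product n y x0)"

text \<open>Functions on the product space are represented by their extension by 0.\<close>

definition kernel_embedding ::
  "'p topology \<Rightarrow> ('p \<Rightarrow> 'p \<Rightarrow> real) \<Rightarrow> ('p set \<Rightarrow> real) \<Rightarrow> 'p \<Rightarrow> real" where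
  "kernel_embedding T K \<mu> =
     (\<lambda>z. if z \<in> topspace T then signed_integral T \<mu> (\<lambda>x. K x z) else 0)"


section \<open>Semi-inner products and reproducing kernel Hilbert spaces\<close>

definition function_subspace :: "('b \<Rightarrow> real) set \<Rightarrow> bool" where
  "function_subspace V \<longleftrightarrow> (\<lambda>_. 0) \<in> V \<and>
     (\<forall>f\<in>V. \<forall>g\<in>V. (\<lambda>x. f x + g x) \<in> V) \<and> (\<forall>f\<in>V. \<forall>a. (\<lambda>x. a * f x) \<in> V)"

definition semi_inner_product_on ::
  "('b \<Rightarrow> real) set \<Rightarrow> (('b \<Rightarrow> real) \<Rightarrow> ('b \<Rightarrow> real) \<Rightarrow> real) \<Rightarrow> bool" where
  "semi_inner_product_on V B \<longleftrightarrow> function_subspace V \<and>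
     (\<forall>f\<in>V. \<forall>g\<in>V. B f g = B g f) \<and>
     (\<forall>f\<in>V. \<forall>g\<in>V. \<forall>h\<in>V. B (\<lambda>x. f x + g x) h = B f h + B g h) \<and>
     (\<forall>f\<in>V. \<forall>h\<in>V. \<forall>a. B (\<lambda>x. a * f x) h = a * B f h) \<and>
     (\<forall>f\<in>V. B f f \<ge> 0)"

definition hilbert_on ::
  "('b \<Rightarrow> real) set \<Rightarrow> (('b \<Rightarrow> real) \<Rightarrow> ('b \<Rightarrow> real) \<Rightarrow> real) \<Rightarrow> bool" where
  "hilbert_on V B \<longleftrightarrow> semi_inner_product_on V B \<and>
     (\<forall>f\<in>V. B f f = 0 \<longrightarrow> f = (\<lambda>_. 0)) \<and>
     (\<forall>s :: nat \<Rightarrow> 'b \<Rightarrow> real. (\<forall>k. s k \<in> V) \<and>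
        (\<forall>e>0. \<exists>N. \<forall>j\<ge>N. \<forall>k\<ge>N. B (\<lambda>x. s j x - s k x) (\<lambda>x. s j x - s k x) < e) \<longrightarrow>
        (\<exists>f\<in>V. (\<lambda>k. B (\<lambda>x. s k x - f x) (\<lambda>x. s k x - f x)) \<longlonglongrightarrow> 0))"

definition is_rkhs ::
  "'p set \<Rightarrow> ('p \<Rightarrow> 'p \<Rightarrow> real) \<Rightarrow> ('p \<Rightarrow> real) set \<Rightarrow> (('p \<Rightarrow> real) \<Rightarrow> ('p \<Rightarrow> real) \<Rightarrow> real) \<Rightarrow> bool" where
  "is_rkhs S K H B \<longleftrightarrow> hilbert_on H B \<and>
     (\<forall>f\<in>H. \<forall>x. x \<notin> S \<longrightarrow> f x = 0) \<and>
     (\<forall>y\<in>S. (\<lambda>x. if x \<in> S then K x y else 0) \<in> H \<and>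
        (\<forall>f\<in>H. B f (\<lambda>x. if x \<in> S then K x y else 0) = f y))"

text \<open>
  For a positive definite \<open>K\<close> the space exists and is unique, and so is the inner product on it;
  only the irrelevant values of the latter outside the space depend on the choice.
\<close>

definition rkhs ::
  "'p set \<Rightarrow> ('p \<Rightarrow> 'p \<Rightarrow> real) \<Rightarrow> ('p \<Rightarrow> real) set \<times> (('p \<Rightarrow> real) \<Rightarrow> ('p \<Rightarrow> real) \<Rightarrow> real)" where
  "rkhs S K = (SOME (H, B). is_rkhs S K H B)"

definition rkhs_space :: "'p set \<Rightarrow> ('p \<Rightarrow> 'p \<Rightarrow> real) \<Rightarrow> ('p \<Rightarrow> real) set" where
  "rkhs_space S K = fst (rkhs S K)"

definition rkhs_inner :: "'p set \<Rightarrow> ('p \<Rightarrow> 'p \<Rightarrow> real) \<Rightarrow> ('p \<Rightarrow> real) \<Rightarrow> ('p \<Rightarrow> real) \<Rightarrow> real" where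
  "rkhs_inner S K = snd (rkhs S K)"


section \<open>Spaces of measures attached to a kernel\<close>

definition FIP ::
  "(nat \<Rightarrow> 'a topology) \<Rightarrow> nat \<Rightarrow> ((nat \<Rightarrow> 'a) \<Rightarrow> (nat \<Rightarrow> 'a) \<Rightarrow> real) \<Rightarrow> ((nat \<Rightarrow> 'a) set \<Rightarrow> real) \<Rightarrow> bool" where
  "FIP X n J \<mu> \<longleftrightarrow>
     (\<lambda>(x, y). J x y) \<in> borel_measurable (borel_alg (prod_topology (prod_space X n) (prod_space X n))) \<and>
     (\<forall>x2\<in>topspace (prod_space X n). \<forall>y2\<in>topspace (prod_space X n).
      \<forall>F\<subseteq>{1..n}. \<forall>G\<subseteq>{1..n}. \<forall>\<pi> \<sigma>. partition_on {1..n} \<pi> \<and> partition_on {1..n} \<sigma> \<longrightarrow>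
        (\<integral>\<^sup>+y1. (\<integral>\<^sup>+x1. ennreal \<bar>J (mix F x1 x2) (mix G y1 y2)\<bar>
            \<partial>marginal_product X \<pi> (variation (prod_space X n) \<mu>))
          \<partial>marginal_product X \<sigma> (variation (prod_space X n) \<mu>)) < \<infinity>)"

definition M_FIP ::
  "(nat \<Rightarrow> 'a topology) \<Rightarrow> nat \<Rightarrow> ((nat \<Rightarrow> 'a) \<Rightarrow> (nat \<Rightarrow> 'a) \<Rightarrow> real) \<Rightarrow> ((nat \<Rightarrow> 'a) set \<Rightarrow> real) set" where
  "M_FIP X n J = {\<mu> \<in> radon_signed (prod_space X n). FIP X n J \<mu>}"

definition P_FIP ::
  "(nat \<Rightarrow> 'a topology) \<Rightarrow> nat \<Rightarrow> ((nat \<Rightarrow> 'a) \<Rightarrow> (nat \<Rightarrow> 'a) \<Rightarrow> real) \<Rightarrow> ((nat \<Rightarrow> 'a) set \<Rightarrow> real) set" where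
  "P_FIP X n J = {P \<in> M_FIP X n J. (\<forall>A. P A \<ge> 0) \<and> P (topspace (prod_space X n)) = 1}"

definition radon_Mn :: "(nat \<Rightarrow> 'a topology) \<Rightarrow> nat \<Rightarrow> ((nat \<Rightarrow> 'a) set \<Rightarrow> real) set" where
  "radon_Mn X n = {\<mu> \<in> radon_signed (prod_space X n).
     \<forall>A. (\<forall>i\<in>{1..n}. A i \<in> sets (borel_alg (X i))) \<and> (\<exists>i\<in>{1..n}. A i = topspace (X i)) \<longrightarrow>
        \<mu> (PiE {1..n} A) = 0}"

definition Mn_FIP ::
  "(nat \<Rightarrow> 'a topology) \<Rightarrow> nat \<Rightarrow> ((nat \<Rightarrow> 'a) \<Rightarrow> (nat \<Rightarrow> 'a) \<Rightarrow> real) \<Rightarrow> ((nat \<Rightarrow> 'a) set \<Rightarrow> real) set" where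
  "Mn_FIP X n J = M_FIP X n J \<inter> radon_Mn X n"

text \<open>
  \<open>variation (prod_space X n) P\<close> is the nonnegative set function \<open>P\<close> as an object of type \<open>measure\<close>.
\<close>

definition marginally_delimited ::
  "(nat \<Rightarrow> 'a topology) \<Rightarrow> nat \<Rightarrow> ((nat \<Rightarrow> 'a) set \<Rightarrow> real) \<Rightarrow> ((nat \<Rightarrow> 'a) set \<Rightarrow> real) \<Rightarrow> bool" where
  "marginally_delimited X n P \<mu> \<longleftrightarrow>
     (\<exists>M\<ge>1. \<forall>F\<subseteq>{1..n}. card F \<le> n - 1 \<longrightarrow>
        (\<forall>A\<in>sets (borel_alg (product_topology X F)).
           emeasure (marginal X F (variation (prod_space X n) \<mu>)) A \<le>
           ennreal M * (\<Sum>\<pi> | partition_on F \<pi>.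
             emeasure (marginal_product X \<pi> (marginal X F (variation (prod_space X n) P))) A)))"

definition Mn_FIP_delimited ::
  "(nat \<Rightarrow> 'a topology) \<Rightarrow> nat \<Rightarrow> ((nat \<Rightarrow> 'a) \<Rightarrow> (nat \<Rightarrow> 'a) \<Rightarrow> real) \<Rightarrow> ((nat \<Rightarrow> 'a) set \<Rightarrow> real) \<Rightarrow>
     ((nat \<Rightarrow> 'a) set \<Rightarrow> real) set" where
  "Mn_FIP_delimited X n J P = {\<mu> \<in> Mn_FIP X n J. marginally_delimited X n P \<mu>}"

end

theory Submission
  imports Defs
begin

text \<open>
  Expanding \<open>delta_product\<close> writes \<open>K\<close> as a signed sum of the functions
  \<open>J (mix F x x0) (mix G y x0)\<close>. Only the term \<open>F = G = {1..n}\<close> survives integration, because a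
  measure in \<open>radon_Mn\<close> has vanishing proper marginals. Symmetry and vanishing on the
  extended diagonal give \<open>K x x = 2 ^ n * J x x0\<close>, so FIP makes \<open>sqrt (K x x)\<close> integrable, and the
  Riesz representation of \<open>f \<mapsto> \<integral>f d\<mu>\<close> is the embedding of \<open>\<mu>\<close>.

  For two different measures, changing the base point coordinate by coordinate and the triangle
  inequality yield \<open>J u v \<le> 2 ^ n * (\<Sum>F. J (mix F u v) w)\<close>. Each term is integrated against one of
  the measures only or against complementary proper marginals of both; the latter are dominated by
  products of marginals of \<open>P\<close>, where FIP of \<open>P\<close> applies.

  Since the Borel sets of a product can exceed the product of the Borel algebras, products of finite
  Radon measures are built by integrating the measures of sections, which are lower semicontinuous for
  open sets.
\<close>

subsection \<open>Tight measures\<close>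

text \<open>FIP speaks about each measure separately, while the bilinear form needs mixed integrals
  of two measures. Delimitation reaches only marginals on at most \<open>n - 1\<close> coordinates,
  so it cannot be applied to \<open>J u v\<close> directly, where both arguments are complete. The
  bound on \<open>J\<close> helps because each of its terms involves \<open>n\<close> coordinates in
  all, some from \<open>u\<close> and the rest from \<open>v\<close>: either both sets of
  coordinates are proper or only one measure occurs.

  The same estimate gives closure of the delimited measures under addition. FIP of a sum refers to
  products of marginals of its variation, and these are dominated by products of marginals of
  \<open>P\<close> unless the partition has a single block. That \<open>P\<close> is a probability
  enters when such a product is restricted to fewer coordinates: blocks that disappear contribute
  the factor 1.

  Nonnegativity of \<open>J\<close>, read off from the diagonal of \<open>K\<close>, removes the
  absolute values in FIP. Since \<open>rkhs\<close> is a choice among the spaces satisfying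
  \<open>is_rkhs\<close>, one of them has to be constructed before anything is known about
  it.\<close>

lemma space_borel_alg [simp]: "space (borel_alg T) = topspace T"
  by (simp add: borel_alg_def space_measure_of_conv)

lemma sets_borel_alg: "sets (borel_alg T) = sigma_sets (topspace T) {U. openin T U}"
  unfolding borel_alg_def by (rule sets_measure_of) (auto dest: openin_subset)

lemma openin_in_borel_alg: "openin T U \<Longrightarrow> U \<in> sets (borel_alg T)"
  by (auto simp: sets_borel_alg)

lemma topspace_in_borel_alg [simp]: "topspace T \<in> sets (borel_alg T)"
  by (simp add: openin_in_borel_alg)

lemma closedin_in_borel_alg: 
  assumes "closedin T C" shows "C \<in> sets (borel_alg T)"
proof -
  have "topspace T - C \<in> sets (borel_alg T)"
    using assms by (intro openin_in_borel_alg) (auto simp: closedin_def)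
  then have "topspace T - (topspace T - C) \<in> sets (borel_alg T)"
    using sets.compl_sets[of "topspace T - C" "borel_alg T"] by simp
  moreover have "topspace T - (topspace T - C) = C"
    using closedin_subset[OF assms] by auto
  ultimately show ?thesis by simp
qed

lemma compactin_in_borel_alg: "Hausdorff_space T \<Longrightarrow> compactin T C \<Longrightarrow> C \<in> sets (borel_alg T)"
  by (simp add: closedin_in_borel_alg compactin_imp_closedin)

lemma borel_alg_subset: "A \<in> sets (borel_alg T) \<Longrightarrow> A \<subseteq> topspace T"
  using sets.sets_into_space by fastforce

lemma continuous_map_measurable:
  assumes "continuous_map S T f" shows "f \<in> measurable (borel_alg S) (borel_alg T)"
  unfolding borel_alg_def[of T]
proof (rule measurable_measure_of)
  show "{U. openin T U} \<subseteq> Pow (topspace T)" by (auto dest: openin_subset)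
  show "f \<in> space (borel_alg S) \<rightarrow> topspace T"
    using assms by (auto simp: continuous_map_def)
  fix y assume "y \<in> {U. openin T U}"
  then show "f -` y \<inter> space (borel_alg S) \<in> sets (borel_alg S)"
    using openin_continuous_map_preimage[OF assms, of y]
    by (auto intro!: openin_in_borel_alg simp: vimage_def Int_def conj_commute)
qed

lemma continuous_map_borel_measurable:
  fixes f :: "'p \<Rightarrow> 'b::topological_space"
  assumes "continuous_map S euclidean f" shows "f \<in> borel_measurable (borel_alg S)"
proof (rule borel_measurableI)
  fix A :: "'b set" assume "open A"
  then show "f -` A \<inter> space (borel_alg S) \<in> sets (borel_alg S)"
    using openin_continuous_map_preimage[OF assms, of A]
    by (auto intro!: openin_in_borel_alg simp: vimage_def Int_def conj_commute)
qed

text \<open>Finite Radon measures in epsilon form, by inner regularity alone. In this shape, images,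
  dominated measures and products are handled by short estimates.\<close>

definition tight :: "'p topology \<Rightarrow> 'p measure \<Rightarrow> bool" where
  "tight T M \<longleftrightarrow> sets M = sets (borel_alg T) \<and> emeasure M (topspace T) < \<infinity> \<and>
     (\<forall>A\<in>sets (borel_alg T). \<forall>e>0. \<exists>C. compactin T C \<and> C \<subseteq> A \<and> emeasure M (A - C) \<le> ennreal e)"

lemma tight_sets: "tight T M \<Longrightarrow> sets M = sets (borel_alg T)"
  by (simp add: tight_def)

lemma tight_space: "tight T M \<Longrightarrow> space M = topspace T"
  by (metis tight_sets sets_eq_imp_space_eq space_borel_alg)

lemma tight_finite: assumes "tight T M" shows "finite_measure M"
  using assms tight_space[OF assms] by (intro finite_measureI) (auto simp: tight_def)

lemma tightD:
  assumes "tight T M" "A \<in> sets (borel_alg T)" "e > 0"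
  obtains C where "compactin T C" "C \<subseteq> A" "emeasure M (A - C) \<le> ennreal e"
  using assms unfolding tight_def by blast

text \<open>Outer regularity is inner regularity of the complement: a compact set that nearly fills
  the complement of \<open>A\<close> is closed, and its own complement is an open set around
  \<open>A\<close> of nearly the same measure.\<close>

lemma radon_tight_iff:
  assumes T: "Hausdorff_space T"
  shows "radon_measure T M \<and> emeasure M (topspace T) < \<infinity> \<longleftrightarrow> tight T M"
proof
  assume L: "radon_measure T M \<and> emeasure M (topspace T) < \<infinity>"
  then have s: "sets M = sets (borel_alg T)" by (simp add: radon_measure_def)
  then have sp: "space M = topspace T" by (metis sets_eq_imp_space_eq space_borel_alg)
  interpret finite_measure M using L sp by (intro finite_measureI) auto
  show "tight T M"
    unfolding tight_def
  proof (intro conjI ballI allI impI s)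
    show "emeasure M (topspace T) < \<infinity>" using L by simp
    fix A e assume A: "A \<in> sets (borel_alg T)" and e: "(0::real) < e"
    let ?S = "SUP C\<in>{C. compactin T C \<and> C \<subseteq> A}. emeasure M C"
    have eq: "emeasure M A = ?S" using L A by (simp add: radon_measure_def)
    have "\<exists>C. compactin T C \<and> C \<subseteq> A \<and> emeasure M A \<le> emeasure M C + ennreal e"
    proof (rule ccontr)
      \<comment> \<open>If every compact subset misses \<open>A\<close> by more than
        \<open>e\<close>, the supremum stays below the measure of \<open>A\<close> by
        \<open>e\<close>. The empty set shows that the difference is nonnegative, so that
        \<open>ennreal\<close> does not truncate it.\<close>
      assume "\<not> ?thesis"
      then have "\<And>C. compactin T C \<Longrightarrow> C \<subseteq> A \<Longrightarrow> measure M C + e \<le> measure M A"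
        using e by (auto simp: emeasure_eq_measure ennreal_plus[symmetric] not_le simp del: ennreal_plus
             intro: less_imp_le)
      then have "?S \<le> ennreal (measure M A - e)"
        by (intro SUP_least) (auto simp: emeasure_eq_measure intro!: ennreal_leI simp: algebra_simps)
      moreover have "measure M A - e \<ge> 0"
        using \<open>\<And>C. compactin T C \<Longrightarrow> C \<subseteq> A \<Longrightarrow> measure M C + e \<le> measure M A\<close>[of "{}"] by simp
      ultimately have "measure M A \<le> measure M A - e"
        using eq emeasure_eq_measure[of A] ennreal_le_iff[of "measure M A - e" "measure M A"] by simp
      then show False using e by simp
    qed
    then obtain C where C: "compactin T C" "C \<subseteq> A" "emeasure M A \<le> emeasure M C + ennreal e" by blast
    have Cs: "C \<in> sets M" using compactin_in_borel_alg[OF T C(1)] s by simp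
    have "emeasure M (A - C) = emeasure M A - emeasure M C"
      using Cs A s C(2) by (intro emeasure_Diff) auto
    also have "\<dots> \<le> ennreal e"
      using C(3) by (simp add: ennreal_minus_le_iff add.commute)
    finally show "\<exists>C. compactin T C \<and> C \<subseteq> A \<and> emeasure M (A - C) \<le> ennreal e" using C by blast
  qed
next
  assume L: "tight T M"
  have s: "sets M = sets (borel_alg T)" using L by (rule tight_sets)
  have sp: "space M = topspace T" using L by (rule tight_space)
  interpret finite_measure M using L by (rule tight_finite)
  have inner: "emeasure M A = (SUP C\<in>{C. compactin T C \<and> C \<subseteq> A}. emeasure M C)"
    if A: "A \<in> sets (borel_alg T)" for A
  proof (rule antisym)
    show "emeasure M A \<le> (SUP C\<in>{C. compactin T C \<and> C \<subseteq> A}. emeasure M C)"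
    proof (rule ennreal_le_epsilon)
      fix e :: real assume "0 < e"
      from tightD[OF L A this] obtain C where C: "compactin T C" "C \<subseteq> A" "emeasure M (A - C) \<le> ennreal e" .
      have "emeasure M A = emeasure M (C \<union> (A - C))" using C(2) by (intro arg_cong[where f="emeasure M"]) auto
      also have "\<dots> \<le> emeasure M C + emeasure M (A - C)"
        using compactin_in_borel_alg[OF T C(1)] A s by (intro emeasure_subadditive) auto
      also have "\<dots> \<le> (SUP C\<in>{C. compactin T C \<and> C \<subseteq> A}. emeasure M C) + ennreal e"
        using C by (intro add_mono SUP_upper) auto
      finally show "emeasure M A \<le> (SUP C\<in>{C. compactin T C \<and> C \<subseteq> A}. emeasure M C) + ennreal e" .
    qed
    show "(SUP C\<in>{C. compactin T C \<and> C \<subseteq> A}. emeasure M C) \<le> emeasure M A"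
      using A s by (intro SUP_least emeasure_mono) auto
  qed
  have outer: "emeasure M A = (INF U\<in>{U. openin T U \<and> A \<subseteq> U}. emeasure M U)"
    if A: "A \<in> sets (borel_alg T)" for A
  proof (rule antisym)
    show "emeasure M A \<le> (INF U\<in>{U. openin T U \<and> A \<subseteq> U}. emeasure M U)"
      using s openin_in_borel_alg[of T] by (intro INF_greatest emeasure_mono) auto
    show "(INF U\<in>{U. openin T U \<and> A \<subseteq> U}. emeasure M U) \<le> emeasure M A"
    proof (rule ennreal_le_epsilon)
      fix e :: real assume e: "0 < e"
      have A': "topspace T - A \<in> sets (borel_alg T)"
        using A sets.compl_sets[of A "borel_alg T"] by simp
      from tightD[OF L A' e] obtain C where
        C: "compactin T C" "C \<subseteq> topspace T - A" "emeasure M (topspace T - A - C) \<le> ennreal e" .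
      let ?U = "topspace T - C"
      have U: "openin T ?U" using compactin_imp_closedin[OF T C(1)] by (simp add: closedin_def)
      have AU: "A \<subseteq> ?U" using C(2) borel_alg_subset[OF A] by auto
      have "?U = A \<union> (topspace T - A - C)" using C(2) borel_alg_subset[OF A] by auto
      then have "emeasure M ?U = emeasure M (A \<union> (topspace T - A - C))" by simp
      also have "\<dots> \<le> emeasure M A + emeasure M (topspace T - A - C)"
        using A A' compactin_in_borel_alg[OF T C(1)] s by (intro emeasure_subadditive) auto
      also have "\<dots> \<le> emeasure M A + ennreal e" using C by (intro add_mono) auto
      finally have "emeasure M ?U \<le> emeasure M A + ennreal e" .
      then show "(INF U\<in>{U. openin T U \<and> A \<subseteq> U}. emeasure M U) \<le> emeasure M A + ennreal e"
        using U AU by (intro INF_lower2[of ?U]) auto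
    qed
  qed
  show "radon_measure T M \<and> emeasure M (topspace T) < \<infinity>"
    unfolding radon_measure_def using s inner outer L by (auto simp: tight_def less_top[symmetric])
qed

text \<open>The image of a compact subset of the preimage of \<open>A\<close> is a compact subset of
  \<open>A\<close>, and what it misses pulls back into what was missed before.\<close>

lemma tight_distr:
  assumes M: "tight S M" and f: "continuous_map S T f" and S: "Hausdorff_space S" and T: "Hausdorff_space T"
  shows "tight T (distr M (borel_alg T) f)"
proof -
  have fm: "f \<in> measurable M (borel_alg T)"
    using continuous_map_measurable[OF f] tight_sets[OF M] by (simp add: measurable_def tight_space[OF M])
  have pre: "f -` A \<inter> topspace S \<in> sets (borel_alg S)" if "A \<in> sets (borel_alg T)" for A
    using measurable_sets[OF continuous_map_measurable[OF f] that] by simp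
  show ?thesis
    unfolding tight_def
  proof (intro conjI ballI allI impI)
    show "emeasure (distr M (borel_alg T) f) (topspace T) < \<infinity>"
      using finite_measure.emeasure_finite[OF tight_finite[OF M]]
      by (subst emeasure_distr[OF fm]) (auto simp: less_top)
    fix A e assume A: "A \<in> sets (borel_alg T)" and e: "(0::real) < e"
    from tightD[OF M pre[OF A] e] obtain C where
      C: "compactin S C" "C \<subseteq> f -` A \<inter> topspace S" "emeasure M (f -` A \<inter> topspace S - C) \<le> ennreal e" .
    have K: "compactin T (f ` C)" using image_compactin[OF C(1) f] .
    have Ks: "A - f ` C \<in> sets (borel_alg T)" using compactin_in_borel_alg[OF T K] A by auto
    have "emeasure (distr M (borel_alg T) f) (A - f ` C) = emeasure M (f -` (A - f ` C) \<inter> space M)"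
      using Ks by (rule emeasure_distr[OF fm])
    also have "\<dots> \<le> emeasure M (f -` A \<inter> topspace S - C)"
      using pre[OF A] compactin_in_borel_alg[OF S C(1)] tight_sets[OF M] tight_space[OF M]
      by (intro emeasure_mono) auto
    also have "\<dots> \<le> ennreal e" using C by simp
    finally show "\<exists>C. compactin T C \<and> C \<subseteq> A \<and> emeasure (distr M (borel_alg T) f) (A - C) \<le> ennreal e"
      using K C(2) by (intro exI[of _ "f ` C"]) auto
  qed simp
qed

lemma tight_dominated:
  assumes M: "tight T M" and N: "sets N = sets (borel_alg T)"
    and le: "\<And>A. A \<in> sets (borel_alg T) \<Longrightarrow> emeasure N A \<le> ennreal c * emeasure M A" and T: "Hausdorff_space T"
  shows "tight T N"
  unfolding tight_def
proof (intro conjI ballI allI impI N)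
  show "emeasure N (topspace T) < \<infinity>"
    using le[of "topspace T"] M by (auto simp: tight_def ennreal_mult_less_top intro: le_less_trans)
  fix A e assume A: "A \<in> sets (borel_alg T)" and e: "(0::real) < e"
  \<comment> \<open>Adding 1 keeps the divisor positive, and \<open>ennreal c\<close> is at most
    \<open>ennreal (\<bar>c\<bar> + 1)\<close> for every real \<open>c\<close>.\<close>
  have "0 < e / (\<bar>c\<bar> + 1)" using e by auto
  from tightD[OF M A this] obtain C where
    C: "compactin T C" "C \<subseteq> A" "emeasure M (A - C) \<le> ennreal (e / (\<bar>c\<bar> + 1))" .
  have "emeasure N (A - C) \<le> ennreal c * emeasure M (A - C)"
    using A compactin_in_borel_alg[OF T C(1)] by (intro le) auto
  also have "\<dots> \<le> ennreal (\<bar>c\<bar> + 1) * ennreal (e / (\<bar>c\<bar> + 1))"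
    using C by (intro mult_mono ennreal_leI) auto
  also have "\<dots> = ennreal e"
    using e by (subst ennreal_mult[symmetric]) (auto simp: field_simps)
  finally show "\<exists>C. compactin T C \<and> C \<subseteq> A \<and> emeasure N (A - C) \<le> ennreal e" using C by blast
qed

lemma suminf_halves_ennreal:
  assumes "0 < (e::real)" shows "(\<Sum>k. ennreal (e / 2 ^ Suc k)) = ennreal e"
proof -
  have "(\<lambda>k. (1/2::real) ^ Suc k) sums 1" by (rule power_half_series)
  then have "(\<lambda>k. e * (1/2) ^ Suc k) sums (e * 1)" by (rule sums_mult)
  then have "(\<lambda>k. e / 2 ^ Suc k) sums e" by (simp add: field_simps power_divide)
  then show ?thesis using assms by (intro suminf_ennreal_eq) auto
qed

text \<open>The sets that are approximable from inside together with their complement form a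
  \<open>\<sigma>\<close>-algebra.\<close>

lemma tight_from_open_closed:
  assumes T: "Hausdorff_space T" and s: "sets M = sets (borel_alg T)" and fin: "emeasure M (topspace T) < \<infinity>"
    and op: "\<And>U e. openin T U \<Longrightarrow> 0 < e \<Longrightarrow> \<exists>C. compactin T C \<and> C \<subseteq> U \<and> emeasure M (U - C) \<le> ennreal e"
    and cl: "\<And>U e. closedin T U \<Longrightarrow> 0 < e \<Longrightarrow> \<exists>C. compactin T C \<and> C \<subseteq> U \<and> emeasure M (U - C) \<le> ennreal e"
  shows "tight T M"
proof -
  have sp: "space M = topspace T" using s by (metis sets_eq_imp_space_eq space_borel_alg)
  interpret finite_measure M using fin sp by (intro finite_measureI) auto
  define I where "I A \<longleftrightarrow> (\<forall>e>0. \<exists>C. compactin T C \<and> C \<subseteq> A \<and> emeasure M (A - C) \<le> ennreal e)" for A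
  have "I A \<and> I (topspace T - A)" if "A \<in> sigma_sets (topspace T) {U. openin T U}" for A
    using that
  proof (induction rule: sigma_sets.induct)
    case (Basic a)
    then have "openin T a" "closedin T (topspace T - a)" by (auto simp: openin_closedin_eq)
    then show ?case using op cl unfolding I_def by blast
  next
    case Empty
    then show ?case using op by (auto simp: I_def intro!: exI[of _ "{}"])
  next
    case (Compl a)
    have "topspace T - (topspace T - a) = a" using Compl(1) by (metis double_diff sets_borel_alg borel_alg_subset order_refl)
    then show ?case using Compl by auto
  next
    case (Union a)
    have am: "a k \<in> sets M" for k using Union(1) s by (simp add: sets_borel_alg)
    have "I (\<Union> (range a))"
      unfolding I_def
    proof (intro allI impI)
      fix e :: real assume e: "0 < e"
      \<comment> \<open>Half of \<open>e\<close> pays for approximating the single sets, the other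
        half for replacing the infinite union of compact sets by a finite, hence compact,
        one.\<close>
      have "\<forall>k. \<exists>C. compactin T C \<and> C \<subseteq> a k \<and> emeasure M (a k - C) \<le> ennreal (e / 2 / 2 ^ Suc k)"
        using Union(2) e unfolding I_def by simp
      then obtain C where C: "\<And>k. compactin T (C k)" "\<And>k. C k \<subseteq> a k"
         "\<And>k. emeasure M (a k - C k) \<le> ennreal (e / 2 / 2 ^ Suc k)" by metis
      have Cs: "C k \<in> sets M" for k using compactin_in_borel_alg[OF T C(1)] s by simp
      define D where "D N = (\<Union>k<N. C k)" for N :: nat
      have z: "(\<Inter>N. (\<Union>k. C k) - D N) = {}"
        by (auto simp: D_def)
      have "(\<lambda>N. emeasure M ((\<Union>k. C k) - D N)) \<longlonglongrightarrow> emeasure M (\<Inter>N. (\<Union>k. C k) - D N)"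
        using Cs by (intro Lim_emeasure_decseq) (auto simp: decseq_def D_def)
      then have "(\<lambda>N. emeasure M ((\<Union>k. C k) - D N)) \<longlonglongrightarrow> 0" by (simp only: z emeasure_empty)
      then have "\<forall>\<^sub>F N in sequentially. emeasure M ((\<Union>k. C k) - D N) < ennreal (e/2)"
        using e by (intro order_tendstoD) auto
      then obtain N where N: "emeasure M ((\<Union>k. C k) - D N) < ennreal (e/2)"
        by (auto simp: eventually_sequentially)
      have K: "compactin T (D N)" unfolding D_def using C(1) by (intro compactin_Union) auto
      have Ds: "D N \<in> sets M" using compactin_in_borel_alg[OF T K] s by simp
      have "emeasure M (\<Union>k. a k - C k) \<le> (\<Sum>k. emeasure M (a k - C k))"
        using am Cs by (intro emeasure_subadditive_countably) auto
      also have "\<dots> \<le> (\<Sum>k. ennreal (e / 2 / 2 ^ Suc k))"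
        using C by (intro suminf_le) auto
      also have "\<dots> = ennreal (e/2)" using e by (intro suminf_halves_ennreal) auto
      finally have half: "emeasure M (\<Union>k. a k - C k) \<le> ennreal (e/2)" .
      have "emeasure M (\<Union>(range a) - D N) \<le> emeasure M ((\<Union>k. a k - C k) \<union> ((\<Union>k. C k) - D N))"
        using am Cs Ds by (intro emeasure_mono) auto
      also have "\<dots> \<le> emeasure M (\<Union>k. a k - C k) + emeasure M ((\<Union>k. C k) - D N)"
        using am Cs Ds by (intro emeasure_subadditive) auto
      also have "\<dots> \<le> ennreal (e/2) + ennreal (e/2)"
        using half N by (intro add_mono) auto
      also have "\<dots> = ennreal (e/2 + e/2)" using e by (intro ennreal_plus[symmetric]) auto
      also have "\<dots> = ennreal e" by simp
      finally show "\<exists>C. compactin T C \<and> C \<subseteq> \<Union> (range a) \<and> emeasure M (\<Union> (range a) - C) \<le> ennreal e"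
        using K C(2) unfolding D_def by (intro exI[of _ "\<Union>k<N. C k"]) blast
    qed
    moreover have "I (topspace T - \<Union> (range a))"
      unfolding I_def
    proof (intro allI impI)
      fix e :: real assume e: "0 < e"
      have "\<forall>k. \<exists>C. compactin T C \<and> C \<subseteq> topspace T - a k \<and> emeasure M (topspace T - a k - C) \<le> ennreal (e / 2 ^ Suc k)"
        using Union(2) e unfolding I_def by simp
      then obtain C where C: "\<And>k. compactin T (C k)" "\<And>k. C k \<subseteq> topspace T - a k"
         "\<And>k. emeasure M (topspace T - a k - C k) \<le> ennreal (e / 2 ^ Suc k)" by metis
      have Cs: "C k \<in> sets M" for k using compactin_in_borel_alg[OF T C(1)] s by simp
      \<comment> \<open>On the complementary side the compact sets are intersected, which preserves
        compactness for infinitely many of them as well.\<close>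
      have K: "compactin T (\<Inter>k. C k)"
        using C(1) compactin_imp_closedin[OF T]
        by (intro closed_compactin[OF C(1)[of 0]] closedin_Inter) auto
      have As: "topspace T - a k - C k \<in> sets M" for k using sets.compl_sets[OF am[of k]] Cs sp by auto
      have "emeasure M (topspace T - \<Union>(range a) - (\<Inter>k. C k)) \<le> emeasure M (\<Union>k. topspace T - a k - C k)"
        using As by (intro emeasure_mono) auto
      also have "\<dots> \<le> (\<Sum>k. emeasure M (topspace T - a k - C k))"
        using As by (intro emeasure_subadditive_countably) auto
      also have "\<dots> \<le> (\<Sum>k. ennreal (e / 2 ^ Suc k))"
        using C by (intro suminf_le) auto
      also have "\<dots> = ennreal e" using e by (intro suminf_halves_ennreal) auto
      finally show "\<exists>C. compactin T C \<and> C \<subseteq> topspace T - \<Union> (range a) \<and>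
         emeasure M (topspace T - \<Union> (range a) - C) \<le> ennreal e"
        using K C(2) by (intro exI[of _ "\<Inter>k. C k"]) blast
    qed
    ultimately show ?case ..
  qed
  then show ?thesis
    unfolding tight_def I_def using s fin by (auto simp: sets_borel_alg)
qed

text \<open>Agreement on \<open>B\<close> extends to finite unions by the \<open>\<pi>\<close>-\<open>\<lambda>\<close> theorem, then to open sets because a
  compact subset of an open set is covered by finitely many members of \<open>B\<close> inside it.\<close>

lemma tight_eqI_base:
  assumes T: "Hausdorff_space T" and M: "tight T M" and N: "tight T N"
    and B: "\<And>U. U \<in> B \<Longrightarrow> openin T U" "Int_stable B" "topspace T \<in> B"
    and base: "\<And>U x. openin T U \<Longrightarrow> x \<in> U \<Longrightarrow> \<exists>V\<in>B. x \<in> V \<and> V \<subseteq> U"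
    and eq: "\<And>U. U \<in> B \<Longrightarrow> emeasure M U = emeasure N U"
  shows "M = N"
proof -
  have BP: "B \<subseteq> Pow (topspace T)" using B(1) openin_subset by blast
  interpret MM: finite_measure M using M by (rule tight_finite)
  interpret NN: finite_measure N using N by (rule tight_finite)
  let ?S = "sigma (topspace T) B"
  have subS: "sets ?S \<subseteq> sets (borel_alg T)"
    unfolding sets_borel_alg sets_measure_of[OF BP] using B(1) by (intro sigma_sets_mono') auto
  \<comment> \<open>The restriction of a measure to the smaller algebra generated by
    \<open>B\<close>, written as an image under the identity so that uniqueness on a generator can
    be applied.\<close>
  define R where "R L = distr L ?S (\<lambda>x. x)" for L :: "'a measure"
  have mm: "(\<lambda>x. x) \<in> measurable M ?S" "(\<lambda>x. x) \<in> measurable N ?S"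
    using subS tight_sets[OF M] tight_sets[OF N] tight_space[OF M] tight_space[OF N]
    by (auto simp: measurable_def Int_absorb2 space_measure_of_conv dest: sets.sets_into_space)
  have R: "emeasure (R M) A = emeasure M A" "emeasure (R N) A = emeasure N A" if "A \<in> sets ?S" for A
  proof -
    have "A \<inter> space M = A" "A \<inter> space N = A"
      using sets.sets_into_space[OF that] tight_space[OF M] tight_space[OF N]
      by (simp_all add: space_measure_of_conv Int_absorb2)
    then show "emeasure (R M) A = emeasure M A" "emeasure (R N) A = emeasure N A"
      using emeasure_distr[OF mm(1) that] emeasure_distr[OF mm(2) that] by (simp_all add: R_def)
  qed
  have "R M = R N"
  proof (rule measure_eqI_generator_eq[where \<Omega>="topspace T" and E=B and A="\<lambda>_. topspace T"])
    show "emeasure (R M) X = emeasure (R N) X" if "X \<in> B" for X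
      using eq[OF that] R[of X] that BP by auto
    show "emeasure (R M) (topspace T) \<noteq> \<infinity>" using R[of "topspace T"] B(3) BP by auto
  qed (use B BP in \<open>auto simp: R_def sets_measure_of\<close>)
  then have eqS: "emeasure M A = emeasure N A" if "A \<in> sets ?S" for A
    using R[OF that] by (simp only:)
  \<comment> \<open>Stated for any two tight measures that agree on the small algebra, in order to
    be used in both directions.\<close>
  have le: "emeasure M U \<le> emeasure N U"
    if U: "openin T U" and M: "tight T M" and N: "tight T N"
      and eqS: "\<And>A. A \<in> sets ?S \<Longrightarrow> emeasure M A = emeasure N A" for U M N
  proof (rule ennreal_le_epsilon)
    fix e :: real assume e: "0 < e"
    from tightD[OF M openin_in_borel_alg[OF U] e] obtain C where
      C: "compactin T C" "C \<subseteq> U" "emeasure M (U - C) \<le> ennreal e" .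
    have "\<exists>\<F>. finite \<F> \<and> \<F> \<subseteq> {V\<in>B. V \<subseteq> U} \<and> C \<subseteq> \<Union>\<F>"
      using base[OF U] C B(1) by (intro compactinD[OF C(1)]) blast+
    then obtain \<F> where F: "finite \<F>" "\<F> \<subseteq> {V\<in>B. V \<subseteq> U}" "C \<subseteq> \<Union>\<F>" by blast
    have FS: "\<Union>\<F> \<in> sets ?S" using F BP by (intro sets.finite_Union) auto
    have Us: "U \<in> sets M" "U \<in> sets N" "\<Union>\<F> \<in> sets M" "C \<in> sets M"
      using openin_in_borel_alg[OF U] subS FS compactin_in_borel_alg[OF T C(1)] tight_sets[OF M] tight_sets[OF N] by auto
    have "emeasure M U \<le> emeasure M (\<Union>\<F> \<union> (U - C))"
      using Us F by (intro emeasure_mono) auto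
    also have "\<dots> \<le> emeasure M (\<Union>\<F>) + emeasure M (U - C)"
      using Us by (intro emeasure_subadditive) auto
    also have "\<dots> \<le> emeasure N (\<Union>\<F>) + ennreal e" using C eqS[OF FS] by (intro add_mono) auto
    also have "emeasure N (\<Union>\<F>) \<le> emeasure N U" using Us F by (intro emeasure_mono) auto
    finally show "emeasure M U \<le> emeasure N U + ennreal e" by (simp add: add_right_mono)
  qed
  show ?thesis
  proof (rule measure_eqI_generator_eq[where \<Omega>="topspace T" and E="{U. openin T U}" and A="\<lambda>_. topspace T"])
    show "emeasure M X = emeasure N X" if "X \<in> {U. openin T U}" for X
      using le[of X M N] le[of X N M] that M N eqS by (simp add: antisym)
  qed (use tight_sets[OF M] tight_sets[OF N] in \<open>auto simp: Int_stable_def sets_borel_alg dest: openin_subset\<close>)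
qed

lemma measurable_tight: "tight T N \<Longrightarrow> measurable N K = measurable (borel_alg T) K"
  by (rule measurable_cong_sets[OF tight_sets refl])

subsection \<open>Products of two tight measures\<close>

text \<open>Sections are preimages under the continuous map that inserts \<open>y\<close>; for
  \<open>y\<close> outside the space they are empty, so the statement holds for all
  \<open>y\<close>.\<close>

lemma sec_sets:
  assumes "E \<in> sets (borel_alg (prod_topology S T))"
  shows "{x. (x, y) \<in> E} \<in> sets (borel_alg S)"
proof (cases "y \<in> topspace T")
  case True
  have "continuous_map S (prod_topology S T) (\<lambda>x. (x, y))"
    using True by (simp add: continuous_map_pairwise o_def)
  from measurable_sets[OF continuous_map_measurable[OF this] assms]
  have "(\<lambda>x. (x, y)) -` E \<inter> topspace S \<in> sets (borel_alg S)" by simp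
  moreover have "(\<lambda>x. (x, y)) -` E \<inter> topspace S = {x. (x, y) \<in> E}"
    using borel_alg_subset[OF assms] by auto
  ultimately show ?thesis by simp
next
  case False
  then have "{x. (x, y) \<in> E} = {}" using borel_alg_subset[OF assms] by auto
  then show ?thesis by simp
qed

text \<open>For open \<open>E\<close> the function is lower semicontinuous, by the tube lemma.\<close>

lemma sec_measurable:
  assumes S: "Hausdorff_space S" and M: "tight S M"
    and E: "E \<in> sets (borel_alg (prod_topology S T))"
  shows "(\<lambda>y. emeasure M {x. (x, y) \<in> E}) \<in> borel_measurable (borel_alg T)"
proof -
  let ?P = "prod_topology S T"
  interpret finite_measure M using M by (rule tight_finite)
  note sM = tight_sets[OF M]
  have "Int_stable {U. openin ?P U}" by (auto simp: Int_stable_def)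
  moreover have "{U. openin ?P U} \<subseteq> Pow (topspace ?P)" using openin_subset by blast
  moreover have "E \<in> sigma_sets (topspace ?P) {U. openin ?P U}" using E by (simp add: sets_borel_alg)
  ultimately show ?thesis
  proof (induction rule: sigma_sets_induct_disjoint)
    case (basic U)
    then have U: "openin ?P U" by simp
    show ?case
    proof (rule borel_measurableI_greater)
      fix a :: ennreal
      have "openin T {y \<in> topspace T. a < emeasure M {x. (x, y) \<in> U}}"
      proof (subst openin_subopen, safe)
        fix y assume y: "y \<in> topspace T" "a < emeasure M {x. (x, y) \<in> U}"
        have "{x. (x, y) \<in> U} \<in> sets (borel_alg S)" using sec_sets[OF openin_in_borel_alg[OF U]] .
        then have "emeasure M {x. (x, y) \<in> U} = (SUP C\<in>{C. compactin S C \<and> C \<subseteq> {x. (x, y) \<in> U}}. emeasure M C)"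
          using radon_tight_iff[OF S, of M] M by (simp add: radon_measure_def)
        then obtain C where C: "compactin S C" "C \<subseteq> {x. (x, y) \<in> U}" "a < emeasure M C"
          using y(2) by (auto simp: less_SUP_iff)
        from tube_lemma_left[OF U C(1) y(1)] C(2) obtain V where
          V: "openin T V" "y \<in> V" "C \<times> V \<subseteq> U" by fast
        have "V \<subseteq> {y \<in> topspace T. a < emeasure M {x. (x, y) \<in> U}}"
        proof safe
          fix z assume z: "z \<in> V"
          then show "z \<in> topspace T" using V openin_subset by blast
          have "emeasure M C \<le> emeasure M {x. (x, z) \<in> U}"
            using V z sM sec_sets[OF openin_in_borel_alg[OF U]] by (intro emeasure_mono) auto
          then show "a < emeasure M {x. (x, z) \<in> U}" using C(3) by simp
        qed
        then show "\<exists>V. openin T V \<and> y \<in> V \<and> V \<subseteq> {y \<in> topspace T. a < emeasure M {x. (x, y) \<in> U}}"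
          using V by blast
      qed
      then show "{y \<in> space (borel_alg T). a < emeasure M {x. (x, y) \<in> U}} \<in> sets (borel_alg T)"
        by (simp add: openin_in_borel_alg)
    qed
  next
    case empty
    then show ?case by simp
  next
    case (compl A)
    have A: "A \<in> sets (borel_alg ?P)" using compl(1) by (simp add: sets_borel_alg)
    have "emeasure M {x. (x, y) \<in> topspace ?P - A} = emeasure M (topspace S) - emeasure M {x. (x, y) \<in> A}"
      if "y \<in> topspace T" for y
    proof -
      have "{x. (x, y) \<in> topspace ?P - A} = topspace S - {x. (x, y) \<in> A}" using that by auto
      then show ?thesis
        using sec_sets[OF A, of y] sM borel_alg_subset[OF A]
        by (simp, subst emeasure_Diff) (auto simp: tight_space[OF M])
    qed
    then show ?case
      using compl(2) by (subst measurable_cong[where g="\<lambda>y. emeasure M (topspace S) - emeasure M {x. (x, y) \<in> A}"]) auto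
  next
    case (union A)
    have A: "A k \<in> sets (borel_alg ?P)" for k using union(2) by (auto simp: sets_borel_alg)
    have "emeasure M {x. (x, y) \<in> (\<Union>k. A k)} = (\<Sum>k. emeasure M {x. (x, y) \<in> A k})" for y
    proof -
      have "{x. (x, y) \<in> (\<Union>k. A k)} = (\<Union>k. {x. (x, y) \<in> A k})" by auto
      then show ?thesis
        using sec_sets[OF A, of y] sM union(1)
        by (simp, subst suminf_emeasure) (auto simp: disjoint_family_on_def)
    qed
    then show ?case using union(3) by simp
  qed
qed

section \<open>The product measure and iterated integrals\<close>

definition rprod :: "'p topology \<Rightarrow> 'q topology \<Rightarrow> 'p measure \<Rightarrow> 'q measure \<Rightarrow> ('p \<times> 'q) measure" where
  "rprod S T M N = measure_of (topspace (prod_topology S T)) (sets (borel_alg (prod_topology S T)))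
     (\<lambda>E. \<integral>\<^sup>+y. emeasure M {x. (x, y) \<in> E} \<partial>N)"

lemma sets_rprod [simp]: "sets (rprod S T M N) = sets (borel_alg (prod_topology S T))"
  using sets.sigma_sets_eq[of "borel_alg (prod_topology S T)"] borel_alg_subset
  unfolding rprod_def by (subst sets_measure_of) fastforce+

lemma space_rprod [simp]: "space (rprod S T M N) = topspace (prod_topology S T)"
  by (simp add: rprod_def space_measure_of_conv)

lemma emeasure_rprod:
  assumes S: "Hausdorff_space S" and M: "tight S M" and N: "tight T N"
    and E: "E \<in> sets (borel_alg (prod_topology S T))"
  shows "emeasure (rprod S T M N) E = (\<integral>\<^sup>+y. emeasure M {x. (x, y) \<in> E} \<partial>N)"
  unfolding rprod_def
proof (rule emeasure_measure_of_sigma)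
  show "sigma_algebra (topspace (prod_topology S T)) (sets (borel_alg (prod_topology S T)))"
    using sets.sigma_algebra_axioms[of "borel_alg (prod_topology S T)"] by simp
  show "positive (sets (borel_alg (prod_topology S T))) (\<lambda>E. \<integral>\<^sup>+y. emeasure M {x. (x, y) \<in> E} \<partial>N)"
    by (simp add: positive_def)
  show "countably_additive (sets (borel_alg (prod_topology S T))) (\<lambda>E. \<integral>\<^sup>+y. emeasure M {x. (x, y) \<in> E} \<partial>N)"
  proof (rule countably_additiveI)
    fix A :: "nat \<Rightarrow> ('a \<times> 'b) set"
    assume A: "range A \<subseteq> sets (borel_alg (prod_topology S T))" "disjoint_family A"
    have "emeasure M {x. (x, y) \<in> (\<Union>k. A k)} = (\<Sum>k. emeasure M {x. (x, y) \<in> A k})" for y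
    proof -
      have "{x. (x, y) \<in> (\<Union>k. A k)} = (\<Union>k. {x. (x, y) \<in> A k})" by auto
      moreover have "{x. (x, y) \<in> A k} \<in> sets M" for k
        using A(1) sec_sets[of "A k" S T y] tight_sets[OF M] by auto
      ultimately show ?thesis
        using A(2) by (simp, subst suminf_emeasure) (auto simp: disjoint_family_on_def)
    qed
    moreover have "(\<lambda>y. emeasure M {x. (x, y) \<in> A k}) \<in> borel_measurable N" for k
      using sec_measurable[OF S M, of "A k" T] A(1) tight_sets[OF N]
      by (subst measurable_cong_sets[OF tight_sets[OF N] refl]) auto
    ultimately show "(\<Sum>k. \<integral>\<^sup>+y. emeasure M {x. (x, y) \<in> A k} \<partial>N) = (\<integral>\<^sup>+y. emeasure M {x. (x, y) \<in> \<Union> (range A)} \<partial>N)"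
      by (simp add: nn_integral_suminf)
  qed
qed (rule E)

text \<open>Both claims go through one induction on \<open>f\<close>, because the formula for
  multiples, sums and limits uses measurability of the inner integrals. Tightness of
  \<open>N\<close> is a premise of the formula alone, so that measurability can be used before an
  outer measure is fixed.\<close>

lemma
  fixes f :: "'p \<times> 'q \<Rightarrow> ennreal"
  assumes S: "Hausdorff_space S" and M: "tight S M"
    and f: "f \<in> borel_measurable (borel_alg (prod_topology S T))"
  shows borel_measurable_nn_integral_tight: "(\<lambda>y. \<integral>\<^sup>+x. f (x, y) \<partial>M) \<in> borel_measurable (borel_alg T)"
    and nn_integral_rprod: "tight T N \<Longrightarrow> (\<integral>\<^sup>+z. f z \<partial>rprod S T M N) = (\<integral>\<^sup>+y. (\<integral>\<^sup>+x. f (x, y) \<partial>M) \<partial>N)"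
proof -
  have sm: "(\<lambda>x. g (x, y)) \<in> borel_measurable M"
    if "g \<in> borel_measurable (borel_alg (prod_topology S T))" "y \<in> topspace T" for g :: "'p \<times> 'q \<Rightarrow> ennreal" and y
  proof -
    have "continuous_map S (prod_topology S T) (\<lambda>x. (x, y))"
      using that by (simp add: continuous_map_pairwise o_def)
    from measurable_compose[OF continuous_map_measurable[OF this] that(1)]
    show ?thesis by (subst measurable_cong_sets[OF tight_sets[OF M] refl])
  qed
  have "(\<lambda>y. \<integral>\<^sup>+x. f (x, y) \<partial>M) \<in> borel_measurable (borel_alg T) \<and>
    (tight T N \<longrightarrow> (\<integral>\<^sup>+z. f z \<partial>rprod S T M N) = (\<integral>\<^sup>+y. (\<integral>\<^sup>+x. f (x, y) \<partial>M) \<partial>N))"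
    using f
  proof (induction rule: borel_measurable_induct)
    case (cong f g)
    have e: "(\<integral>\<^sup>+x. f (x, y) \<partial>M) = (\<integral>\<^sup>+x. g (x, y) \<partial>M)" if "y \<in> topspace T" for y
      using cong(3) that by (intro nn_integral_cong) (auto simp: tight_space[OF M])
    have "(\<integral>\<^sup>+z. f z \<partial>rprod S T M N) = (\<integral>\<^sup>+z. g z \<partial>rprod S T M N)"
      using cong(3) by (intro nn_integral_cong) auto
    moreover have "(\<integral>\<^sup>+y. (\<integral>\<^sup>+x. f (x, y) \<partial>M) \<partial>N) = (\<integral>\<^sup>+y. (\<integral>\<^sup>+x. g (x, y) \<partial>M) \<partial>N)" if "tight T N"
      by (rule nn_integral_cong) (simp add: e tight_space[OF that])
    moreover have "(\<lambda>y. \<integral>\<^sup>+x. f (x, y) \<partial>M) \<in> borel_measurable (borel_alg T) \<longleftrightarrow>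
       (\<lambda>y. \<integral>\<^sup>+x. g (x, y) \<partial>M) \<in> borel_measurable (borel_alg T)"
      by (rule measurable_cong) (simp add: e)
    ultimately show ?case using cong(4) by auto
  next
    case (set A)
    have i: "(\<integral>\<^sup>+x. indicator A (x, y) \<partial>M) = emeasure M {x. (x, y) \<in> A}" for y
    proof -
      have "(\<integral>\<^sup>+x. indicator A (x, y) \<partial>M) = (\<integral>\<^sup>+x. indicator {x. (x, y) \<in> A} x \<partial>M)"
        by (intro nn_integral_cong) (auto simp: indicator_def)
      then show ?thesis using sec_sets[OF set(1), of y] tight_sets[OF M] by simp
    qed
    show ?case
      using sec_measurable[OF S M set(1)] emeasure_rprod[OF S M _ set(1)] set(1) by (auto simp: i)
  next
    case (mult u c)
    have i: "(\<integral>\<^sup>+x. c * u (x, y) \<partial>M) = c * (\<integral>\<^sup>+x. u (x, y) \<partial>M)" if "y \<in> topspace T" for y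
      using sm[OF mult(2) that] by (rule nn_integral_cmult)
    have m: "(\<lambda>y. \<integral>\<^sup>+x. c * u (x, y) \<partial>M) \<in> borel_measurable (borel_alg T)"
      using i mult(4) by (subst measurable_cong[where g="\<lambda>y. c * (\<integral>\<^sup>+x. u (x, y) \<partial>M)"]) auto
    moreover have "(\<integral>\<^sup>+z. c * u z \<partial>rprod S T M N) = (\<integral>\<^sup>+y. (\<integral>\<^sup>+x. c * u (x, y) \<partial>M) \<partial>N)" if N: "tight T N"
    proof -
      have "(\<integral>\<^sup>+z. c * u z \<partial>rprod S T M N) = c * (\<integral>\<^sup>+z. u z \<partial>rprod S T M N)"
        using mult(2) by (intro nn_integral_cmult) (auto simp: measurable_cong_sets[OF sets_rprod refl])
      also have "\<dots> = c * (\<integral>\<^sup>+y. (\<integral>\<^sup>+x. u (x, y) \<partial>M) \<partial>N)" using mult(4) N by simp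
      also have "\<dots> = (\<integral>\<^sup>+y. c * (\<integral>\<^sup>+x. u (x, y) \<partial>M) \<partial>N)"
        using mult(4) by (intro nn_integral_cmult[symmetric]) (simp add: measurable_tight[OF N])
      also have "\<dots> = (\<integral>\<^sup>+y. (\<integral>\<^sup>+x. c * u (x, y) \<partial>M) \<partial>N)"
        using i by (intro nn_integral_cong) (auto simp: tight_space[OF N])
      finally show ?thesis .
    qed
    ultimately show ?case by simp
  next
    case (add u v)
    have i: "(\<integral>\<^sup>+x. v (x, y) + u (x, y) \<partial>M) = (\<integral>\<^sup>+x. v (x, y) \<partial>M) + (\<integral>\<^sup>+x. u (x, y) \<partial>M)" if "y \<in> topspace T" for y
      using sm[OF add(1) that] sm[OF add(3) that] by (intro nn_integral_add) auto
    have m: "(\<lambda>y. \<integral>\<^sup>+x. v (x, y) + u (x, y) \<partial>M) \<in> borel_measurable (borel_alg T)"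
      using i add by (subst measurable_cong[where g="\<lambda>y. (\<integral>\<^sup>+x. v (x, y) \<partial>M) + (\<integral>\<^sup>+x. u (x, y) \<partial>M)"]) auto
    moreover have "(\<integral>\<^sup>+z. v z + u z \<partial>rprod S T M N) = (\<integral>\<^sup>+y. (\<integral>\<^sup>+x. v (x, y) + u (x, y) \<partial>M) \<partial>N)" if N: "tight T N"
    proof -
      have "(\<integral>\<^sup>+z. v z + u z \<partial>rprod S T M N) = (\<integral>\<^sup>+z. v z \<partial>rprod S T M N) + (\<integral>\<^sup>+z. u z \<partial>rprod S T M N)"
        using add by (intro nn_integral_add) (auto simp: measurable_cong_sets[OF sets_rprod refl])
      also have "\<dots> = (\<integral>\<^sup>+y. (\<integral>\<^sup>+x. v (x, y) \<partial>M) \<partial>N) + (\<integral>\<^sup>+y. (\<integral>\<^sup>+x. u (x, y) \<partial>M) \<partial>N)" using add N by simp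
      also have "\<dots> = (\<integral>\<^sup>+y. (\<integral>\<^sup>+x. v (x, y) \<partial>M) + (\<integral>\<^sup>+x. u (x, y) \<partial>M) \<partial>N)"
        using add by (intro nn_integral_add[symmetric]) (simp_all add: measurable_tight[OF N])
      also have "\<dots> = (\<integral>\<^sup>+y. (\<integral>\<^sup>+x. v (x, y) + u (x, y) \<partial>M) \<partial>N)"
        using i by (intro nn_integral_cong) (auto simp: tight_space[OF N])
      finally show ?thesis .
    qed
    ultimately show ?case by simp
  next
    case (seq U)
    have i: "(\<integral>\<^sup>+x. (SUP i. U i) (x, y) \<partial>M) = (SUP i. \<integral>\<^sup>+x. U i (x, y) \<partial>M)" if "y \<in> topspace T" for y
      using sm[OF seq(1) that] seq(3)
      by (simp add: image_image SUP_apply, intro nn_integral_monotone_convergence_SUP) (auto simp: incseq_def le_fun_def)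
    have "(\<lambda>y. SUP i. \<integral>\<^sup>+x. U i (x, y) \<partial>M) \<in> borel_measurable (borel_alg T)"
      using seq(5) by (intro borel_measurable_SUP) auto
    then have m: "(\<lambda>y. \<integral>\<^sup>+x. (SUP i. U i) (x, y) \<partial>M) \<in> borel_measurable (borel_alg T)"
      using measurable_cong[of "borel_alg T" "\<lambda>y. \<integral>\<^sup>+x. (SUP i. U i) (x, y) \<partial>M", OF i] by simp
    moreover have "(\<integral>\<^sup>+z. (SUP i. U i) z \<partial>rprod S T M N) = (\<integral>\<^sup>+y. (\<integral>\<^sup>+x. (SUP i. U i) (x, y) \<partial>M) \<partial>N)" if N: "tight T N"
    proof -
      have "(\<integral>\<^sup>+z. (SUP i. U i) z \<partial>rprod S T M N) = (SUP i. \<integral>\<^sup>+z. U i z \<partial>rprod S T M N)"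
        using seq(1,3) by (simp add: image_image SUP_apply, intro nn_integral_monotone_convergence_SUP) (auto simp: measurable_cong_sets[OF sets_rprod refl])
      also have "\<dots> = (SUP i. \<integral>\<^sup>+y. (\<integral>\<^sup>+x. U i (x, y) \<partial>M) \<partial>N)" using seq(5) N by simp
      also have "\<dots> = (\<integral>\<^sup>+y. (SUP i. \<integral>\<^sup>+x. U i (x, y) \<partial>M) \<partial>N)"
        using seq(3,5)
        by (intro nn_integral_monotone_convergence_SUP[symmetric])
          (auto simp: incseq_def le_fun_def measurable_tight[OF N] intro!: nn_integral_mono)
      also have "\<dots> = (\<integral>\<^sup>+y. (\<integral>\<^sup>+x. (SUP i. U i) (x, y) \<partial>M) \<partial>N)"
        using i by (intro nn_integral_cong) (auto simp: tight_space[OF N])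
      finally show ?thesis .
    qed
    ultimately show ?case by simp
  qed
  then show "(\<lambda>y. \<integral>\<^sup>+x. f (x, y) \<partial>M) \<in> borel_measurable (borel_alg T)"
    and "tight T N \<Longrightarrow> (\<integral>\<^sup>+z. f z \<partial>rprod S T M N) = (\<integral>\<^sup>+y. (\<integral>\<^sup>+x. f (x, y) \<partial>M) \<partial>N)" by auto
qed

lemma Times_in_borel_alg:
  assumes A: "A \<in> sets (borel_alg S)" and B: "B \<in> sets (borel_alg T)"
  shows "A \<times> B \<in> sets (borel_alg (prod_topology S T))"
proof -
  have "fst -` A \<inter> topspace (prod_topology S T) \<in> sets (borel_alg (prod_topology S T))"
    using measurable_sets[OF continuous_map_measurable[OF continuous_map_fst] A, of T] by simp
  moreover have "snd -` B \<inter> topspace (prod_topology S T) \<in> sets (borel_alg (prod_topology S T))"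
    using measurable_sets[OF continuous_map_measurable[OF continuous_map_snd] B, of S] by simp
  ultimately have "(fst -` A \<inter> topspace (prod_topology S T)) \<inter> (snd -` B \<inter> topspace (prod_topology S T))
      \<in> sets (borel_alg (prod_topology S T))" by (rule sets.Int)
  also have "(fst -` A \<inter> topspace (prod_topology S T)) \<inter> (snd -` B \<inter> topspace (prod_topology S T)) = A \<times> B"
    using borel_alg_subset[OF A] borel_alg_subset[OF B] by auto
  finally show ?thesis .
qed

lemma emeasure_rprod_Times:
  assumes S: "Hausdorff_space S" and M: "tight S M" and N: "tight T N"
    and A: "A \<in> sets (borel_alg S)" and B: "B \<in> sets (borel_alg T)"
  shows "emeasure (rprod S T M N) (A \<times> B) = emeasure M A * emeasure N B"
proof -
  have "emeasure (rprod S T M N) (A \<times> B) = (\<integral>\<^sup>+y. emeasure M {x. (x, y) \<in> A \<times> B} \<partial>N)"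
    using S M N Times_in_borel_alg[OF A B] by (rule emeasure_rprod)
  also have "\<dots> = (\<integral>\<^sup>+y. emeasure M A * indicator B y \<partial>N)"
    by (intro nn_integral_cong) (auto simp: indicator_def)
  also have "\<dots> = emeasure M A * emeasure N B"
    using B tight_sets[OF N] by (intro nn_integral_cmult_indicator) auto
  finally show ?thesis .
qed

text \<open>The compact set is a finite union of rectangles. The values of \<open>f\<close>, the
  measure of the section, are cut into levels \<open>L j\<close> of height \<open>d\<close>, and
  each level is shrunk to a compact \<open>K j\<close>. By the tube lemma, a compact
  \<open>C z\<close> that nearly fills the section at \<open>z\<close> lies in all sections over a
  neighbourhood \<open>V z\<close>, and finitely many of these cover \<open>K j\<close>. For
  \<open>y\<close> in \<open>V z\<close> and in the same level, \<open>C z\<close> also nearly fills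
  the section at \<open>y\<close>, since the two sections differ in measure by less than
  \<open>d\<close>.\<close>

lemma rprod_inner_open:
  assumes S: "Hausdorff_space S" and T: "Hausdorff_space T" and M: "tight S M" and N: "tight T N"
    and U: "openin (prod_topology S T) U" and e: "0 < (e::real)"
  shows "\<exists>D. compactin (prod_topology S T) D \<and> D \<subseteq> U \<and> emeasure (rprod S T M N) (U - D) \<le> ennreal e"
proof -
  let ?P = "prod_topology S T"
  interpret M: finite_measure M using M by (rule tight_finite)
  interpret N: finite_measure N using N by (rule tight_finite)
  note sM = tight_sets[OF M] and sN = tight_sets[OF N]
  define m where "m = measure M (topspace S)"
  define l where "l = measure N (topspace T)"
  have ml: "0 \<le> m" "0 \<le> l" by (auto simp: m_def l_def)
  \<comment> \<open>The loss will be \<open>2 * d\<close> on good sections and at most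
    \<open>m\<close> on a set of sections of measure \<open>2 * d\<close>; adding 1 keeps the
    divisor positive.\<close>
  define d where "d = e / (2 * (m + l) + 1)"
  have d: "0 < d" using e ml by (auto simp: d_def)
  have de: "2 * d * l + m * (2 * d) \<le> e"
  proof -
    have "2 * d * l + m * (2 * d) = d * (2 * (m + l))" by (simp add: algebra_simps)
    also have "\<dots> \<le> d * (2 * (m + l) + 1)" using d by (intro mult_left_mono) auto
    also have "\<dots> = e" using ml by (simp add: d_def)
    finally show ?thesis .
  qed
  define f where "f y = measure M {x. (x, y) \<in> U}" for y
  have secU: "{x. (x, y) \<in> U} \<in> sets (borel_alg S)" for y
    using sec_sets[OF openin_in_borel_alg[OF U]] .
  have fm: "f \<in> borel_measurable (borel_alg T)"
    unfolding f_def measure_def using sec_measurable[OF S M openin_in_borel_alg[OF U]] by simp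
  have f0: "0 \<le> f y" "f y \<le> m" for y
    unfolding f_def m_def using tight_space[OF M] M.bounded_measure by (auto)
  \<comment> \<open>The index of the highest level that can occur, as \<open>f\<close> is bounded by
    \<open>m\<close>.\<close>
  define k where "k = nat \<lfloor>m / d\<rfloor>"
  define L where "L j = {y \<in> topspace T. real j * d \<le> f y \<and> f y < (real j + 1) * d}" for j :: nat
  have LB: "L j \<in> sets (borel_alg T)" for j
  proof -
    have "{y \<in> space (borel_alg T). real j * d \<le> f y \<and> f y < (real j + 1) * d} \<in> sets (borel_alg T)"
      using fm by measurable
    then show ?thesis by (simp add: L_def)
  qed
  have Lex: "\<exists>j\<le>k. y \<in> L j" if "y \<in> topspace T" for y
  proof (intro exI conjI)
    show "nat \<lfloor>f y / d\<rfloor> \<le> k" unfolding k_def using f0[of y] d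
      by (intro nat_mono floor_mono divide_right_mono) auto
    have "real (nat \<lfloor>f y / d\<rfloor>) = of_int \<lfloor>f y / d\<rfloor>" using f0[of y] d by simp
    moreover have "of_int \<lfloor>f y / d\<rfloor> \<le> f y / d" "f y / d < of_int \<lfloor>f y / d\<rfloor> + 1" by linarith+
    ultimately show "y \<in> L (nat \<lfloor>f y / d\<rfloor>)"
      using that unfolding L_def pos_le_divide_eq[OF d] pos_divide_less_eq[OF d] by simp
  qed
  \<comment> \<open>The \<open>k + 1\<close> levels share a total loss of \<open>d\<close>.\<close>
  have "\<forall>j. \<exists>K. compactin T K \<and> K \<subseteq> L j \<and> emeasure N (L j - K) \<le> ennreal (d / (real k + 1))"
    using N LB d unfolding tight_def by simp
  then obtain K where K: "\<And>j. compactin T (K j)" "\<And>j. K j \<subseteq> L j"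
    "\<And>j. emeasure N (L j - K j) \<le> ennreal (d / (real k + 1))" by metis
  define Q where "Q y CV \<longleftrightarrow> compactin S (fst CV) \<and> fst CV \<subseteq> {x. (x, y) \<in> U} \<and>
     emeasure M ({x. (x, y) \<in> U} - fst CV) \<le> ennreal d \<and>
     openin T (snd CV) \<and> y \<in> snd CV \<and> fst CV \<times> snd CV \<subseteq> U" for y CV
  have "\<exists>CV. Q y CV" if y: "y \<in> topspace T" for y
  proof -
    from tightD[OF M secU d] obtain C where
      C: "compactin S C" "C \<subseteq> {x. (x, y) \<in> U}" "emeasure M ({x. (x, y) \<in> U} - C) \<le> ennreal d" .
    from tube_lemma_left[OF U C(1) y] C(2) obtain V where "openin T V" "y \<in> V" "C \<times> V \<subseteq> U" by fast
    then show ?thesis using C by (intro exI[of _ "(C, V)"]) (simp add: Q_def)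
  qed
  then have "\<forall>y\<in>topspace T. \<exists>CV. Q y CV" by blast
  from bchoice[OF this] obtain h where h: "\<And>y. y \<in> topspace T \<Longrightarrow> Q y (h y)" by blast
  define C where "C y = fst (h y)" for y
  define V where "V y = snd (h y)" for y
  have CV: "\<And>y. y \<in> topspace T \<Longrightarrow> compactin S (C y)"
    "\<And>y. y \<in> topspace T \<Longrightarrow> C y \<subseteq> {x. (x, y) \<in> U}"
    "\<And>y. y \<in> topspace T \<Longrightarrow> emeasure M ({x. (x, y) \<in> U} - C y) \<le> ennreal d"
    "\<And>y. y \<in> topspace T \<Longrightarrow> openin T (V y)" "\<And>y. y \<in> topspace T \<Longrightarrow> y \<in> V y"
    "\<And>y. y \<in> topspace T \<Longrightarrow> C y \<times> V y \<subseteq> U"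
    using h unfolding Q_def C_def V_def by (simp_all only:)
  have KT: "K j \<subseteq> topspace T" for j using K(1) compactin_subset_topspace by blast
  have "\<exists>Y. finite Y \<and> Y \<subseteq> K j \<and> K j \<subseteq> (\<Union>y\<in>Y. V y)" for j
  proof -
    have "openin T A" if "A \<in> V ` K j" for A using CV(4) KT[of j] that by auto
    moreover have "K j \<subseteq> \<Union>(V ` K j)" using CV(5) KT[of j] by auto
    ultimately obtain \<F> where F: "finite \<F>" "\<F> \<subseteq> V ` K j" "K j \<subseteq> \<Union>\<F>"
      using compactinD[OF K(1)[of j], of "V ` K j"] by auto
    from finite_subset_image[OF F(1,2)] obtain Y where "finite Y" "Y \<subseteq> K j" "\<F> = V ` Y" by auto
    then show ?thesis using F(3) by blast
  qed
  then obtain Y where Y: "\<And>j. finite (Y j)" "\<And>j. Y j \<subseteq> K j" "\<And>j. K j \<subseteq> (\<Union>y\<in>Y j. V y)" by metis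
  define I where "I = (SIGMA j:{..k}. Y j)"
  have finI: "finite I" unfolding I_def using Y(1) by auto
  have IT: "snd p \<in> topspace T" if "p \<in> I" for p using that Y(2) KT unfolding I_def by fastforce
  define B where "B p = V (snd p) \<inter> K (fst p)" for p
  have BB: "B p \<in> sets (borel_alg T)" if "p \<in> I" for p
    unfolding B_def using CV(4)[OF IT[OF that]] compactin_in_borel_alg[OF T K(1)] by (auto intro: openin_in_borel_alg)
  \<comment> \<open>The pieces share a second loss of \<open>d\<close>; the added 1 covers an empty
    \<open>I\<close>.\<close>
  have "\<forall>p\<in>I. \<exists>W. compactin T W \<and> W \<subseteq> B p \<and> emeasure N (B p - W) \<le> ennreal (d / (real (card I) + 1))"
    using N BB d unfolding tight_def by simp
  then obtain W where W: "\<And>p. p \<in> I \<Longrightarrow> compactin T (W p)" "\<And>p. p \<in> I \<Longrightarrow> W p \<subseteq> B p"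
    "\<And>p. p \<in> I \<Longrightarrow> emeasure N (B p - W p) \<le> ennreal (d / (real (card I) + 1))" by metis
  define D where "D = (\<Union>p\<in>I. C (snd p) \<times> W p)"
  have D: "compactin ?P D"
    unfolding D_def using finI CV(1) W(1) IT by (intro compactin_Union) (auto simp: compactin_Times)
  have DU: "D \<subseteq> U"
    unfolding D_def using CV(6) IT W(2) by (fastforce simp: B_def)
  \<comment> \<open>The exceptional points \<open>y\<close>, lost either when levels or when pieces
    were made compact. Every other \<open>y\<close> lies in some \<open>W p\<close>.\<close>
  define Z where "Z = (\<Union>j\<le>k. L j - K j) \<union> (\<Union>p\<in>I. B p - W p)"
  have KB: "K j \<in> sets (borel_alg T)" for j using compactin_in_borel_alg[OF T K(1)] .
  have WB: "W p \<in> sets (borel_alg T)" if "p \<in> I" for p using compactin_in_borel_alg[OF T W(1)[OF that]] .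
  have ZB: "Z \<in> sets N"
    unfolding Z_def sN using LB KB BB WB finI by (intro sets.Un sets.finite_UN) auto
  have ZN: "emeasure N Z \<le> ennreal (2 * d)"
  proof -
    have "emeasure N Z \<le> emeasure N (\<Union>j\<le>k. L j - K j) + emeasure N (\<Union>p\<in>I. B p - W p)"
      unfolding Z_def using LB KB BB WB finI sN by (intro emeasure_subadditive sets.finite_UN) auto
    also have "\<dots> \<le> (\<Sum>j\<le>k. emeasure N (L j - K j)) + (\<Sum>p\<in>I. emeasure N (B p - W p))"
      using LB KB BB WB finI sN by (intro add_mono emeasure_subadditive_finite) auto
    also have "\<dots> \<le> (\<Sum>j\<le>k. ennreal (d / (real k + 1))) + (\<Sum>p\<in>I. ennreal (d / (real (card I) + 1)))"
      using K(3) W(3) by (intro add_mono sum_mono) auto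
    also have "\<dots> = ennreal (\<Sum>j\<le>k. d / (real k + 1)) + ennreal (\<Sum>p\<in>I. d / (real (card I) + 1))"
      using d by (subst (1 2) sum_ennreal) auto
    also have "\<dots> \<le> ennreal d + ennreal d"
      using d by (intro add_mono ennreal_leI) (auto simp: field_simps)
    also have "\<dots> = ennreal (d + d)" using d by (intro ennreal_plus[symmetric]) auto
    finally show ?thesis by simp
  qed
  have bound: "emeasure M {x. (x, y) \<in> U - D} \<le> ennreal (2 * d) + ennreal m * indicator Z y"
    if y: "y \<in> topspace T" for y
  proof (cases "y \<in> Z")
    case True
    have "emeasure M {x. (x, y) \<in> U - D} \<le> emeasure M (space M)"
      by (rule emeasure_space)
    also have "\<dots> = ennreal m" by (simp add: m_def tight_space[OF M] M.emeasure_eq_measure)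
    finally show ?thesis using True by (simp add: add_increasing)
  next
    case False
    obtain j where j: "j \<le> k" "y \<in> L j" using Lex[OF y] by blast
    then have yK: "y \<in> K j" using False by (auto simp: Z_def)
    then obtain z where z: "z \<in> Y j" "y \<in> V z" using Y(3) by blast
    then have p: "(j, z) \<in> I" using j by (auto simp: I_def)
    have "y \<in> B (j, z)" using z yK by (simp add: B_def)
    then have yW: "y \<in> W (j, z)" using False p by (auto simp: Z_def)
    have zT: "z \<in> topspace T" using IT[OF p] by simp
    have CB: "C z \<in> sets M" using compactin_in_borel_alg[OF S CV(1)[OF zT]] sM by simp
    have Cy: "C z \<subseteq> {x. (x, y) \<in> U}" using CV(6)[OF zT] z(2) by auto
    have sub: "{x. (x, y) \<in> U - D} \<subseteq> {x. (x, y) \<in> U} - C z"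
      using p yW by (force simp: D_def)
    have "measure M ({x. (x, z) \<in> U} - C z) \<le> d"
      using CV(3)[OF zT] d by (simp add: M.emeasure_eq_measure)
    \<comment> \<open>\<open>C z\<close> misses at most \<open>d\<close> of the section at
      \<open>z\<close>; as \<open>y\<close> and \<open>z\<close> are in level \<open>j\<close>, it
      misses at most \<open>2 * d\<close> of the section at \<open>y\<close>.\<close>
    then have "f z - measure M (C z) \<le> d"
      using M.finite_measure_Diff[of "{x. (x, z) \<in> U}" "C z"] secU sM CB CV(2)[OF zT] by (simp add: f_def)
    moreover have "real j * d \<le> f z" using z(1) Y(2) K(2) by (fastforce simp: L_def)
    moreover have "f y < (real j + 1) * d" using j by (simp add: L_def)
    moreover have "measure M ({x. (x, y) \<in> U} - C z) = f y - measure M (C z)"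
      using M.finite_measure_Diff[of "{x. (x, y) \<in> U}" "C z"] secU sM CB Cy by (simp add: f_def)
    ultimately have le: "measure M ({x. (x, y) \<in> U} - C z) \<le> 2 * d" by (simp add: algebra_simps)
    have "emeasure M {x. (x, y) \<in> U - D} \<le> emeasure M ({x. (x, y) \<in> U} - C z)"
      using sub secU sM CB by (intro emeasure_mono) auto
    also have "\<dots> \<le> ennreal (2 * d)" using le by (simp add: M.emeasure_eq_measure ennreal_leI)
    finally show ?thesis by (simp add: add_increasing2)
  qed
  have UD: "U - D \<in> sets (borel_alg ?P)"
    using openin_in_borel_alg[OF U] compactin_in_borel_alg[OF _ D] S T Hausdorff_space_prod_topology by blast
  have "emeasure (rprod S T M N) (U - D) = (\<integral>\<^sup>+y. emeasure M {x. (x, y) \<in> U - D} \<partial>N)"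
    using S M N UD by (rule emeasure_rprod)
  also have "\<dots> \<le> (\<integral>\<^sup>+y. ennreal (2 * d) + ennreal m * indicator Z y \<partial>N)"
    using bound by (intro nn_integral_mono) (simp add: tight_space[OF N])
  also have "\<dots> = ennreal (2 * d) * emeasure N (topspace T) + ennreal m * emeasure N Z"
    using ZB by (simp add: nn_integral_add nn_integral_cmult tight_space[OF N])
  also have "\<dots> \<le> ennreal (2 * d) * ennreal l + ennreal m * ennreal (2 * d)"
    using ZN by (intro add_mono mult_mono) (auto simp: l_def N.emeasure_eq_measure)
  also have "\<dots> = ennreal (2 * d * l + m * (2 * d))"
    using ml d by (simp add: ennreal_plus ennreal_mult)
  also have "\<dots> \<le> ennreal e" using de by (rule ennreal_leI)
  finally show ?thesis using D DU by blast
qed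

text \<open>A closed set is intersected with a compact rectangle that carries nearly all the mass;
  the result is compact. Together with the open case this is enough for all Borel sets.\<close>

lemma tight_rprod:
  assumes S: "Hausdorff_space S" and T: "Hausdorff_space T" and M: "tight S M" and N: "tight T N"
  shows "tight (prod_topology S T) (rprod S T M N)"
proof (rule tight_from_open_closed)
  let ?P = "prod_topology S T"
  interpret M: finite_measure M using M by (rule tight_finite)
  interpret N: finite_measure N using N by (rule tight_finite)
  show P: "Hausdorff_space ?P" using S T by (simp add: Hausdorff_space_prod_topology)
  show "emeasure (rprod S T M N) (topspace ?P) < \<infinity>"
    using emeasure_rprod_Times[OF S M N, of "topspace S" "topspace T"]
    by (simp add: ennreal_mult_less_top M.emeasure_eq_measure N.emeasure_eq_measure)
  show "\<exists>D. compactin ?P D \<and> D \<subseteq> U \<and> emeasure (rprod S T M N) (U - D) \<le> ennreal e"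
    if "openin ?P U" "0 < e" for U e
    using rprod_inner_open[OF S T M N that] .
  show "\<exists>D. compactin ?P D \<and> D \<subseteq> U \<and> emeasure (rprod S T M N) (U - D) \<le> ennreal e"
    if U: "closedin ?P U" and e: "0 < e" for U e
  proof -
    define m where "m = measure M (topspace S)"
    define l where "l = measure N (topspace T)"
    have ml: "0 \<le> m" "0 \<le> l" by (auto simp: m_def l_def)
    define d where "d = e / (m + l + 1)"
    have d: "0 < d" using e ml by (auto simp: d_def)
    have de: "d * l + m * d \<le> e"
    proof -
      have "d * l + m * d \<le> d * (m + l + 1)" using d by (simp add: algebra_simps)
      also have "\<dots> = e" using ml by (simp add: d_def)
      finally show ?thesis .
    qed
    from tightD[OF M topspace_in_borel_alg d] obtain K where
      K: "compactin S K" "K \<subseteq> topspace S" "emeasure M (topspace S - K) \<le> ennreal d" .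
    from tightD[OF N topspace_in_borel_alg d] obtain L where
      L: "compactin T L" "L \<subseteq> topspace T" "emeasure N (topspace T - L) \<le> ennreal d" .
    note KB = compactin_in_borel_alg[OF S K(1)] and LB = compactin_in_borel_alg[OF T L(1)]
    have D: "compactin ?P (U \<inter> K \<times> L)"
      using U K L by (intro closed_Int_compactin) (auto simp: compactin_Times)
    have 1: "(topspace S - K) \<times> topspace T \<in> sets (borel_alg ?P)"
      "topspace S \<times> (topspace T - L) \<in> sets (borel_alg ?P)"
      using KB LB by (intro Times_in_borel_alg sets.Diff; simp)+
    have "emeasure (rprod S T M N) (U - U \<inter> K \<times> L)
      \<le> emeasure (rprod S T M N) ((topspace S - K) \<times> topspace T \<union> topspace S \<times> (topspace T - L))"
      using 1 closedin_subset[OF U] by (intro emeasure_mono) auto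
    also have "\<dots> \<le> emeasure (rprod S T M N) ((topspace S - K) \<times> topspace T)
       + emeasure (rprod S T M N) (topspace S \<times> (topspace T - L))"
      using 1 by (intro emeasure_subadditive) auto
    also have "\<dots> = emeasure M (topspace S - K) * emeasure N (topspace T)
       + emeasure M (topspace S) * emeasure N (topspace T - L)"
      using KB LB by (simp add: emeasure_rprod_Times[OF S M N] sets.Diff)
    also have "\<dots> \<le> ennreal d * ennreal l + ennreal m * ennreal d"
      using K L by (intro add_mono mult_mono) (auto simp: l_def m_def N.emeasure_eq_measure M.emeasure_eq_measure)
    also have "\<dots> = ennreal (d * l + m * d)"
      using ml d by (simp add: ennreal_plus ennreal_mult)
    also have "\<dots> \<le> ennreal e" using de by (rule ennreal_leI)
    finally show ?thesis using D by blast
  qed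
qed simp

subsection \<open>Products of marginals\<close>

text \<open>Domination on sets passes to integrals by induction on \<open>f\<close>. A finite family
  on the right accommodates sums over partitions; a one-element family gives the usual comparison of
  two measures.\<close>

lemma nn_integral_sum_dominated:
  fixes M :: "'a measure" and N :: "'i \<Rightarrow> 'a measure"
  assumes N: "\<And>i. i \<in> I \<Longrightarrow> sets (N i) = sets M" and fin: "finite I"
    and le: "\<And>A. A \<in> sets M \<Longrightarrow> emeasure M A \<le> c * (\<Sum>i\<in>I. emeasure (N i) A)"
    and f: "f \<in> borel_measurable M"
  shows "(\<integral>\<^sup>+x. f x \<partial>M) \<le> c * (\<Sum>i\<in>I. \<integral>\<^sup>+x. f x \<partial>N i)"
proof -
  have sp: "space (N i) = space M" if "i \<in> I" for i using N[OF that] by (rule sets_eq_imp_space_eq)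
  have m: "g \<in> borel_measurable (N i)" if "i \<in> I" "g \<in> borel_measurable M" for i and g :: "'a \<Rightarrow> ennreal"
    using that(2) by (simp add: measurable_cong_sets[OF N[OF that(1)] refl])
  show ?thesis
    using f
  proof (induction rule: borel_measurable_induct)
    case (cong f g)
    have "(\<integral>\<^sup>+x. f x \<partial>M) = (\<integral>\<^sup>+x. g x \<partial>M)" using cong(3) by (intro nn_integral_cong)
    moreover have "(\<Sum>i\<in>I. \<integral>\<^sup>+x. f x \<partial>N i) = (\<Sum>i\<in>I. \<integral>\<^sup>+x. g x \<partial>N i)"
      using cong(3) sp by (intro sum.cong nn_integral_cong) auto
    ultimately show ?case using cong(4) by simp
  next
    case (set A)
    then show ?case using le[of A] N by simp
  next
    case (mult u d)
    have "(\<integral>\<^sup>+x. d * u x \<partial>M) = d * (\<integral>\<^sup>+x. u x \<partial>M)" using mult(2) by (rule nn_integral_cmult)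
    also have "\<dots> \<le> d * (c * (\<Sum>i\<in>I. \<integral>\<^sup>+x. u x \<partial>N i))" using mult(4) by (intro mult_left_mono) auto
    also have "\<dots> = c * (\<Sum>i\<in>I. d * (\<integral>\<^sup>+x. u x \<partial>N i))" by (simp add: sum_distrib_left mult.left_commute)
    also have "(\<Sum>i\<in>I. d * (\<integral>\<^sup>+x. u x \<partial>N i)) = (\<Sum>i\<in>I. \<integral>\<^sup>+x. d * u x \<partial>N i)"
      using m[OF _ mult(2)] by (intro sum.cong refl nn_integral_cmult[symmetric])
    finally show ?case .
  next
    case (add u v)
    have "(\<integral>\<^sup>+x. v x + u x \<partial>M) = (\<integral>\<^sup>+x. v x \<partial>M) + (\<integral>\<^sup>+x. u x \<partial>M)" using add(1,3) by (intro nn_integral_add)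
    also have "\<dots> \<le> c * (\<Sum>i\<in>I. \<integral>\<^sup>+x. v x \<partial>N i) + c * (\<Sum>i\<in>I. \<integral>\<^sup>+x. u x \<partial>N i)"
      using add by (intro add_mono) auto
    also have "\<dots> = c * (\<Sum>i\<in>I. (\<integral>\<^sup>+x. v x \<partial>N i) + (\<integral>\<^sup>+x. u x \<partial>N i))"
      by (simp add: sum.distrib distrib_left)
    also have "(\<Sum>i\<in>I. (\<integral>\<^sup>+x. v x \<partial>N i) + (\<integral>\<^sup>+x. u x \<partial>N i)) = (\<Sum>i\<in>I. \<integral>\<^sup>+x. v x + u x \<partial>N i)"
      using m[OF _ add(1)] m[OF _ add(3)] by (intro sum.cong refl nn_integral_add[symmetric])
    finally show ?case .
  next
    case (seq U)
    have "(\<integral>\<^sup>+x. (SUP i. U i) x \<partial>M) = (SUP i. \<integral>\<^sup>+x. U i x \<partial>M)"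
      using seq(1,3) by (simp add: image_image SUP_apply, intro nn_integral_monotone_convergence_SUP) auto
    also have "\<dots> \<le> c * (\<Sum>i\<in>I. \<integral>\<^sup>+x. (SUP i. U i) x \<partial>N i)"
    proof (rule SUP_least)
      fix k
      have "(\<integral>\<^sup>+x. U k x \<partial>M) \<le> c * (\<Sum>i\<in>I. \<integral>\<^sup>+x. U k x \<partial>N i)" by (rule seq(5))
      also have "\<dots> \<le> c * (\<Sum>i\<in>I. \<integral>\<^sup>+x. (SUP i. U i) x \<partial>N i)"
        by (intro mult_left_mono sum_mono nn_integral_mono) (auto simp: SUP_apply image_image intro!: SUP_upper)
      finally show "(\<integral>\<^sup>+x. U k x \<partial>M) \<le> c * (\<Sum>i\<in>I. \<integral>\<^sup>+x. (SUP i. U i) x \<partial>N i)" .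
    qed
    finally show ?case .
  qed
qed

section \<open>Restricting and gluing coordinates\<close>

lemma continuous_map_into_product:
  assumes "\<And>s. s \<in> topspace S \<Longrightarrow> f s \<in> extensional K" "\<And>k. k \<in> K \<Longrightarrow> continuous_map S (X k) (\<lambda>s. f s k)"
  shows "continuous_map S (product_topology X K) f"
  using assms by (auto simp: continuous_map_componentwise)

lemma continuous_map_restrict_product:
  assumes "F \<subseteq> G" shows "continuous_map (product_topology X G) (product_topology X F) (\<lambda>x. restrict x F)"
  using assms by (intro continuous_map_into_product) (auto intro!: continuous_map_product_projection)

lemma continuous_map_fst_coord:
  "k \<in> F \<Longrightarrow> continuous_map (prod_topology (product_topology X F) T) (X k) (\<lambda>z. fst z k)"
  using continuous_map_compose[OF continuous_map_fst continuous_map_product_projection[of k F X]]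
  by (simp add: o_def)

lemma continuous_map_snd_coord:
  "k \<in> F \<Longrightarrow> continuous_map (prod_topology T (product_topology X F)) (X k) (\<lambda>z. snd z k)"
  using continuous_map_compose[OF continuous_map_snd continuous_map_product_projection[of k F X]]
  by (simp add: o_def)

lemma mix_extensional:
  "x \<in> topspace (product_topology X F) \<Longrightarrow> y \<in> topspace (product_topology X G) \<Longrightarrow> mix F x y \<in> topspace (product_topology X (F \<union> G))"
  by (auto simp: mix_def PiE_iff extensional_def)

lemma continuous_map_mix:
  "continuous_map (prod_topology (product_topology X F) (product_topology X G)) (product_topology X (F \<union> G))
     (\<lambda>(x, y). mix F x y)"
proof (rule continuous_map_into_product)
  let ?P = "prod_topology (product_topology X F) (product_topology X G)"
  show "(case s of (x, y) \<Rightarrow> mix F x y) \<in> extensional (F \<union> G)" if "s \<in> topspace ?P" for s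
    using that by (auto simp: mix_def PiE_iff extensional_def)
  show "continuous_map ?P (X k) (\<lambda>s. (case s of (x, y) \<Rightarrow> mix F x y) k)" if "k \<in> F \<union> G" for k
    using that continuous_map_fst_coord[of k F X "product_topology X G"]
      continuous_map_snd_coord[of k G "product_topology X F" X]
    by (cases "k \<in> F") (auto simp: mix_def case_prod_beta)
qed

text \<open>For disjoint \<open>F\<close> and \<open>G\<close> this is the product of
  \<open>M\<close> and \<open>N\<close>, carried from pairs of points to points with coordinates in
  \<open>F \<union> G\<close>.\<close>

definition join :: "(nat \<Rightarrow> 'a topology) \<Rightarrow> nat set \<Rightarrow> nat set \<Rightarrow> (nat \<Rightarrow> 'a) measure \<Rightarrow> (nat \<Rightarrow> 'a) measure \<Rightarrow> (nat \<Rightarrow> 'a) measure" where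
  "join X F G M N = distr (rprod (product_topology X F) (product_topology X G) M N)
     (borel_alg (product_topology X (F \<union> G))) (\<lambda>(x, y). mix F x y)"

locale hausdorff_family =
  fixes X :: "nat \<Rightarrow> 'a topology" and I :: "nat set"
  assumes finite_I: "finite I" and hausdorff: "\<And>i. i \<in> I \<Longrightarrow> Hausdorff_space (X i)"
begin

abbreviation PT :: "nat set \<Rightarrow> (nat \<Rightarrow> 'a) topology" where "PT G \<equiv> product_topology X G"

lemma hausdorff_PT: "G \<subseteq> I \<Longrightarrow> Hausdorff_space (PT G)"
  using hausdorff by (auto simp: Hausdorff_space_product_topology)

lemma box_borel:
  assumes "G \<subseteq> I" "\<And>i. i \<in> G \<Longrightarrow> openin (X i) (A i)" shows "PiE G A \<in> sets (borel_alg (PT G))"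
  using assms finite_subset[OF assms(1) finite_I]
  by (intro openin_in_borel_alg) (simp add: openin_PiE)

text \<open>Open boxes form a base of the product topology that is stable under intersection, so
  tight measures are compared on them.\<close>

lemma tight_eqI_boxes:
  assumes G: "G \<subseteq> I" and M: "tight (PT G) M" and N: "tight (PT G) N"
    and eq: "\<And>A. (\<And>i. i \<in> G \<Longrightarrow> openin (X i) (A i)) \<Longrightarrow> emeasure M (PiE G A) = emeasure N (PiE G A)"
  shows "M = N"
proof (rule tight_eqI_base[OF hausdorff_PT[OF G] M N])
  let ?B = "{PiE G A | A. \<forall>i\<in>G. openin (X i) (A i)}"
  have fG: "finite G" using G finite_I finite_subset by blast
  show "openin (PT G) U" if "U \<in> ?B" for U using that fG by (auto simp: openin_PiE)
  show "Int_stable ?B"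
    unfolding Int_stable_def
  proof safe
    fix A B assume A: "\<forall>i\<in>G. openin (X i) (A i)" and B: "\<forall>i\<in>G. openin (X i) (B i)"
    show "\<exists>C. PiE G A \<inter> PiE G B = PiE G C \<and> (\<forall>i\<in>G. openin (X i) (C i))"
      using A B by (intro exI[of _ "\<lambda>i. A i \<inter> B i"]) (auto simp: PiE_Int)
  qed
  show "topspace (PT G) \<in> ?B" by auto
  show "\<exists>V\<in>?B. x \<in> V \<and> V \<subseteq> U" if "openin (PT G) U" "x \<in> U" for U x
  proof -
    from bspec[OF iffD1[OF openin_product_topology_alt that(1)] that(2)]
    obtain A where A: "\<forall>i\<in>G. openin (X i) (A i)" "x \<in> PiE G A" "PiE G A \<subseteq> U" by auto
    then show ?thesis by (intro bexI[of _ "PiE G A"]) auto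
  qed
  show "emeasure M U = emeasure N U" if "U \<in> ?B" for U using that eq by auto
qed

lemma tight_marginal:
  assumes "F \<subseteq> G" "G \<subseteq> I" "tight (PT G) N" shows "tight (PT F) (marginal X F N)"
  unfolding marginal_def using assms
  by (intro tight_distr[OF _ continuous_map_restrict_product] hausdorff_PT) auto

lemma emeasure_marginal:
  assumes "F \<subseteq> G" "tight (PT G) N" "A \<in> sets (borel_alg (PT F))"
  shows "emeasure (marginal X F N) A = emeasure N {x \<in> topspace (PT G). restrict x F \<in> A}"
proof -
  have "(\<lambda>x. restrict x F) \<in> measurable N (borel_alg (PT F))"
    unfolding measurable_tight[OF assms(2)]
    using continuous_map_measurable[OF continuous_map_restrict_product[OF assms(1)]] .
  then have "emeasure (marginal X F N) A = emeasure N ((\<lambda>x. restrict x F) -` A \<inter> space N)"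
    unfolding marginal_def using assms(3) by (rule emeasure_distr)
  also have "(\<lambda>x. restrict x F) -` A \<inter> space N = {x \<in> topspace (PT G). restrict x F \<in> A}"
    by (auto simp: tight_space[OF assms(2)])
  finally show ?thesis .
qed

lemma nn_integral_marginal:
  assumes "F \<subseteq> G" "tight (PT G) N" "f \<in> borel_measurable (borel_alg (PT F))"
  shows "(\<integral>\<^sup>+x. f x \<partial>marginal X F N) = (\<integral>\<^sup>+x. f (restrict x F) \<partial>N)"
proof -
  have "(\<lambda>x. restrict x F) \<in> measurable N (borel_alg (PT F))"
    unfolding measurable_tight[OF assms(2)]
    using continuous_map_measurable[OF continuous_map_restrict_product[OF assms(1)]] .
  then show ?thesis unfolding marginal_def using assms(3) by (intro nn_integral_distr) auto
qed

lemma marginal_marginal: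
  assumes "F \<subseteq> G" "G \<subseteq> H" "tight (PT H) N"
  shows "marginal X F (marginal X G N) = marginal X F N"
proof -
  have m: "(\<lambda>x. restrict x G) \<in> measurable N (borel_alg (PT G))"
    unfolding measurable_tight[OF assms(3)]
    using continuous_map_measurable[OF continuous_map_restrict_product[OF assms(2)]] .
  have "marginal X F (marginal X G N) = distr N (borel_alg (PT F)) ((\<lambda>x. restrict x F) \<circ> (\<lambda>x. restrict x G))"
    unfolding marginal_def
    by (rule distr_distr[OF continuous_map_measurable[OF continuous_map_restrict_product[OF assms(1)]] m])
  also have "(\<lambda>x. restrict x F) \<circ> (\<lambda>x. restrict x G) = (\<lambda>x. restrict x F)"
    using assms(1) by (auto simp: restrict_def o_def fun_eq_iff)
  finally show ?thesis by (simp only: marginal_def)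
qed

lemma marginal_self:
  assumes "tight (PT G) N" shows "marginal X G N = N"
proof -
  have "marginal X G N = distr N (borel_alg (PT G)) (\<lambda>x. x)"
    unfolding marginal_def
    by (intro distr_cong refl) (auto simp: tight_space[OF assms] PiE_def extensional_restrict)
  also have "\<dots> = N" using distr_id2[OF tight_sets[OF assms, symmetric]] .
  finally show ?thesis .
qed

lemma tight_join:
  assumes "F \<union> G \<subseteq> I" "tight (PT F) M" "tight (PT G) N"
  shows "tight (PT (F \<union> G)) (join X F G M N)"
  unfolding join_def using assms hausdorff_PT
  by (intro tight_distr[OF tight_rprod continuous_map_mix]) (auto simp: Hausdorff_space_prod_topology)

lemma mix_measurable:
  "(\<lambda>(x, y). mix F x y) \<in> measurable (rprod (PT F) (PT G) M N) (borel_alg (PT (F \<union> G)))"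
  using continuous_map_measurable[OF continuous_map_mix, of F X G]
  by (subst measurable_cong_sets[OF sets_rprod refl])

lemma nn_integral_join:
  assumes "F \<union> G \<subseteq> I" "tight (PT F) M" "tight (PT G) N" "f \<in> borel_measurable (borel_alg (PT (F \<union> G)))"
  shows "(\<integral>\<^sup>+z. f z \<partial>join X F G M N) = (\<integral>\<^sup>+y. (\<integral>\<^sup>+x. f (mix F x y) \<partial>M) \<partial>N)"
proof -
  have "(\<integral>\<^sup>+z. f z \<partial>join X F G M N) = (\<integral>\<^sup>+z. f (case z of (x, y) \<Rightarrow> mix F x y) \<partial>rprod (PT F) (PT G) M N)"
    unfolding join_def using mix_measurable assms(4) by (intro nn_integral_distr) auto
  also have "\<dots> = (\<integral>\<^sup>+y. (\<integral>\<^sup>+x. f (mix F x y) \<partial>M) \<partial>N)"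
    using assms hausdorff_PT measurable_compose[OF continuous_map_measurable[OF continuous_map_mix, of F X G] assms(4)]
    by (subst nn_integral_rprod) auto
  finally show ?thesis .
qed

lemma emeasure_join_Int:
  assumes "F \<union> G \<subseteq> I" "F \<inter> G = {}" "tight (PT F) M" "tight (PT G) N"
    "A \<in> sets (borel_alg (PT F))" "B \<in> sets (borel_alg (PT G))"
  shows "emeasure (join X F G M N) {z \<in> topspace (PT (F \<union> G)). restrict z F \<in> A \<and> restrict z G \<in> B} = emeasure M A * emeasure N B"
proof -
  let ?E = "{z \<in> topspace (PT (F \<union> G)). restrict z F \<in> A \<and> restrict z G \<in> B}"
  have "(\<lambda>x. restrict x F) -` A \<inter> topspace (PT (F \<union> G)) \<in> sets (borel_alg (PT (F \<union> G)))"
    "(\<lambda>x. restrict x G) -` B \<inter> topspace (PT (F \<union> G)) \<in> sets (borel_alg (PT (F \<union> G)))"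
    using measurable_sets[OF continuous_map_measurable[OF continuous_map_restrict_product] assms(5), of "F \<union> G"]
      measurable_sets[OF continuous_map_measurable[OF continuous_map_restrict_product] assms(6), of "F \<union> G"] by auto
  from sets.Int[OF this] have E: "?E \<in> sets (borel_alg (PT (F \<union> G)))"
    by (rule back_subst[of "\<lambda>s. s \<in> sets (borel_alg (PT (F \<union> G)))"]) auto
  have "emeasure (join X F G M N) ?E = emeasure (rprod (PT F) (PT G) M N)
      ((\<lambda>(x, y). mix F x y) -` ?E \<inter> space (rprod (PT F) (PT G) M N))"
    unfolding join_def using mix_measurable E by (rule emeasure_distr)
  also have "(\<lambda>(x, y). mix F x y) -` ?E \<inter> space (rprod (PT F) (PT G) M N) = A \<times> B"
  proof -
    have 1: "restrict (mix F x y) F = x" "restrict (mix F x y) G = y"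
      if "x \<in> topspace (PT F)" "y \<in> topspace (PT G)" for x y
      using that assms(2) by (auto simp: mix_def fun_eq_iff PiE_iff extensional_def)
    have AB: "A \<subseteq> topspace (PT F)" "B \<subseteq> topspace (PT G)" using assms(5,6) borel_alg_subset by blast+
    have "(a, b) \<in> (\<lambda>(x, y). mix F x y) -` ?E \<inter> space (rprod (PT F) (PT G) M N) \<longleftrightarrow> (a, b) \<in> A \<times> B" for a b
    proof (cases "a \<in> topspace (PT F) \<and> b \<in> topspace (PT G)")
      case True
      then show ?thesis
        using 1[of a b] mix_extensional[of a X F b G] by (simp del: topspace_product_topology)
    next
      case False
      then show ?thesis using AB by (auto simp del: topspace_product_topology)
    qed
    then show ?thesis unfolding set_eq_iff split_paired_All by blast
  qed
  also have "emeasure (rprod (PT F) (PT G) M N) (A \<times> B) = emeasure M A * emeasure N B"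
    using assms hausdorff_PT by (intro emeasure_rprod_Times) auto
  finally show ?thesis .
qed

text \<open>Domination is applied to the outer measure, with the inner integral as integrand, and
  then to the inner measure for each fixed \<open>y\<close>; this multiplies the constants.\<close>

lemma nn_integral_join_dominated:
  assumes FG: "F \<union> G \<subseteq> I" and M: "tight (PT F) M" and N: "tight (PT G) N"
    and fin: "finite J" "finite K"
    and MJ: "\<And>j. j \<in> J \<Longrightarrow> tight (PT F) (M' j)" and NK: "\<And>k. k \<in> K \<Longrightarrow> tight (PT G) (N' k)"
    and lM: "\<And>A. A \<in> sets (borel_alg (PT F)) \<Longrightarrow> emeasure M A \<le> c * (\<Sum>j\<in>J. emeasure (M' j) A)"
    and lN: "\<And>A. A \<in> sets (borel_alg (PT G)) \<Longrightarrow> emeasure N A \<le> d * (\<Sum>k\<in>K. emeasure (N' k) A)"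
    and f: "f \<in> borel_measurable (borel_alg (prod_topology (PT F) (PT G)))"
  shows "(\<integral>\<^sup>+y. (\<integral>\<^sup>+x. f (x, y) \<partial>M) \<partial>N) \<le> c * d * (\<Sum>j\<in>J. \<Sum>k\<in>K. (\<integral>\<^sup>+y. (\<integral>\<^sup>+x. f (x, y) \<partial>M' j) \<partial>N' k))"
proof -
  have HF: "Hausdorff_space (PT F)" using FG hausdorff_PT by auto
  have m1: "(\<lambda>x. f (x, y)) \<in> borel_measurable (borel_alg (PT F))" if "y \<in> topspace (PT G)" for y
  proof -
    have "continuous_map (PT F) (prod_topology (PT F) (PT G)) (\<lambda>x. (x, y))"
      using that by (simp add: continuous_map_pairwise o_def)
    from measurable_compose[OF continuous_map_measurable[OF this] f] show ?thesis .
  qed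
  have m2: "(\<lambda>y. \<integral>\<^sup>+x. f (x, y) \<partial>L) \<in> borel_measurable (borel_alg (PT G))" if "tight (PT F) L" for L
    using HF that f by (rule borel_measurable_nn_integral_tight)
  have in1: "(\<integral>\<^sup>+x. f (x, y) \<partial>M) \<le> c * (\<Sum>j\<in>J. \<integral>\<^sup>+x. f (x, y) \<partial>M' j)" if "y \<in> topspace (PT G)" for y
    using lM m1[OF that] tight_sets[OF M] tight_sets[OF MJ] fin
    by (intro nn_integral_sum_dominated) (auto simp: measurable_tight[OF M])
  have "(\<integral>\<^sup>+y. (\<integral>\<^sup>+x. f (x, y) \<partial>M) \<partial>N) \<le> d * (\<Sum>k\<in>K. (\<integral>\<^sup>+y. (\<integral>\<^sup>+x. f (x, y) \<partial>M) \<partial>N' k))"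
    using lN m2[OF M] tight_sets[OF N] tight_sets[OF NK] fin
    by (intro nn_integral_sum_dominated) (auto simp: measurable_tight[OF N])
  also have "\<dots> \<le> d * (\<Sum>k\<in>K. (\<integral>\<^sup>+y. c * (\<Sum>j\<in>J. \<integral>\<^sup>+x. f (x, y) \<partial>M' j) \<partial>N' k))"
    using in1 tight_space[OF NK] by (intro mult_left_mono sum_mono nn_integral_mono) auto
  also have "\<dots> = d * (\<Sum>k\<in>K. c * (\<Sum>j\<in>J. (\<integral>\<^sup>+y. (\<integral>\<^sup>+x. f (x, y) \<partial>M' j) \<partial>N' k)))"
    using m2[OF MJ] by (simp add: nn_integral_cmult nn_integral_sum measurable_tight[OF NK] borel_measurable_sum)
  also have "\<dots> = c * d * (\<Sum>k\<in>K. \<Sum>j\<in>J. (\<integral>\<^sup>+y. (\<integral>\<^sup>+x. f (x, y) \<partial>M' j) \<partial>N' k))"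
    by (simp add: sum_distrib_left ac_simps)
  also have "\<dots> = c * d * (\<Sum>j\<in>J. \<Sum>k\<in>K. (\<integral>\<^sup>+y. (\<integral>\<^sup>+x. f (x, y) \<partial>M' j) \<partial>N' k))"
    by (subst sum.swap) simp
  finally show ?thesis .
qed

end

section \<open>Products over the blocks of a partition\<close>

lemma partition_on_Un:
  assumes "partition_on F \<tau>" "partition_on G \<sigma>" "F \<inter> G = {}"
  shows "partition_on (F \<union> G) (\<tau> \<union> \<sigma>)" and "\<tau> \<inter> \<sigma> = {}"
proof -
  have *: "B \<noteq> {}" "B \<subseteq> F" if "B \<in> \<tau>" for B using assms(1) that by (auto simp: partition_on_def)
  have **: "B \<noteq> {}" "B \<subseteq> G" if "B \<in> \<sigma>" for B using assms(2) that by (auto simp: partition_on_def)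
  show "\<tau> \<inter> \<sigma> = {}" using * ** assms(3) by blast
  have "disjoint (\<tau> \<union> \<sigma>)"
    unfolding disjoint_def
  proof (intro ballI impI)
    fix a b assume ab: "a \<in> \<tau> \<union> \<sigma>" "b \<in> \<tau> \<union> \<sigma>" "a \<noteq> b"
    have "disjoint \<tau>" "disjoint \<sigma>" using assms by (auto simp: partition_on_def)
    then have d: "a \<in> \<tau> \<Longrightarrow> b \<in> \<tau> \<Longrightarrow> a \<inter> b = {}" "a \<in> \<sigma> \<Longrightarrow> b \<in> \<sigma> \<Longrightarrow> a \<inter> b = {}"
      using ab(3) unfolding disjoint_def by simp_all
    show "a \<inter> b = {}"
      using ab(1,2) d *(2)[of a] *(2)[of b] **(2)[of a] **(2)[of b] assms(3) by (elim UnE) auto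
  qed
  then show "partition_on (F \<union> G) (\<tau> \<union> \<sigma>)" using assms by (auto simp: partition_on_def)
qed

lemma cylinder_eq_PiE:
  assumes "B \<subseteq> G" "\<And>i. i \<in> B \<Longrightarrow> A i \<subseteq> U i"
  shows "{x \<in> PiE G U. restrict x B \<in> PiE B A} = PiE G (\<lambda>i. if i \<in> B then A i else U i)"
proof (intro set_eqI iffI)
  fix x assume x: "x \<in> PiE G (\<lambda>i. if i \<in> B then A i else U i)"
  have *: "x i \<in> (if i \<in> B then A i else U i)" if "i \<in> G" for i using PiE_mem[OF x that] .
  have "x i \<in> A i" if "i \<in> B" for i using *[of i] that assms(1) by auto
  moreover have "x i \<in> U i" if "i \<in> G" for i using *[OF that] assms(2)[of i] by (auto split: if_splits)
  ultimately show "x \<in> {x \<in> PiE G U. restrict x B \<in> PiE B A}" using x by (simp add: PiE_iff)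
qed (simp add: PiE_iff)

context hausdorff_family
begin

lemma finite_partition: "partition_on G \<pi> \<Longrightarrow> G \<subseteq> I \<Longrightarrow> finite \<pi>"
  using finite_elements[OF finite_subset[OF _ finite_I]] .

text \<open>The property that singles out \<open>radon_product\<close>, with tightness in place of
  the Radon property and with the ground set as a parameter.\<close>

definition product_spec :: "nat set \<Rightarrow> nat set set \<Rightarrow> (nat set \<Rightarrow> (nat \<Rightarrow> 'a) measure) \<Rightarrow> (nat \<Rightarrow> 'a) measure \<Rightarrow> bool" where
  "product_spec G \<pi> N Q \<longleftrightarrow> tight (PT G) Q \<and>
     (\<forall>B. (\<forall>F\<in>\<pi>. B F \<in> sets (borel_alg (PT F))) \<longrightarrow>
        emeasure Q {x \<in> topspace (PT G). \<forall>F\<in>\<pi>. restrict x F \<in> B F} = (\<Prod>F\<in>\<pi>. emeasure (N F) (B F)))"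

lemma box_eq_blocks:
  assumes "partition_on G \<pi>" "\<And>i. i \<in> G \<Longrightarrow> A i \<subseteq> topspace (X i)"
  shows "{x \<in> topspace (PT G). \<forall>F\<in>\<pi>. restrict x F \<in> PiE F A} = PiE G A"
proof -
  have G: "G = \<Union>\<pi>" using assms(1) by (simp add: partition_on_def)
  show ?thesis using assms(2) unfolding G by (auto simp: PiE_iff extensional_def)
qed

lemma product_spec_box:
  assumes "product_spec G \<pi> N Q" "partition_on G \<pi>" "G \<subseteq> I" "\<And>i. i \<in> G \<Longrightarrow> openin (X i) (A i)"
  shows "emeasure Q (PiE G A) = (\<Prod>F\<in>\<pi>. emeasure (N F) (PiE F A))"
proof -
  have G: "G = \<Union>\<pi>" using assms(2) by (simp add: partition_on_def)
  have "PiE F A \<in> sets (borel_alg (PT F))" if "F \<in> \<pi>" for F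
    using that assms(3,4) by (intro box_borel) (auto simp: G)
  then have "emeasure Q {x \<in> topspace (PT G). \<forall>F\<in>\<pi>. restrict x F \<in> PiE F A} = (\<Prod>F\<in>\<pi>. emeasure (N F) (PiE F A))"
    using assms(1)[unfolded product_spec_def, THEN conjunct2, THEN spec[of _ "\<lambda>F. PiE F A"]] by auto
  moreover have "A i \<subseteq> topspace (X i)" if "i \<in> G" for i using assms(4)[OF that] by (rule openin_subset)
  ultimately show ?thesis using box_eq_blocks[OF assms(2)] by simp
qed

lemma product_spec_unique:
  assumes "product_spec G \<pi> N Q" "product_spec G \<pi> N Q'" "partition_on G \<pi>" "G \<subseteq> I"
  shows "Q = Q'"
  using assms by (intro tight_eqI_boxes[of G]) (auto simp: product_spec_box product_spec_def)

lemma radon_product_eq: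
  assumes Q: "product_spec G \<pi> N Q" and \<pi>: "partition_on G \<pi>" "G \<subseteq> I"
  shows "radon_product X \<pi> N = Q"
  unfolding radon_product_def
proof (rule the_equality)
  have G: "\<Union>\<pi> = G" using \<pi>(1) by (simp add: partition_on_def)
  show "radon_measure (PT (\<Union>\<pi>)) Q \<and> (\<forall>B. (\<forall>F\<in>\<pi>. B F \<in> sets (borel_alg (PT F))) \<longrightarrow>
        emeasure Q {x \<in> topspace (PT (\<Union>\<pi>)). \<forall>F\<in>\<pi>. restrict x F \<in> B F} = (\<Prod>F\<in>\<pi>. emeasure (N F) (B F)))"
    using Q radon_tight_iff[OF hausdorff_PT[OF \<pi>(2)], of Q] unfolding G product_spec_def by blast
  fix Q' assume Q': "radon_measure (PT (\<Union>\<pi>)) Q' \<and> (\<forall>B. (\<forall>F\<in>\<pi>. B F \<in> sets (borel_alg (PT F))) \<longrightarrow>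
        emeasure Q' {x \<in> topspace (PT (\<Union>\<pi>)). \<forall>F\<in>\<pi>. restrict x F \<in> B F} = (\<Prod>F\<in>\<pi>. emeasure (N F) (B F)))"
  \<comment> \<open>To see that \<open>Q'\<close> is tight its total mass must be finite. The box
    whose factors are the whole spaces gives it the same total mass as \<open>Q\<close>.\<close>
  have top: "{x \<in> topspace (PT G). \<forall>F\<in>\<pi>. restrict x F \<in> topspace (PT F)} = topspace (PT G)"
    unfolding G[symmetric] by (auto simp: PiE_iff extensional_def)
  have "emeasure Q' {x \<in> topspace (PT G). \<forall>F\<in>\<pi>. restrict x F \<in> topspace (PT F)} = (\<Prod>F\<in>\<pi>. emeasure (N F) (topspace (PT F)))"
    using Q' unfolding G by (simp del: topspace_product_topology)
  moreover have "emeasure Q {x \<in> topspace (PT G). \<forall>F\<in>\<pi>. restrict x F \<in> topspace (PT F)} = (\<Prod>F\<in>\<pi>. emeasure (N F) (topspace (PT F)))"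
    using Q unfolding product_spec_def by (simp del: topspace_product_topology)
  moreover have "emeasure Q (topspace (PT G)) < \<infinity>" using Q by (simp add: product_spec_def tight_def)
  ultimately have "emeasure Q' (topspace (PT G)) < \<infinity>" unfolding top by (simp only:)
  then have "tight (PT G) Q'" using Q' radon_tight_iff[OF hausdorff_PT[OF \<pi>(2)], of Q'] unfolding G by blast
  then have "product_spec G \<pi> N Q'" using Q' unfolding G product_spec_def by blast
  then show "Q' = Q" using product_spec_unique Q \<pi> by blast
qed

text \<open>The empty product is the unit mass at the only point over the empty index set, the
  constant function \<open>undefined\<close>.\<close>

lemma product_spec_empty: "\<exists>Q. product_spec {} {} N Q"
proof -
  let ?u = "(\<lambda>_. undefined) :: nat \<Rightarrow> 'a"
  define Q where "Q = distr (count_space {()}) (borel_alg (PT {})) (\<lambda>_. ?u)"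
  have top: "topspace (PT {}) = {?u}" by simp
  have m: "(\<lambda>_. ?u) \<in> measurable (count_space {()}) (borel_alg (PT {}))" by simp
  have e: "emeasure Q A = (if ?u \<in> A then 1 else 0)" if "A \<in> sets (borel_alg (PT {}))" for A
    unfolding Q_def by (subst emeasure_distr[OF m that]) (auto simp: UNIV_unit emeasure_count_space)
  have "tight (PT {}) Q"
    unfolding tight_def
  proof (intro conjI ballI allI impI)
    show "sets Q = sets (borel_alg (PT {}))" by (simp add: Q_def)
    show "emeasure Q (topspace (PT {})) < \<infinity>"
      using e[of "topspace (PT {})"] by (simp add: sets.top[of "borel_alg (PT {})", simplified])
    fix A e assume A: "A \<in> sets (borel_alg (PT {}))" "0 < (e::real)"
    have s: "A \<subseteq> {?u}" using borel_alg_subset[OF A(1)] by simp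
    then have "compactin (PT {}) A"
      by (intro finite_imp_compactin) (auto intro: finite_subset)
    then show "\<exists>C. compactin (PT {}) C \<and> C \<subseteq> A \<and> emeasure Q (A - C) \<le> ennreal e"
      by (intro exI[of _ A]) simp
  qed
  moreover have "emeasure Q {x \<in> topspace (PT {}). \<forall>F\<in>{}. restrict x F \<in> B F} = 1" for B :: "nat set \<Rightarrow> (nat \<Rightarrow> 'a) set"
    using e[of "topspace (PT {})"] by (simp add: sets.top[of "borel_alg (PT {})", simplified])
  ultimately show ?thesis unfolding product_spec_def by auto
qed

text \<open>The condition on the blocks of \<open>\<pi>\<close> depends only on the restriction to
  \<open>G\<close>, so together with the new block it becomes a rectangle for
  \<open>join\<close>.\<close>

lemma product_spec_insert:
  assumes Q: "product_spec G \<pi> N Q" and \<pi>: "partition_on G \<pi>" and F: "F \<inter> G = {}" "F \<noteq> {}" "F \<union> G \<subseteq> I"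
    and N: "tight (PT F) (N F)"
  shows "product_spec (F \<union> G) (insert F \<pi>) N (join X F G (N F) Q)"
  unfolding product_spec_def
proof (intro conjI allI impI)
  have Qt: "tight (PT G) Q" using Q by (simp add: product_spec_def)
  show "tight (PT (F \<union> G)) (join X F G (N F) Q)"
    using F(3) N Qt by (rule tight_join)
  fix B assume B: "\<forall>F'\<in>insert F \<pi>. B F' \<in> sets (borel_alg (PT F'))"
  have fin: "finite \<pi>" using finite_partition[OF \<pi>] F(3) by auto
  have G: "G = \<Union>\<pi>" using \<pi> by (simp add: partition_on_def)
  have FG: "F \<notin> \<pi>" using F(1,2) unfolding G by auto
  let ?B = "{x \<in> topspace (PT G). \<forall>F\<in>\<pi>. restrict x F \<in> B F}"
  have B': "?B \<in> sets (borel_alg (PT G))"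
  proof -
    have "{x \<in> topspace (PT G). restrict x F' \<in> B F'} \<in> sets (borel_alg (PT G))" if "F' \<in> \<pi>" for F'
    proof -
      have "F' \<subseteq> G" using that G by auto
      then have "(\<lambda>x. restrict x F') \<in> measurable (borel_alg (PT G)) (borel_alg (PT F'))"
        by (intro continuous_map_measurable continuous_map_restrict_product)
      moreover have "B F' \<in> sets (borel_alg (PT F'))" using B that by simp
      ultimately have "(\<lambda>x. restrict x F') -` B F' \<inter> space (borel_alg (PT G)) \<in> sets (borel_alg (PT G))"
        by (rule measurable_sets)
      moreover have "{x \<in> topspace (PT G). restrict x F' \<in> B F'} = (\<lambda>x. restrict x F') -` B F' \<inter> space (borel_alg (PT G))"
        by auto
      ultimately show ?thesis by (simp only:)
    qed
    then have "{x \<in> space (borel_alg (PT G)). \<forall>F\<in>\<pi>. restrict x F \<in> B F} \<in> sets (borel_alg (PT G))"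
      using fin by (intro sets.sets_Collect_finite_All) auto
    then show ?thesis by simp
  qed
  have eq: "{x \<in> topspace (PT (F \<union> G)). \<forall>F'\<in>insert F \<pi>. restrict x F' \<in> B F'} =
    {z \<in> topspace (PT (F \<union> G)). restrict z F \<in> B F \<and> restrict z G \<in> ?B}"
  proof -
    have "restrict (restrict z G) F' = restrict z F'" if "F' \<in> \<pi>" for z :: "nat \<Rightarrow> 'a" and F'
      using that G by (auto simp: restrict_def fun_eq_iff)
    moreover have "restrict z G \<in> topspace (PT G)" if "z \<in> topspace (PT (F \<union> G))" for z
      using that by (auto simp: PiE_iff)
    ultimately show ?thesis by (intro Collect_cong conj_cong refl) (simp del: topspace_product_topology)
  qed
  have "emeasure (join X F G (N F) Q) {x \<in> topspace (PT (F \<union> G)). \<forall>F'\<in>insert F \<pi>. restrict x F' \<in> B F'}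
     = emeasure (N F) (B F) * emeasure Q ?B"
    unfolding eq using F(3,1) N Qt _ B' by (rule emeasure_join_Int) (use B in auto)
  also have "emeasure Q ?B = (\<Prod>F\<in>\<pi>. emeasure (N F) (B F))"
    using Q B unfolding product_spec_def by simp
  finally show "emeasure (join X F G (N F) Q) {x \<in> topspace (PT (F \<union> G)). \<forall>F'\<in>insert F \<pi>. restrict x F' \<in> B F'}
     = (\<Prod>F\<in>insert F \<pi>. emeasure (N F) (B F))"
    by (simp only: prod.insert[OF fin FG])
qed

lemma partition_on_insertD:
  assumes "partition_on G (insert F \<pi>)" "F \<notin> \<pi>"
  shows "partition_on (\<Union>\<pi>) \<pi>" "F \<inter> \<Union>\<pi> = {}" "F \<noteq> {}" "G = F \<union> \<Union>\<pi>"
  using assms by (auto simp: partition_on_def disjoint_def)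

lemma product_spec_radon_product:
  assumes "partition_on G \<pi>" "G \<subseteq> I" "\<And>F. F \<in> \<pi> \<Longrightarrow> tight (PT F) (N F)"
  shows "product_spec G \<pi> N (radon_product X \<pi> N)"
proof -
  have "\<exists>Q. product_spec G \<pi> N Q"
    using finite_partition[OF assms(1,2)] assms
  proof (induction \<pi> arbitrary: G rule: finite_induct)
    case empty
    then show ?case using product_spec_empty by (simp add: partition_on_def)
  next
    case (insert F \<pi>)
    note P = partition_on_insertD[OF insert(4,2)]
    have "\<Union>\<pi> \<subseteq> I" using P(4) insert(5) by auto
    then obtain Q where "product_spec (\<Union>\<pi>) \<pi> N Q" using insert.IH[OF P(1)] insert(6) by auto
    moreover have "F \<union> \<Union>\<pi> \<subseteq> I" "tight (PT F) (N F)" using insert(5,6) unfolding P(4) by auto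
    ultimately show ?case unfolding P(4) using product_spec_insert[OF _ P(1,2,3)] by (intro exI)
  qed
  then obtain Q where Q: "product_spec G \<pi> N Q" ..
  show ?thesis using Q unfolding radon_product_eq[OF Q assms(1,2)] .
qed

lemma radon_product_insert:
  assumes "partition_on G (insert F \<pi>)" "G \<subseteq> I" "\<And>F'. F' \<in> insert F \<pi> \<Longrightarrow> tight (PT F') (N F')" "F \<notin> \<pi>"
  shows "radon_product X (insert F \<pi>) N = join X F (\<Union>\<pi>) (N F) (radon_product X \<pi> N)"
proof -
  note P = partition_on_insertD[OF assms(1,4)]
  have "product_spec (\<Union>\<pi>) \<pi> N (radon_product X \<pi> N)"
    using assms P by (intro product_spec_radon_product) auto
  from product_spec_insert[OF this P(1,2,3)] have "product_spec G (insert F \<pi>) N (join X F (\<Union>\<pi>) (N F) (radon_product X \<pi> N))"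
    using assms P(4) by auto
  then show ?thesis using assms by (intro radon_product_eq)
qed

lemma marginal_product_spec:
  assumes "partition_on G \<pi>" "G \<subseteq> H" "H \<subseteq> I" "tight (PT H) \<nu>"
  shows "product_spec G \<pi> (\<lambda>F. marginal X F \<nu>) (marginal_product X \<pi> \<nu>)"
  unfolding marginal_product_def
proof (rule product_spec_radon_product)
  show "tight (PT F) (marginal X F \<nu>)" if "F \<in> \<pi>" for F
    using that assms by (intro tight_marginal) (auto simp: partition_on_def)
qed (use assms in auto)

lemma tight_marginal_product:
  assumes "partition_on G \<pi>" "G \<subseteq> H" "H \<subseteq> I" "tight (PT H) \<nu>"
  shows "tight (PT G) (marginal_product X \<pi> \<nu>)"
  using marginal_product_spec[OF assms] by (simp add: product_spec_def)

text \<open>Removes the intermediate marginal in \<open>marginally_delimited\<close>, where the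
  products are formed from the marginal of \<open>P\<close> on \<open>F\<close>.\<close>

lemma marginal_product_marginal:
  assumes "\<Union>\<pi> \<subseteq> F" "F \<subseteq> H" "tight (PT H) \<nu>"
  shows "marginal_product X \<pi> (marginal X F \<nu>) = marginal_product X \<pi> \<nu>"
proof -
  have "marginal X B (marginal X F \<nu>) = marginal X B \<nu>" if "B \<in> \<pi>" for B
    using assms that by (intro marginal_marginal[of _ _ H]) auto
  then show ?thesis unfolding marginal_product_def radon_product_def
    by (simp cong: prod.cong)
qed

text \<open>Through the one-block partition, FIP speaks about the measure itself. The index set is
  nonempty because blocks are.\<close>

lemma marginal_product_trivial:
  assumes "tight (PT I) \<nu>" "I \<noteq> {}"
  shows "marginal_product X {I} \<nu> = \<nu>"
  unfolding marginal_product_def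
proof (rule radon_product_eq)
  show "partition_on I {I}" using assms(2) by (simp add: partition_on_space)
  have r: "restrict x I = x" if "x \<in> topspace (PT I)" for x
    using that by (auto simp: PiE_iff extensional_restrict)
  have "{x \<in> topspace (PT I). restrict x I \<in> B I} = B I" if "B I \<in> sets (borel_alg (PT I))" for B :: "nat set \<Rightarrow> (nat \<Rightarrow> 'a) set"
    using borel_alg_subset[OF that] r by (auto simp del: topspace_product_topology)
  then show "product_spec I {I} (\<lambda>F. marginal X F \<nu>) \<nu>"
    unfolding product_spec_def using assms(1) by (simp add: marginal_self)
qed simp

text \<open>The mass of the cylinder over the box \<open>A\<close> on the coordinates in
  \<open>B\<close>. With marginals of boxes written as cylinders in the full space, products over
  different partitions can be compared factor by factor.\<close>

definition cyl :: "(nat \<Rightarrow> 'a set) \<Rightarrow> (nat \<Rightarrow> 'a) measure \<Rightarrow> nat set \<Rightarrow> ennreal" where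
  "cyl A \<nu> B = emeasure \<nu> (PiE I (\<lambda>i. if i \<in> B then A i else topspace (X i)))"

lemma cyl_empty: "tight (PT I) \<nu> \<Longrightarrow> cyl A \<nu> {} = emeasure \<nu> (topspace (PT I))"
  by (simp add: cyl_def)

lemma marginal_product_box:
  assumes \<pi>: "partition_on G \<pi>" "G \<subseteq> I" and \<nu>: "tight (PT I) \<nu>" and A: "\<And>i. i \<in> G \<Longrightarrow> openin (X i) (A i)"
  shows "emeasure (marginal_product X \<pi> \<nu>) (PiE G A) = (\<Prod>B\<in>\<pi>. cyl A \<nu> B)"
proof -
  have G: "G = \<Union>\<pi>" using \<pi>(1) by (simp add: partition_on_def)
  have "emeasure (marginal_product X \<pi> \<nu>) (PiE G A) = (\<Prod>B\<in>\<pi>. emeasure (marginal X B \<nu>) (PiE B A))"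
    using marginal_product_spec[OF \<pi> order_refl \<nu>] \<pi> A by (rule product_spec_box)
  also have "\<dots> = (\<Prod>B\<in>\<pi>. cyl A \<nu> B)"
  proof (rule prod.cong[OF refl])
    fix B assume B: "B \<in> \<pi>"
    have BI: "B \<subseteq> I" using B \<pi>(2) G by auto
    have "PiE B A \<in> sets (borel_alg (PT B))" using BI A B G by (intro box_borel) auto
    from emeasure_marginal[OF BI \<nu> this] have
      "emeasure (marginal X B \<nu>) (PiE B A) = emeasure \<nu> {x \<in> topspace (PT I). restrict x B \<in> PiE B A}" .
    also have "{x \<in> topspace (PT I). restrict x B \<in> PiE B A} = PiE I (\<lambda>i. if i \<in> B then A i else topspace (X i))"
    proof -
      have "A i \<subseteq> topspace (X i)" if "i \<in> B" for i using that B G A openin_subset by blast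
      then show ?thesis unfolding topspace_product_topology by (rule cylinder_eq_PiE[OF BI])
    qed
    finally show "emeasure (marginal X B \<nu>) (PiE B A) = cyl A \<nu> B" by (simp add: cyl_def)
  qed
  finally show ?thesis .
qed

text \<open>Restriction to \<open>H\<close> replaces each block by its trace on \<open>H\<close>.
  Empty traces contribute the total mass of \<open>\<nu>\<close>, which is 1, so dropping them
  changes nothing.\<close>

lemma marginal_marginal_product:
  assumes \<pi>: "partition_on G \<pi>" "G \<subseteq> I" and \<nu>: "tight (PT I) \<nu>" and H: "H \<subseteq> G"
    and prob: "emeasure \<nu> (topspace (PT I)) = 1"
  shows "marginal X H (marginal_product X \<pi> \<nu>) = marginal_product X ((\<inter>) H ` \<pi> - {{}}) \<nu>"
proof (rule tight_eqI_boxes[of H])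
  let ?\<rho> = "(\<inter>) H ` \<pi> - {{}}"
  have \<rho>: "partition_on H ?\<rho>" using partition_on_restrict[OF \<pi>(1), of H] H by (simp add: Int_absorb2)
  note t = tight_marginal_product[OF \<pi> order_refl \<nu>]
  show HI: "H \<subseteq> I" using H \<pi>(2) by auto
  show "tight (PT H) (marginal X H (marginal_product X \<pi> \<nu>))" using tight_marginal[OF H \<pi>(2) t] .
  show "tight (PT H) (marginal_product X ?\<rho> \<nu>)" using tight_marginal_product[OF \<rho> HI order_refl \<nu>] .
  fix A assume A: "\<And>i. i \<in> H \<Longrightarrow> openin (X i) (A i)"
  define A' where "A' i = (if i \<in> H then A i else topspace (X i))" for i
  have A': "openin (X i) (A' i)" if "i \<in> G" for i using A by (simp add: A'_def)
  have AH: "A i \<subseteq> topspace (X i)" if "i \<in> H" for i using A[OF that] by (rule openin_subset)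
  have "emeasure (marginal X H (marginal_product X \<pi> \<nu>)) (PiE H A) =
      emeasure (marginal_product X \<pi> \<nu>) {x \<in> topspace (PT G). restrict x H \<in> PiE H A}"
    using emeasure_marginal[OF H t box_borel[OF HI A]] by simp
  also have "{x \<in> topspace (PT G). restrict x H \<in> PiE H A} = PiE G A'"
    unfolding A'_def topspace_product_topology using H AH by (rule cylinder_eq_PiE)
  also have "emeasure (marginal_product X \<pi> \<nu>) (PiE G A') = (\<Prod>B\<in>\<pi>. cyl A' \<nu> B)"
    using marginal_product_box[OF \<pi> \<nu> A'] .
  also have "\<dots> = (\<Prod>B\<in>\<pi>. cyl A \<nu> (H \<inter> B))"
    unfolding cyl_def A'_def by (intro prod.cong refl arg_cong2[where f=emeasure] PiE_cong) auto
  also have "\<dots> = (\<Prod>C\<in>(\<inter>) H ` \<pi>. cyl A \<nu> C)"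
  \<comment> \<open>Taking traces is injective except for empty traces: two distinct blocks are
    disjoint, so a common trace is empty and its factor is 1.\<close>
  proof (subst prod.reindex_nontrivial)
    show "finite \<pi>" using finite_partition[OF \<pi>] .
    fix x y assume xy: "x \<in> \<pi>" "y \<in> \<pi>" "x \<noteq> y" "H \<inter> x = H \<inter> y"
    then have "x \<inter> y = {}" using \<pi>(1) by (auto simp: partition_on_def disjoint_def)
    then have "H \<inter> x = {}" using xy(4) by auto
    then show "cyl A \<nu> (H \<inter> x) = 1" using prob cyl_empty[OF \<nu>] by simp
  qed (simp add: o_def)
  also have "\<dots> = (\<Prod>C\<in>?\<rho>. cyl A \<nu> C)"
    using finite_partition[OF \<pi>] prob cyl_empty[OF \<nu>, of A]
    by (intro prod.mono_neutral_right) auto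
  also have "\<dots> = emeasure (marginal_product X ?\<rho> \<nu>) (PiE H A)"
    using marginal_product_box[OF \<rho> HI \<nu> A] by simp
  finally show "emeasure (marginal X H (marginal_product X \<pi> \<nu>)) (PiE H A) = emeasure (marginal_product X ?\<rho> \<nu>) (PiE H A)" .
qed

text \<open>On a box both sides are the product of the cylinder masses over the blocks of
  \<open>\<tau>\<close> and of \<open>\<sigma>\<close>.\<close>

lemma join_marginal_product:
  assumes \<tau>: "partition_on F \<tau>" and \<sigma>: "partition_on G \<sigma>" and FG: "F \<inter> G = {}" "F \<union> G \<subseteq> I" and \<nu>: "tight (PT I) \<nu>"
  shows "join X F G (marginal_product X \<tau> \<nu>) (marginal_product X \<sigma> \<nu>) = marginal_product X (\<tau> \<union> \<sigma>) \<nu>"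
proof (rule tight_eqI_boxes[OF FG(2)])
  have FI: "F \<subseteq> I" "G \<subseteq> I" using FG by auto
  note u = partition_on_Un[OF \<tau> \<sigma> FG(1)]
  note tF = tight_marginal_product[OF \<tau> FI(1) order_refl \<nu>] and tG = tight_marginal_product[OF \<sigma> FI(2) order_refl \<nu>]
  show "tight (PT (F \<union> G)) (join X F G (marginal_product X \<tau> \<nu>) (marginal_product X \<sigma> \<nu>))"
    using FG(2) tF tG by (rule tight_join)
  show "tight (PT (F \<union> G)) (marginal_product X (\<tau> \<union> \<sigma>) \<nu>)"
    using tight_marginal_product[OF u(1) FG(2) order_refl \<nu>] .
  fix A assume A: "\<And>i. i \<in> F \<union> G \<Longrightarrow> openin (X i) (A i)"
  have AT: "A i \<subseteq> topspace (X i)" if "i \<in> F \<union> G" for i using A[OF that] by (rule openin_subset)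
  have "PiE (F \<union> G) A = {z \<in> topspace (PT (F \<union> G)). restrict z F \<in> PiE F A \<and> restrict z G \<in> PiE G A}"
    unfolding topspace_product_topology
  proof (intro set_eqI iffI)
    fix z assume "z \<in> PiE (F \<union> G) A"
    then show "z \<in> {z \<in> PiE (F \<union> G) (\<lambda>i. topspace (X i)). restrict z F \<in> PiE F A \<and> restrict z G \<in> PiE G A}"
      using AT by (auto simp: PiE_iff)
  qed (auto simp: PiE_iff)
  then have "emeasure (join X F G (marginal_product X \<tau> \<nu>) (marginal_product X \<sigma> \<nu>)) (PiE (F \<union> G) A) =
     emeasure (marginal_product X \<tau> \<nu>) (PiE F A) * emeasure (marginal_product X \<sigma> \<nu>) (PiE G A)"
    using emeasure_join_Int[OF FG(2,1) tF tG, of "PiE F A" "PiE G A"] box_borel[OF FI(1)] box_borel[OF FI(2)] A by simp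
  also have "\<dots> = (\<Prod>B\<in>\<tau>. cyl A \<nu> B) * (\<Prod>B\<in>\<sigma>. cyl A \<nu> B)"
    using marginal_product_box[OF \<tau> FI(1) \<nu>] marginal_product_box[OF \<sigma> FI(2) \<nu>] A by simp
  also have "\<dots> = (\<Prod>B\<in>\<tau> \<union> \<sigma>. cyl A \<nu> B)"
    using finite_partition[OF \<tau> FI(1)] finite_partition[OF \<sigma> FI(2)] u(2) by (intro prod.union_disjoint[symmetric])
  also have "\<dots> = emeasure (marginal_product X (\<tau> \<union> \<sigma>) \<nu>) (PiE (F \<union> G) A)"
    using marginal_product_box[OF u(1) FG(2) \<nu> A] by simp
  finally show "emeasure (join X F G (marginal_product X \<tau> \<nu>) (marginal_product X \<sigma> \<nu>)) (PiE (F \<union> G) A) =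
     emeasure (marginal_product X (\<tau> \<union> \<sigma>) \<nu>) (PiE (F \<union> G) A)" .
qed

end

section \<open>Domination by sums of products of marginals\<close>

context hausdorff_family
begin

lemma finite_partitions: "F \<subseteq> I \<Longrightarrow> finite {\<pi>. partition_on F \<pi>}"
  using finitely_many_partition_on[OF finite_subset[OF _ finite_I]] .

text \<open>The inequality of \<open>marginally_delimited\<close> for a single \<open>F\<close>,
  with the marginals taken directly from \<open>P\<close>.\<close>

definition dominated :: "nat set \<Rightarrow> ennreal \<Rightarrow> (nat \<Rightarrow> 'a) measure \<Rightarrow> (nat \<Rightarrow> 'a) measure \<Rightarrow> bool" where
  "dominated F c M P \<longleftrightarrow> (\<forall>A\<in>sets (borel_alg (PT F)).
     emeasure M A \<le> c * (\<Sum>\<pi> | partition_on F \<pi>. emeasure (marginal_product X \<pi> P) A))"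

lemma nn_integral_dominated:
  assumes "F \<subseteq> I" "tight (PT F) M" "tight (PT I) P" "dominated F c M P" "f \<in> borel_measurable (borel_alg (PT F))"
  shows "(\<integral>\<^sup>+x. f x \<partial>M) \<le> c * (\<Sum>\<pi> | partition_on F \<pi>. \<integral>\<^sup>+x. f x \<partial>marginal_product X \<pi> P)"
proof (rule nn_integral_sum_dominated)
  show "sets (marginal_product X \<pi> P) = sets M" if "\<pi> \<in> {\<pi>. partition_on F \<pi>}" for \<pi>
    using that tight_sets[OF tight_marginal_product[OF _ assms(1) order_refl assms(3), of \<pi>]] tight_sets[OF assms(2)] by simp
  show "emeasure M A \<le> c * (\<Sum>\<pi> | partition_on F \<pi>. emeasure (marginal_product X \<pi> P) A)" if "A \<in> sets M" for A
    using that assms(4) tight_sets[OF assms(2)] by (simp add: dominated_def)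
  show "f \<in> borel_measurable M" using assms(5) by (simp add: measurable_tight[OF assms(2)])
qed (rule finite_partitions[OF assms(1)])

text \<open>The blocks are nonempty and \<open>F\<close> and \<open>G\<close> are disjoint, so a
  union of two partitions determines both. The pairs thus inject into the partitions of
  \<open>F \<union> G\<close>, and the remaining terms are nonnegative.\<close>

lemma sum_partition_Un_le:
  fixes g :: "nat set set \<Rightarrow> ennreal"
  assumes "F \<inter> G = {}" "F \<union> G \<subseteq> I"
  shows "(\<Sum>\<tau> | partition_on F \<tau>. \<Sum>\<sigma> | partition_on G \<sigma>. g (\<tau> \<union> \<sigma>)) \<le> (\<Sum>\<rho> | partition_on (F \<union> G) \<rho>. g \<rho>)"
proof -
  let ?S = "{\<tau>. partition_on F \<tau>} \<times> {\<sigma>. partition_on G \<sigma>}"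
  have rec: "\<tau> = {B \<in> \<tau> \<union> \<sigma>. B \<subseteq> F}" "\<sigma> = {B \<in> \<tau> \<union> \<sigma>. B \<subseteq> G}"
    if "partition_on F \<tau>" "partition_on G \<sigma>" for \<tau> \<sigma>
  proof -
    have *: "B \<noteq> {}" "B \<subseteq> F" if "B \<in> \<tau>" for B using \<open>partition_on F \<tau>\<close> that by (auto simp: partition_on_def)
    have **: "B \<noteq> {}" "B \<subseteq> G" if "B \<in> \<sigma>" for B using \<open>partition_on G \<sigma>\<close> that by (auto simp: partition_on_def)
    have "B \<notin> \<sigma>" if "B \<subseteq> F" for B using **[of B] that assms(1) by auto
    moreover have "B \<notin> \<tau>" if "B \<subseteq> G" for B using *[of B] that assms(1) by auto
    ultimately show "\<tau> = {B \<in> \<tau> \<union> \<sigma>. B \<subseteq> F}" "\<sigma> = {B \<in> \<tau> \<union> \<sigma>. B \<subseteq> G}"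
      using *(2) **(2) by (simp_all add: set_eq_iff) blast+
  qed
  have inj: "inj_on (\<lambda>(\<tau>, \<sigma>). \<tau> \<union> \<sigma>) ?S"
  proof (rule inj_onI, clarify)
    fix t s t' s' assume a: "partition_on F t" "partition_on G s" "partition_on F t'" "partition_on G s'" "t \<union> s = t' \<union> s'"
    have "t = {B \<in> t' \<union> s'. B \<subseteq> F}" "s = {B \<in> t' \<union> s'. B \<subseteq> G}"
      using rec[OF a(1,2)] unfolding a(5) by blast+
    then show "t = t' \<and> s = s'" using rec[OF a(3,4)] by (metis (no_types))
  qed
  have "(\<Sum>\<tau> | partition_on F \<tau>. \<Sum>\<sigma> | partition_on G \<sigma>. g (\<tau> \<union> \<sigma>)) = (\<Sum>p\<in>?S. g (case p of (\<tau>, \<sigma>) \<Rightarrow> \<tau> \<union> \<sigma>))"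
    by (simp add: sum.cartesian_product case_prod_beta)
  also have "\<dots> = (\<Sum>\<rho>\<in>(\<lambda>(\<tau>, \<sigma>). \<tau> \<union> \<sigma>) ` ?S. g \<rho>)"
    by (simp add: sum.reindex[OF inj])
  also have "\<dots> \<le> (\<Sum>\<rho> | partition_on (F \<union> G) \<rho>. g \<rho>)"
    using finite_partitions[OF assms(2)] partition_on_Un(1)[OF _ _ assms(1)]
    by (intro sum_mono2) auto
  finally show ?thesis .
qed

text \<open>A product of marginals of \<open>P\<close> over \<open>F\<close> joined with one over
  \<open>G\<close> is again such a product over \<open>F \<union> G\<close>. Domination of the two
  measures therefore turns a mixed integral into integrals that involve \<open>P\<close>
  alone.\<close>

lemma pair_dominated:
  assumes FG: "F \<inter> G = {}" "F \<union> G \<subseteq> I" and M: "tight (PT F) M" and N: "tight (PT G) N" and P: "tight (PT I) P"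
    and dM: "dominated F c M P" and dN: "dominated G d N P" and f: "f \<in> borel_measurable (borel_alg (PT (F \<union> G)))"
  shows "(\<integral>\<^sup>+y. (\<integral>\<^sup>+x. f (mix F x y) \<partial>M) \<partial>N) \<le> c * d * (\<Sum>\<rho> | partition_on (F \<union> G) \<rho>. \<integral>\<^sup>+z. f z \<partial>marginal_product X \<rho> P)"
proof -
  have FI: "F \<subseteq> I" "G \<subseteq> I" using FG by auto
  note tF = tight_marginal_product[OF _ FI(1) order_refl P] and tG = tight_marginal_product[OF _ FI(2) order_refl P]
  have f': "(\<lambda>z. f (case z of (x, y) \<Rightarrow> mix F x y)) \<in> borel_measurable (borel_alg (prod_topology (PT F) (PT G)))"
    using measurable_compose[OF continuous_map_measurable[OF continuous_map_mix] f] .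
  have "(\<integral>\<^sup>+y. (\<integral>\<^sup>+x. f (mix F x y) \<partial>M) \<partial>N) \<le> c * d * (\<Sum>\<tau> | partition_on F \<tau>. \<Sum>\<sigma> | partition_on G \<sigma>.
      (\<integral>\<^sup>+y. (\<integral>\<^sup>+x. f (mix F x y) \<partial>marginal_product X \<tau> P) \<partial>marginal_product X \<sigma> P))"
    using nn_integral_join_dominated[OF FG(2) M N finite_partitions[OF FI(1)] finite_partitions[OF FI(2)], of "\<lambda>\<pi>. marginal_product X \<pi> P" "\<lambda>\<pi>. marginal_product X \<pi> P" c d, OF _ _ _ _ f']
      tF tG dM dN by (simp add: dominated_def)
  also have "\<dots> = c * d * (\<Sum>\<tau> | partition_on F \<tau>. \<Sum>\<sigma> | partition_on G \<sigma>. \<integral>\<^sup>+z. f z \<partial>marginal_product X (\<tau> \<union> \<sigma>) P)"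
  proof (intro arg_cong[where f="(*) (c * d)"] sum.cong refl)
    fix \<tau> \<sigma> assume "\<tau> \<in> {\<tau>. partition_on F \<tau>}" "\<sigma> \<in> {\<sigma>. partition_on G \<sigma>}"
    then have ts: "partition_on F \<tau>" "partition_on G \<sigma>" by auto
    show "(\<integral>\<^sup>+y. (\<integral>\<^sup>+x. f (mix F x y) \<partial>marginal_product X \<tau> P) \<partial>marginal_product X \<sigma> P) =
       (\<integral>\<^sup>+z. f z \<partial>marginal_product X (\<tau> \<union> \<sigma>) P)"
      unfolding join_marginal_product[OF ts FG P, symmetric]
      using nn_integral_join[OF FG(2) tF[OF ts(1)] tG[OF ts(2)] f] by simp
  qed
  also have "\<dots> \<le> c * d * (\<Sum>\<rho> | partition_on (F \<union> G) \<rho>. \<integral>\<^sup>+z. f z \<partial>marginal_product X \<rho> P)"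
    by (intro mult_left_mono sum_partition_Un_le FG) auto
  finally show ?thesis .
qed

text \<open>Only proper subsets occur: these are the sets with at most \<open>n - 1\<close>
  elements, to which delimitation applies. One finite constant serves all of them.\<close>

definition tame :: "ennreal \<Rightarrow> (nat \<Rightarrow> 'a) measure \<Rightarrow> (nat \<Rightarrow> 'a) measure \<Rightarrow> bool" where
  "tame c \<alpha> P \<longleftrightarrow> c < \<infinity> \<and> (\<forall>F. F \<subset> I \<longrightarrow> dominated F c (marginal X F \<alpha>) P)"

text \<open>If no block is all of \<open>I\<close>, every block marginal is dominated, and the
  blocks are joined one at a time. Each block multiplies the constant by \<open>c\<close>.\<close>

lemma marginal_product_dominated:
  assumes \<alpha>: "tight (PT I) \<alpha>" and P: "tight (PT I) P" and t: "tame c \<alpha> P"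
  shows "partition_on G \<pi> \<Longrightarrow> G \<subseteq> I \<Longrightarrow> I \<notin> \<pi> \<Longrightarrow> \<exists>d<\<infinity>. dominated G d (marginal_product X \<pi> \<alpha>) P"
proof -
  have "finite \<pi> \<Longrightarrow> partition_on G \<pi> \<Longrightarrow> G \<subseteq> I \<Longrightarrow> I \<notin> \<pi> \<Longrightarrow> \<exists>d<\<infinity>. dominated G d (marginal_product X \<pi> \<alpha>) P"
  proof (induction \<pi> arbitrary: G rule: finite_induct)
    case empty
    then have "G = {}" by (simp add: partition_on_def)
    moreover have "marginal_product X {} \<alpha> = marginal_product X {} P"
      by (simp add: marginal_product_def radon_product_def)
    ultimately have "dominated G 1 (marginal_product X {} \<alpha>) P" by (simp add: dominated_def partition_on_empty)
    then show ?case by (intro exI[of _ 1]) simp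
  next
    case (insert F \<pi>)
    note Q = partition_on_insertD[OF insert(4,2)]
    have sub: "F \<subset> I" "\<Union>\<pi> \<subseteq> I" "F \<union> \<Union>\<pi> \<subseteq> I" using insert(5,6) Q(4) by auto
    obtain d where d: "d < \<infinity>" "dominated (\<Union>\<pi>) d (marginal_product X \<pi> \<alpha>) P"
      using insert.IH[OF Q(1) sub(2)] insert(6) by auto
    have dF: "dominated F c (marginal X F \<alpha>) P" "c < \<infinity>" using t sub(1) by (auto simp: tame_def)
    have tF: "tight (PT F) (marginal X F \<alpha>)" using tight_marginal[OF _ order_refl \<alpha>] sub(1) by auto
    note tG = tight_marginal_product[OF Q(1) sub(2) order_refl \<alpha>]
    have bl: "tight (PT F') (marginal X F' \<alpha>)" if "F' \<in> insert F \<pi>" for F'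
      using that sub by (intro tight_marginal[OF _ order_refl \<alpha>]) auto
    have eq: "marginal_product X (insert F \<pi>) \<alpha> = join X F (\<Union>\<pi>) (marginal X F \<alpha>) (marginal_product X \<pi> \<alpha>)"
      unfolding marginal_product_def using insert(4,5) bl insert(2) by (rule radon_product_insert)
    have "dominated G (c * d) (marginal_product X (insert F \<pi>) \<alpha>) P"
      unfolding dominated_def
    proof
      fix A assume A: "A \<in> sets (borel_alg (PT G))"
      then have A': "A \<in> sets (borel_alg (PT (F \<union> \<Union>\<pi>)))" unfolding Q(4) .
      have tj: "tight (PT (F \<union> \<Union>\<pi>)) (join X F (\<Union>\<pi>) (marginal X F \<alpha>) (marginal_product X \<pi> \<alpha>))"
        using tight_join[OF sub(3) tF tG] .
      have m: "(indicator A :: _ \<Rightarrow> ennreal) \<in> borel_measurable (borel_alg (PT (F \<union> \<Union>\<pi>)))" using A' by simp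
      have i: "emeasure L A = (\<integral>\<^sup>+z. indicator A z \<partial>L)" if "tight (PT (F \<union> \<Union>\<pi>)) L" for L
        using A' tight_sets[OF that] by simp
      have "emeasure (marginal_product X (insert F \<pi>) \<alpha>) A =
         (\<integral>\<^sup>+y. (\<integral>\<^sup>+x. indicator A (mix F x y) \<partial>marginal X F \<alpha>) \<partial>marginal_product X \<pi> \<alpha>)"
        unfolding eq i[OF tj] by (rule nn_integral_join[OF sub(3) tF tG m])
      also have "\<dots> \<le> c * d * (\<Sum>\<rho> | partition_on (F \<union> \<Union>\<pi>) \<rho>. \<integral>\<^sup>+z. indicator A z \<partial>marginal_product X \<rho> P)"
        by (rule pair_dominated[OF Q(2) sub(3) tF tG P dF(1) d(2) m])
      also have "\<dots> = c * d * (\<Sum>\<rho> | partition_on G \<rho>. emeasure (marginal_product X \<rho> P) A)"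
        unfolding Q(4) using i[OF tight_marginal_product[OF _ sub(3) order_refl P]] by simp
      finally show "emeasure (marginal_product X (insert F \<pi>) \<alpha>) A \<le> c * d * (\<Sum>\<rho> | partition_on G \<rho>. emeasure (marginal_product X \<rho> P) A)" .
    qed
    moreover have "c * d < \<infinity>" using d(1) dF(2) by (simp add: ennreal_mult_less_top)
    ultimately show ?case by blast
  qed
  then show "partition_on G \<pi> \<Longrightarrow> G \<subseteq> I \<Longrightarrow> I \<notin> \<pi> \<Longrightarrow> \<exists>d<\<infinity>. dominated G d (marginal_product X \<pi> \<alpha>) P"
    using finite_partition by blast
qed

text \<open>The marginal on \<open>F\<close> of a product of marginals of \<open>P\<close> is a
  product of marginals over the traces of the blocks. Each such term is bounded by the whole sum
  over partitions of \<open>F\<close>, so the constant grows by the number \<open>?k\<close> of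
  partitions of \<open>I\<close>.\<close>

lemma tame_of_dominated:
  assumes \<beta>: "tight (PT I) \<beta>" and P: "tight (PT I) P" and prob: "emeasure P (topspace (PT I)) = 1"
    and d: "dominated I d \<beta> P" "d < \<infinity>"
  shows "\<exists>c. tame c \<beta> P"
proof -
  let ?k = "of_nat (card {\<pi>. partition_on I \<pi>}) :: ennreal"
  have "dominated F (d * ?k) (marginal X F \<beta>) P" if F: "F \<subseteq> I" for F
    unfolding dominated_def
  proof
    fix A assume A: "A \<in> sets (borel_alg (PT F))"
    let ?A = "{x \<in> topspace (PT I). restrict x F \<in> A}"
    have "(\<lambda>x. restrict x F) -` A \<inter> space (borel_alg (PT I)) \<in> sets (borel_alg (PT I))"
      using continuous_map_measurable[OF continuous_map_restrict_product[OF F]] A by (rule measurable_sets)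
    moreover have "?A = (\<lambda>x. restrict x F) -` A \<inter> space (borel_alg (PT I))" by auto
    ultimately have A': "?A \<in> sets (borel_alg (PT I))" by (simp only:)
    have "emeasure (marginal X F \<beta>) A = emeasure \<beta> ?A" using F \<beta> A by (rule emeasure_marginal)
    also have "\<dots> \<le> d * (\<Sum>\<pi> | partition_on I \<pi>. emeasure (marginal_product X \<pi> P) ?A)"
      using d(1) A' unfolding dominated_def by blast
    also have "\<dots> \<le> d * (\<Sum>\<pi> | partition_on I \<pi>. \<Sum>\<rho> | partition_on F \<rho>. emeasure (marginal_product X \<rho> P) A)"
    proof (intro mult_left_mono sum_mono)
      fix \<pi> assume "\<pi> \<in> {\<pi>. partition_on I \<pi>}"
      then have \<pi>: "partition_on I \<pi>" by simp
      let ?\<rho> = "(\<inter>) F ` \<pi> - {{}}"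
      have \<rho>: "partition_on F ?\<rho>" using partition_on_restrict[OF \<pi>, of F] F by (simp add: Int_absorb2)
      have "emeasure (marginal_product X \<pi> P) ?A = emeasure (marginal X F (marginal_product X \<pi> P)) A"
        using F tight_marginal_product[OF \<pi> order_refl order_refl P] A by (rule emeasure_marginal[symmetric])
      also have "\<dots> = emeasure (marginal_product X ?\<rho> P) A"
        unfolding marginal_marginal_product[OF \<pi> order_refl P F prob] ..
      also have "\<dots> \<le> (\<Sum>\<rho> | partition_on F \<rho>. emeasure (marginal_product X \<rho> P) A)"
        using \<rho> finite_partitions[OF F] by (intro member_le_sum) auto
      finally show "emeasure (marginal_product X \<pi> P) ?A \<le> (\<Sum>\<rho> | partition_on F \<rho>. emeasure (marginal_product X \<rho> P) A)" .
    qed auto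
    finally show "emeasure (marginal X F \<beta>) A \<le> d * ?k * (\<Sum>\<rho> | partition_on F \<rho>. emeasure (marginal_product X \<rho> P) A)"
      by (simp add: mult.assoc)
  qed
  moreover have "d * ?k < \<infinity>" using d(2) by (simp add: ennreal_mult_less_top ennreal_of_nat_eq_real_of_nat)
  ultimately show ?thesis unfolding tame_def by blast
qed

end

subsection \<open>Signed measures and their variation\<close>

text \<open>The set function inside \<open>variation\<close>, separated from it because additivity
  has to be proved before \<open>variation\<close> can be evaluated on sets.\<close>

definition vsum :: "'p topology \<Rightarrow> ('p set \<Rightarrow> real) \<Rightarrow> 'p set \<Rightarrow> ennreal" where
  "vsum T \<mu> A = (SUP C\<in>{C. finite C \<and> C \<subseteq> sets (borel_alg T) \<and> partition_on A C}. \<Sum>B\<in>C. ennreal \<bar>\<mu> B\<bar>)"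

lemma signed_measure_sums:
  "signed_measure T \<mu> \<Longrightarrow> range A \<subseteq> sets (borel_alg T) \<Longrightarrow> disjoint_family A \<Longrightarrow> (\<lambda>k::nat. \<mu> (A k)) sums \<mu> (\<Union>k. A k)"
  by (auto simp: signed_measure_def)

lemma signed_measure_empty: "signed_measure T \<mu> \<Longrightarrow> \<mu> {} = 0"
  by (simp add: signed_measure_def)

lemma vsum_upper:
  "finite C \<Longrightarrow> C \<subseteq> sets (borel_alg T) \<Longrightarrow> partition_on A C \<Longrightarrow> (\<Sum>B\<in>C. ennreal \<bar>\<mu> B\<bar>) \<le> vsum T \<mu> A"
  unfolding vsum_def by (rule SUP_upper) simp

lemma trivial_partition_ex:
  assumes "A \<in> sets (borel_alg T)"
  shows "\<exists>C. finite C \<and> C \<subseteq> sets (borel_alg T) \<and> partition_on A C"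
proof (cases "A = {}")
  case True
  then show ?thesis by (intro exI[of _ "{}"]) (simp add: partition_on_def)
next
  case False
  then show ?thesis using assms by (intro exI[of _ "{A}"]) (simp add: partition_on_def)
qed

lemma abs_le_vsum:
  assumes "signed_measure T \<mu>" "A \<in> sets (borel_alg T)" shows "ennreal \<bar>\<mu> A\<bar> \<le> vsum T \<mu> A"
proof (cases "A = {}")
  case True
  then show ?thesis using signed_measure_empty[OF assms(1)] by simp
next
  case False
  then show ?thesis using vsum_upper[of "{A}" T A \<mu>] assms(2) by (simp add: partition_on_def)
qed

text \<open>A partition of \<open>A\<close> and one of \<open>B\<close> together partition the
  union. The two suprema are then taken one after the other.\<close>

lemma vsum_superadd:
  assumes A: "A \<in> sets (borel_alg T)" and B: "B \<in> sets (borel_alg T)" and AB: "A \<inter> B = {}"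
  shows "vsum T \<mu> A + vsum T \<mu> B \<le> vsum T \<mu> (A \<union> B)"
proof -
  let ?P = "\<lambda>A. {C. finite C \<and> C \<subseteq> sets (borel_alg T) \<and> partition_on A C}"
  have ne: "?P A \<noteq> {}" "?P B \<noteq> {}" using trivial_partition_ex[OF A] trivial_partition_ex[OF B] by auto
  have le: "(\<Sum>B\<in>C. ennreal \<bar>\<mu> B\<bar>) + (\<Sum>B\<in>D. ennreal \<bar>\<mu> B\<bar>) \<le> vsum T \<mu> (A \<union> B)"
    if C: "C \<in> ?P A" and D: "D \<in> ?P B" for C D
  proof -
    note u = partition_on_Un[of A C B D] 
    have "(\<Sum>B\<in>C. ennreal \<bar>\<mu> B\<bar>) + (\<Sum>B\<in>D. ennreal \<bar>\<mu> B\<bar>) = (\<Sum>B\<in>C \<union> D. ennreal \<bar>\<mu> B\<bar>)"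
      using C D u AB by (intro sum.union_disjoint[symmetric]) auto
    also have "\<dots> \<le> vsum T \<mu> (A \<union> B)" using C D u AB by (intro vsum_upper) auto
    finally show ?thesis .
  qed
  have "vsum T \<mu> A + vsum T \<mu> B = (SUP D\<in>?P B. vsum T \<mu> A + (\<Sum>B\<in>D. ennreal \<bar>\<mu> B\<bar>))"
    unfolding vsum_def[of T \<mu> B] by (rule ennreal_SUP_add_right[OF ne(2)])
  also have "\<dots> \<le> vsum T \<mu> (A \<union> B)"
  proof (rule SUP_least)
    fix D assume D: "D \<in> ?P B"
    have "vsum T \<mu> A + (\<Sum>B\<in>D. ennreal \<bar>\<mu> B\<bar>) = (SUP C\<in>?P A. (\<Sum>B\<in>C. ennreal \<bar>\<mu> B\<bar>) + (\<Sum>B\<in>D. ennreal \<bar>\<mu> B\<bar>))"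
      unfolding vsum_def[of T \<mu> A] by (rule ennreal_SUP_add_left[OF ne(1), symmetric])
    also have "\<dots> \<le> vsum T \<mu> (A \<union> B)" using le D by (intro SUP_least) blast
    finally show "vsum T \<mu> A + (\<Sum>B\<in>D. ennreal \<bar>\<mu> B\<bar>) \<le> vsum T \<mu> (A \<union> B)" .
  qed
  finally show ?thesis .
qed

lemma vsum_mono:
  assumes A: "A \<in> sets (borel_alg T)" and B: "B \<in> sets (borel_alg T)" and AB: "A \<subseteq> B"
  shows "vsum T \<mu> A \<le> vsum T \<mu> B"
proof -
  have "vsum T \<mu> A \<le> vsum T \<mu> A + vsum T \<mu> (B - A)" by simp
  also have "\<dots> \<le> vsum T \<mu> (A \<union> (B - A))" using A B by (intro vsum_superadd) auto
  also have "A \<union> (B - A) = B" using AB by auto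
  finally show ?thesis .
qed

lemma vsum_empty: "signed_measure T \<mu> \<Longrightarrow> vsum T \<mu> {} = 0"
proof -
  assume "signed_measure T \<mu>"
  have "{C. finite C \<and> C \<subseteq> sets (borel_alg T) \<and> partition_on {} C} = {{}}" by (auto simp: partition_on_def)
  then show ?thesis by (simp add: vsum_def)
qed

text \<open>Superadditivity bounds the partial sums by the value of the union. Conversely, each
  block of a finite partition of the union is cut along the sets \<open>A k\<close>, and for fixed
  \<open>k\<close> the pieces partition \<open>A k\<close>.\<close>

lemma vsum_countably_additive:
  assumes \<mu>: "signed_measure T \<mu>"
  shows "countably_additive (sets (borel_alg T)) (vsum T \<mu>)"
proof (rule countably_additiveI)
  fix A :: "nat \<Rightarrow> _" assume A: "range A \<subseteq> sets (borel_alg T)" "disjoint_family A"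
  have Ak: "A k \<in> sets (borel_alg T)" for k using A(1) by auto
  have U: "(\<Union>k. A k) \<in> sets (borel_alg T)" using A(1) by (rule sets.countable_UN)
  show "(\<Sum>k. vsum T \<mu> (A k)) = vsum T \<mu> (\<Union>k. A k)"
  proof (rule antisym)
    have "(\<Sum>k<n. vsum T \<mu> (A k)) \<le> vsum T \<mu> (\<Union>k<n. A k)" for n
    proof (induction n)
      case 0
      then show ?case by simp
    next
      case (Suc n)
      have "(\<Sum>k<Suc n. vsum T \<mu> (A k)) \<le> vsum T \<mu> (\<Union>k<n. A k) + vsum T \<mu> (A n)"
        using Suc by (simp add: add_right_mono)
      also have "\<dots> \<le> vsum T \<mu> ((\<Union>k<n. A k) \<union> A n)"
      proof (rule vsum_superadd)
        have "A k \<inter> A n = {}" if "k < n" for k using A(2) that by (auto simp: disjoint_family_on_def)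
        then show "(\<Union>k<n. A k) \<inter> A n = {}" by blast
      qed (use Ak in auto)
      also have "(\<Union>k<n. A k) \<union> A n = (\<Union>k<Suc n. A k)" by (auto simp: lessThan_Suc)
      finally show ?case .
    qed
    moreover have "vsum T \<mu> (\<Union>k<n. A k) \<le> vsum T \<mu> (\<Union>k. A k)" for n
      using Ak U by (intro vsum_mono) auto
    ultimately have "(\<Sum>k<n. vsum T \<mu> (A k)) \<le> vsum T \<mu> (\<Union>k. A k)" for n using order_trans by blast
    then have "(\<Sum>k<n. vsum T \<mu> (A k)) + 0 \<le> vsum T \<mu> (\<Union>k. A k)" for n by simp
    then show "(\<Sum>k. vsum T \<mu> (A k)) \<le> vsum T \<mu> (\<Union>k. A k)"
      using ennreal_suminf_bound_add[of "\<lambda>k. vsum T \<mu> (A k)" 0] by simp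
    show "vsum T \<mu> (\<Union>k. A k) \<le> (\<Sum>k. vsum T \<mu> (A k))"
      unfolding vsum_def[of T \<mu> "\<Union>k. A k"]
    proof (rule SUP_least)
      fix C assume "C \<in> {C. finite C \<and> C \<subseteq> sets (borel_alg T) \<and> partition_on (\<Union>k. A k) C}"
      then have C: "finite C" "C \<subseteq> sets (borel_alg T)" "partition_on (\<Union>k. A k) C" by auto
      have 1: "ennreal \<bar>\<mu> B\<bar> \<le> (\<Sum>k. ennreal \<bar>\<mu> (A k \<inter> B)\<bar>)" if B: "B \<in> C" for B
      proof -
        have BU: "B = (\<Union>k. A k \<inter> B)" using C(3) B by (auto simp: partition_on_def)
        have "disjoint_family (\<lambda>k. A k \<inter> B)" using A(2) by (auto simp: disjoint_family_on_def)
        moreover have "range (\<lambda>k. A k \<inter> B) \<subseteq> sets (borel_alg T)" using Ak B C(2) by auto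
        ultimately have "(\<lambda>k. \<mu> (A k \<inter> B)) sums \<mu> B"
          using signed_measure_sums[OF \<mu>, of "\<lambda>k. A k \<inter> B"] BU by simp
        \<comment> \<open>The triangle inequality is used for the finite sums and passed to the
          limit, which avoids asking for absolute convergence in advance.\<close>
        then have lim: "(\<lambda>n. ennreal \<bar>\<Sum>k<n. \<mu> (A k \<inter> B)\<bar>) \<longlonglongrightarrow> ennreal \<bar>\<mu> B\<bar>"
          unfolding sums_def by (intro tendsto_ennrealI tendsto_rabs)
        have "ennreal \<bar>\<Sum>k<n. \<mu> (A k \<inter> B)\<bar> \<le> (\<Sum>k. ennreal \<bar>\<mu> (A k \<inter> B)\<bar>)" for n
        proof -
          have "ennreal \<bar>\<Sum>k<n. \<mu> (A k \<inter> B)\<bar> \<le> ennreal (\<Sum>k<n. \<bar>\<mu> (A k \<inter> B)\<bar>)"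
            by (intro ennreal_leI sum_abs)
          also have "\<dots> = (\<Sum>k<n. ennreal \<bar>\<mu> (A k \<inter> B)\<bar>)" by simp
          also have "\<dots> \<le> (\<Sum>k. ennreal \<bar>\<mu> (A k \<inter> B)\<bar>)" by (rule sum_le_suminf) auto
          finally show ?thesis .
        qed
        then show ?thesis by (intro LIMSEQ_le_const2[OF lim] exI allI impI)
      qed
      have 2: "(\<Sum>B\<in>C. ennreal \<bar>\<mu> (A k \<inter> B)\<bar>) \<le> vsum T \<mu> (A k)" for k
      proof -
        let ?D = "(\<inter>) (A k) ` C - {{}}"
        have D: "partition_on (A k) ?D"
        proof -
          have "A k \<inter> (\<Union>k. A k) = A k" by auto
          then show ?thesis using partition_on_restrict[OF C(3), of "A k"] by simp
        qed
        have "(\<Sum>B\<in>C. ennreal \<bar>\<mu> (A k \<inter> B)\<bar>) = (\<Sum>B\<in>(\<inter>) (A k) ` C. ennreal \<bar>\<mu> B\<bar>)"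
        proof (subst sum.reindex_nontrivial)
          fix x y assume xy: "x \<in> C" "y \<in> C" "x \<noteq> y" "A k \<inter> x = A k \<inter> y"
          then have "x \<inter> y = {}" using C(3) by (auto simp: partition_on_def disjoint_def)
          then have "A k \<inter> x = {}" using xy(4) by auto
          then show "ennreal \<bar>\<mu> (A k \<inter> x)\<bar> = 0" using signed_measure_empty[OF \<mu>] by simp
        qed (use C in \<open>auto simp: o_def\<close>)
        also have "\<dots> = (\<Sum>B\<in>?D. ennreal \<bar>\<mu> B\<bar>)"
          using C(1) signed_measure_empty[OF \<mu>] by (intro sum.mono_neutral_right) auto
        also have "\<dots> \<le> vsum T \<mu> (A k)" using D C Ak by (intro vsum_upper) auto
        finally show ?thesis .
      qed
      have "(\<Sum>B\<in>C. ennreal \<bar>\<mu> B\<bar>) \<le> (\<Sum>B\<in>C. \<Sum>k. ennreal \<bar>\<mu> (A k \<inter> B)\<bar>)" using 1 by (rule sum_mono)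
      also have "\<dots> = (\<Sum>k. \<Sum>B\<in>C. ennreal \<bar>\<mu> (A k \<inter> B)\<bar>)" by (intro suminf_sum[symmetric]) simp
      also have "\<dots> \<le> (\<Sum>k. vsum T \<mu> (A k))" using 2 by (intro suminf_le) auto
      finally show "(\<Sum>B\<in>C. ennreal \<bar>\<mu> B\<bar>) \<le> (\<Sum>k. vsum T \<mu> (A k))" .
    qed
  qed
qed

lemma sets_measure_of_borel [simp]: "sets (measure_of (topspace T) (sets (borel_alg T)) f) = sets (borel_alg T)"
proof -
  have "sets (borel_alg T) \<subseteq> Pow (topspace T)" using borel_alg_subset by auto
  then show ?thesis using sets.sigma_sets_eq[of "borel_alg T"] by simp
qed

lemma emeasure_measure_of_borel:
  assumes "f {} = 0" "countably_additive (sets (borel_alg T)) f" "A \<in> sets (borel_alg T)"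
  shows "emeasure (measure_of (topspace T) (sets (borel_alg T)) f) A = f A"
proof (rule emeasure_measure_of_sigma)
  show "sigma_algebra (topspace T) (sets (borel_alg T))"
    using sets.sigma_algebra_axioms[of "borel_alg T"] by simp
qed (use assms in \<open>auto simp: positive_def\<close>)

lemma variation_vsum: "variation T \<mu> = measure_of (topspace T) (sets (borel_alg T)) (vsum T \<mu>)"
  unfolding variation_def vsum_def ..

lemma sets_variation [simp]: "sets (variation T \<mu>) = sets (borel_alg T)"
  by (simp add: variation_vsum)

lemma space_variation [simp]: "space (variation T \<mu>) = topspace T"
  by (metis sets_variation sets_eq_imp_space_eq space_borel_alg)

lemma emeasure_variation:
  "signed_measure T \<mu> \<Longrightarrow> A \<in> sets (borel_alg T) \<Longrightarrow> emeasure (variation T \<mu>) A = vsum T \<mu> A"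
  unfolding variation_vsum using vsum_empty vsum_countably_additive by (intro emeasure_measure_of_borel)

text \<open>Finite additivity makes every partition sum equal to \<open>\<mu> A\<close>. This
  identifies the variation of a probability with the probability, in particular its total mass
  1.\<close>

lemma variation_nonneg:
  assumes \<mu>: "signed_measure T \<mu>" and nn: "\<And>A. 0 \<le> \<mu> A" and A: "A \<in> sets (borel_alg T)"
  shows "emeasure (variation T \<mu>) A = ennreal (\<mu> A)"
proof -
  have fin_add: "\<mu> (A \<union> B) = \<mu> A + \<mu> B" if "A \<in> sets (borel_alg T)" "B \<in> sets (borel_alg T)" "A \<inter> B = {}" for A B
  proof -
    have "(\<lambda>k. \<mu> (binaryset A B k)) sums \<mu> (\<Union>k. binaryset A B k)"
      using that by (intro signed_measure_sums[OF \<mu>]) (auto simp: range_binaryset_eq disjoint_family_on_def binaryset_def)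
    moreover have "(\<lambda>k. \<mu> (binaryset A B k)) sums (\<mu> A + \<mu> B)"
      by (rule binaryset_sums) (rule signed_measure_empty[OF \<mu>])
    ultimately show ?thesis using sums_unique2 by (metis UN_binaryset_eq)
  qed
  have sum: "(\<Sum>B\<in>C. \<mu> B) = \<mu> (\<Union>C)" if "finite C" "C \<subseteq> sets (borel_alg T)" "disjoint C" for C
    using that
  proof (induction C rule: finite_induct)
    case empty
    then show ?case using signed_measure_empty[OF \<mu>] by simp
  next
    case (insert x F)
    have "x \<inter> \<Union>F = {}" using insert(2,5) by (auto simp: disjoint_def)
    moreover have "\<Union>F \<in> sets (borel_alg T)" using insert(1,4) by (intro sets.finite_Union) auto
    ultimately show ?case using insert fin_add[of x "\<Union>F"] by (auto simp: pairwise_insert)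
  qed
  have "vsum T \<mu> A \<le> ennreal (\<mu> A)"
    unfolding vsum_def
  proof (rule SUP_least)
    fix C assume C: "C \<in> {C. finite C \<and> C \<subseteq> sets (borel_alg T) \<and> partition_on A C}"
    then show "(\<Sum>B\<in>C. ennreal \<bar>\<mu> B\<bar>) \<le> ennreal (\<mu> A)"
      using sum[of C] nn by (simp add: partition_on_def)
  qed
  moreover have "ennreal (\<mu> A) \<le> vsum T \<mu> A" using abs_le_vsum[OF \<mu> A] nn[of A] by simp
  ultimately show ?thesis using emeasure_variation[OF \<mu> A] by simp
qed

lemma radon_signedD:
  assumes "Hausdorff_space T" "\<mu> \<in> radon_signed T"
  shows "signed_measure T \<mu>" "tight T (variation T \<mu>)"
  using assms radon_tight_iff[OF assms(1)] by (auto simp: radon_signed_def)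

lemma radon_signedI:
  assumes "Hausdorff_space T" "signed_measure T \<mu>" "tight T (variation T \<mu>)"
  shows "\<mu> \<in> radon_signed T"
  using assms radon_tight_iff[OF assms(1), of "variation T \<mu>"] by (auto simp: radon_signed_def)

lemma abs_le_variation:
  assumes "Hausdorff_space T" "\<mu> \<in> radon_signed T" "A \<in> sets (borel_alg T)"
  shows "\<bar>\<mu> A\<bar> \<le> measure (variation T \<mu>) A"
proof -
  note s = radon_signedD[OF assms(1,2)]
  interpret finite_measure "variation T \<mu>" using s(2) by (rule tight_finite)
  have "ennreal \<bar>\<mu> A\<bar> \<le> ennreal (measure (variation T \<mu>) A)"
    using abs_le_vsum[OF s(1) assms(3)] emeasure_variation[OF s(1) assms(3)]
    unfolding emeasure_eq_measure by (simp only:)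
  then show ?thesis by (simp only: ennreal_le_iff[OF measure_nonneg])
qed

text \<open>The sign \<open>s\<close> treats both Jordan parts at once; the terms are nonnegative
  because \<open>\<bar>\<mu> A\<bar>\<close> is at most the variation.\<close>

lemma half_variation_countably_additive:
  assumes T: "Hausdorff_space T" "\<mu> \<in> radon_signed T" and s: "s = 1 \<or> s = - 1"
  shows "countably_additive (sets (borel_alg T)) (\<lambda>A. ennreal ((measure (variation T \<mu>) A + s * \<mu> A) / 2))"
proof (rule countably_additiveI)
  note m = radon_signedD[OF T]
  interpret finite_measure "variation T \<mu>" using m(2) by (rule tight_finite)
  fix A :: "nat \<Rightarrow> _" assume A: "range A \<subseteq> sets (borel_alg T)" "disjoint_family A"
  have "(\<lambda>k. measure (variation T \<mu>) (A k)) sums measure (variation T \<mu>) (\<Union>k. A k)"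
    using A by (intro finite_measure_UNION) auto
  moreover have "(\<lambda>k. s * \<mu> (A k)) sums (s * \<mu> (\<Union>k. A k))" using signed_measure_sums[OF m(1) A] by (rule sums_mult)
  ultimately have "(\<lambda>k. (measure (variation T \<mu>) (A k) + s * \<mu> (A k)) / 2) sums
    ((measure (variation T \<mu>) (\<Union>k. A k) + s * \<mu> (\<Union>k. A k)) / 2)"
    by (intro sums_divide sums_add)
  moreover have "0 \<le> (measure (variation T \<mu>) (A k) + s * \<mu> (A k)) / 2" for k
    using abs_le_variation[OF T, of "A k"] A(1) s by (auto simp: subset_eq)
  ultimately show "(\<Sum>k. ennreal ((measure (variation T \<mu>) (A k) + s * \<mu> (A k)) / 2)) =
    ennreal ((measure (variation T \<mu>) (\<Union>k. A k) + s * \<mu> (\<Union>k. A k)) / 2)"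
    by (intro suminf_ennreal_eq)
qed

lemma
  assumes T: "Hausdorff_space T" "\<mu> \<in> radon_signed T"
  shows sets_pos_part: "sets (pos_part T \<mu>) = sets (borel_alg T)"
    and sets_neg_part: "sets (neg_part T \<mu>) = sets (borel_alg T)"
    and emeasure_pos_part: "\<And>A. A \<in> sets (borel_alg T) \<Longrightarrow> emeasure (pos_part T \<mu>) A = ennreal ((measure (variation T \<mu>) A + \<mu> A) / 2)"
    and emeasure_neg_part: "\<And>A. A \<in> sets (borel_alg T) \<Longrightarrow> emeasure (neg_part T \<mu>) A = ennreal ((measure (variation T \<mu>) A - \<mu> A) / 2)"
    and measure_pos_part: "\<And>A. A \<in> sets (borel_alg T) \<Longrightarrow> measure (pos_part T \<mu>) A = (measure (variation T \<mu>) A + \<mu> A) / 2"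
    and measure_neg_part: "\<And>A. A \<in> sets (borel_alg T) \<Longrightarrow> measure (neg_part T \<mu>) A = (measure (variation T \<mu>) A - \<mu> A) / 2"
    and tight_pos_part: "tight T (pos_part T \<mu>)"
    and tight_neg_part: "tight T (neg_part T \<mu>)"
proof -
  note m = radon_signedD[OF T]
  interpret finite_measure "variation T \<mu>" using m(2) by (rule tight_finite)
  show s: "sets (pos_part T \<mu>) = sets (borel_alg T)" "sets (neg_part T \<mu>) = sets (borel_alg T)"
    by (simp_all add: pos_part_def neg_part_def)
  show p: "emeasure (pos_part T \<mu>) A = ennreal ((measure (variation T \<mu>) A + \<mu> A) / 2)"
    and n: "emeasure (neg_part T \<mu>) A = ennreal ((measure (variation T \<mu>) A - \<mu> A) / 2)"
    if A: "A \<in> sets (borel_alg T)" for A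
    unfolding pos_part_def neg_part_def
    using half_variation_countably_additive[OF T, of 1] half_variation_countably_additive[OF T, of "- 1"]
      signed_measure_empty[OF m(1)] A by (subst emeasure_measure_of_borel; simp)+
  have nn: "0 \<le> (measure (variation T \<mu>) A + \<mu> A) / 2" "0 \<le> (measure (variation T \<mu>) A - \<mu> A) / 2"
    if "A \<in> sets (borel_alg T)" for A
    using abs_le_variation[OF T that] by auto
  show "measure (pos_part T \<mu>) A = (measure (variation T \<mu>) A + \<mu> A) / 2"
    and "measure (neg_part T \<mu>) A = (measure (variation T \<mu>) A - \<mu> A) / 2"
    if A: "A \<in> sets (borel_alg T)" for A
    using p[OF A] n[OF A] nn[OF A] by (simp_all add: measure_def)
  have "(measure (variation T \<mu>) A + \<mu> A) / 2 \<le> measure (variation T \<mu>) A"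
    "(measure (variation T \<mu>) A - \<mu> A) / 2 \<le> measure (variation T \<mu>) A" if "A \<in> sets (borel_alg T)" for A
    using abs_le_variation[OF T that] by (auto simp: field_simps)
  then have "emeasure (pos_part T \<mu>) A \<le> ennreal 1 * emeasure (variation T \<mu>) A"
    "emeasure (neg_part T \<mu>) A \<le> ennreal 1 * emeasure (variation T \<mu>) A" if "A \<in> sets (borel_alg T)" for A
    using p[OF that] n[OF that] that by (auto simp: emeasure_eq_measure intro!: ennreal_leI)
  then show "tight T (pos_part T \<mu>)" "tight T (neg_part T \<mu>)"
    using tight_dominated[OF m(2) s(1) _ T(1)] tight_dominated[OF m(2) s(2) _ T(1)] by blast+
qed

section \<open>Linear relations between measures and between their integrals\<close>

lemma integral_simple_function:
  fixes s :: "'a \<Rightarrow> real"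
  assumes "finite_measure M" "simple_function M s"
  shows "integral\<^sup>L M s = (\<Sum>y\<in>s ` space M. measure M {x\<in>space M. s x = y} * y)"
proof -
  interpret finite_measure M by fact
  have "Bochner_Integration.simple_bochner_integrable M s" using assms(2) by (simp add: Bochner_Integration.simple_bochner_integrable.simps)
  from Bochner_Integration.simple_bochner_integrable_eq_integral[OF this] show ?thesis
    by (simp add: Bochner_Integration.simple_bochner_integral_def)
qed

text \<open>One sequence of simple functions approximates \<open>f\<close> for all the measures at
  once, and on simple functions the relation is immediate. The sequence is bounded by
  \<open>2 * \<bar>f x\<bar>\<close>, so dominated convergence applies to each measure. Linearity of
  integrals in the measure rests on this, as variation and Jordan parts are not linear.\<close>

lemma integral_lincomb_eq_0:
  fixes M :: "'i \<Rightarrow> 'a measure" and c :: "'i \<Rightarrow> real" and f :: "'a \<Rightarrow> real"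
  assumes K: "finite K" and fin: "\<And>i. i \<in> K \<Longrightarrow> finite_measure (M i)" and s: "\<And>i. i \<in> K \<Longrightarrow> sets (M i) = sets B"
    and f: "\<And>i. i \<in> K \<Longrightarrow> integrable (M i) f"
    and z: "\<And>A. A \<in> sets B \<Longrightarrow> (\<Sum>i\<in>K. c i * measure (M i) A) = 0"
  shows "(\<Sum>i\<in>K. c i * integral\<^sup>L (M i) f) = 0"
proof (cases "K = {}")
  case True
  then show ?thesis by simp
next
  case False
  then obtain i0 where i0: "i0 \<in> K" by auto
  have sp: "space (M i) = space B" if "i \<in> K" for i using sets_eq_imp_space_eq[OF s[OF that]] .
  have fB: "f \<in> borel_measurable B"
    using borel_measurable_integrable[OF f[OF i0]] measurable_cong_sets[OF s[OF i0] refl] by blast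
  obtain F where F: "\<And>k. simple_function B (F k)" "\<And>x. x \<in> space B \<Longrightarrow> (\<lambda>k. F k x) \<longlonglongrightarrow> f x"
    "\<And>k x. x \<in> space B \<Longrightarrow> \<bar>F k x\<bar> \<le> 2 * \<bar>f x\<bar>"
  proof -
    from borel_measurable_implies_sequence_metric[OF fB, of 0] obtain F where
      "\<forall>k. simple_function B (F k)" "\<forall>x\<in>space B. (\<lambda>k. F k x) \<longlonglongrightarrow> f x"
      "\<forall>k. \<forall>x\<in>space B. dist (F k x) 0 \<le> 2 * dist (f x) 0" by (elim exE conjE)
    then show ?thesis by (intro that[of F]) simp_all
  qed
  have sf: "simple_function (M i) (F k)" if "i \<in> K" for i k
    using F(1)[of k] s[OF that] sp[OF that] by (simp add: simple_function_def)
  have lim: "(\<lambda>k. integral\<^sup>L (M i) (F k)) \<longlonglongrightarrow> integral\<^sup>L (M i) f" if i: "i \<in> K" for i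
  proof (rule integral_dominated_convergence[where w="\<lambda>x. 2 * \<bar>f x\<bar>"])
    show "f \<in> borel_measurable (M i)" using f[OF i] by auto
    show "F k \<in> borel_measurable (M i)" for k using sf[OF i] by (rule borel_measurable_simple_function)
    show "integrable (M i) (\<lambda>x. 2 * \<bar>f x\<bar>)" using f[OF i] by auto
  qed (use F(2,3) sp[OF i] in auto)
  have "(\<Sum>i\<in>K. c i * integral\<^sup>L (M i) (F k)) = 0" for k
  proof -
    have "c i * integral\<^sup>L (M i) (F k) =
      (\<Sum>y\<in>F k ` space B. y * (c i * measure (M i) {x\<in>space B. F k x = y}))" if i: "i \<in> K" for i
      unfolding integral_simple_function[OF fin[OF i] sf[OF i]] sp[OF i] sum_distrib_left
      by (intro sum.cong refl) simp
    then have "(\<Sum>i\<in>K. c i * integral\<^sup>L (M i) (F k)) =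
      (\<Sum>i\<in>K. \<Sum>y\<in>F k ` space B. y * (c i * measure (M i) {x\<in>space B. F k x = y}))"
      by (rule sum.cong[OF refl])
    also have "\<dots> = (\<Sum>y\<in>F k ` space B. y * (\<Sum>i\<in>K. c i * measure (M i) {x\<in>space B. F k x = y}))"
      by (subst sum.swap) (simp add: sum_distrib_left)
    also have "\<dots> = 0"
    proof -
      have "{x\<in>space B. F k x = y} \<in> sets B" for y
      proof -
        have "F k -` {y} \<inter> space B \<in> sets B" using F(1)[of k] by (rule simple_functionD)
        moreover have "{x\<in>space B. F k x = y} = F k -` {y} \<inter> space B" by auto
        ultimately show ?thesis by (simp only:)
      qed
      then show ?thesis by (simp add: z)
    qed
    finally show ?thesis .
  qed
  then have "(\<lambda>k. 0) \<longlonglongrightarrow> (\<Sum>i\<in>K. c i * integral\<^sup>L (M i) f)"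
    using tendsto_sum[of K "\<lambda>i k. c i * integral\<^sup>L (M i) (F k)", OF tendsto_mult[OF tendsto_const lim]] by simp
  then show ?thesis using LIMSEQ_unique tendsto_const by blast
qed

lemma integrable_dominated:
  fixes f :: "'a \<Rightarrow> real"
  assumes f: "integrable M f" and s: "sets N = sets M"
    and le: "\<And>A. A \<in> sets M \<Longrightarrow> emeasure N A \<le> ennreal c * emeasure M A"
  shows "integrable N f"
proof (rule integrableI_bounded)
  have fM: "f \<in> borel_measurable M" using f by auto
  then show fN: "f \<in> borel_measurable N" using measurable_cong_sets[OF s refl] by blast
  have "(\<integral>\<^sup>+x. ennreal (norm (f x)) \<partial>N) \<le> ennreal c * (\<Sum>i\<in>{()}. \<integral>\<^sup>+x. ennreal (norm (f x)) \<partial>M)"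
    using s le fN by (intro nn_integral_sum_dominated) auto
  also have "\<dots> < \<infinity>" using f by (simp add: integrable_iff_bounded ennreal_mult_less_top)
  finally show "(\<integral>\<^sup>+x. ennreal (norm (f x)) \<partial>N) < \<infinity>" .
qed

context
  fixes T :: "'p topology"
  assumes T: "Hausdorff_space T"
begin

lemma integrable_parts:
  fixes f :: "'p \<Rightarrow> real"
  assumes \<mu>: "\<mu> \<in> radon_signed T" and f: "integrable (variation T \<mu>) f"
  shows "integrable (pos_part T \<mu>) f" "integrable (neg_part T \<mu>) f"
proof -
  note m = radon_signedD[OF T \<mu>]
  interpret finite_measure "variation T \<mu>" using m(2) by (rule tight_finite)
  have "(measure (variation T \<mu>) A + \<mu> A) / 2 \<le> measure (variation T \<mu>) A"
    "(measure (variation T \<mu>) A - \<mu> A) / 2 \<le> measure (variation T \<mu>) A" if "A \<in> sets (borel_alg T)" for A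
    using abs_le_variation[OF T \<mu> that] by (auto simp: field_simps)
  then have "emeasure (pos_part T \<mu>) A \<le> ennreal 1 * emeasure (variation T \<mu>) A"
    "emeasure (neg_part T \<mu>) A \<le> ennreal 1 * emeasure (variation T \<mu>) A" if "A \<in> sets (borel_alg T)" for A
    using emeasure_pos_part[OF T \<mu> that] emeasure_neg_part[OF T \<mu> that] that
    by (auto simp: emeasure_eq_measure intro!: ennreal_leI)
  then show "integrable (pos_part T \<mu>) f" "integrable (neg_part T \<mu>) f"
    using integrable_dominated[OF f] sets_pos_part[OF T \<mu>] sets_neg_part[OF T \<mu>] sets_variation[of T \<mu>] by metis+
qed

text \<open>The Jordan parts of a combination are not the combinations of the parts. The relation is
  therefore rewritten for all positive and negative parts together: \<open>(i, True)\<close> is the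
  positive part with weight \<open>c i\<close>, \<open>(i, False)\<close> the negative part with
  weight \<open>- c i\<close>.\<close>

lemma signed_integral_lincomb_eq_0:
  assumes K: "finite K" and \<mu>: "\<And>i. i \<in> K \<Longrightarrow> \<mu> i \<in> radon_signed T"
    and f: "\<And>i. i \<in> K \<Longrightarrow> integrable (variation T (\<mu> i)) f"
    and z: "\<And>A. (\<Sum>i\<in>K. c i * \<mu> i A) = 0"
  shows "(\<Sum>i\<in>K. c i * signed_integral T (\<mu> i) f) = 0"
proof -
  define M where "M p = (if snd p then pos_part T (\<mu> (fst p)) else neg_part T (\<mu> (fst p)))" for p
  define d where "d p = (if snd p then c (fst p) else - c (fst p))" for p
  have two: "(\<Sum>p\<in>K \<times> UNIV. g p) = (\<Sum>i\<in>K. g (i, True) + g (i, False))" for g :: "_ \<Rightarrow> real"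
  proof -
    have "(\<Sum>p\<in>K \<times> UNIV. g p) = (\<Sum>i\<in>K. \<Sum>b\<in>UNIV. g (i, b))" by (simp add: sum.cartesian_product)
    then show ?thesis by (simp add: UNIV_bool add.commute)
  qed
  have "(\<Sum>p\<in>K \<times> UNIV. d p * integral\<^sup>L (M p) f) = 0"
  proof (rule integral_lincomb_eq_0[where B="borel_alg T"])
    show "finite (K \<times> (UNIV :: bool set))" using K by simp
    show "finite_measure (M p)" if "p \<in> K \<times> UNIV" for p
      using that tight_finite[OF tight_pos_part[OF T \<mu>]] tight_finite[OF tight_neg_part[OF T \<mu>]] by (auto simp: M_def)
    show "sets (M p) = sets (borel_alg T)" if "p \<in> K \<times> UNIV" for p
      using that sets_pos_part[OF T \<mu>] sets_neg_part[OF T \<mu>] by (auto simp: M_def)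
    show "integrable (M p) f" if "p \<in> K \<times> UNIV" for p
      using that integrable_parts[OF \<mu> f] by (auto simp: M_def)
    show "(\<Sum>p\<in>K \<times> UNIV. d p * measure (M p) A) = 0" if A: "A \<in> sets (borel_alg T)" for A
    proof -
      have "(\<Sum>p\<in>K \<times> UNIV. d p * measure (M p) A) = (\<Sum>i\<in>K. c i * \<mu> i A)"
        unfolding two d_def M_def
        by (intro sum.cong refl) (simp add: measure_pos_part[OF T \<mu> A] measure_neg_part[OF T \<mu> A] field_simps)
      then show ?thesis using z by simp
    qed
  qed
  moreover have "(\<Sum>p\<in>K \<times> UNIV. d p * integral\<^sup>L (M p) f) = (\<Sum>i\<in>K. c i * signed_integral T (\<mu> i) f)"
    unfolding two d_def M_def signed_integral_def by (simp add: algebra_simps)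
  ultimately show ?thesis by simp
qed

text \<open>The variation is the sum of the two Jordan parts, written as a relation between three
  measures with weights 1, -1 and -1.\<close>

lemma signed_integral_abs_le:
  assumes \<mu>: "\<mu> \<in> radon_signed T" and f: "integrable (variation T \<mu>) f"
  shows "\<bar>signed_integral T \<mu> f\<bar> \<le> (\<integral>x. \<bar>f x\<bar> \<partial>variation T \<mu>)"
proof -
  define M where "M k = (if k = 0 then variation T \<mu> else if k = 1 then pos_part T \<mu> else neg_part T \<mu>)" for k :: nat
  define c where "c k = (if k = 0 then 1 else - 1 :: real)" for k :: nat
  have fa: "integrable (variation T \<mu>) (\<lambda>x. \<bar>f x\<bar>)" using f by simp
  have three: "{..<3::nat} = {0, 1, 2}" by auto
  have "(\<Sum>k<3. c k * integral\<^sup>L (M k) (\<lambda>x. \<bar>f x\<bar>)) = 0"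
  proof (rule integral_lincomb_eq_0[where B="borel_alg T"])
    show "finite_measure (M k)" for k
      using tight_finite[OF tight_pos_part[OF T \<mu>]] tight_finite[OF tight_neg_part[OF T \<mu>]]
        tight_finite[OF radon_signedD(2)[OF T \<mu>]] by (simp add: M_def)
    show "sets (M k) = sets (borel_alg T)" for k
      by (simp add: M_def sets_pos_part[OF T \<mu>] sets_neg_part[OF T \<mu>])
    show "integrable (M k) (\<lambda>x. \<bar>f x\<bar>)" for k
      using integrable_parts[OF \<mu> fa] fa by (simp add: M_def)
    show "(\<Sum>k<3. c k * measure (M k) A) = 0" if A: "A \<in> sets (borel_alg T)" for A
      by (simp add: three M_def c_def measure_pos_part[OF T \<mu> A] measure_neg_part[OF T \<mu> A] field_simps)
  qed simp
  then have "(\<integral>x. \<bar>f x\<bar> \<partial>variation T \<mu>) = (\<integral>x. \<bar>f x\<bar> \<partial>pos_part T \<mu>) + (\<integral>x. \<bar>f x\<bar> \<partial>neg_part T \<mu>)"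
    by (simp add: three M_def c_def)
  moreover have "\<bar>integral\<^sup>L (pos_part T \<mu>) f\<bar> \<le> (\<integral>x. \<bar>f x\<bar> \<partial>pos_part T \<mu>)"
    "\<bar>integral\<^sup>L (neg_part T \<mu>) f\<bar> \<le> (\<integral>x. \<bar>f x\<bar> \<partial>neg_part T \<mu>)" by (rule integral_abs_bound)+
  ultimately show ?thesis unfolding signed_integral_def by linarith
qed

lemma signed_integral_add:
  assumes \<mu>: "\<mu> \<in> radon_signed T" and f: "integrable (variation T \<mu>) f" "integrable (variation T \<mu>) g"
  shows "signed_integral T \<mu> (\<lambda>x. f x + g x) = signed_integral T \<mu> f + signed_integral T \<mu> g"
  using integrable_parts[OF \<mu> f(1)] integrable_parts[OF \<mu> f(2)] by (simp add: signed_integral_def)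

lemma signed_integral_cmult: "signed_integral T \<mu> (\<lambda>x. a * f x) = a * signed_integral T \<mu> f"
  by (simp add: signed_integral_def algebra_simps)

lemma signed_integral_sum:
  assumes \<mu>: "\<mu> \<in> radon_signed T" and f: "\<And>i. i \<in> K \<Longrightarrow> integrable (variation T \<mu>) (f i)"
  shows "signed_integral T \<mu> (\<lambda>x. \<Sum>i\<in>K. f i x) = (\<Sum>i\<in>K. signed_integral T \<mu> (f i))"
  using integrable_parts[OF \<mu> f] by (simp add: signed_integral_def sum_subtractf)

lemma signed_integral_cong:
  assumes \<mu>: "\<mu> \<in> radon_signed T" and f: "\<And>x. x \<in> topspace T \<Longrightarrow> f x = g x"
  shows "signed_integral T \<mu> f = signed_integral T \<mu> g"
proof -
  have "integral\<^sup>L (pos_part T \<mu>) f = integral\<^sup>L (pos_part T \<mu>) g"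
    using f by (intro Bochner_Integration.integral_cong) (auto simp: tight_space[OF tight_pos_part[OF T \<mu>]])
  moreover have "integral\<^sup>L (neg_part T \<mu>) f = integral\<^sup>L (neg_part T \<mu>) g"
    using f by (intro Bochner_Integration.integral_cong) (auto simp: tight_space[OF tight_neg_part[OF T \<mu>]])
  ultimately show ?thesis by (simp add: signed_integral_def)
qed

section \<open>Linear combinations of signed Radon measures\<close>

lemma signed_measure_lincomb:
  assumes "signed_measure T \<mu>" "signed_measure T \<eta>"
  shows "signed_measure T (\<lambda>A. a * \<mu> A + b * \<eta> A)"
  using assms unfolding signed_measure_def by (auto intro!: sums_add sums_mult)

lemma variation_lincomb_le:
  assumes \<mu>: "signed_measure T \<mu>" and \<eta>: "signed_measure T \<eta>" and A: "A \<in> sets (borel_alg T)"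
  shows "emeasure (variation T (\<lambda>A. a * \<mu> A + b * \<eta> A)) A \<le>
    ennreal \<bar>a\<bar> * emeasure (variation T \<mu>) A + ennreal \<bar>b\<bar> * emeasure (variation T \<eta>) A"
  unfolding emeasure_variation[OF signed_measure_lincomb[OF \<mu> \<eta>] A] emeasure_variation[OF \<mu> A] emeasure_variation[OF \<eta> A]
  unfolding vsum_def[of T "\<lambda>A. a * \<mu> A + b * \<eta> A"]
proof (rule SUP_least)
  fix C assume "C \<in> {C. finite C \<and> C \<subseteq> sets (borel_alg T) \<and> partition_on A C}"
  then have C: "finite C" "C \<subseteq> sets (borel_alg T)" "partition_on A C" by auto
  have "(\<Sum>B\<in>C. ennreal \<bar>a * \<mu> B + b * \<eta> B\<bar>) \<le> (\<Sum>B\<in>C. ennreal \<bar>a\<bar> * ennreal \<bar>\<mu> B\<bar> + ennreal \<bar>b\<bar> * ennreal \<bar>\<eta> B\<bar>)"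
  proof (rule sum_mono)
    fix B
    have "\<bar>a * \<mu> B + b * \<eta> B\<bar> \<le> \<bar>a\<bar> * \<bar>\<mu> B\<bar> + \<bar>b\<bar> * \<bar>\<eta> B\<bar>"
      unfolding abs_mult[symmetric] by (rule abs_triangle_ineq)
    then have "ennreal \<bar>a * \<mu> B + b * \<eta> B\<bar> \<le> ennreal (\<bar>a\<bar> * \<bar>\<mu> B\<bar> + \<bar>b\<bar> * \<bar>\<eta> B\<bar>)" by (rule ennreal_leI)
    then show "ennreal \<bar>a * \<mu> B + b * \<eta> B\<bar> \<le> ennreal \<bar>a\<bar> * ennreal \<bar>\<mu> B\<bar> + ennreal \<bar>b\<bar> * ennreal \<bar>\<eta> B\<bar>"
      by (simp add: ennreal_mult)
  qed
  also have "\<dots> = ennreal \<bar>a\<bar> * (\<Sum>B\<in>C. ennreal \<bar>\<mu> B\<bar>) + ennreal \<bar>b\<bar> * (\<Sum>B\<in>C. ennreal \<bar>\<eta> B\<bar>)"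
    by (simp only: sum.distrib sum_distrib_left)
  also have "\<dots> \<le> ennreal \<bar>a\<bar> * vsum T \<mu> A + ennreal \<bar>b\<bar> * vsum T \<eta> A"
    using C by (intro add_mono mult_left_mono vsum_upper) auto
  finally show "(\<Sum>B\<in>C. ennreal \<bar>a * \<mu> B + b * \<eta> B\<bar>) \<le> ennreal \<bar>a\<bar> * vsum T \<mu> A + ennreal \<bar>b\<bar> * vsum T \<eta> A" .
qed

text \<open>The union of a compact set that suits \<open>\<mu>\<close> and one that suits
  \<open>\<eta>\<close> suits the combination, whose variation is bounded by the weighted sum of the
  two.\<close>

lemma radon_signed_lincomb:
  assumes \<mu>: "\<mu> \<in> radon_signed T" and \<eta>: "\<eta> \<in> radon_signed T"
  shows "(\<lambda>A. a * \<mu> A + b * \<eta> A) \<in> radon_signed T"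
proof (rule radon_signedI[OF T])
  let ?\<nu> = "\<lambda>A. a * \<mu> A + b * \<eta> A"
  note m = radon_signedD[OF T \<mu>] and e = radon_signedD[OF T \<eta>]
  note le = variation_lincomb_le[OF m(1) e(1), of _ a b]
  show "signed_measure T ?\<nu>" using m(1) e(1) by (rule signed_measure_lincomb)
  show "tight T (variation T ?\<nu>)"
    unfolding tight_def
  proof (intro conjI ballI allI impI)
    have "ennreal \<bar>a\<bar> * emeasure (variation T \<mu>) (topspace T) + ennreal \<bar>b\<bar> * emeasure (variation T \<eta>) (topspace T) < \<infinity>"
      using m(2) e(2) by (auto simp: tight_def ennreal_mult_less_top)
    then show "emeasure (variation T ?\<nu>) (topspace T) < \<infinity>" using le[of "topspace T"] by (auto intro: le_less_trans)
    fix A r assume A: "A \<in> sets (borel_alg T)" and r: "(0::real) < r"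
    define q where "q = r / (\<bar>a\<bar> + \<bar>b\<bar> + 1)"
    have q: "0 < q" using r by (simp add: q_def add_pos_nonneg)
    have "q * (\<bar>a\<bar> + \<bar>b\<bar> + 1) = r" unfolding q_def by (simp add: add_nonneg_eq_0_iff)
    then have qr: "\<bar>a\<bar> * q + \<bar>b\<bar> * q \<le> r" using q by (simp add: algebra_simps)
    from tightD[OF m(2) A q] obtain C where C: "compactin T C" "C \<subseteq> A" "emeasure (variation T \<mu>) (A - C) \<le> ennreal q" .
    from tightD[OF e(2) A q] obtain D where D: "compactin T D" "D \<subseteq> A" "emeasure (variation T \<eta>) (A - D) \<le> ennreal q" .
    note CB = compactin_in_borel_alg[OF T C(1)] and DB = compactin_in_borel_alg[OF T D(1)]
    have "emeasure (variation T ?\<nu>) (A - (C \<union> D)) \<le>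
      ennreal \<bar>a\<bar> * emeasure (variation T \<mu>) (A - (C \<union> D)) + ennreal \<bar>b\<bar> * emeasure (variation T \<eta>) (A - (C \<union> D))"
      using A CB DB by (intro le) auto
    also have "\<dots> \<le> ennreal \<bar>a\<bar> * emeasure (variation T \<mu>) (A - C) + ennreal \<bar>b\<bar> * emeasure (variation T \<eta>) (A - D)"
      using A CB DB by (intro add_mono mult_left_mono emeasure_mono) auto
    also have "\<dots> \<le> ennreal \<bar>a\<bar> * ennreal q + ennreal \<bar>b\<bar> * ennreal q"
      using C D by (intro add_mono mult_left_mono) auto
    also have "\<dots> = ennreal (\<bar>a\<bar> * q + \<bar>b\<bar> * q)" using q by (simp add: ennreal_mult)
    also have "\<dots> \<le> ennreal r" using qr by (rule ennreal_leI)
    finally show "\<exists>C. compactin T C \<and> C \<subseteq> A \<and> emeasure (variation T ?\<nu>) (A - C) \<le> ennreal r"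
      using C D compactin_Un[OF C(1) D(1)] by (intro exI[of _ "C \<union> D"]) auto
  qed simp
qed

lemma nn_integral_variation_lincomb_le:
  assumes \<mu>: "\<mu> \<in> radon_signed T" and \<eta>: "\<eta> \<in> radon_signed T" and f: "f \<in> borel_measurable (borel_alg T)"
  shows "(\<integral>\<^sup>+x. f x \<partial>variation T (\<lambda>A. a * \<mu> A + b * \<eta> A)) \<le>
    ennreal (\<bar>a\<bar> + \<bar>b\<bar>) * ((\<integral>\<^sup>+x. f x \<partial>variation T \<mu>) + (\<integral>\<^sup>+x. f x \<partial>variation T \<eta>))"
proof -
  note m = radon_signedD[OF T \<mu>] and e = radon_signedD[OF T \<eta>]
  define N where "N k = (if k then variation T \<mu> else variation T \<eta>)" for k
  have "(\<integral>\<^sup>+x. f x \<partial>variation T (\<lambda>A. a * \<mu> A + b * \<eta> A)) \<le> ennreal (\<bar>a\<bar> + \<bar>b\<bar>) * (\<Sum>k\<in>UNIV. \<integral>\<^sup>+x. f x \<partial>N k)"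
  proof (rule nn_integral_sum_dominated)
    fix A assume "A \<in> sets (variation T (\<lambda>A. a * \<mu> A + b * \<eta> A))"
    then have A: "A \<in> sets (borel_alg T)" by simp
    have "emeasure (variation T (\<lambda>A. a * \<mu> A + b * \<eta> A)) A \<le>
       ennreal \<bar>a\<bar> * emeasure (variation T \<mu>) A + ennreal \<bar>b\<bar> * emeasure (variation T \<eta>) A"
      using m(1) e(1) A by (rule variation_lincomb_le)
    also have "\<dots> \<le> ennreal (\<bar>a\<bar> + \<bar>b\<bar>) * emeasure (variation T \<mu>) A + ennreal (\<bar>a\<bar> + \<bar>b\<bar>) * emeasure (variation T \<eta>) A"
      by (intro add_mono mult_right_mono ennreal_leI) auto
    finally show "emeasure (variation T (\<lambda>A. a * \<mu> A + b * \<eta> A)) A \<le> ennreal (\<bar>a\<bar> + \<bar>b\<bar>) * (\<Sum>k\<in>UNIV. emeasure (N k) A)"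
      by (simp add: UNIV_bool N_def distrib_left add.commute)
  qed (use f measurable_cong_sets[OF sets_variation refl] in \<open>auto simp: N_def\<close>)
  then show ?thesis by (simp add: UNIV_bool N_def add.commute)
qed

end

subsection \<open>Finitely supported coefficient functions\<close>

text \<open>The integral of \<open>g\<close> against the finitely supported signed measure with
  point masses \<open>c\<close>.\<close>

definition lin :: "('p \<Rightarrow> real) \<Rightarrow> ('p \<Rightarrow> real) \<Rightarrow> real" where
  "lin c g = (\<Sum>x | c x \<noteq> 0. c x * g x)"

definition fsupp :: "'p set \<Rightarrow> ('p \<Rightarrow> real) set" where
  "fsupp S = {c. finite {x. c x \<noteq> 0} \<and> {x. c x \<noteq> 0} \<subseteq> S}"

lemma lin_superset:
  assumes "finite D" "{x. c x \<noteq> 0} \<subseteq> D" shows "lin c g = (\<Sum>x\<in>D. c x * g x)"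
  unfolding lin_def using assms by (intro sum.mono_neutral_left) auto

lemma fsupp_lincomb:
  assumes "c \<in> fsupp S" "d \<in> fsupp S" shows "(\<lambda>x. a * c x + b * d x) \<in> fsupp S"
proof -
  have sub: "{x. a * c x + b * d x \<noteq> 0} \<subseteq> {x. c x \<noteq> 0} \<union> {x. d x \<noteq> 0}" by auto
  then have "finite {x. a * c x + b * d x \<noteq> 0}" by (rule finite_subset) (use assms in \<open>auto simp: fsupp_def\<close>)
  then show ?thesis using sub assms by (auto simp: fsupp_def)
qed

lemma fsupp_zero: "(\<lambda>x. 0) \<in> fsupp S"
  by (simp add: fsupp_def)

lemma fsupp_single: "x \<in> S \<Longrightarrow> (\<lambda>y. of_bool (y = x)) \<in> fsupp S"
  by (simp add: fsupp_def)

lemma lin_single: "lin (\<lambda>y. of_bool (y = x)) g = g x"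
  by (simp add: lin_def)

lemma lin_zero: "lin (\<lambda>y. 0) g = 0"
  by (simp add: lin_def)

lemma lin_lincomb_left:
  assumes "c \<in> fsupp S" "d \<in> fsupp S"
  shows "lin (\<lambda>x. a * c x + b * d x) g = a * lin c g + b * lin d g"
proof -
  let ?D = "{x. c x \<noteq> 0} \<union> {x. d x \<noteq> 0}"
  have D: "finite ?D" using assms by (auto simp: fsupp_def)
  have "lin (\<lambda>x. a * c x + b * d x) g = (\<Sum>x\<in>?D. (a * c x + b * d x) * g x)"
    using D by (intro lin_superset) auto
  also have "\<dots> = a * (\<Sum>x\<in>?D. c x * g x) + b * (\<Sum>x\<in>?D. d x * g x)"
    by (simp add: sum_distrib_left sum.distrib[symmetric] algebra_simps)
  also have "\<dots> = a * lin c g + b * lin d g"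
    using lin_superset[OF D, of c g] lin_superset[OF D, of d g] by simp
  finally show ?thesis .
qed

lemma lin_lincomb_right: "lin c (\<lambda>x. a * g x + b * h x) = a * lin c g + b * lin c h"
  by (simp add: lin_def sum_distrib_left sum.distrib[symmetric] algebra_simps)

lemma lin_cong: "c \<in> fsupp S \<Longrightarrow> (\<And>x. x \<in> S \<Longrightarrow> g x = h x) \<Longrightarrow> lin c g = lin c h"
  unfolding lin_def by (intro sum.cong) (auto simp: fsupp_def)

lemma lin_swap: "lin c (\<lambda>x. lin d (\<lambda>y. K x y)) = lin d (\<lambda>y. lin c (\<lambda>x. K x y))"
proof -
  have "lin c (\<lambda>x. lin d (\<lambda>y. K x y)) = (\<Sum>x | c x \<noteq> 0. \<Sum>y | d y \<noteq> 0. c x * (d y * K x y))"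
    by (simp add: lin_def sum_distrib_left)
  also have "\<dots> = (\<Sum>y | d y \<noteq> 0. \<Sum>x | c x \<noteq> 0. c x * (d y * K x y))" by (rule sum.swap)
  also have "\<dots> = lin d (\<lambda>y. lin c (\<lambda>x. K x y))"
    by (simp add: lin_def sum_distrib_left mult.left_commute)
  finally show ?thesis .
qed

subsection \<open>Semi-inner products and the Riesz representation\<close>

lemma quadratic_nonneg:
  fixes a b c :: real
  assumes "\<And>t. 0 \<le> a + 2 * b * t + c * t\<^sup>2" "0 \<le> c" shows "b\<^sup>2 \<le> a * c"
proof (cases "c = 0")
  case True
  have "b = 0"
  proof (rule ccontr)
    assume b: "b \<noteq> 0"
    \<comment> \<open>The parameter is chosen so that the affine function takes the value
      -1.\<close>
    have "0 \<le> a + 2 * b * (- (a + 1) / (2 * b))" using assms(1)[of "- (a + 1) / (2 * b)"] True by simp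
    also have "\<dots> = - 1" using b by (simp add: field_simps)
    finally show False by simp
  qed
  then show ?thesis using True by simp
next
  case False
  then have c: "0 < c" using assms(2) by simp
  have "0 \<le> a + 2 * b * (- b / c) + c * (- b / c)\<^sup>2" by (rule assms(1))
  also have "\<dots> = (a * c - b\<^sup>2) / c" using c by (simp add: field_simps power2_eq_square)
  finally show ?thesis using c by (simp add: zero_le_divide_iff)
qed

context
  fixes V :: "('b \<Rightarrow> real) set" and B :: "('b \<Rightarrow> real) \<Rightarrow> ('b \<Rightarrow> real) \<Rightarrow> real"
  assumes sip: "semi_inner_product_on V B"
begin

lemma sip_sym: "f \<in> V \<Longrightarrow> g \<in> V \<Longrightarrow> B f g = B g f"
  using sip by (simp add: semi_inner_product_on_def)

lemma sip_nonneg: "f \<in> V \<Longrightarrow> 0 \<le> B f f"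
  using sip by (simp add: semi_inner_product_on_def)

lemma sip_lincomb_in: "f \<in> V \<Longrightarrow> g \<in> V \<Longrightarrow> (\<lambda>x. a * f x + b * g x) \<in> V"
  using sip by (auto simp: semi_inner_product_on_def function_subspace_def)

lemma sip_lincomb:
  assumes "f \<in> V" "g \<in> V" "h \<in> V" shows "B (\<lambda>x. a * f x + b * g x) h = a * B f h + b * B g h"
proof -
  have add: "\<forall>f\<in>V. \<forall>g\<in>V. \<forall>h\<in>V. B (\<lambda>x. f x + g x) h = B f h + B g h"
    using sip unfolding semi_inner_product_on_def by (elim conjE)
  have "(\<lambda>x. a * f x) \<in> V" "(\<lambda>x. b * g x) \<in> V"
    using sip assms by (auto simp: semi_inner_product_on_def function_subspace_def)
  then have "B (\<lambda>x. a * f x + b * g x) h = B (\<lambda>x. a * f x) h + B (\<lambda>x. b * g x) h"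
    using assms(3) by (intro add[rule_format])
  moreover have "B (\<lambda>x. a * f x) h = a * B f h" "B (\<lambda>x. b * g x) h = b * B g h"
    using sip assms unfolding semi_inner_product_on_def by blast+
  ultimately show ?thesis by simp
qed

lemma sip_lincomb_right: "f \<in> V \<Longrightarrow> g \<in> V \<Longrightarrow> h \<in> V \<Longrightarrow> B h (\<lambda>x. a * f x + b * g x) = a * B h f + b * B h g"
  using sip_lincomb[of f g h a b] sip_sym sip_lincomb_in[of f g a b] by simp

lemma sip_quad:
  "f \<in> V \<Longrightarrow> g \<in> V \<Longrightarrow> B (\<lambda>x. a * f x + b * g x) (\<lambda>x. a * f x + b * g x) = a\<^sup>2 * B f f + 2 * a * b * B f g + b\<^sup>2 * B g g"
  using sip_lincomb_in[of f g a b] sip_sym[of f g]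
  by (simp add: sip_lincomb sip_lincomb_right power2_eq_square algebra_simps)

lemma sip_cauchy_schwarz:
  assumes "f \<in> V" "g \<in> V" shows "(B f g)\<^sup>2 \<le> B f f * B g g"
proof (rule quadratic_nonneg)
  show "0 \<le> B g g" using assms sip_nonneg by simp
  show "0 \<le> B f f + 2 * B f g * t + B g g * t\<^sup>2" for t
    using sip_nonneg[OF sip_lincomb_in[OF assms, of 1 t]] sip_quad[OF assms, of 1 t] by (simp add: algebra_simps)
qed

end

lemma tendsto_zero_of_square_le:
  fixes x y :: "nat \<Rightarrow> real"
  assumes le: "\<And>k. (x k)\<^sup>2 \<le> y k" and y: "y \<longlonglongrightarrow> 0"
  shows "x \<longlonglongrightarrow> 0"
proof -
  have "(\<lambda>k. (x k)\<^sup>2) \<longlonglongrightarrow> 0"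
  proof (rule real_tendsto_sandwich[OF _ _ tendsto_const y])
    show "\<forall>\<^sub>F k in sequentially. 0 \<le> (x k)\<^sup>2" by simp
    show "\<forall>\<^sub>F k in sequentially. (x k)\<^sup>2 \<le> y k" using le by simp
  qed
  from tendsto_real_sqrt[OF this] show ?thesis by (simp add: tendsto_rabs_zero_iff)
qed

text \<open>The parallelogram step for a minimising sequence. Here \<open>a\<close> and
  \<open>c\<close> are squared norms, \<open>b\<close> is the inner product, \<open>p\<close> and
  \<open>q\<close> are values of the functional, and \<open>u\<close> and \<open>v\<close> are the
  distances from the infimum \<open>m\<close>; the first premise is minimality at the
  midpoint.\<close>

lemma midpoint_estimate:
  fixes m a b c p q u v :: real
  assumes "m \<le> (a + 2 * b + c) / 4 - (p + q)" "a - 2 * p < m + u" "c - 2 * q < m + v"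
  shows "a - 2 * b + c \<le> 2 * u + 2 * v"
  using assms by (simp add: field_simps)

text \<open>The representer is the limit of a minimising sequence of \<open>f \<mapsto> B f f - 2 \<phi> f\<close>.\<close>

lemma riesz_representation:
  assumes H: "hilbert_on V B"
    and lin: "\<And>f g a b. f \<in> V \<Longrightarrow> g \<in> V \<Longrightarrow> \<phi> (\<lambda>x. a * f x + b * g x) = a * \<phi> f + b * \<phi> g"
    and bd: "\<And>f. f \<in> V \<Longrightarrow> (\<phi> f)\<^sup>2 \<le> C * B f f" and C: "0 \<le> C"
  shows "\<exists>r\<in>V. \<forall>f\<in>V. B r f = \<phi> f"
proof -
  have sip: "semi_inner_product_on V B" using H by (simp add: hilbert_on_def)
  note inV = sip_lincomb_in[OF sip] and quad = sip_quad[OF sip] and nn = sip_nonneg[OF sip]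
  have V0: "(\<lambda>_. 0) \<in> V" using sip by (simp add: semi_inner_product_on_def function_subspace_def)
  define E where "E f = B f f - 2 * \<phi> f" for f
  have low: "- C \<le> E f" if f: "f \<in> V" for f
  proof -
    \<comment> \<open>The functional is bounded below by the inequality of means:
      \<open>\<bar>2 * \<phi> f\<bar>\<close> is at most twice the geometric mean of
      \<open>C\<close> and \<open>B f f\<close>, hence at most their sum.\<close>
    have "0 \<le> (B f f - C)\<^sup>2" by simp
    then have "4 * (C * B f f) \<le> (B f f + C)\<^sup>2" by (simp add: power2_eq_square algebra_simps)
    moreover have "(2 * \<phi> f)\<^sup>2 \<le> 4 * (C * B f f)" using bd[OF f] by (simp add: power_mult_distrib)
    ultimately have sq: "(2 * \<phi> f)\<^sup>2 \<le> (B f f + C)\<^sup>2" by simp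
    have "\<bar>2 * \<phi> f\<bar> \<le> \<bar>B f f + C\<bar>" using sq by (simp add: abs_le_square_iff)
    then show ?thesis using C nn[OF f] unfolding E_def by linarith
  qed
  define m where "m = Inf (E ` V)"
  have bdd: "bdd_below (E ` V)" using low by (auto intro!: bdd_belowI2)
  have mE: "m \<le> E f" if "f \<in> V" for f unfolding m_def using bdd that by (intro cInf_lower) auto
  have "\<exists>f\<in>V. E f < m + 1 / (real k + 1)" for k
  proof -
    have "Inf (E ` V) < m + 1 / (real k + 1)" by (simp add: m_def add_pos_nonneg)
    then show ?thesis using bdd V0 cInf_less_iff[of "E ` V"] by auto
  qed
  then obtain s where s: "\<And>k. s k \<in> V" "\<And>k. E (s k) < m + 1 / (real k + 1)" by metis
  have dist: "B (\<lambda>x. s j x - s k x) (\<lambda>x. s j x - s k x) \<le> 2 / (real j + 1) + 2 / (real k + 1)" for j k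
  proof -
    have "m \<le> E (\<lambda>x. 1/2 * s j x + 1/2 * s k x)" by (rule mE[OF inV[OF s(1) s(1)]])
    also have "\<dots> = (B (s j) (s j) + 2 * B (s j) (s k) + B (s k) (s k)) / 4 - (\<phi> (s j) + \<phi> (s k))"
      using quad[OF s(1) s(1), of "1/2" j "1/2" k] lin[OF s(1) s(1), of "1/2" j "1/2" k]
      unfolding E_def by (simp add: power2_eq_square field_simps)
    finally have mm: "m \<le> (B (s j) (s j) + 2 * B (s j) (s k) + B (s k) (s k)) / 4 - (\<phi> (s j) + \<phi> (s k))" .
    have eq: "B (\<lambda>x. s j x - s k x) (\<lambda>x. s j x - s k x) = B (s j) (s j) - 2 * B (s j) (s k) + B (s k) (s k)"
      using quad[OF s(1) s(1), of 1 j "-1" k] by simp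
    have "B (\<lambda>x. s j x - s k x) (\<lambda>x. s j x - s k x) \<le> 2 * (1 / (real j + 1)) + 2 * (1 / (real k + 1))"
      unfolding eq using mm s(2)[of j, unfolded E_def] s(2)[of k, unfolded E_def] by (rule midpoint_estimate)
    then show ?thesis by simp
  qed
  have "\<forall>e>0. \<exists>N. \<forall>j\<ge>N. \<forall>k\<ge>N. B (\<lambda>x. s j x - s k x) (\<lambda>x. s j x - s k x) < e"
  proof (intro allI impI)
    fix e :: real assume e: "0 < e"
    obtain N where N: "4 / e < real N" using reals_Archimedean2 by blast
    have "2 / (real j + 1) < e / 2" if "j \<ge> N" for j
    proof -
      have "4 / e < real j + 1" using N that by linarith
      then show ?thesis using e by (simp add: field_simps)
    qed
    then show "\<exists>N. \<forall>j\<ge>N. \<forall>k\<ge>N. B (\<lambda>x. s j x - s k x) (\<lambda>x. s j x - s k x) < e"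
    proof (intro exI[of _ N] allI impI)
      fix j k assume "N \<le> j" "N \<le> k"
      then have "2 / (real j + 1) + 2 / (real k + 1) < e / 2 + e / 2"
        using \<open>\<And>j. N \<le> j \<Longrightarrow> 2 / (real j + 1) < e / 2\<close> by (intro add_strict_mono)
      then show "B (\<lambda>x. s j x - s k x) (\<lambda>x. s j x - s k x) < e" using dist[of j k] by simp
    qed
  qed
  then obtain r where r: "r \<in> V" "(\<lambda>k. B (\<lambda>x. s k x - r x) (\<lambda>x. s k x - r x)) \<longlonglongrightarrow> 0"
    using H s(1) unfolding hilbert_on_def by blast
  have "B r f = \<phi> f" if f: "f \<in> V" for f
  proof -
    have diffV: "(\<lambda>x. s k x - r x) \<in> V" for k using inV[OF s(1) r(1), of 1 k "-1"] by simp
    \<comment> \<open>\<open>s k\<close> minimises \<open>E\<close> up to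
      \<open>1 / (k + 1)\<close>, also against \<open>s k + t * f\<close>. This gives a nonnegative
      quadratic in \<open>t\<close>, whose discriminant bounds the defect of \<open>s k\<close> as a
      representer.\<close>
    have 1: "(B (s k) f - \<phi> f)\<^sup>2 \<le> 1 / (real k + 1) * B f f" for k
    proof (rule quadratic_nonneg)
      show "0 \<le> B f f" using nn f by simp
      fix t
      have "m \<le> E (\<lambda>x. 1 * s k x + t * f x)" by (rule mE[OF inV[OF s(1) f]])
      also have "\<dots> = E (s k) + 2 * t * (B (s k) f - \<phi> f) + t\<^sup>2 * B f f"
        using quad[OF s(1) f, of 1 k t] lin[OF s(1) f, of 1 k t] unfolding E_def by (simp add: algebra_simps)
      finally show "0 \<le> 1 / (real k + 1) + 2 * (B (s k) f - \<phi> f) * t + B f f * t\<^sup>2"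
        using s(2)[of k] by (simp add: algebra_simps)
    qed
    have "(\<lambda>k. 1 / (real k + 1) * B f f) \<longlonglongrightarrow> 0 * B f f"
      using LIMSEQ_inverse_real_of_nat by (intro tendsto_mult tendsto_const) (simp add: inverse_eq_divide add.commute)
    then have l1: "(\<lambda>k. B (s k) f - \<phi> f) \<longlonglongrightarrow> 0"
      unfolding mult_zero_left by (rule tendsto_zero_of_square_le[OF 1])
    have 2: "(B (s k) f - B r f)\<^sup>2 \<le> B (\<lambda>x. s k x - r x) (\<lambda>x. s k x - r x) * B f f" for k
    proof -
      have "B (\<lambda>x. s k x - r x) f = B (s k) f - B r f"
        using sip_lincomb[OF sip s(1) r(1) f, of 1 k "-1"] by simp
      then show ?thesis using sip_cauchy_schwarz[OF sip diffV f, of k] by simp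
    qed
    have "(\<lambda>k. B (\<lambda>x. s k x - r x) (\<lambda>x. s k x - r x) * B f f) \<longlonglongrightarrow> 0 * B f f"
      using r(2) by (intro tendsto_mult tendsto_const)
    then have l2: "(\<lambda>k. B (s k) f - B r f) \<longlonglongrightarrow> 0"
      unfolding mult_zero_left by (rule tendsto_zero_of_square_le[OF 2])
    have "(\<lambda>k. (B (s k) f - \<phi> f) - (B (s k) f - B r f)) \<longlonglongrightarrow> 0 - 0" using l1 l2 by (rule tendsto_diff)
    then have "(\<lambda>k::nat. B r f - \<phi> f) \<longlonglongrightarrow> 0" by simp
    then show ?thesis by (simp add: LIMSEQ_const_iff)
  qed
  then show ?thesis using r(1) by blast
qed

subsection \<open>Existence of reproducing kernel Hilbert spaces\<close>

text \<open>Vanishing on the integers makes the function periodic and so bounded everywhere, and a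
  bounded additive function is zero because its multiples would grow. It supplies homogeneity of an
  inner product defined by polarisation, for which only additivity follows directly from the
  parallelogram law.\<close>

lemma bounded_additive_zero:
  fixes \<psi> :: "real \<Rightarrow> real"
  assumes add: "\<And>s t. \<psi> (s + t) = \<psi> s + \<psi> t" and one: "\<psi> 1 = 0"
    and bd: "\<And>t. 0 \<le> t \<Longrightarrow> t \<le> 1 \<Longrightarrow> \<bar>\<psi> t\<bar> \<le> C"
  shows "\<psi> t = 0"
proof -
  have nat: "\<psi> (real n * t) = real n * \<psi> t" for n t
  proof (induction n)
    case 0
    then show ?case using add[of 0 0] by simp
  next
    case (Suc n)
    then show ?case using add[of t "real n * t"] by (simp add: algebra_simps)
  qed
  have neg: "\<psi> (- t) = - \<psi> t" for t using add[of t "- t"] add[of 0 0] by simp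
  have int: "\<psi> (of_int i) = 0" for i :: int
  proof (cases "0 \<le> i")
    case True
    then show ?thesis using nat[of "nat i" 1] one by simp
  next
    case False
    then show ?thesis using nat[of "nat (- i)" 1] one neg[of "of_int i"] by simp
  qed
  have all: "\<bar>\<psi> t\<bar> \<le> C" for t
  proof -
    have "\<psi> t = \<psi> (of_int \<lfloor>t\<rfloor>) + \<psi> (frac t)" using add[of "of_int \<lfloor>t\<rfloor>" "frac t"] by (simp add: frac_def)
    then show ?thesis using int bd[of "frac t"] frac_ge_0[of t] frac_lt_1[of t] by simp
  qed
  show ?thesis
  proof (rule ccontr)
    assume "\<psi> t \<noteq> 0"
    then obtain n where "C / \<bar>\<psi> t\<bar> < real n" using reals_Archimedean2 by blast
    then have "C < real n * \<bar>\<psi> t\<bar>" using \<open>\<psi> t \<noteq> 0\<close> by (simp add: field_simps)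
    also have "\<dots> = \<bar>\<psi> (real n * t)\<bar>" by (simp add: nat abs_mult)
    also have "\<dots> \<le> C" by (rule all)
    finally show False by simp
  qed
qed

definition psd_kernel :: "'p set \<Rightarrow> ('p \<Rightarrow> 'p \<Rightarrow> real) \<Rightarrow> bool" where
  "psd_kernel S K \<longleftrightarrow> (\<forall>x\<in>S. \<forall>y\<in>S. K x y = K y x) \<and>
     (\<forall>c\<in>fsupp S. 0 \<le> lin c (\<lambda>x. lin c (\<lambda>y. K x y)))"

text \<open>The squared norm of \<open>g\<close> is \<open>sup\<^sub>c (2 lin c g - \<parallel>\<Sum>\<^sub>x c x K x\<parallel>\<^sup>2)\<close>, by duality. In this form the
  parallelogram law is a change of variables and completeness is pointwise.\<close>

context
  fixes S :: "'p set" and K :: "'p \<Rightarrow> 'p \<Rightarrow> real"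
  assumes psd: "psd_kernel S K"
begin

definition bil :: "('p \<Rightarrow> real) \<Rightarrow> ('p \<Rightarrow> real) \<Rightarrow> real" where
  "bil c d = lin c (\<lambda>x. lin d (\<lambda>y. K x y))"

definition dual :: "('p \<Rightarrow> real) \<Rightarrow> ('p \<Rightarrow> real) \<Rightarrow> real" where
  "dual g c = 2 * lin c g - bil c c"

definition rspace :: "('p \<Rightarrow> real) set" where
  "rspace = {g. (\<forall>x. x \<notin> S \<longrightarrow> g x = 0) \<and> (\<exists>C. \<forall>c\<in>fsupp S. dual g c \<le> C)}"

definition rnorm :: "('p \<Rightarrow> real) \<Rightarrow> real" where
  "rnorm g = (SUP c\<in>fsupp S. dual g c)"

definition rinner :: "('p \<Rightarrow> real) \<Rightarrow> ('p \<Rightarrow> real) \<Rightarrow> real" where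
  "rinner g h = (rnorm (\<lambda>x. g x + h x) - rnorm (\<lambda>x. g x - h x)) / 4"

lemma bil_sym: "c \<in> fsupp S \<Longrightarrow> d \<in> fsupp S \<Longrightarrow> bil c d = bil d c"
proof -
  assume cd: "c \<in> fsupp S" "d \<in> fsupp S"
  have "bil c d = lin d (\<lambda>y. lin c (\<lambda>x. K x y))" unfolding bil_def by (rule lin_swap)
  also have "\<dots> = bil d c"
    unfolding bil_def using psd cd by (intro lin_cong[OF cd(2)] lin_cong[OF cd(1)]) (auto simp: psd_kernel_def)
  finally show ?thesis .
qed

lemma bil_lincomb_left:
  "c \<in> fsupp S \<Longrightarrow> d \<in> fsupp S \<Longrightarrow> bil (\<lambda>x. a * c x + b * d x) e = a * bil c e + b * bil d e"
  unfolding bil_def by (rule lin_lincomb_left)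

lemma bil_lincomb_right:
  "c \<in> fsupp S \<Longrightarrow> d \<in> fsupp S \<Longrightarrow> bil e (\<lambda>x. a * c x + b * d x) = a * bil e c + b * bil e d"
  unfolding bil_def by (simp add: lin_lincomb_left lin_lincomb_right)

lemma bil_quad:
  "c \<in> fsupp S \<Longrightarrow> d \<in> fsupp S \<Longrightarrow> bil (\<lambda>x. a * c x + b * d x) (\<lambda>x. a * c x + b * d x) =
    a\<^sup>2 * bil c c + 2 * a * b * bil c d + b\<^sup>2 * bil d d"
  using bil_sym[of c d] by (simp add: bil_lincomb_left bil_lincomb_right power2_eq_square algebra_simps)

lemma bil_nonneg: "c \<in> fsupp S \<Longrightarrow> 0 \<le> bil c c"
  using psd by (simp add: psd_kernel_def bil_def)

lemma bil_zero: "bil (\<lambda>x. 0) (\<lambda>x. 0) = 0"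
  by (simp add: bil_def lin_zero)

lemma rspace_outside: "g \<in> rspace \<Longrightarrow> x \<notin> S \<Longrightarrow> g x = 0"
  by (simp add: rspace_def)

lemma dual_le_rnorm:
  assumes "g \<in> rspace" "c \<in> fsupp S" shows "dual g c \<le> rnorm g"
proof -
  obtain C where "\<And>c. c \<in> fsupp S \<Longrightarrow> dual g c \<le> C" using assms(1) by (auto simp: rspace_def)
  then have "bdd_above (dual g ` fsupp S)" by (rule bdd_aboveI2)
  then show ?thesis unfolding rnorm_def by (rule cSUP_upper[OF assms(2)])
qed

lemma rnorm_le: "(\<And>c. c \<in> fsupp S \<Longrightarrow> dual g c \<le> C) \<Longrightarrow> rnorm g \<le> C"
  unfolding rnorm_def using fsupp_zero by (intro cSUP_least) auto

lemma rnorm_nonneg: "g \<in> rspace \<Longrightarrow> 0 \<le> rnorm g"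
  using dual_le_rnorm[of g "\<lambda>_. 0"] fsupp_zero[of S] by (simp add: dual_def lin_zero bil_zero)

text \<open>The substitution is \<open>a = (c + d) / 2\<close> and \<open>b = (c - d) / 2\<close>,
  with inverse \<open>c = a + b\<close> and \<open>d = a - b\<close>.\<close>

lemma dual_parallelogram:
  assumes "c \<in> fsupp S" "d \<in> fsupp S"
  shows "dual (\<lambda>x. g x + h x) c + dual (\<lambda>x. g x - h x) d =
    2 * dual g (\<lambda>x. 1/2 * c x + 1/2 * d x) + 2 * dual h (\<lambda>x. 1/2 * c x + (-1/2) * d x)"
  using bil_quad[OF assms, of "1/2" "1/2"] bil_quad[OF assms, of "1/2" "-1/2"]
    lin_lincomb_left[OF assms, of "1/2" "1/2" g] lin_lincomb_left[OF assms, of "1/2" "-1/2" h]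
    lin_lincomb_right[of c 1 g 1 h] lin_lincomb_right[of d 1 g "-1" h]
  unfolding dual_def by (simp add: power2_eq_square algebra_simps)

text \<open>Setting one of the two coefficient functions to zero in the parallelogram identity
  leaves a bound for the sum or for the difference alone.\<close>

lemma rspace_add_diff:
  assumes g: "g \<in> rspace" and h: "h \<in> rspace"
  shows "(\<lambda>x. g x + h x) \<in> rspace" "(\<lambda>x. g x - h x) \<in> rspace"
proof -
  have *: "dual (\<lambda>x. g x + h x) c + dual (\<lambda>x. g x - h x) d \<le> 2 * rnorm g + 2 * rnorm h"
    if "c \<in> fsupp S" "d \<in> fsupp S" for c d
    unfolding dual_parallelogram[OF that]
    using dual_le_rnorm[OF g fsupp_lincomb[OF that, of "1/2" "1/2"]]
      dual_le_rnorm[OF h fsupp_lincomb[OF that, of "1/2" "-1/2"]] by linarith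
  have z: "dual f (\<lambda>x. 0) = 0" for f by (simp add: dual_def lin_zero bil_zero)
  show "(\<lambda>x. g x + h x) \<in> rspace"
    using *[OF _ fsupp_zero] rspace_outside[OF g] rspace_outside[OF h] unfolding z
    by (auto simp: rspace_def intro!: exI[of _ "2 * rnorm g + 2 * rnorm h"])
  show "(\<lambda>x. g x - h x) \<in> rspace"
    using *[OF fsupp_zero] rspace_outside[OF g] rspace_outside[OF h] unfolding z
    by (auto simp: rspace_def intro!: exI[of _ "2 * rnorm g + 2 * rnorm h"])
qed

lemma rnorm_parallelogram:
  assumes g: "g \<in> rspace" and h: "h \<in> rspace"
  shows "rnorm (\<lambda>x. g x + h x) + rnorm (\<lambda>x. g x - h x) = 2 * rnorm g + 2 * rnorm h"
proof (rule antisym)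
  let ?p = "\<lambda>x. g x + h x" and ?m = "\<lambda>x. g x - h x"
  note pm = rspace_add_diff[OF g h]
  have *: "dual ?p c + dual ?m d \<le> 2 * rnorm g + 2 * rnorm h" if "c \<in> fsupp S" "d \<in> fsupp S" for c d
    unfolding dual_parallelogram[OF that]
    using dual_le_rnorm[OF g fsupp_lincomb[OF that, of "1/2" "1/2"]]
      dual_le_rnorm[OF h fsupp_lincomb[OF that, of "1/2" "-1/2"]] by linarith
  have "rnorm ?p \<le> 2 * rnorm g + 2 * rnorm h - dual ?m d" if "d \<in> fsupp S" for d
    using *[OF _ that] by (intro rnorm_le) (simp add: algebra_simps)
  then have "rnorm ?m \<le> 2 * rnorm g + 2 * rnorm h - rnorm ?p"
    by (intro rnorm_le) (simp add: algebra_simps)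
  then show "rnorm ?p + rnorm ?m \<le> 2 * rnorm g + 2 * rnorm h" by simp
  have **: "2 * dual g a + 2 * dual h b \<le> rnorm ?p + rnorm ?m" if ab: "a \<in> fsupp S" "b \<in> fsupp S" for a b
  proof -
    let ?c = "\<lambda>x. 1 * a x + 1 * b x" and ?d = "\<lambda>x. 1 * a x + (- 1) * b x"
    have cd: "?c \<in> fsupp S" "?d \<in> fsupp S" using fsupp_lincomb[OF ab] by blast+
    have "(\<lambda>x. 1/2 * ?c x + 1/2 * ?d x) = a" "(\<lambda>x. 1/2 * ?c x + (-1/2) * ?d x) = b" by (auto simp: fun_eq_iff field_simps)
    then show ?thesis
      using dual_parallelogram[OF cd, of g h] dual_le_rnorm[OF pm(1) cd(1)] dual_le_rnorm[OF pm(2) cd(2)] by simp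
  qed
  have "rnorm g \<le> (rnorm ?p + rnorm ?m) / 2 - dual h b" if "b \<in> fsupp S" for b
    using **[OF _ that] by (intro rnorm_le) (simp add: field_simps)
  then have "rnorm h \<le> (rnorm ?p + rnorm ?m) / 2 - rnorm g"
    by (intro rnorm_le) (simp add: field_simps)
  then show "2 * rnorm g + 2 * rnorm h \<le> rnorm ?p + rnorm ?m" by (simp add: field_simps)
qed

lemma rspace_zero: "(\<lambda>x. 0) \<in> rspace" and rnorm_zero: "rnorm (\<lambda>x. 0) = 0"
proof -
  have d: "dual (\<lambda>x. 0) c \<le> 0" if "c \<in> fsupp S" for c
    using bil_nonneg[OF that] by (simp add: dual_def lin_def)
  show z: "(\<lambda>x. 0) \<in> rspace" using d by (auto simp: rspace_def)
  show "rnorm (\<lambda>x. 0) = 0" using rnorm_nonneg[OF z] rnorm_le[of "\<lambda>x. 0" 0] d by simp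
qed

text \<open>For nonzero \<open>t\<close>, \<open>dual\<close> of \<open>t * g\<close> at
  \<open>c\<close> is \<open>t\<^sup>2\<close> times \<open>dual\<close> of \<open>g\<close> at
  \<open>c / t\<close>. This gives one inequality for the norm; the other one is the same inequality
  for \<open>1 / t\<close>.\<close>

lemma rspace_scale: "g \<in> rspace \<Longrightarrow> (\<lambda>x. t * g x) \<in> rspace" and rnorm_scale: "g \<in> rspace \<Longrightarrow> rnorm (\<lambda>x. t * g x) = t\<^sup>2 * rnorm g"
proof -
  have *: "(\<lambda>x. t * g x) \<in> rspace \<and> rnorm (\<lambda>x. t * g x) \<le> t\<^sup>2 * rnorm g" if g: "g \<in> rspace" and t: "t \<noteq> 0" for t g
  proof -
    have d: "dual (\<lambda>x. t * g x) c \<le> t\<^sup>2 * rnorm g" if c: "c \<in> fsupp S" for c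
    proof -
      let ?c = "\<lambda>x. 1 / t * c x + 0 * c x"
      have "dual (\<lambda>x. t * g x) c = t\<^sup>2 * dual g ?c"
        using bil_quad[OF c c, of "1/t" 0] lin_lincomb_left[OF c c, of "1/t" 0 g] lin_lincomb_right[of c t g 0 g] t
        by (simp add: dual_def field_simps power2_eq_square)
      also have "\<dots> \<le> t\<^sup>2 * rnorm g" using dual_le_rnorm[OF g fsupp_lincomb[OF c c]] by (rule mult_left_mono) simp
      finally show ?thesis .
    qed
    show ?thesis
    proof
      show "(\<lambda>x. t * g x) \<in> rspace" using d rspace_outside[OF g] by (auto simp: rspace_def)
    qed (rule rnorm_le[OF d])
  qed
  show "(\<lambda>x. t * g x) \<in> rspace" if g: "g \<in> rspace"
    by (cases "t = 0") (use rspace_zero *[OF g] in auto)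
  show "rnorm (\<lambda>x. t * g x) = t\<^sup>2 * rnorm g" if g: "g \<in> rspace"
  proof (cases "t = 0")
    case True
    then show ?thesis using rnorm_zero by simp
  next
    case False
    have "rnorm (\<lambda>x. 1 / t * (t * g x)) \<le> (1 / t)\<^sup>2 * rnorm (\<lambda>x. t * g x)"
      using False by (intro conjunct2[OF *[OF conjunct1[OF *[OF g False]]]]) simp
    then have "rnorm g \<le> rnorm (\<lambda>x. t * g x) / t\<^sup>2" using False by (simp add: power_divide)
    then have "t\<^sup>2 * rnorm g \<le> rnorm (\<lambda>x. t * g x)" using False by (simp add: pos_le_divide_eq mult.commute)
    then show ?thesis using *[OF g False] by simp
  qed
qed

lemma rinner_self: "g \<in> rspace \<Longrightarrow> rinner g g = rnorm g"
proof -
  assume g: "g \<in> rspace"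
  have "(\<lambda>x. g x + g x) = (\<lambda>x. 2 * g x)" by auto
  then show ?thesis using rnorm_scale[OF g, of 2] by (simp add: rinner_def rnorm_zero)
qed

lemma rnorm_minus_commute: "g \<in> rspace \<Longrightarrow> h \<in> rspace \<Longrightarrow> rnorm (\<lambda>x. g x - h x) = rnorm (\<lambda>x. h x - g x)"
  using rnorm_scale[OF rspace_add_diff(2)[of g h], of "- 1"] by simp

lemma rinner_sym: "g \<in> rspace \<Longrightarrow> h \<in> rspace \<Longrightarrow> rinner g h = rinner h g"
  using rnorm_minus_commute[of g h] by (simp add: rinner_def add.commute)

text \<open>The Jordan-von Neumann argument: the parallelogram law for \<open>f + h\<close> with
  \<open>g\<close> and for \<open>g + h\<close> with \<open>f\<close> expresses the norm of
  \<open>f + g + h\<close>. Replacing \<open>h\<close> by its negative exchanges the two difference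
  terms, which cancel when the expressions are subtracted.\<close>

lemma rinner_add:
  assumes f: "f \<in> rspace" and g: "g \<in> rspace" and h: "h \<in> rspace"
  shows "rinner (\<lambda>x. f x + g x) h = rinner f h + rinner g h"
proof -
  have *: "2 * rnorm (\<lambda>x. f x + g x + h x) = 2 * rnorm (\<lambda>x. f x + h x) + 2 * rnorm (\<lambda>x. g x + h x)
      + 2 * rnorm f + 2 * rnorm g - rnorm (\<lambda>x. (f x + h x) - g x) - rnorm (\<lambda>x. (g x + h x) - f x)"
    if h: "h \<in> rspace" for h
  proof -
    have 1: "rnorm (\<lambda>x. (f x + h x) + g x) + rnorm (\<lambda>x. (f x + h x) - g x) = 2 * rnorm (\<lambda>x. f x + h x) + 2 * rnorm g"
      by (rule rnorm_parallelogram[OF rspace_add_diff(1)[OF f h] g])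
    have 2: "rnorm (\<lambda>x. (g x + h x) + f x) + rnorm (\<lambda>x. (g x + h x) - f x) = 2 * rnorm (\<lambda>x. g x + h x) + 2 * rnorm f"
      by (rule rnorm_parallelogram[OF rspace_add_diff(1)[OF g h] f])
    have "(\<lambda>x. (f x + h x) + g x) = (\<lambda>x. f x + g x + h x)" "(\<lambda>x. (g x + h x) + f x) = (\<lambda>x. f x + g x + h x)"
      by (auto simp: fun_eq_iff)
    with 1 2 show ?thesis by simp
  qed
  have mh: "(\<lambda>x. - h x) \<in> rspace" using rspace_scale[OF h, of "- 1"] by simp
  have a: "rnorm (\<lambda>x. (f x - h x) - g x) = rnorm (\<lambda>x. (g x + h x) - f x)"
    using rnorm_minus_commute[OF f rspace_add_diff(1)[OF g h]] by (simp add: algebra_simps)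
  have b: "rnorm (\<lambda>x. (g x - h x) - f x) = rnorm (\<lambda>x. (f x + h x) - g x)"
    using rnorm_minus_commute[OF g rspace_add_diff(1)[OF f h]] by (simp add: algebra_simps)
  have "rnorm (\<lambda>x. f x + g x + h x) - rnorm (\<lambda>x. f x + g x - h x) =
      (rnorm (\<lambda>x. f x + h x) - rnorm (\<lambda>x. f x - h x)) + (rnorm (\<lambda>x. g x + h x) - rnorm (\<lambda>x. g x - h x))"
    using *[OF h] *[OF mh] a b by simp
  then show ?thesis unfolding rinner_def by (simp only: add_divide_distrib)
qed

text \<open>The defect of homogeneity is additive in \<open>t\<close>, vanishes at 1 and is bounded
  on the unit interval, hence is zero.\<close>

lemma rinner_scale:
  assumes f: "f \<in> rspace" and h: "h \<in> rspace" shows "rinner (\<lambda>x. t * f x) h = t * rinner f h"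
proof -
  define \<psi> where "\<psi> t = rinner (\<lambda>x. t * f x) h - t * rinner f h" for t
  have bd: "\<bar>rinner g h\<bar> \<le> (rnorm g + rnorm h) / 2" if g: "g \<in> rspace" for g
    using rnorm_parallelogram[OF g h] rnorm_nonneg[OF rspace_add_diff(1)[OF g h]] rnorm_nonneg[OF rspace_add_diff(2)[OF g h]]
    unfolding rinner_def by (simp add: abs_le_iff field_simps)
  have "\<psi> t = 0"
  proof (rule bounded_additive_zero[of \<psi>])
    show "\<psi> (s + t) = \<psi> s + \<psi> t" for s t
      using rinner_add[OF rspace_scale[OF f, of s] rspace_scale[OF f, of t] h] by (simp add: \<psi>_def distrib_right)
    show "\<psi> 1 = 0" by (simp add: \<psi>_def)
    show "\<bar>\<psi> t\<bar> \<le> (rnorm f + rnorm h) / 2 + \<bar>rinner f h\<bar>" if t: "0 \<le> t" "t \<le> 1" for t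
    proof -
      have "t\<^sup>2 * rnorm f \<le> 1 * rnorm f" using t rnorm_nonneg[OF f] by (intro mult_right_mono) (auto simp: power_le_one)
      moreover have "\<bar>rinner (\<lambda>x. t * f x) h\<bar> \<le> (t\<^sup>2 * rnorm f + rnorm h) / 2"
        using bd[OF rspace_scale[OF f, of t]] unfolding rnorm_scale[OF f] .
      moreover have "\<bar>t * rinner f h\<bar> \<le> \<bar>rinner f h\<bar>" using t by (simp add: abs_mult mult_left_le_one_le)
      moreover have "\<bar>\<psi> t\<bar> \<le> \<bar>rinner (\<lambda>x. t * f x) h\<bar> + \<bar>t * rinner f h\<bar>"
        unfolding \<psi>_def by (rule abs_triangle_ineq4)
      ultimately show ?thesis by argo
    qed
  qed
  then show ?thesis by (simp add: \<psi>_def)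
qed

lemma rspace_sip: "semi_inner_product_on rspace rinner"
  unfolding semi_inner_product_on_def function_subspace_def
  by (intro conjI ballI allI rspace_zero rspace_add_diff(1) rspace_scale rinner_sym rinner_add rinner_scale)
    (simp_all add: rinner_self rnorm_nonneg)

text \<open>Testing the supremum with \<open>- t\<close> times the point mass at \<open>x\<close>
  yields a nonnegative quadratic in \<open>t\<close>, and the discriminant is the claim.\<close>

lemma rspace_pointwise: "g \<in> rspace \<Longrightarrow> x \<in> S \<Longrightarrow> (g x)\<^sup>2 \<le> rnorm g * K x x"
proof (rule quadratic_nonneg)
  assume g: "g \<in> rspace" and x: "x \<in> S"
  let ?e = "\<lambda>y. of_bool (y = x) :: real"
  note e = fsupp_single[OF x]
  show "0 \<le> K x x" using bil_nonneg[OF e] by (simp add: bil_def lin_single)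
  show "0 \<le> rnorm g + 2 * g x * t + K x x * t\<^sup>2" for t
    using dual_le_rnorm[OF g fsupp_lincomb[OF e e, of "- t" 0]] bil_quad[OF e e, of "- t" 0] lin_lincomb_left[OF e e, of "- t" 0 g]
    by (simp add: dual_def bil_def lin_single algebra_simps)
qed

text \<open>Adding the kernel function at \<open>y\<close> to \<open>g\<close> corresponds to adding
  the point mass at \<open>y\<close> to the coefficient function. All values of \<open>dual\<close>
  move by the same constant \<open>2 * g y + K y y\<close>, and so does their supremum; polarisation
  then gives the reproducing property.\<close>

lemma rnorm_kernel:
  assumes y: "y \<in> S" and g: "g \<in> rspace"
  defines "k \<equiv> \<lambda>x. if x \<in> S then K x y else 0"
  shows "k \<in> rspace" "rnorm (\<lambda>x. g x + k x) = rnorm g + 2 * g y + K y y"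
proof -
  let ?e = "\<lambda>x. of_bool (x = y) :: real"
  note e = fsupp_single[OF y]
  have kb: "lin c k = bil c ?e" if c: "c \<in> fsupp S" for c
    unfolding bil_def lin_single by (rule lin_cong[OF c]) (simp add: k_def)
  have ee: "bil ?e ?e = K y y" by (simp add: bil_def lin_single)
  have shift: "dual (\<lambda>x. g x + k x) (\<lambda>x. 1 * d x + 1 * ?e x) = dual g d + (2 * g y + K y y)" if d: "d \<in> fsupp S" for d g
    using bil_quad[OF d e, of 1 1] lin_lincomb_left[OF d e, of 1 1 g] lin_lincomb_left[OF d e, of 1 1 k]
      lin_lincomb_right[of "\<lambda>x. 1 * d x + 1 * ?e x" 1 g 1 k] kb[OF d] kb[OF e] ee
    by (simp add: dual_def lin_single algebra_simps)
  have up: "dual (\<lambda>x. g x + k x) c \<le> rnorm g + (2 * g y + K y y)" if c: "c \<in> fsupp S" and g: "g \<in> rspace" for c g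
  proof -
    let ?d = "\<lambda>x. 1 * c x + (- 1) * ?e x"
    have "(\<lambda>x. 1 * ?d x + 1 * ?e x) = c" by auto
    then show ?thesis using shift[OF fsupp_lincomb[OF c e, of 1 "- 1"], of g] dual_le_rnorm[OF g fsupp_lincomb[OF c e, of 1 "- 1"]] by simp
  qed
  have gk: "(\<lambda>x. g x + k x) \<in> rspace" if "g \<in> rspace" for g
    using up[OF _ that] rspace_outside[OF that] by (auto simp: rspace_def k_def)
  show "k \<in> rspace" using gk[OF rspace_zero] by simp
  have "rnorm g \<le> rnorm (\<lambda>x. g x + k x) - (2 * g y + K y y)"
  proof (rule rnorm_le)
    fix d assume d: "d \<in> fsupp S"
    show "dual g d \<le> rnorm (\<lambda>x. g x + k x) - (2 * g y + K y y)"
      using shift[OF d, of g] dual_le_rnorm[OF gk[OF g] fsupp_lincomb[OF d e, of 1 1]] by simp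
  qed
  moreover have "rnorm (\<lambda>x. g x + k x) \<le> rnorm g + (2 * g y + K y y)" using up[OF _ g] by (rule rnorm_le)
  ultimately show "rnorm (\<lambda>x. g x + k x) = rnorm g + 2 * g y + K y y" by simp
qed

lemma rinner_kernel:
  assumes y: "y \<in> S" and g: "g \<in> rspace"
  shows "rinner g (\<lambda>x. if x \<in> S then K x y else 0) = g y"
proof -
  let ?k = "\<lambda>x. if x \<in> S then K x y else 0"
  have mg: "(\<lambda>x. - g x) \<in> rspace" using rspace_scale[OF g, of "- 1"] by simp
  have n: "rnorm (\<lambda>x. - g x) = rnorm g" using rnorm_scale[OF g, of "- 1"] by simp
  have "rnorm (\<lambda>x. g x - ?k x) = rnorm (\<lambda>x. - g x + ?k x)"
    using rnorm_minus_commute[OF g rnorm_kernel(1)[OF y g]] by simp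
  then show ?thesis
    using rnorm_kernel(2)[OF y g] rnorm_kernel(2)[OF y mg] n by (simp add: rinner_def)
qed

text \<open>Cauchy sequences converge pointwise. For fixed \<open>c\<close>, \<open>dual g c\<close>
  involves finitely many values of \<open>g\<close>, so the Cauchy bound passes to the limit for
  each \<open>c\<close>, and the supremum over \<open>c\<close> is taken afterwards.\<close>

lemma rspace_complete:
  assumes s: "\<And>k. s k \<in> rspace"
    and cauchy: "\<And>e. 0 < e \<Longrightarrow> \<exists>N. \<forall>j\<ge>N. \<forall>k\<ge>N. rnorm (\<lambda>x. s j x - s k x) < e"
  shows "\<exists>f\<in>rspace. (\<lambda>k::nat. rnorm (\<lambda>x. s k x - f x)) \<longlonglongrightarrow> 0"
proof -
  have conv: "convergent (\<lambda>k. s k x)" for x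
  proof (cases "x \<in> S")
    case False
    then show ?thesis using rspace_outside[OF s] by (simp add: convergent_const)
  next
    case True
    have "Cauchy (\<lambda>k. s k x)"
    proof (rule CauchyI)
      fix e :: real assume e: "0 < e"
      have Kx: "0 \<le> K x x" using bil_nonneg[OF fsupp_single[OF True]] by (simp add: bil_def lin_single)
      then have "0 < e\<^sup>2 / (K x x + 1)" using e by (simp add: add_nonneg_pos)
      from cauchy[OF this] obtain N where N: "\<And>j k. j \<ge> N \<Longrightarrow> k \<ge> N \<Longrightarrow> rnorm (\<lambda>x. s j x - s k x) < e\<^sup>2 / (K x x + 1)" by blast
      have "\<bar>s j x - s k x\<bar> < e" if "j \<ge> N" "k \<ge> N" for j k
      proof -
        have d: "(\<lambda>x. s j x - s k x) \<in> rspace" using rspace_add_diff(2)[OF s s] .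
        have "(s j x - s k x)\<^sup>2 \<le> rnorm (\<lambda>x. s j x - s k x) * K x x" using rspace_pointwise[OF d True] .
        also have "\<dots> \<le> e\<^sup>2 / (K x x + 1) * K x x" using N[OF that] Kx by (intro mult_right_mono) auto
        also have "\<dots> < e\<^sup>2" using e Kx by (simp add: field_simps add_nonneg_pos)
        finally have "\<bar>s j x - s k x\<bar>\<^sup>2 < e\<^sup>2" by simp
        then show ?thesis using e power2_less_imp_less by fastforce
      qed
      then show "\<exists>M. \<forall>m\<ge>M. \<forall>n\<ge>M. norm (s m x - s n x) < e" by auto
    qed
    then show ?thesis by (simp add: Cauchy_convergent_iff)
  qed
  define f where "f x = lim (\<lambda>k. s k x)" for x
  have f: "(\<lambda>k. s k x) \<longlonglongrightarrow> f x" for x using conv[of x] by (simp add: f_def convergent_LIMSEQ_iff)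
  have tail: "dual (\<lambda>x. s k x - f x) c \<le> e"
    if N: "\<forall>j\<ge>N. \<forall>k\<ge>N. rnorm (\<lambda>x. s j x - s k x) < e" and k: "k \<ge> N" and c: "c \<in> fsupp S" for N e k c
  proof -
    have "(\<lambda>j. dual (\<lambda>x. s k x - s j x) c) \<longlonglongrightarrow> dual (\<lambda>x. s k x - f x) c"
      unfolding dual_def lin_def using f by (intro tendsto_intros)
    moreover have "dual (\<lambda>x. s k x - s j x) c \<le> e" if "j \<ge> N" for j
      using dual_le_rnorm[OF rspace_add_diff(2)[OF s s] c, of k j] N that k by (meson less_imp_le order_trans)
    ultimately show ?thesis by (intro LIMSEQ_le_const2) auto
  qed
  have fout: "f x = 0" if "x \<notin> S" for x
    using f[of x] rspace_outside[OF s that] by (simp add: LIMSEQ_const_iff)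
  obtain N where N: "\<forall>j\<ge>N. \<forall>k\<ge>N. rnorm (\<lambda>x. s j x - s k x) < 1" using cauchy[of 1] by auto
  have "(\<lambda>x. s N x - f x) \<in> rspace"
    using tail[OF N order_refl] fout rspace_outside[OF s] by (auto simp: rspace_def)
  from rspace_add_diff(2)[OF s[of N] this] have fr: "f \<in> rspace" by simp
  have "(\<lambda>k. rnorm (\<lambda>x. s k x - f x)) \<longlonglongrightarrow> 0"
  proof (rule LIMSEQ_I)
    fix r :: real assume r: "0 < r"
    then obtain N where N: "\<forall>j\<ge>N. \<forall>k\<ge>N. rnorm (\<lambda>x. s j x - s k x) < r / 2" using cauchy[of "r / 2"] by auto
    have "\<bar>rnorm (\<lambda>x. s k x - f x)\<bar> < r" if "k \<ge> N" for k
    proof -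
      have "rnorm (\<lambda>x. s k x - f x) \<le> r / 2" using tail[OF N that] by (rule rnorm_le)
      then show ?thesis using rnorm_nonneg[OF rspace_add_diff(2)[OF s fr]] r by simp
    qed
    then show "\<exists>no. \<forall>n\<ge>no. norm (rnorm (\<lambda>x. s n x - f x) - 0) < r" by auto
  qed
  then show ?thesis using fr by blast
qed

lemma rspace_is_rkhs: "is_rkhs S K rspace rinner"
  unfolding is_rkhs_def hilbert_on_def
proof (intro conjI ballI allI impI)
  show "semi_inner_product_on rspace rinner" by (rule rspace_sip)
  show "g = (\<lambda>_. 0)" if "g \<in> rspace" "rinner g g = 0" for g
  proof
    fix x show "g x = 0"
      using that rspace_pointwise[of g x] rspace_outside[of g x] rinner_self[of g] by (cases "x \<in> S") auto
  qed
  show "\<exists>f\<in>rspace. (\<lambda>k. rinner (\<lambda>x. s k x - f x) (\<lambda>x. s k x - f x)) \<longlonglongrightarrow> 0"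
    if h: "(\<forall>k. s k \<in> rspace) \<and> (\<forall>e>0. \<exists>N. \<forall>j\<ge>N. \<forall>k\<ge>N. rinner (\<lambda>x. s j x - s k x) (\<lambda>x. s j x - s k x) < e)"
    for s :: "nat \<Rightarrow> 'p \<Rightarrow> real"
  proof -
    have s: "s k \<in> rspace" for k using h by blast
    have "\<exists>N. \<forall>j\<ge>N. \<forall>k\<ge>N. rnorm (\<lambda>x. s j x - s k x) < e" if "0 < e" for e
      using h that rinner_self[OF rspace_add_diff(2)[OF s s]] by simp
    from rspace_complete[OF s this] obtain f where f: "f \<in> rspace" "(\<lambda>k. rnorm (\<lambda>x. s k x - f x)) \<longlonglongrightarrow> 0" by blast
    then show ?thesis using rinner_self[OF rspace_add_diff(2)[OF s f(1)]] by (intro bexI[of _ f]) simp_all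
  qed
  show "g x = 0" if "g \<in> rspace" "x \<notin> S" for g x using rspace_outside[OF that] .
  show "(\<lambda>x. if x \<in> S then K x y else 0) \<in> rspace" if "y \<in> S" for y using rnorm_kernel(1)[OF that rspace_zero] .
  show "rinner g (\<lambda>x. if x \<in> S then K x y else 0) = g y" if "y \<in> S" "g \<in> rspace" for g y using rinner_kernel[OF that] .
qed

end

lemma rkhs_is_rkhs:
  assumes "psd_kernel S K" shows "is_rkhs S K (rkhs_space S K) (rkhs_inner S K)"
proof -
  have "case rkhs S K of (H, B) \<Rightarrow> is_rkhs S K H B"
    unfolding rkhs_def using rspace_is_rkhs[OF assms] by (intro someI[of "\<lambda>(H, B). is_rkhs S K H B" "(rspace S K, rinner S K)"]) simp
  then show ?thesis by (simp add: rkhs_space_def rkhs_inner_def case_prod_beta)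
qed

subsection \<open>The kernel\<close>

lemma lin_weighted_sum:
  assumes K: "finite K" and c: "\<And>i. i \<in> K \<Longrightarrow> c i \<in> fsupp S"
  shows "(\<lambda>u. \<Sum>i\<in>K. a i * c i u) \<in> fsupp S" "lin (\<lambda>u. \<Sum>i\<in>K. a i * c i u) g = (\<Sum>i\<in>K. a i * lin (c i) g)"
proof -
  have "(\<lambda>u. \<Sum>i\<in>K. a i * c i u) \<in> fsupp S \<and> lin (\<lambda>u. \<Sum>i\<in>K. a i * c i u) g = (\<Sum>i\<in>K. a i * lin (c i) g)"
    using K c
  proof (induction K rule: finite_induct)
    case empty
    then show ?case using fsupp_zero[of S] by (simp add: lin_zero)
  next
    case (insert i K)
    have ci: "c i \<in> fsupp S" and IH: "(\<lambda>u. \<Sum>i\<in>K. a i * c i u) \<in> fsupp S"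
      "lin (\<lambda>u. \<Sum>i\<in>K. a i * c i u) g = (\<Sum>i\<in>K. a i * lin (c i) g)" using insert by auto
    show ?case
      using fsupp_lincomb[OF ci IH(1), of "a i" 1] lin_lincomb_left[OF ci IH(1), of "a i" 1 g] insert(1,2) IH(2) by simp
  qed
  then show "(\<lambda>u. \<Sum>i\<in>K. a i * c i u) \<in> fsupp S" "lin (\<lambda>u. \<Sum>i\<in>K. a i * c i u) g = (\<Sum>i\<in>K. a i * lin (c i) g)" by auto
qed

lemma lin_sum_right: "lin c (\<lambda>v. \<Sum>i\<in>K. a i * h i v) = (\<Sum>i\<in>K. a i * lin c (h i))"
proof -
  have "lin c (\<lambda>v. \<Sum>i\<in>K. a i * h i v) = (\<Sum>x | c x \<noteq> 0. \<Sum>i\<in>K. c x * (a i * h i x))"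
    by (simp add: lin_def sum_distrib_left)
  also have "\<dots> = (\<Sum>i\<in>K. \<Sum>x | c x \<noteq> 0. c x * (a i * h i x))" by (rule sum.swap)
  also have "\<dots> = (\<Sum>i\<in>K. a i * lin c (h i))"
    by (simp add: lin_def sum_distrib_left mult.left_commute)
  finally show ?thesis .
qed

lemma fin_double_integral_lin: "fin_double_integral f c d = lin d (\<lambda>v. lin c (\<lambda>u. f u v))"
  by (simp add: fin_double_integral_def lin_def mult.commute)

text \<open>Positivity is tested on mass 1 at \<open>q\<close> together with mass 1 or -1 at
  \<open>p\<close>. For \<open>p = q\<close> the bound says that the diagonal is
  nonnegative.\<close>

lemma psd_kernel_diagonal_bound:
  assumes K: "psd_kernel S K" and p: "p \<in> S" and q: "q \<in> S"
  shows "\<bar>K p q\<bar> \<le> (K p p + K q q) / 2"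
proof -
  have sym: "K q p = K p q" using K p q by (simp add: psd_kernel_def)
  have "0 \<le> a\<^sup>2 * K p p + 2 * a * K p q + K q q" for a
  proof -
    let ?c = "\<lambda>x. a * of_bool (x = p) + 1 * of_bool (x = q)"
    note e = fsupp_single[OF p] fsupp_single[OF q]
    have "?c \<in> fsupp S" using fsupp_lincomb[OF e] .
    then have "0 \<le> lin ?c (\<lambda>x. lin ?c (\<lambda>y. K x y))" using K by (simp add: psd_kernel_def)
    also have "\<dots> = a\<^sup>2 * K p p + 2 * a * K p q + K q q"
      unfolding lin_lincomb_left[OF e] lin_single using sym by (simp add: power2_eq_square algebra_simps)
    finally show ?thesis .
  qed
  from this[of 1] this[of "- 1"] show ?thesis by (simp add: abs_le_iff)
qed

section \<open>The kernel \<open>K\<close> attached to \<open>J\<close>, and bounds for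
  \<open>J\<close>\<close>

locale pdi_kernel =
  fixes X :: "nat \<Rightarrow> 'a topology" and n :: nat and J :: "(nat \<Rightarrow> 'a) \<Rightarrow> (nat \<Rightarrow> 'a) \<Rightarrow> real"
  assumes n_pos: "n \<ge> 1"
    and hausdorff_X: "\<And>i. i \<in> {1..n} \<Longrightarrow> Hausdorff_space (X i)"
    and cont_J: "continuous_map (prod_topology (prod_space X n) (prod_space X n)) euclideanreal (\<lambda>(x, y). J x y)"
    and pdi: "PDI X n J"
    and zero_J: "\<And>x y. x \<in> topspace (prod_space X n) \<Longrightarrow> y \<in> topspace (prod_space X n) \<Longrightarrow>
                 \<exists>i\<in>{1..n}. x i = y i \<Longrightarrow> J x y = 0"
begin

sublocale hausdorff_family X "{1..n}"
  by unfold_locales (use hausdorff_X in auto)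

abbreviation T :: "(nat \<Rightarrow> 'a) topology" where "T \<equiv> prod_space X n"
abbreviation S :: "(nat \<Rightarrow> 'a) set" where "S \<equiv> topspace (prod_space X n)"
text \<open>The sign of the term of an expanded product of differences that takes the first point on
  \<open>F\<close> and the second one elsewhere.\<close>

abbreviation sgnF :: "nat set \<Rightarrow> real" where "sgnF F \<equiv> (-1) ^ card ({1..n} - F)"
abbreviation form :: "((nat \<Rightarrow> 'a) \<Rightarrow> real) \<Rightarrow> ((nat \<Rightarrow> 'a) \<Rightarrow> real) \<Rightarrow> real" where
  "form c d \<equiv> fin_double_integral (\<lambda>u v. (-1) ^ n * J u v) c d"

lemma mix_in: "x \<in> S \<Longrightarrow> y \<in> S \<Longrightarrow> mix F x y \<in> S"
  by (auto simp: mix_def PiE_iff extensional_def)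

lemma S_ext: "x \<in> S \<Longrightarrow> x \<in> extensional {1..n}"
  by (auto simp: PiE_iff)

lemma n_symD: "x \<in> S \<Longrightarrow> y \<in> S \<Longrightarrow> F \<subseteq> {1..n} \<Longrightarrow> J x y = J (mix F x y) (mix F y x)"
  using pdi by (auto simp: PDI_def n_symmetric_def)

lemma J_sym: "x \<in> S \<Longrightarrow> y \<in> S \<Longrightarrow> J x y = J y x"
  using n_symD[of x y "{}"] by (simp add: mix_def)

text \<open>Multiplying out the product over the coordinates, \<open>F\<close> collects those where
  the first term of the difference is chosen. Extensionality turns agreement on
  \<open>{1..n}\<close> into equality of points.\<close>

lemma delta_product_expand:
  assumes u: "u \<in> S" and v: "v \<in> S"
  shows "delta_product n u v t = (\<Sum>F\<in>Pow {1..n}. sgnF F * of_bool (t = mix F u v))"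
proof (cases "t \<in> extensional {1..n}")
  case False
  then have "t \<noteq> mix F u v" for F using S_ext[OF mix_in[OF u v]] by blast
  then show ?thesis using False by (simp add: delta_product_def)
next
  case True
  have "delta_product n u v t = (\<Prod>i\<in>{1..n}. of_bool (t i = u i) + (- of_bool (t i = v i)))"
    using True by (simp add: delta_product_def)
  also have "\<dots> = (\<Sum>F\<in>Pow {1..n}. (\<Prod>i\<in>F. of_bool (t i = u i)) * (\<Prod>i\<in>{1..n} - F. - of_bool (t i = v i)))"
    by (rule prod_add) simp
  also have "\<dots> = (\<Sum>F\<in>Pow {1..n}. sgnF F * of_bool (t = mix F u v))"
  proof (rule sum.cong[OF refl])
    fix F assume F: "F \<in> Pow {1..n}"
    have fF: "finite F" using F finite_subset by auto
    have 1: "(\<Prod>i\<in>F. of_bool (t i = u i) :: real) = of_bool (\<forall>i\<in>F. t i = u i)" using fF by (induction F) auto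
    have 2: "(\<Prod>i\<in>A. - of_bool (t i = v i) :: real) = (-1) ^ card A * of_bool (\<forall>i\<in>A. t i = v i)" if "finite A" for A
      using that by (induction A) auto
    have "(t = mix F u v) \<longleftrightarrow> (\<forall>i\<in>F. t i = u i) \<and> (\<forall>i\<in>{1..n} - F. t i = v i)"
    proof
      assume r: "(\<forall>i\<in>F. t i = u i) \<and> (\<forall>i\<in>{1..n} - F. t i = v i)"
      show "t = mix F u v"
      proof
        fix i show "t i = mix F u v i"
          using r True S_ext[OF v] F by (cases "i \<in> {1..n}") (auto simp: mix_def extensional_def)
      qed
    qed (use F in \<open>auto simp: mix_def\<close>)
    then show "(\<Prod>i\<in>F. of_bool (t i = u i)) * (\<Prod>i\<in>{1..n} - F. - of_bool (t i = v i)) = sgnF F * of_bool (t = mix F u v)"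
      unfolding 1 2[OF finite_Diff[OF finite_atLeastAtMost]] by simp
  qed
  finally show ?thesis .
qed

lemma lin_delta_product:
  assumes u: "u \<in> S" and v: "v \<in> S"
  shows "delta_product n u v \<in> fsupp S" "lin (delta_product n u v) g = (\<Sum>F\<in>Pow {1..n}. sgnF F * g (mix F u v))"
proof -
  have eq: "delta_product n u v = (\<lambda>t. \<Sum>F\<in>Pow {1..n}. sgnF F * of_bool (t = mix F u v))"
    using delta_product_expand[OF u v] by auto
  have P: "finite (Pow {1..n})" by simp
  note w = lin_weighted_sum[OF P, of "\<lambda>F t. of_bool (t = mix F u v)" S, OF fsupp_single[OF mix_in[OF u v]]]
  show "delta_product n u v \<in> fsupp S" unfolding eq by (rule w)
  show "lin (delta_product n u v) g = (\<Sum>F\<in>Pow {1..n}. sgnF F * g (mix F u v))" unfolding eq w(2) lin_single ..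
qed

text \<open>Changing the base point: \<open>\<delta>\<^sub>u - \<delta>\<^sub>v = (\<delta>\<^sub>u - \<delta>\<^sub>w) - (\<delta>\<^sub>v - \<delta>\<^sub>w)\<close> in each coordinate.\<close>

lemma delta_product_rebase:
  "delta_product n u v t = (\<Sum>F\<in>Pow {1..n}. sgnF F * delta_product n (mix F u v) w t)"
proof (cases "t \<in> extensional {1..n}")
  case False
  then show ?thesis by (simp add: delta_product_def)
next
  case True
  let ?d = "\<lambda>a i. of_bool (t i = a i) - of_bool (t i = w i) :: real"
  have "delta_product n u v t = (\<Prod>i\<in>{1..n}. ?d u i + (- ?d v i))"
    using True by (simp add: delta_product_def)
  also have "\<dots> = (\<Sum>F\<in>Pow {1..n}. (\<Prod>i\<in>F. ?d u i) * (\<Prod>i\<in>{1..n} - F. - ?d v i))"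
    by (rule prod_add) simp
  also have "\<dots> = (\<Sum>F\<in>Pow {1..n}. sgnF F * delta_product n (mix F u v) w t)"
  proof (rule sum.cong[OF refl])
    fix F assume F: "F \<in> Pow {1..n}"
    have "(\<Prod>i\<in>{1..n} - F. - ?d v i) = sgnF F * (\<Prod>i\<in>{1..n} - F. ?d v i)"
      using prod.distrib[of "\<lambda>_. - 1" "?d v" "{1..n} - F"] by simp
    moreover have "delta_product n (mix F u v) w t = (\<Prod>i\<in>F. ?d u i) * (\<Prod>i\<in>{1..n} - F. ?d v i)"
    proof -
      have "delta_product n (mix F u v) w t = (\<Prod>i\<in>F \<union> ({1..n} - F). ?d (mix F u v) i)"
        using F True by (simp add: delta_product_def Un_absorb1)
      also have "\<dots> = (\<Prod>i\<in>F. ?d (mix F u v) i) * (\<Prod>i\<in>{1..n} - F. ?d (mix F u v) i)"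
        using F finite_subset by (intro prod.union_disjoint) auto
      also have "\<dots> = (\<Prod>i\<in>F. ?d u i) * (\<Prod>i\<in>{1..n} - F. ?d v i)"
        by (intro arg_cong2[where f="(*)"] prod.cong) (auto simp: mix_def)
      finally show ?thesis .
    qed
    ultimately show "(\<Prod>i\<in>F. ?d u i) * (\<Prod>i\<in>{1..n} - F. - ?d v i) = sgnF F * delta_product n (mix F u v) w t"
      by simp
  qed
  finally show ?thesis .
qed

lemma fin_Mn_iff:
  "c \<in> fin_Mn X n \<longleftrightarrow> c \<in> fsupp S \<and> (\<forall>A. (\<forall>i\<in>{1..n}. A i \<subseteq> topspace (X i)) \<and> (\<exists>i\<in>{1..n}. A i = topspace (X i)) \<longrightarrow>
     lin c (\<lambda>x. of_bool (x \<in> PiE {1..n} A)) = 0)"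
proof -
  have *: "(\<Sum>x | c x \<noteq> 0 \<and> x \<in> PiE {1..n} A. c x) = lin c (\<lambda>x. of_bool (x \<in> PiE {1..n} A))"
    if f: "finite {x. c x \<noteq> 0}" for A
  proof -
    have "{x. c x \<noteq> 0 \<and> x \<in> PiE {1..n} A} = {x \<in> {x. c x \<noteq> 0}. x \<in> PiE {1..n} A}" by auto
    then have "(\<Sum>x | c x \<noteq> 0 \<and> x \<in> PiE {1..n} A. c x) = (\<Sum>x\<in>{x. c x \<noteq> 0}. if x \<in> PiE {1..n} A then c x else 0)"
      using sum.inter_filter[OF f, of c "\<lambda>x. x \<in> PiE {1..n} A"] by (simp only:)
    also have "\<dots> = lin c (\<lambda>x. of_bool (x \<in> PiE {1..n} A))"
      unfolding lin_def by (intro sum.cong) auto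
    finally show ?thesis .
  qed
  show ?thesis
  proof (cases "finite {x. c x \<noteq> 0}")
    case True
    show ?thesis unfolding fin_Mn_def fsupp_def mem_Collect_eq *[OF True] conj_assoc ..
  next
    case False
    then show ?thesis by (simp add: fin_Mn_def fsupp_def)
  qed
qed

text \<open>The integral of the indicator of a box factors over the coordinates, and a coordinate
  with the full space contributes 1 - 1.\<close>

lemma delta_product_fin_Mn:
  assumes u: "u \<in> S" and v: "v \<in> S" shows "delta_product n u v \<in> fin_Mn X n"
  unfolding fin_Mn_iff
proof (intro conjI allI impI)
  show "delta_product n u v \<in> fsupp S" using lin_delta_product[OF u v] by simp
  fix A assume A: "(\<forall>i\<in>{1..n}. A i \<subseteq> topspace (X i)) \<and> (\<exists>i\<in>{1..n}. A i = topspace (X i))"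
  then obtain j where j: "j \<in> {1..n}" "A j = topspace (X j)" by blast
  have "lin (delta_product n u v) (\<lambda>x. of_bool (x \<in> PiE {1..n} A)) = (\<Sum>F\<in>Pow {1..n}. sgnF F * of_bool (mix F u v \<in> PiE {1..n} A))"
    by (rule lin_delta_product[OF u v])
  also have "\<dots> = (\<Sum>F\<in>Pow {1..n}. (\<Prod>i\<in>F. of_bool (u i \<in> A i)) * (\<Prod>i\<in>{1..n} - F. - of_bool (v i \<in> A i)))"
  proof (rule sum.cong[OF refl])
    fix F assume F: "F \<in> Pow {1..n}"
    have fF: "finite F" using F finite_subset by auto
    have 1: "(\<Prod>i\<in>F. of_bool (u i \<in> A i) :: real) = of_bool (\<forall>i\<in>F. u i \<in> A i)" using fF by (induction F) auto
    have 2: "(\<Prod>i\<in>B. - of_bool (v i \<in> A i) :: real) = (-1) ^ card B * of_bool (\<forall>i\<in>B. v i \<in> A i)" if "finite B" for B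
      using that by (induction B) auto
    have "mix F u v \<in> PiE {1..n} A \<longleftrightarrow> (\<forall>i\<in>F. u i \<in> A i) \<and> (\<forall>i\<in>{1..n} - F. v i \<in> A i)"
      using S_ext[OF mix_in[OF u v, of F]] F by (auto simp: PiE_iff mix_def)
    then show "sgnF F * of_bool (mix F u v \<in> PiE {1..n} A) = (\<Prod>i\<in>F. of_bool (u i \<in> A i)) * (\<Prod>i\<in>{1..n} - F. - of_bool (v i \<in> A i))"
      unfolding 1 2[OF finite_Diff[OF finite_atLeastAtMost]] by simp
  qed
  also have "\<dots> = (\<Prod>i\<in>{1..n}. of_bool (u i \<in> A i) + (- of_bool (v i \<in> A i)))"
    by (rule prod_add[symmetric]) simp
  also have "\<dots> = 0"
  proof (rule prod_zero)
    have "u j \<in> A j" "v j \<in> A j" using u v j by (auto simp: PiE_iff)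
    then show "\<exists>a\<in>{1..n}. of_bool (u a \<in> A a) + - of_bool (v a \<in> A a) = (0::real)" using j(1) by (intro bexI[of _ j]) auto
  qed simp
  finally show "lin (delta_product n u v) (\<lambda>x. of_bool (x \<in> PiE {1..n} A)) = 0" .
qed

lemma kernel_K_expand:
  assumes "x0 \<in> S" "x \<in> S" "y \<in> S"
  shows "kernel_K n J x0 x y = (\<Sum>F\<in>Pow {1..n}. \<Sum>G\<in>Pow {1..n}. sgnF F * sgnF G * ((-1) ^ n * J (mix F x x0) (mix G y x0)))"
proof -
  have "kernel_K n J x0 x y = (\<Sum>G\<in>Pow {1..n}. sgnF G * (\<Sum>F\<in>Pow {1..n}. sgnF F * ((-1) ^ n * J (mix F x x0) (mix G y x0))))"
    unfolding kernel_K_def fin_double_integral_lin lin_delta_product(2)[OF assms(3,1)] lin_delta_product(2)[OF assms(2,1)] ..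
  also have "\<dots> = (\<Sum>G\<in>Pow {1..n}. \<Sum>F\<in>Pow {1..n}. sgnF F * sgnF G * ((-1) ^ n * J (mix F x x0) (mix G y x0)))"
    unfolding sum_distrib_left by (intro sum.cong refl) simp
  also have "\<dots> = (\<Sum>F\<in>Pow {1..n}. \<Sum>G\<in>Pow {1..n}. sgnF F * sgnF G * ((-1) ^ n * J (mix F x x0) (mix G y x0)))"
    by (rule sum.swap)
  finally show ?thesis .
qed

text \<open>Serves twice: with arbitrary points it yields positive definiteness of \<open>K\<close>,
  and with the mixed points of two given points it yields the bound on \<open>J\<close>.\<close>

lemma form_delta_sum:
  assumes K: "finite K" and p: "\<And>i. i \<in> K \<Longrightarrow> p i \<in> S" and w: "w \<in> S"
  shows "form (\<lambda>t. \<Sum>i\<in>K. a i * delta_product n (p i) w t) (\<lambda>t. \<Sum>i\<in>K. a i * delta_product n (p i) w t) =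
    (\<Sum>i\<in>K. \<Sum>j\<in>K. a i * a j * kernel_K n J w (p i) (p j))"
proof -
  have f: "delta_product n (p i) w \<in> fsupp S" if "i \<in> K" for i using lin_delta_product(1)[OF p[OF that] w] .
  have l: "lin (\<lambda>u. \<Sum>i\<in>K. a i * delta_product n (p i) w u) g = (\<Sum>i\<in>K. a i * lin (delta_product n (p i) w) g)" for g
    by (rule lin_weighted_sum(2)[of K "\<lambda>i. delta_product n (p i) w" S a g, OF K f])
  have "form (\<lambda>t. \<Sum>i\<in>K. a i * delta_product n (p i) w t) (\<lambda>t. \<Sum>i\<in>K. a i * delta_product n (p i) w t) =
     (\<Sum>j\<in>K. a j * lin (delta_product n (p j) w) (\<lambda>v. \<Sum>i\<in>K. a i * lin (delta_product n (p i) w) (\<lambda>u. (-1) ^ n * J u v)))"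
    unfolding fin_double_integral_lin l ..
  also have "\<dots> = (\<Sum>j\<in>K. \<Sum>i\<in>K. a i * a j * kernel_K n J w (p i) (p j))"
  proof (rule sum.cong[OF refl])
    fix j assume "j \<in> K"
    have "lin (delta_product n (p j) w) (\<lambda>v. \<Sum>i\<in>K. a i * lin (delta_product n (p i) w) (\<lambda>u. (-1) ^ n * J u v)) =
       (\<Sum>i\<in>K. a i * lin (delta_product n (p j) w) (\<lambda>v. lin (delta_product n (p i) w) (\<lambda>u. (-1) ^ n * J u v)))"
      by (rule lin_sum_right)
    then show "a j * lin (delta_product n (p j) w) (\<lambda>v. \<Sum>i\<in>K. a i * lin (delta_product n (p i) w) (\<lambda>u. (-1) ^ n * J u v)) =
       (\<Sum>i\<in>K. a i * a j * kernel_K n J w (p i) (p j))"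
      unfolding kernel_K_def fin_double_integral_lin sum_distrib_left
      by (simp only:, unfold sum_distrib_left, intro sum.cong refl, simp)
  qed
  also have "\<dots> = (\<Sum>i\<in>K. \<Sum>j\<in>K. a i * a j * kernel_K n J w (p i) (p j))" by (rule sum.swap)
  finally show ?thesis .
qed

lemma kernel_K_psd:
  assumes w: "w \<in> S" shows "psd_kernel S (kernel_K n J w)"
  unfolding psd_kernel_def
proof (intro conjI ballI)
  fix x y assume xy: "x \<in> S" "y \<in> S"
  have "(\<Sum>F\<in>Pow {1..n}. \<Sum>G\<in>Pow {1..n}. sgnF F * sgnF G * ((-1) ^ n * J (mix F x w) (mix G y w))) =
    (\<Sum>F\<in>Pow {1..n}. \<Sum>G\<in>Pow {1..n}. sgnF G * sgnF F * ((-1) ^ n * J (mix G y w) (mix F x w)))"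
    using J_sym[OF mix_in[OF xy(1) w] mix_in[OF xy(2) w]] by (intro sum.cong refl) simp
  also have "\<dots> = (\<Sum>G\<in>Pow {1..n}. \<Sum>F\<in>Pow {1..n}. sgnF G * sgnF F * ((-1) ^ n * J (mix G y w) (mix F x w)))"
    by (rule sum.swap)
  finally show "kernel_K n J w x y = kernel_K n J w y x"
    unfolding kernel_K_expand[OF w xy] kernel_K_expand[OF w xy(2,1)] .
next
  fix c assume c: "c \<in> fsupp S"
  let ?K = "{x. c x \<noteq> 0}"
  let ?e = "\<lambda>t. \<Sum>x\<in>?K. c x * delta_product n x w t"
  have K: "finite ?K" "\<And>x. x \<in> ?K \<Longrightarrow> x \<in> S" using c by (auto simp: fsupp_def)
  have "?e \<in> fin_Mn X n"
    unfolding fin_Mn_iff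
  proof (intro conjI allI impI)
    have f: "delta_product n x w \<in> fsupp S" if "x \<in> ?K" for x using lin_delta_product(1)[OF K(2)[OF that] w] .
    show "?e \<in> fsupp S" by (rule lin_weighted_sum(1)[of ?K "\<lambda>x. delta_product n x w" S c, OF K(1) f])
    fix A assume A: "(\<forall>i\<in>{1..n}. A i \<subseteq> topspace (X i)) \<and> (\<exists>i\<in>{1..n}. A i = topspace (X i))"
    show "lin ?e (\<lambda>x. of_bool (x \<in> PiE {1..n} A)) = 0"
    proof -
      have "lin ?e (\<lambda>x. of_bool (x \<in> PiE {1..n} A)) = (\<Sum>x\<in>?K. c x * lin (delta_product n x w) (\<lambda>x. of_bool (x \<in> PiE {1..n} A)))"
        by (rule lin_weighted_sum(2)[of ?K "\<lambda>x. delta_product n x w" S c, OF K(1) f])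
      moreover have "lin (delta_product n x w) (\<lambda>x. of_bool (x \<in> PiE {1..n} A)) = 0" if "x \<in> ?K" for x
        using delta_product_fin_Mn[OF K(2)[OF that] w] A unfolding fin_Mn_iff by blast
      ultimately show ?thesis by simp
    qed
  qed
  then have "0 \<le> form ?e ?e" using pdi by (auto simp: PDI_def)
  also have "\<dots> = (\<Sum>x\<in>?K. \<Sum>y\<in>?K. c x * c y * kernel_K n J w x y)"
    using form_delta_sum[OF K(1), of "\<lambda>x. x" w c] K(2) w by simp
  also have "\<dots> = lin c (\<lambda>x. lin c (\<lambda>y. kernel_K n J w x y))"
    by (simp add: lin_def sum_distrib_left mult.assoc)
  finally show "0 \<le> lin c (\<lambda>x. lin c (\<lambda>y. kernel_K n J w x y))" .
qed

text \<open>\<open>mix F x w\<close> and \<open>mix G x w\<close> share a coordinate unless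
  \<open>G\<close> is the complement of \<open>F\<close>. The \<open>2 ^ n\<close> surviving terms
  all equal \<open>J x w\<close> by \<open>n\<close>-symmetry, and their signs multiply to the
  \<open>(-1) ^ n\<close> that is already in front of \<open>J\<close>.\<close>

lemma kernel_K_diagonal:
  assumes x: "x \<in> S" and w: "w \<in> S" shows "kernel_K n J w x x = 2 ^ n * J x w"
proof -
  have z: "(\<Sum>G\<in>Pow {1..n}. sgnF F * sgnF G * ((-1) ^ n * J (mix F x w) (mix G x w))) = J x w" if F: "F \<in> Pow {1..n}" for F
  proof -
    have "J (mix F x w) (mix G x w) = 0" if G: "G \<in> Pow {1..n}" "G \<noteq> {1..n} - F" for G
    proof (rule zero_J[OF mix_in[OF x w] mix_in[OF x w]])
      show "\<exists>i\<in>{1..n}. mix F x w i = mix G x w i"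
      proof (rule ccontr)
        assume "\<not> ?thesis"
        then have ne: "mix F x w i \<noteq> mix G x w i" if "i \<in> {1..n}" for i using that by blast
        \<comment> \<open>Two mixtures that differ at \<open>i\<close> choose different points
          there.\<close>
        have "i \<in> F \<longleftrightarrow> i \<notin> G" if "i \<in> {1..n}" for i
          using ne[OF that] by (cases "i \<in> F"; cases "i \<in> G") (simp_all add: mix_def)
        then show False using F G by auto
      qed
    qed
    then have "(\<Sum>G\<in>Pow {1..n}. sgnF F * sgnF G * ((-1) ^ n * J (mix F x w) (mix G x w))) =
      (\<Sum>G\<in>{{1..n} - F}. sgnF F * sgnF G * ((-1) ^ n * J (mix F x w) (mix G x w)))"
      by (intro sum.mono_neutral_right) auto
    also have "\<dots> = sgnF F * sgnF ({1..n} - F) * ((-1) ^ n * J (mix F x w) (mix ({1..n} - F) x w))" by simp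
    also have "mix ({1..n} - F) x w = mix F w x"
      using S_ext[OF x] S_ext[OF w] F by (auto simp: mix_def fun_eq_iff extensional_def)
    also have "J (mix F x w) (mix F w x) = J x w" using n_symD[OF x w, of F] F by simp
    also have "sgnF F * sgnF ({1..n} - F) = (-1) ^ n"
    proof -
      have c: "{1..n} - ({1..n} - F) = F" using F by auto
      have fF: "finite F" using F finite_subset by auto
      have "card F \<le> n" using card_mono[of "{1..n}" F] F by simp
      moreover have "card ({1..n} - F) = n - card F" using card_Diff_subset[OF fF, of "{1..n}"] F by simp
      ultimately have "card ({1..n} - F) + card F = n" by simp
      then show ?thesis unfolding c power_add[symmetric] by simp
    qed
    finally show ?thesis by (simp add: mult.assoc[symmetric] power_mult_distrib[symmetric])
  qed
  show ?thesis unfolding kernel_K_expand[OF w x x] using z by (simp add: card_Pow)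
qed

lemma J_nonneg: "x \<in> S \<Longrightarrow> y \<in> S \<Longrightarrow> 0 \<le> J x y"
proof -
  assume xy: "x \<in> S" "y \<in> S"
  have "0 \<le> kernel_K n J y x x"
    using psd_kernel_diagonal_bound[OF kernel_K_psd[OF xy(2)] xy(1) xy(1)] by simp
  then show ?thesis unfolding kernel_K_diagonal[OF xy] using mult_le_cancel_left_pos[of "2 ^ n" 0 "J x y"] by simp
qed

text \<open>\<open>2 ^ n * J u v\<close> is the energy of the product of differences from
  \<open>u\<close> to \<open>v\<close>. Rebased at \<open>w\<close>, it is a signed double sum of
  values of \<open>K\<close>, each at most the mean of two diagonal values
  \<open>2 ^ n * J (mix F u v) w\<close>. The factor \<open>2 ^ n\<close> in the conclusion counts
  the choices of the second index.\<close>

lemma J_bound: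
  assumes u: "u \<in> S" and v: "v \<in> S" and w: "w \<in> S"
  shows "J u v \<le> 2 ^ n * (\<Sum>F\<in>Pow {1..n}. J (mix F u v) w)"
proof -
  let ?P = "Pow {1..n}"
  have m: "mix F u v \<in> S" for F using mix_in[OF u v] .
  have eq: "delta_product n u v = (\<lambda>t. \<Sum>F\<in>?P. sgnF F * delta_product n (mix F u v) w t)"
    using delta_product_rebase by blast
  have "2 ^ n * J u v = form (delta_product n u v) (delta_product n u v)"
    using kernel_K_diagonal[OF u v] by (simp add: kernel_K_def)
  also have "\<dots> = (\<Sum>F\<in>?P. \<Sum>G\<in>?P. sgnF F * sgnF G * kernel_K n J w (mix F u v) (mix G u v))"
    unfolding eq using m w by (intro form_delta_sum) auto
  also have "\<dots> \<le> (\<Sum>F\<in>?P. \<Sum>G\<in>?P. (2 ^ n * J (mix F u v) w + 2 ^ n * J (mix G u v) w) / 2)"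
  proof (intro sum_mono)
    fix F G assume "F \<in> ?P" "G \<in> ?P"
    have "sgnF F * sgnF G * kernel_K n J w (mix F u v) (mix G u v) \<le> \<bar>sgnF F * sgnF G * kernel_K n J w (mix F u v) (mix G u v)\<bar>"
      by (rule abs_ge_self)
    also have "\<dots> = \<bar>kernel_K n J w (mix F u v) (mix G u v)\<bar>" by (simp add: abs_mult power_abs)
    also have "\<dots> \<le> (kernel_K n J w (mix F u v) (mix F u v) + kernel_K n J w (mix G u v) (mix G u v)) / 2"
      by (rule psd_kernel_diagonal_bound[OF kernel_K_psd[OF w] m m])
    finally show "sgnF F * sgnF G * kernel_K n J w (mix F u v) (mix G u v) \<le> (2 ^ n * J (mix F u v) w + 2 ^ n * J (mix G u v) w) / 2"
      unfolding kernel_K_diagonal[OF m w] .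
  qed
  also have "\<dots> = 2 ^ n * (2 ^ n * (\<Sum>F\<in>?P. J (mix F u v) w))"
    by (simp add: add_divide_distrib sum.distrib card_Pow sum_distrib_left[symmetric] sum_divide_distrib[symmetric])
  finally show ?thesis by (simp only: mult_le_cancel_left_pos[of "2 ^ n :: real", OF zero_less_power[OF zero_less_numeral]])
qed

end

subsection \<open>Integration against signed Radon measures\<close>

lemma borel_measurable_section:
  assumes y: "y \<in> topspace T" and f: "f \<in> borel_measurable (borel_alg (prod_topology S T))"
  shows "(\<lambda>x. f (x, y)) \<in> borel_measurable (borel_alg S)"
proof -
  have "continuous_map S (prod_topology S T) (\<lambda>x. (x, y))"
    using y by (simp add: continuous_map_pairwise o_def)
  from measurable_compose[OF continuous_map_measurable[OF this] f] show ?thesis .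
qed

text \<open>The integral is 0 at those \<open>y\<close> where the section is not integrable. It is
  thus the difference of two measurable functions on the measurable set where \<open>a\<close> is
  finite, and 0 off it.\<close>

lemma borel_measurable_lebesgue_integral_tight:
  fixes f :: "'p \<times> 'q \<Rightarrow> real"
  assumes S: "Hausdorff_space S" and M: "tight S M" and f: "f \<in> borel_measurable (borel_alg (prod_topology S T))"
  shows "(\<lambda>y. \<integral>x. f (x, y) \<partial>M) \<in> borel_measurable (borel_alg T)"
proof -
  define a where "a y = (\<integral>\<^sup>+x. ennreal \<bar>f (x, y)\<bar> \<partial>M)" for y
  define p where "p y = (\<integral>\<^sup>+x. ennreal (f (x, y)) \<partial>M)" for y
  define q where "q y = (\<integral>\<^sup>+x. ennreal (- f (x, y)) \<partial>M)" for y
  have m: "a \<in> borel_measurable (borel_alg T)" "p \<in> borel_measurable (borel_alg T)" "q \<in> borel_measurable (borel_alg T)"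
    unfolding a_def p_def q_def
    using f by (intro borel_measurable_nn_integral_tight[OF S M, of "\<lambda>z. ennreal \<bar>f z\<bar>"]
      borel_measurable_nn_integral_tight[OF S M, of "\<lambda>z. ennreal (f z)"]
      borel_measurable_nn_integral_tight[OF S M, of "\<lambda>z. ennreal (- f z)"]; measurable)+
  have eq: "(\<integral>x. f (x, y) \<partial>M) = (if a y < \<infinity> then enn2real (p y) - enn2real (q y) else 0)" if y: "y \<in> topspace T" for y
  proof -
    have fy: "(\<lambda>x. f (x, y)) \<in> borel_measurable M"
      unfolding measurable_tight[OF M] using y f by (rule borel_measurable_section)
    have "integrable M (\<lambda>x. f (x, y)) \<longleftrightarrow> a y < \<infinity>" using fy by (simp add: integrable_iff_bounded a_def)
    then show ?thesis using real_lebesgue_integral_def[of M "\<lambda>x. f (x, y)"] not_integrable_integral_eq[of M "\<lambda>x. f (x, y)"]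
      by (auto simp: p_def q_def)
  qed
  have "(\<lambda>y. if a y < \<infinity> then enn2real (p y) - enn2real (q y) else 0) \<in> borel_measurable (borel_alg T)"
    using m by measurable
  then show ?thesis by (subst measurable_cong[OF eq]) auto
qed

lemma borel_measurable_signed_integral:
  assumes T: "Hausdorff_space S" "\<mu> \<in> radon_signed S" and f: "f \<in> borel_measurable (borel_alg (prod_topology S T))"
  shows "(\<lambda>y. signed_integral S \<mu> (\<lambda>x. f (x, y))) \<in> borel_measurable (borel_alg T)"
  unfolding signed_integral_def
  using borel_measurable_lebesgue_integral_tight[OF T(1) tight_pos_part[OF T] f]
    borel_measurable_lebesgue_integral_tight[OF T(1) tight_neg_part[OF T] f] by (rule borel_measurable_diff)

lemma integrable_variation_iff:
  fixes f :: "'p \<Rightarrow> real"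
  assumes "f \<in> borel_measurable (borel_alg T)"
  shows "integrable (variation T \<mu>) f \<longleftrightarrow> (\<integral>\<^sup>+x. ennreal \<bar>f x\<bar> \<partial>variation T \<mu>) < \<infinity>"
  using assms measurable_cong_sets[OF sets_variation refl, of T \<mu> borel] by (auto simp: integrable_iff_bounded)

text \<open>An instance of the linear relation between three signed measures with weights
  \<open>a\<close>, \<open>b\<close> and -1.\<close>

lemma signed_integral_add_measure:
  assumes T: "Hausdorff_space T" and m: "\<mu> \<in> radon_signed T" "\<eta> \<in> radon_signed T" "(\<lambda>A. a * \<mu> A + b * \<eta> A) \<in> radon_signed T"
    and f: "integrable (variation T \<mu>) f" "integrable (variation T \<eta>) f" "integrable (variation T (\<lambda>A. a * \<mu> A + b * \<eta> A)) f"
  shows "signed_integral T (\<lambda>A. a * \<mu> A + b * \<eta> A) f = a * signed_integral T \<mu> f + b * signed_integral T \<eta> f"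
proof -
  define m' where "m' k = (if k = 0 then \<mu> else if k = 1 then \<eta> else (\<lambda>A. a * \<mu> A + b * \<eta> A))" for k :: nat
  define c where "c k = (if k = 0 then a else if k = 1 then b else - 1)" for k :: nat
  have "(\<Sum>k\<in>{0, 1, 2}. c k * signed_integral T (m' k) f) = 0"
    using m f by (intro signed_integral_lincomb_eq_0[OF T]) (auto simp: m'_def c_def)
  then show ?thesis by (simp add: m'_def c_def)
qed

subsection \<open>The embedding of measures into the reproducing kernel Hilbert space\<close>

context
  fixes T :: "'p topology" and K :: "'p \<Rightarrow> 'p \<Rightarrow> real"
  assumes T: "Hausdorff_space T" and psd: "psd_kernel (topspace T) K"
    and cont: "continuous_map (prod_topology T T) euclideanreal (\<lambda>(x, y). K x y)"
begin

abbreviation "HK \<equiv> rkhs_space (topspace T) K"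
abbreviation "BK \<equiv> rkhs_inner (topspace T) K"
abbreviation "kf y \<equiv> (\<lambda>x. if x \<in> topspace T then K x y else 0)"

lemma HK_sip: "semi_inner_product_on HK BK" and HK_hilbert: "hilbert_on HK BK"
  using rkhs_is_rkhs[OF psd] by (auto simp: is_rkhs_def hilbert_on_def)

lemma HK_outside: "f \<in> HK \<Longrightarrow> x \<notin> topspace T \<Longrightarrow> f x = 0"
  using rkhs_is_rkhs[OF psd] by (auto simp: is_rkhs_def)

lemma kf_in: "y \<in> topspace T \<Longrightarrow> kf y \<in> HK"
  using rkhs_is_rkhs[OF psd] by (auto simp: is_rkhs_def)

lemma HK_reproducing: "y \<in> topspace T \<Longrightarrow> f \<in> HK \<Longrightarrow> BK f (kf y) = f y"
  using rkhs_is_rkhs[OF psd] by (auto simp: is_rkhs_def)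

lemma K_sym: "x \<in> topspace T \<Longrightarrow> y \<in> topspace T \<Longrightarrow> K x y = K y x"
  using psd by (simp add: psd_kernel_def)

lemma BK_kf: "x \<in> topspace T \<Longrightarrow> y \<in> topspace T \<Longrightarrow> BK (kf x) (kf y) = K y x"
  using HK_reproducing[OF _ kf_in, of y x] by simp

lemma K_diag_nonneg: "x \<in> topspace T \<Longrightarrow> 0 \<le> K x x"
  using sip_nonneg[OF HK_sip kf_in, of x] BK_kf[of x x] by simp

lemma HK_bound:
  assumes f: "f \<in> HK" and x: "x \<in> topspace T" shows "\<bar>f x\<bar> \<le> sqrt (BK f f) * sqrt (K x x)"
proof -
  have "(f x)\<^sup>2 \<le> BK f f * K x x"
    using sip_cauchy_schwarz[OF HK_sip f kf_in[OF x]] HK_reproducing[OF x f] BK_kf[OF x x] by simp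
  from real_sqrt_le_mono[OF this] show ?thesis by (simp add: real_sqrt_mult)
qed

lemma K_bound: "x \<in> topspace T \<Longrightarrow> y \<in> topspace T \<Longrightarrow> \<bar>K x y\<bar> \<le> sqrt (K x x) * sqrt (K y y)"
  using HK_bound[OF kf_in, of y x] BK_kf[of y y] by (simp add: mult.commute)

lemma diag_measurable: "(\<lambda>x. K x x) \<in> borel_measurable (borel_alg T)"
proof -
  have "continuous_map T (prod_topology T T) (\<lambda>x. (x, x))" by (simp add: continuous_map_pairwise o_def)
  from continuous_map_compose[OF this cont] show ?thesis
    by (intro continuous_map_borel_measurable) (simp add: o_def)
qed

text \<open>Functions of the space are continuous where the kernel is: by Cauchy-Schwarz, the square
  of \<open>f x - f y\<close> is at most \<open>d x\<close>, the squared norm of \<open>f\<close>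
  times the squared distance of the kernel functions at \<open>x\<close> and \<open>y\<close>. This
  is continuous in \<open>x\<close> and vanishes at \<open>y\<close>, so \<open>a < f\<close> holds
  on an open set.\<close>

lemma HK_measurable:
  assumes f: "f \<in> HK" shows "f \<in> borel_measurable (borel_alg T)"
proof (rule borel_measurableI_greater)
  fix a
  have "openin T {y \<in> topspace T. a < f y}"
  proof (subst openin_subopen, safe)
    fix y assume y: "y \<in> topspace T" "a < f y"
    define d where "d x = BK f f * (K x x - 2 * K x y + K y y)" for x
    have c1: "continuous_map T euclideanreal (\<lambda>x. K x x)"
    proof -
      have "continuous_map T (prod_topology T T) (\<lambda>x. (x, x))" by (simp add: continuous_map_pairwise o_def)
      from continuous_map_compose[OF this cont] show ?thesis by (simp add: o_def)
    qed
    have c2: "continuous_map T euclideanreal (\<lambda>x. K x y)"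
    proof -
      have "continuous_map T (prod_topology T T) (\<lambda>x. (x, y))" using y by (simp add: continuous_map_pairwise o_def)
      from continuous_map_compose[OF this cont] show ?thesis by (simp add: o_def)
    qed
    have "continuous_map T euclideanreal d"
      unfolding d_def using c1 c2
      by (intro continuous_map_real_mult_left continuous_map_add continuous_map_diff) auto
    then have U: "openin T {x \<in> topspace T. d x \<in> {..<(f y - a)\<^sup>2}}"
      by (rule openin_continuous_map_preimage) simp
    have dist: "(f x - f y)\<^sup>2 \<le> d x" if x: "x \<in> topspace T" for x
    proof -
      note kxy = kf_in[OF x] kf_in[OF y(1)]
      let ?g = "\<lambda>z. 1 * kf x z + (- 1) * kf y z"
      have "BK f ?g = f x - f y"
        using sip_lincomb_right[OF HK_sip kxy f, of 1 "- 1"] HK_reproducing[OF x f] HK_reproducing[OF y(1) f] by simp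
      moreover have "BK ?g ?g = K x x - 2 * K x y + K y y"
        using sip_quad[OF HK_sip kxy, of 1 "- 1"] BK_kf[OF x x] BK_kf[OF x y(1)] BK_kf[OF y(1) y(1)] K_sym[OF x y(1)] by simp
      ultimately show ?thesis
        using sip_cauchy_schwarz[OF HK_sip f sip_lincomb_in[OF HK_sip kxy, of 1 "- 1"]] unfolding d_def by simp
    qed
    have "{x \<in> topspace T. d x \<in> {..<(f y - a)\<^sup>2}} \<subseteq> {x \<in> topspace T. a < f x}"
    proof safe
      fix x assume x: "x \<in> topspace T" "d x < (f y - a)\<^sup>2"
      then have "\<bar>f x - f y\<bar>\<^sup>2 < (f y - a)\<^sup>2" using dist[OF x(1)] by simp
      then have "\<bar>f x - f y\<bar> < f y - a" by (rule power2_less_imp_less) (use y in simp)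
      then show "a < f x" by linarith
    qed
    moreover have "y \<in> {x \<in> topspace T. d x \<in> {..<(f y - a)\<^sup>2}}" using y by (simp add: d_def)
    ultimately show "\<exists>U. openin T U \<and> y \<in> U \<and> U \<subseteq> {y \<in> topspace T. a < f y}" using U by blast
  qed
  then show "{x \<in> space (borel_alg T). a < f x} \<in> sets (borel_alg T)" by (simp add: openin_in_borel_alg)
qed

lemma HK_integrable:
  assumes f: "f \<in> HK" and i: "integrable (variation T \<mu>) (\<lambda>x. sqrt (K x x))"
  shows "integrable (variation T \<mu>) f"
proof (rule Bochner_Integration.integrable_bound)
  show "integrable (variation T \<mu>) (\<lambda>x. sqrt (BK f f) * sqrt (K x x))" using i by simp
  show "f \<in> borel_measurable (variation T \<mu>)"
    using HK_measurable[OF f] measurable_cong_sets[OF sets_variation refl, of T \<mu> borel] by blast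
  have "norm (f x) \<le> norm (sqrt (BK f f) * sqrt (K x x))" if "x \<in> space (variation T \<mu>)" for x
  proof -
    have "x \<in> topspace T" using that by simp
    then show ?thesis using HK_bound[OF f, of x] by simp
  qed
  then show "AE x in variation T \<mu>. norm (f x) \<le> norm (sqrt (BK f f) * sqrt (K x x))" by (rule AE_I2)
qed

lemma kernel_embedding_inner:
  assumes \<mu>: "\<mu> \<in> radon_signed T" and i: "integrable (variation T \<mu>) (\<lambda>x. sqrt (K x x))"
  shows "kernel_embedding T K \<mu> \<in> HK" "\<And>f. f \<in> HK \<Longrightarrow> BK (kernel_embedding T K \<mu>) f = signed_integral T \<mu> f"
proof -
  \<comment> \<open>The norm bound of the functional: by the reproducing property,
    \<open>\<bar>f x\<bar>\<close> is at most the norm of \<open>f\<close> times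
    \<open>sqrt (K x x)\<close>.\<close>
  define C where "C = (\<integral>x. sqrt (K x x) \<partial>variation T \<mu>)"
  have "\<exists>r\<in>HK. \<forall>f\<in>HK. BK r f = signed_integral T \<mu> f"
  proof (rule riesz_representation[OF HK_hilbert])
    show "signed_integral T \<mu> (\<lambda>x. a * f x + b * g x) = a * signed_integral T \<mu> f + b * signed_integral T \<mu> g"
      if "f \<in> HK" "g \<in> HK" for f g a b
      using signed_integral_add[OF T \<mu>, of "\<lambda>x. a * f x" "\<lambda>x. b * g x"] HK_integrable[OF that(1) i] HK_integrable[OF that(2) i]
        signed_integral_cmult[OF T, of \<mu> a f] signed_integral_cmult[OF T, of \<mu> b g] by simp
    show "(signed_integral T \<mu> f)\<^sup>2 \<le> C\<^sup>2 * BK f f" if f: "f \<in> HK" for f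
    proof -
      have "\<bar>signed_integral T \<mu> f\<bar> \<le> (\<integral>x. \<bar>f x\<bar> \<partial>variation T \<mu>)"
        using signed_integral_abs_le[OF T \<mu> HK_integrable[OF f i]] .
      also have "\<dots> \<le> (\<integral>x. sqrt (BK f f) * sqrt (K x x) \<partial>variation T \<mu>)"
        using HK_integrable[OF f i] i HK_bound[OF f] by (intro integral_mono) auto
      also have "\<dots> = sqrt (BK f f) * C" by (simp add: C_def)
      finally have "\<bar>signed_integral T \<mu> f\<bar>\<^sup>2 \<le> (sqrt (BK f f) * C)\<^sup>2" by (intro power_mono) auto
      then show ?thesis using sip_nonneg[OF HK_sip f] by (simp add: power_mult_distrib mult.commute)
    qed
  qed simp
  then obtain r where r: "r \<in> HK" "\<And>f. f \<in> HK \<Longrightarrow> BK r f = signed_integral T \<mu> f" by blast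
  have "r = kernel_embedding T K \<mu>"
  proof
    fix z show "r z = kernel_embedding T K \<mu> z"
    proof (cases "z \<in> topspace T")
      case True
      have "r z = signed_integral T \<mu> (kf z)" using HK_reproducing[OF True r(1)] r(2)[OF kf_in[OF True]] by simp
      also have "\<dots> = signed_integral T \<mu> (\<lambda>x. K x z)" by (rule signed_integral_cong[OF T \<mu>]) simp
      finally show ?thesis using True by (simp add: kernel_embedding_def)
    next
      case False
      then show ?thesis using HK_outside[OF r(1)] by (simp add: kernel_embedding_def)
    qed
  qed
  then show "kernel_embedding T K \<mu> \<in> HK" "\<And>f. f \<in> HK \<Longrightarrow> BK (kernel_embedding T K \<mu>) f = signed_integral T \<mu> f"
    using r by auto
qed

text \<open>The inner integral is the embedding of \<open>\<mu>\<close>, an element of the space.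
  Integrating it against \<open>\<eta>\<close> is pairing it with the embedding of
  \<open>\<eta>\<close>.\<close>

lemma double_integral_rkhs_inner:
  assumes \<mu>: "\<mu> \<in> radon_signed T" and i: "integrable (variation T \<mu>) (\<lambda>x. sqrt (K x x))"
    and \<eta>: "\<eta> \<in> radon_signed T" and j: "integrable (variation T \<eta>) (\<lambda>x. sqrt (K x x))"
  shows "double_integral T K \<mu> \<eta> = BK (kernel_embedding T K \<mu>) (kernel_embedding T K \<eta>)"
proof -
  note e = kernel_embedding_inner[OF \<mu> i] and f = kernel_embedding_inner[OF \<eta> j]
  have "double_integral T K \<mu> \<eta> = signed_integral T \<eta> (kernel_embedding T K \<mu>)"
    unfolding double_integral_def by (rule signed_integral_cong[OF T \<eta>]) (simp add: kernel_embedding_def)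
  also have "\<dots> = BK (kernel_embedding T K \<eta>) (kernel_embedding T K \<mu>)" using f(2)[OF e(1)] by simp
  also have "\<dots> = BK (kernel_embedding T K \<mu>) (kernel_embedding T K \<eta>)" using sip_sym[OF HK_sip f(1) e(1)] .
  finally show ?thesis .
qed

text \<open>The bound of \<open>K\<close> by the geometric mean of its diagonal values separates the
  two variables.\<close>

lemma double_integrable_kernel:
  assumes i: "integrable (variation T \<mu>) (\<lambda>x. sqrt (K x x))" and j: "integrable (variation T \<eta>) (\<lambda>x. sqrt (K x x))"
  shows "double_integrable T K \<mu> \<eta>"
  unfolding double_integrable_def
proof
  show "(\<lambda>(u, v). K u v) \<in> borel_measurable (borel_alg (prod_topology T T))"
    using cont by (rule continuous_map_borel_measurable)
  define A where "A \<nu> = (\<integral>\<^sup>+u. ennreal (sqrt (K u u)) \<partial>variation T \<nu>)" for \<nu>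
  have fin: "A \<nu> < \<infinity>" if "integrable (variation T \<nu>) (\<lambda>x. sqrt (K x x))" for \<nu>
  proof -
    have "A \<nu> = (\<integral>\<^sup>+u. ennreal (norm (sqrt (K u u))) \<partial>variation T \<nu>)"
      unfolding A_def by (rule nn_integral_cong) (simp add: K_diag_nonneg)
    then show ?thesis using that by (simp add: integrable_iff_bounded)
  qed
  have m: "(\<lambda>u. ennreal (sqrt (K u u))) \<in> borel_measurable (variation T \<nu>)" for \<nu>
    unfolding measurable_cong_sets[OF sets_variation refl, of T \<nu>] using diag_measurable by simp
  have "(\<integral>\<^sup>+v. (\<integral>\<^sup>+u. ennreal \<bar>K u v\<bar> \<partial>variation T \<mu>) \<partial>variation T \<eta>) \<le>
    (\<integral>\<^sup>+v. (\<integral>\<^sup>+u. ennreal (sqrt (K v v)) * ennreal (sqrt (K u u)) \<partial>variation T \<mu>) \<partial>variation T \<eta>)"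
  proof (intro nn_integral_mono)
    fix u v assume "v \<in> space (variation T \<eta>)" "u \<in> space (variation T \<mu>)"
    then have uv: "u \<in> topspace T" "v \<in> topspace T" by auto
    have "ennreal \<bar>K u v\<bar> \<le> ennreal (sqrt (K v v) * sqrt (K u u))"
      using K_bound[OF uv] by (intro ennreal_leI) (simp add: mult.commute)
    also have "\<dots> = ennreal (sqrt (K v v)) * ennreal (sqrt (K u u))"
      using K_diag_nonneg uv by (intro ennreal_mult) auto
    finally show "ennreal \<bar>K u v\<bar> \<le> ennreal (sqrt (K v v)) * ennreal (sqrt (K u u))" .
  qed
  also have "\<dots> = A \<eta> * A \<mu>"
    unfolding A_def by (simp add: nn_integral_cmult[OF m] nn_integral_multc[OF m])
  also have "\<dots> < \<infinity>" using fin[OF i] fin[OF j] by (simp add: ennreal_mult_less_top)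
  finally show "(\<integral>\<^sup>+v. (\<integral>\<^sup>+u. ennreal \<bar>K u v\<bar> \<partial>variation T \<mu>) \<partial>variation T \<eta>) < \<infinity>" .
qed

end

subsection \<open>Integrability of the kernel\<close>

lemma nn_integral_null_space:
  assumes "emeasure M (space M) = 0" shows "integral\<^sup>N M f = 0"
proof -
  have "AE x in M. x \<notin> space M" using assms by (intro AE_not_in) (auto simp: null_sets_def)
  then have "AE x in M. f x = 0" using AE_space by eventually_elim auto
  then have "integral\<^sup>N M f = (\<integral>\<^sup>+x. 0 \<partial>M)" by (rule nn_integral_cong_AE)
  then show ?thesis by simp
qed

context pdi_kernel
begin

lemma cont_mix_const:
  assumes "z \<in> S" "E \<subseteq> {1..n}" shows "continuous_map (PT E) (PT {1..n}) (\<lambda>t. mix E t z)"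
proof (rule continuous_map_into_product)
  fix k assume k: "k \<in> {1..n}"
  show "continuous_map (PT E) (X k) (\<lambda>t. mix E t z k)"
  proof (cases "k \<in> E")
    case True
    then show ?thesis by (simp add: mix_def continuous_map_product_projection)
  next
    case False
    then show ?thesis using assms k by (simp add: mix_def PiE_iff)
  qed
qed (use assms in \<open>auto simp: mix_def extensional_def PiE_iff \<close>)

lemma cont_mix:
  assumes "z \<in> S" shows "continuous_map T T (\<lambda>x. mix F x z)"
proof (rule continuous_map_into_product)
  fix k assume k: "k \<in> {1..n}"
  show "continuous_map T (X k) (\<lambda>t. mix F t z k)"
    using assms k by (cases "k \<in> F") (simp_all add: mix_def PiE_iff continuous_map_product_projection)
qed (use assms in \<open>auto simp: mix_def extensional_def PiE_iff\<close>)

lemma cont_J_compose: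
  assumes "continuous_map U T f" "continuous_map U T g"
  shows "continuous_map U euclideanreal (\<lambda>s. J (f s) (g s))"
proof -
  have "continuous_map U (prod_topology T T) (\<lambda>s. (f s, g s))"
    using assms by (simp add: continuous_map_pairwise o_def)
  from continuous_map_compose[OF this cont_J] show ?thesis by (simp add: o_def)
qed

lemma cont_J_mix:
  assumes "a \<in> S" "b \<in> S"
  shows "continuous_map (prod_topology T T) euclideanreal (\<lambda>(u, v). J (mix F u a) (mix G v b))"
  unfolding case_prod_beta
  using continuous_map_compose[OF continuous_map_fst cont_mix[OF assms(1), of F], of T]
    continuous_map_compose[OF continuous_map_snd cont_mix[OF assms(2), of G], of T]
  by (intro cont_J_compose) (simp_all add: o_def)

lemma kernel_K_cont:
  assumes w: "w \<in> S" shows "continuous_map (prod_topology T T) euclideanreal (\<lambda>(x, y). kernel_K n J w x y)"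
proof (rule continuous_map_eq)
  let ?f = "\<lambda>z. \<Sum>F\<in>Pow {1..n}. \<Sum>G\<in>Pow {1..n}. sgnF F * sgnF G * ((-1) ^ n * (case z of (u, v) \<Rightarrow> J (mix F u w) (mix G v w)))"
  show "continuous_map (prod_topology T T) euclideanreal ?f"
    using cont_J_mix[OF w w] by (intro continuous_map_sum continuous_map_real_mult_left) auto
  fix z assume "z \<in> topspace (prod_topology T T)"
  then show "?f z = (case z of (x, y) \<Rightarrow> kernel_K n J w x y)"
    using kernel_K_expand[OF w, of "fst z" "snd z"] by (simp add: case_prod_beta mem_Times_iff)
qed

text \<open>The one-measure part of FIP: the first argument is mixed with a fixed point and the
  second is fixed. Absolute values are absent because \<open>J\<close> is nonnegative.\<close>

definition integ :: "(nat \<Rightarrow> 'a) measure \<Rightarrow> bool" where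
  "integ \<alpha> \<longleftrightarrow> (\<forall>F\<subseteq>{1..n}. \<forall>z\<in>S. \<forall>w\<in>S. (\<integral>\<^sup>+x. ennreal (J (mix F x z) w) \<partial>\<alpha>) < \<infinity>)"

lemma integD: "integ \<alpha> \<Longrightarrow> F \<subseteq> {1..n} \<Longrightarrow> z \<in> S \<Longrightarrow> w \<in> S \<Longrightarrow> (\<integral>\<^sup>+x. ennreal (J (mix F x z) w) \<partial>\<alpha>) < \<infinity>"
  by (simp add: integ_def)

text \<open>With no coordinate of the second argument integrated, the outer integral is
  multiplication by the total mass, so for a nonzero measure finiteness passes to the inner
  integral.\<close>

lemma FIP_integ:
  assumes \<mu>: "\<mu> \<in> radon_signed T" and fip: "FIP X n J \<mu>" and \<rho>: "partition_on {1..n} \<rho>"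
    and nz: "emeasure (variation T \<mu>) S \<noteq> 0"
  shows "integ (marginal_product X \<rho> (variation T \<mu>))"
  unfolding integ_def
proof (intro allI impI ballI)
  let ?v = "variation T \<mu>" and ?a = "marginal_product X \<rho> (variation T \<mu>)"
  have H: "Hausdorff_space T" using hausdorff_PT by simp
  note v = radon_signedD[OF H \<mu>]
  have ne: "{1..n} \<noteq> {}" using n_pos by simp
  fix F z w assume F: "F \<subseteq> {1..n}" and z: "z \<in> S" and w: "w \<in> S"
  have "(\<integral>\<^sup>+y1. (\<integral>\<^sup>+x1. ennreal \<bar>J (mix F x1 z) (mix {} y1 w)\<bar> \<partial>?a) \<partial>marginal_product X {{1..n}} ?v) < \<infinity>"
    using fip F z w \<rho> partition_on_space[OF ne] unfolding FIP_def by blast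
  then have "(\<integral>\<^sup>+y1. (\<integral>\<^sup>+x1. ennreal \<bar>J (mix F x1 z) w\<bar> \<partial>?a) \<partial>?v) < \<infinity>"
    unfolding marginal_product_trivial[OF v(2) ne] by (simp add: mix_def)
  then have "(\<integral>\<^sup>+x1. ennreal \<bar>J (mix F x1 z) w\<bar> \<partial>?a) < \<infinity>"
    using nz by (auto simp: ennreal_mult_less_top)
  moreover have "(\<integral>\<^sup>+x1. ennreal \<bar>J (mix F x1 z) w\<bar> \<partial>?a) = (\<integral>\<^sup>+x1. ennreal (J (mix F x1 z) w) \<partial>?a)"
  proof (rule nn_integral_cong)
    fix x assume "x \<in> space ?a"
    then have "x \<in> S" using tight_space[OF tight_marginal_product[OF \<rho> order_refl order_refl v(2)]] by simp
    then show "ennreal \<bar>J (mix F x z) w\<bar> = ennreal (J (mix F x z) w)" using J_nonneg[OF mix_in[OF _ z] w] by simp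
  qed
  ultimately show "(\<integral>\<^sup>+x. ennreal (J (mix F x z) w) \<partial>?a) < \<infinity>" by simp
qed

lemma FIP_integ_variation:
  assumes \<mu>: "\<mu> \<in> radon_signed T" and fip: "FIP X n J \<mu>"
  shows "integ (variation T \<mu>)"
proof (cases "emeasure (variation T \<mu>) S = 0")
  case True
  then show ?thesis using nn_integral_null_space[of "variation T \<mu>"] by (simp add: integ_def)
next
  case False
  have ne: "{1..n} \<noteq> {}" using n_pos by simp
  have H: "Hausdorff_space T" using hausdorff_PT by simp
  show ?thesis
    using FIP_integ[OF \<mu> fip partition_on_space[OF ne] False] marginal_product_trivial[OF radon_signedD(2)[OF H \<mu>] ne] by simp
qed

text \<open>A partition of \<open>E\<close> is completed by the complement of \<open>E\<close> as
  one more block. The product over \<open>\<rho>\<close> is then the marginal on \<open>E\<close> of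
  a product over all coordinates, to which the hypothesis applies.\<close>

lemma integ_sub:
  assumes P: "tight T P" and prob: "emeasure P S = 1"
    and all: "\<And>\<rho>. partition_on {1..n} \<rho> \<Longrightarrow> integ (marginal_product X \<rho> P)"
    and E: "E \<subseteq> {1..n}" and \<rho>: "partition_on E \<rho>" and z: "z \<in> S" and w: "w \<in> S"
  shows "(\<integral>\<^sup>+t. ennreal (J (mix E t z) w) \<partial>marginal_product X \<rho> P) < \<infinity>"
proof -
  \<comment> \<open>Removing the empty set covers \<open>E = {1..n}\<close>, where no block is
    added.\<close>
  define \<sigma> where "\<sigma> = {{1..n} - E} - {{}}"
  have \<sigma>: "partition_on ({1..n} - E) \<sigma>" by (auto simp: \<sigma>_def partition_on_def disjoint_def)
  have u: "partition_on {1..n} (\<rho> \<union> \<sigma>)"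
  proof -
    have "partition_on (E \<union> ({1..n} - E)) (\<rho> \<union> \<sigma>)" using \<rho> \<sigma> by (rule partition_on_Un) auto
    then show ?thesis using E by (simp add: Un_absorb1)
  qed
  have r: "(\<inter>) E ` (\<rho> \<union> \<sigma>) - {{}} = \<rho>"
  proof -
    have *: "E \<inter> B = B" "B \<noteq> {}" if "B \<in> \<rho>" for B using \<rho> that by (auto simp: partition_on_def)
    have "(\<inter>) E ` \<rho> = (\<lambda>B. B) ` \<rho>" using *(1) by (intro image_cong) auto
    moreover have "(\<inter>) E ` \<sigma> - {{}} = {}" by (auto simp: \<sigma>_def)
    moreover have "\<rho> - {{}} = \<rho>" using *(2) by auto
    ultimately show ?thesis by (simp only: image_Un Un_Diff Un_empty_right image_ident)
  qed
  note t = tight_marginal_product[OF u order_refl order_refl P]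
  have m: "(\<lambda>t. ennreal (J (mix E t z) w)) \<in> borel_measurable (borel_alg (PT E))"
    using continuous_map_borel_measurable[OF cont_J_compose[OF cont_mix_const[OF z E], of "\<lambda>_. w"]] w by simp
  have "(\<integral>\<^sup>+t. ennreal (J (mix E t z) w) \<partial>marginal_product X \<rho> P) =
     (\<integral>\<^sup>+t. ennreal (J (mix E t z) w) \<partial>marginal X E (marginal_product X (\<rho> \<union> \<sigma>) P))"
    unfolding marginal_marginal_product[OF u order_refl P E prob] r ..
  also have "\<dots> = (\<integral>\<^sup>+x. ennreal (J (mix E (restrict x E) z) w) \<partial>marginal_product X (\<rho> \<union> \<sigma>) P)"
    using E t m by (rule nn_integral_marginal)
  also have "\<dots> = (\<integral>\<^sup>+x. ennreal (J (mix E x z) w) \<partial>marginal_product X (\<rho> \<union> \<sigma>) P)"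
  proof -
    have "mix E (restrict x E) z = mix E x z" for x by (auto simp: mix_def)
    then show ?thesis by simp
  qed
  also have "\<dots> < \<infinity>" using integD[OF all[OF u] E z w] .
  finally show ?thesis .
qed

text \<open>The two measures are split apart by \<open>J_bound\<close>: each term is integrated against one of the
  measures only, or against proper marginals of both, where they are dominated by products of
  marginals of \<open>P\<close>.\<close>

lemma pair_term_finite:
  assumes P: "tight T P" and prob: "emeasure P S = 1"
    and all: "\<And>\<rho>. partition_on {1..n} \<rho> \<Longrightarrow> integ (marginal_product X \<rho> P)"
    and \<alpha>: "tight T \<alpha>" "tame c \<alpha> P" "integ \<alpha>" and \<beta>: "tight T \<beta>" "tame d \<beta> P" "integ \<beta>"
    and H: "H1 \<subseteq> {1..n}" "H2 \<subseteq> {1..n}" "H1 \<inter> H2 = {}" and z: "z \<in> S" and w: "w \<in> S"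
  shows "(\<integral>\<^sup>+y. (\<integral>\<^sup>+x. ennreal (J (mix (H1 \<union> H2) (mix H1 x y) z) w) \<partial>\<alpha>) \<partial>\<beta>) < \<infinity>"
proof -
  consider "H1 = {1..n}" | "H2 = {1..n}" | "H1 \<subset> {1..n}" "H2 \<subset> {1..n}" using H by blast
  then show ?thesis
  proof cases
    case 1
    have "mix (H1 \<union> H2) (mix H1 x y) z = mix {1..n} x z" for x y
      using H(2) unfolding 1 by (auto simp: mix_def fun_eq_iff)
    then have "(\<integral>\<^sup>+y. (\<integral>\<^sup>+x. ennreal (J (mix (H1 \<union> H2) (mix H1 x y) z) w) \<partial>\<alpha>) \<partial>\<beta>) =
      (\<integral>\<^sup>+x. ennreal (J (mix {1..n} x z) w) \<partial>\<alpha>) * emeasure \<beta> (space \<beta>)" by simp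
    moreover have "emeasure \<beta> (space \<beta>) < \<infinity>"
      using \<beta>(1) unfolding tight_space[OF \<beta>(1)] by (simp add: tight_def)
    ultimately show ?thesis using integD[OF \<alpha>(3) order_refl z w] by (simp add: ennreal_mult_less_top)
  next
    case 2
    then have e: "H1 = {}" using H by auto
    have "mix (H1 \<union> H2) (mix H1 x y) z = mix {1..n} y z" for x y
      unfolding 2 e by (auto simp: mix_def fun_eq_iff)
    moreover have m: "(\<lambda>y. ennreal (J (mix {1..n} y z) w)) \<in> borel_measurable \<beta>"
      unfolding measurable_tight[OF \<beta>(1)]
      using continuous_map_borel_measurable[OF cont_J_compose[OF cont_mix[OF z], of "\<lambda>_. w"]] w by simp
    ultimately have "(\<integral>\<^sup>+y. (\<integral>\<^sup>+x. ennreal (J (mix (H1 \<union> H2) (mix H1 x y) z) w) \<partial>\<alpha>) \<partial>\<beta>) =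
      (\<integral>\<^sup>+y. ennreal (J (mix {1..n} y z) w) \<partial>\<beta>) * emeasure \<alpha> (space \<alpha>)" by (simp add: nn_integral_multc)
    moreover have "emeasure \<alpha> (space \<alpha>) < \<infinity>"
      using \<alpha>(1) unfolding tight_space[OF \<alpha>(1)] by (simp add: tight_def)
    ultimately show ?thesis using integD[OF \<beta>(3) order_refl z w] by (simp add: ennreal_mult_less_top)
  next
    case 3
    let ?E = "H1 \<union> H2"
    have E: "?E \<subseteq> {1..n}" using H by auto
    define g where "g t = ennreal (J (mix ?E t z) w)" for t
    have g: "g \<in> borel_measurable (borel_alg (PT ?E))"
      unfolding g_def using continuous_map_borel_measurable[OF cont_J_compose[OF cont_mix_const[OF z E], of "\<lambda>_. w"]] w by simp
    have gm: "(\<lambda>p. g (case p of (x, y) \<Rightarrow> mix H1 x y)) \<in> borel_measurable (borel_alg (prod_topology (PT H1) (PT H2)))"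
      using measurable_compose[OF continuous_map_measurable[OF continuous_map_mix] g] .
    note t1 = tight_marginal[OF H(1) order_refl \<alpha>(1)] and t2 = tight_marginal[OF H(2) order_refl \<beta>(1)]
    define h where "h y = (\<integral>\<^sup>+x. g (mix H1 x y) \<partial>marginal X H1 \<alpha>)" for y
    have hm: "h \<in> borel_measurable (borel_alg (PT H2))"
      unfolding h_def using borel_measurable_nn_integral_tight[OF hausdorff_PT[OF H(1)] t1 gm] by simp
    \<comment> \<open>Only the coordinates of \<open>x\<close> in \<open>H1\<close> and those of
      \<open>y\<close> in \<open>H2\<close> enter, so both integrals are integrals against
      marginals.\<close>
    have "(\<integral>\<^sup>+y. (\<integral>\<^sup>+x. ennreal (J (mix (H1 \<union> H2) (mix H1 x y) z) w) \<partial>\<alpha>) \<partial>\<beta>) = (\<integral>\<^sup>+y. h (restrict y H2) \<partial>\<beta>)"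
    proof (rule nn_integral_cong)
      fix y assume "y \<in> space \<beta>"
      then have "y \<in> S" using tight_space[OF \<beta>(1)] by simp
      then have y: "restrict y H2 \<in> topspace (PT H2)" using H(2) by (auto simp: PiE_iff)
      have "(\<integral>\<^sup>+x. ennreal (J (mix (H1 \<union> H2) (mix H1 x y) z) w) \<partial>\<alpha>) = (\<integral>\<^sup>+x. g (mix H1 (restrict x H1) (restrict y H2)) \<partial>\<alpha>)"
      proof (rule nn_integral_cong)
        fix x
        have "mix ?E (mix H1 x y) z = mix ?E (mix H1 (restrict x H1) (restrict y H2)) z" by (auto simp: mix_def)
        then show "ennreal (J (mix ?E (mix H1 x y) z) w) = g (mix H1 (restrict x H1) (restrict y H2))" by (simp add: g_def)
      qed
      also have "\<dots> = h (restrict y H2)"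
        unfolding h_def using borel_measurable_section[OF y gm]
        by (intro nn_integral_marginal[OF H(1) \<alpha>(1), symmetric]) simp
      finally show "(\<integral>\<^sup>+x. ennreal (J (mix ?E (mix H1 x y) z) w) \<partial>\<alpha>) = h (restrict y H2)" .
    qed
    also have "\<dots> = (\<integral>\<^sup>+y. h y \<partial>marginal X H2 \<beta>)" by (rule nn_integral_marginal[OF H(2) \<beta>(1) hm, symmetric])
    also have "\<dots> \<le> c * d * (\<Sum>\<rho> | partition_on ?E \<rho>. \<integral>\<^sup>+t. g t \<partial>marginal_product X \<rho> P)"
    proof -
      have "dominated H1 c (marginal X H1 \<alpha>) P" "dominated H2 d (marginal X H2 \<beta>) P"
        using \<alpha>(2) \<beta>(2) 3 unfolding tame_def by blast+
      then show ?thesis unfolding h_def by (rule pair_dominated[OF H(3) E t1 t2 P _ _ g])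
    qed
    also have "\<dots> < \<infinity>"
    proof -
      have "(\<Sum>\<rho> | partition_on ?E \<rho>. \<integral>\<^sup>+t. g t \<partial>marginal_product X \<rho> P) < \<infinity>"
        unfolding infinity_ennreal_def ennreal_sum_less_top[OF finite_partitions[OF E]] g_def
      proof
        fix \<rho> assume "\<rho> \<in> {\<rho>. partition_on ?E \<rho>}"
        then have "partition_on ?E \<rho>" by simp
        from integ_sub[OF P prob all E this z w]
        show "(\<integral>\<^sup>+t. ennreal (J (mix ?E t z) w) \<partial>marginal_product X \<rho> P) < top"
          unfolding infinity_ennreal_def .
      qed
      moreover have "c < \<infinity>" "d < \<infinity>" using \<alpha>(2) \<beta>(2) unfolding tame_def by blast+
      ultimately show ?thesis by (simp add: ennreal_mult_less_top)
    qed
    finally show ?thesis .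
  qed
qed

text \<open>\<open>J_bound\<close> is applied to the two mixed points with \<open>x2\<close> as base
  point. In its term for \<open>H\<close>, the coordinates in \<open>H \<inter> F\<close> come from
  \<open>x\<close>, those in \<open>G - H\<close> from \<open>y\<close>, and the rest from the fixed
  points; the first two sets are disjoint, as the estimate of single terms requires.\<close>

lemma pair_finite:
  assumes P: "tight T P" and prob: "emeasure P S = 1"
    and all: "\<And>\<rho>. partition_on {1..n} \<rho> \<Longrightarrow> integ (marginal_product X \<rho> P)"
    and \<alpha>: "tight T \<alpha>" "tame c \<alpha> P" "integ \<alpha>" and \<beta>: "tight T \<beta>" "tame d \<beta> P" "integ \<beta>"
    and FG: "F \<subseteq> {1..n}" "G \<subseteq> {1..n}" and x2: "x2 \<in> S" and y2: "y2 \<in> S"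
  shows "(\<integral>\<^sup>+y. (\<integral>\<^sup>+x. ennreal \<bar>J (mix F x x2) (mix G y y2)\<bar> \<partial>\<alpha>) \<partial>\<beta>) < \<infinity>"
proof -
  define t where "t H x y = ennreal (J (mix (H \<inter> F \<union> (G - H)) (mix (H \<inter> F) x y) (mix H x2 y2)) x2)" for H x y
  have eq: "mix H (mix F x x2) (mix G y y2) = mix (H \<inter> F \<union> (G - H)) (mix (H \<inter> F) x y) (mix H x2 y2)" for H x y
    by (auto simp: mix_def fun_eq_iff)
  have z: "mix H x2 y2 \<in> S" for H using mix_in[OF x2 y2] .
  have HT: "Hausdorff_space T" using hausdorff_PT by simp
  have tm: "(\<lambda>p. t H (fst p) (snd p)) \<in> borel_measurable (borel_alg (prod_topology T T))" for H
  proof -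
    let ?E = "H \<inter> F \<union> (G - H)" and ?A = "H \<inter> F"
    have "continuous_map (prod_topology T T) T (\<lambda>p. mix ?E (mix ?A (fst p) (snd p)) (mix H x2 y2))"
    proof (rule continuous_map_into_product)
      fix k assume k: "k \<in> {1..n}"
      have zk: "mix H x2 y2 k \<in> topspace (X k)" using z[of H] k by (auto simp: PiE_iff)
      show "continuous_map (prod_topology T T) (X k) (\<lambda>p. mix ?E (mix ?A (fst p) (snd p)) (mix H x2 y2) k)"
        using k zk continuous_map_fst_coord[OF k, of X T] continuous_map_snd_coord[OF k, of T X]
        by (cases "k \<in> ?E"; cases "k \<in> ?A") (simp_all add: mix_def[of ?E] mix_def[of ?A])
    next
      fix p assume "p \<in> topspace (prod_topology T T)"
      then have "fst p \<in> S" "snd p \<in> S" by (auto simp: mem_Times_iff)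
      from mix_in[OF mix_in[OF this] z] show "mix ?E (mix ?A (fst p) (snd p)) (mix H x2 y2) \<in> extensional {1..n}"
        by (rule S_ext)
    qed
    from continuous_map_borel_measurable[OF cont_J_compose[OF this, of "\<lambda>_. x2"]] x2
    show ?thesis by (simp add: t_def)
  qed
  have sm: "(\<lambda>x. t H x y) \<in> borel_measurable \<alpha>" if "y \<in> S" for H y
    unfolding measurable_tight[OF \<alpha>(1)] using borel_measurable_section[OF that tm] by simp
  have om: "(\<lambda>y. \<integral>\<^sup>+x. t H x y \<partial>\<alpha>) \<in> borel_measurable \<beta>" for H
    unfolding measurable_tight[OF \<beta>(1)] using borel_measurable_nn_integral_tight[OF HT \<alpha>(1) tm, of H] by simp
  have "(\<integral>\<^sup>+y. (\<integral>\<^sup>+x. ennreal \<bar>J (mix F x x2) (mix G y y2)\<bar> \<partial>\<alpha>) \<partial>\<beta>) \<le>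
    (\<integral>\<^sup>+y. ennreal (2 ^ n) * (\<Sum>H\<in>Pow {1..n}. \<integral>\<^sup>+x. t H x y \<partial>\<alpha>) \<partial>\<beta>)"
  proof (rule nn_integral_mono)
    fix y assume "y \<in> space \<beta>"
    then have y: "y \<in> S" using tight_space[OF \<beta>(1)] by simp
    have "(\<integral>\<^sup>+x. ennreal \<bar>J (mix F x x2) (mix G y y2)\<bar> \<partial>\<alpha>) \<le> (\<integral>\<^sup>+x. ennreal (2 ^ n) * (\<Sum>H\<in>Pow {1..n}. t H x y) \<partial>\<alpha>)"
    proof (rule nn_integral_mono)
      fix x assume "x \<in> space \<alpha>"
      then have x: "x \<in> S" using tight_space[OF \<alpha>(1)] by simp
      note uv = mix_in[OF x x2, of F] mix_in[OF y y2, of G]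
      have nn: "0 \<le> J (mix H (mix F x x2) (mix G y y2)) x2" for H using J_nonneg[OF mix_in[OF uv] x2] .
      have "ennreal \<bar>J (mix F x x2) (mix G y y2)\<bar> = ennreal (J (mix F x x2) (mix G y y2))" using J_nonneg[OF uv] by simp
      also have "\<dots> \<le> ennreal (2 ^ n * (\<Sum>H\<in>Pow {1..n}. J (mix H (mix F x x2) (mix G y y2)) x2))"
        using J_bound[OF uv x2] by (rule ennreal_leI)
      also have "\<dots> = ennreal (2 ^ n) * (\<Sum>H\<in>Pow {1..n}. ennreal (J (mix H (mix F x x2) (mix G y y2)) x2))"
        using nn by (simp add: ennreal_mult sum_nonneg)
      finally show "ennreal \<bar>J (mix F x x2) (mix G y y2)\<bar> \<le> ennreal (2 ^ n) * (\<Sum>H\<in>Pow {1..n}. t H x y)"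
        unfolding t_def eq .
    qed
    also have "\<dots> = ennreal (2 ^ n) * (\<Sum>H\<in>Pow {1..n}. \<integral>\<^sup>+x. t H x y \<partial>\<alpha>)"
      using sm[OF y] by (simp add: nn_integral_cmult nn_integral_sum)
    finally show "(\<integral>\<^sup>+x. ennreal \<bar>J (mix F x x2) (mix G y y2)\<bar> \<partial>\<alpha>) \<le> ennreal (2 ^ n) * (\<Sum>H\<in>Pow {1..n}. \<integral>\<^sup>+x. t H x y \<partial>\<alpha>)" .
  qed
  also have "\<dots> = ennreal (2 ^ n) * (\<Sum>H\<in>Pow {1..n}. \<integral>\<^sup>+y. (\<integral>\<^sup>+x. t H x y \<partial>\<alpha>) \<partial>\<beta>)"
    using om by (simp add: nn_integral_cmult nn_integral_sum)
  also have "\<dots> < \<infinity>"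
  proof -
    have "(\<integral>\<^sup>+y. (\<integral>\<^sup>+x. t H x y \<partial>\<alpha>) \<partial>\<beta>) < \<infinity>" for H
      unfolding t_def using FG by (intro pair_term_finite[OF P prob all \<alpha> \<beta> _ _ _ z x2]) auto
    then have "(\<Sum>H\<in>Pow {1..n}. \<integral>\<^sup>+y. (\<integral>\<^sup>+x. t H x y \<partial>\<alpha>) \<partial>\<beta>) < top"
      by (subst ennreal_sum_less_top) auto
    then show ?thesis by (auto simp: ennreal_mult_less_top)
  qed
  finally show ?thesis .
qed

text \<open>Both product measures in FIP satisfy what is assumed of the variation of
  \<open>\<nu>\<close>. For the one-block partition they are that variation; otherwise they are
  dominated by products of marginals of \<open>P\<close>, which gives integrability and tameness.
  FIP then reduces to the estimate for pairs.\<close>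

lemma FIP_of_tame:
  assumes P: "tight T P" and prob: "emeasure P S = 1"
    and all: "\<And>\<rho>. partition_on {1..n} \<rho> \<Longrightarrow> integ (marginal_product X \<rho> P)"
    and \<nu>: "\<nu> \<in> radon_signed T" and t: "tame c (variation T \<nu>) P" and i: "integ (variation T \<nu>)"
  shows "FIP X n J \<nu>"
proof -
  let ?v = "variation T \<nu>"
  have HT: "Hausdorff_space T" using hausdorff_PT by simp
  have v: "tight T ?v" using radon_signedD(2)[OF HT \<nu>] .
  have ne: "{1..n} \<noteq> {}" using n_pos by simp
  have good: "tight T (marginal_product X \<pi> ?v) \<and> (\<exists>c. tame c (marginal_product X \<pi> ?v) P) \<and> integ (marginal_product X \<pi> ?v)"
    if \<pi>: "partition_on {1..n} \<pi>" for \<pi>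
  proof (cases "{1..n} \<in> \<pi>")
    case True
    have "B = {1..n}" if "B \<in> \<pi>" for B
    proof (rule ccontr)
      assume "B \<noteq> {1..n}"
      then have "B \<inter> {1..n} = {}" using \<pi> True that by (auto simp: partition_on_def disjoint_def)
      moreover have "B \<subseteq> {1..n}" "B \<noteq> {}" using \<pi> that by (auto simp: partition_on_def)
      ultimately show False by auto
    qed
    then have "\<pi> = {{1..n}}" using True by blast
    then show ?thesis using v t i marginal_product_trivial[OF v ne] by auto
  next
    case False
    let ?a = "marginal_product X \<pi> ?v"
    have ta: "tight T ?a" using tight_marginal_product[OF \<pi> order_refl order_refl v] .
    obtain d where d: "d < \<infinity>" "dominated {1..n} d ?a P"
      using marginal_product_dominated[OF v P t \<pi> order_refl False] by blast
    have "integ ?a"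
      unfolding integ_def
    proof (intro allI impI ballI)
      fix F z w assume F: "F \<subseteq> {1..n}" and zw: "z \<in> S" "w \<in> S"
      have "(\<lambda>x. ennreal (J (mix F x z) w)) \<in> borel_measurable (borel_alg T)"
        using continuous_map_borel_measurable[OF cont_J_compose[OF cont_mix[OF zw(1), of F], of "\<lambda>_. w"]] zw(2) by simp
      from nn_integral_dominated[OF order_refl ta P d(2) this]
      have "(\<integral>\<^sup>+x. ennreal (J (mix F x z) w) \<partial>?a) \<le> d * (\<Sum>\<rho> | partition_on {1..n} \<rho>. \<integral>\<^sup>+x. ennreal (J (mix F x z) w) \<partial>marginal_product X \<rho> P)" .
      also have "\<dots> < \<infinity>"
      proof -
        have "(\<Sum>\<rho> | partition_on {1..n} \<rho>. \<integral>\<^sup>+x. ennreal (J (mix F x z) w) \<partial>marginal_product X \<rho> P) < top"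
          unfolding ennreal_sum_less_top[OF finite_partitions[OF order_refl]] using integD[OF all F zw] by simp
        then show ?thesis using d(1) by (auto simp: ennreal_mult_less_top)
      qed
      finally show "(\<integral>\<^sup>+x. ennreal (J (mix F x z) w) \<partial>?a) < \<infinity>" .
    qed
    then show ?thesis using ta tame_of_dominated[OF ta P prob d(2,1)] by blast
  qed
  show ?thesis
    unfolding FIP_def
  proof (intro conjI ballI allI impI)
    show "(\<lambda>(x, y). J x y) \<in> borel_measurable (borel_alg (prod_topology T T))"
      using cont_J by (rule continuous_map_borel_measurable)
    fix x2 y2 F G \<pi> \<sigma>
    assume a: "x2 \<in> S" "y2 \<in> S" "F \<subseteq> {1..n}" "G \<subseteq> {1..n}" "partition_on {1..n} \<pi> \<and> partition_on {1..n} \<sigma>"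
    obtain c d where cd: "tame c (marginal_product X \<pi> ?v) P" "tame d (marginal_product X \<sigma> ?v) P"
      using good a(5) by blast
    have g: "tight T (marginal_product X \<pi> ?v)" "integ (marginal_product X \<pi> ?v)"
      "tight T (marginal_product X \<sigma> ?v)" "integ (marginal_product X \<sigma> ?v)" using good a(5) by auto
    show "(\<integral>\<^sup>+y1. (\<integral>\<^sup>+x1. ennreal \<bar>J (mix F x1 x2) (mix G y1 y2)\<bar> \<partial>marginal_product X \<pi> ?v) \<partial>marginal_product X \<sigma> ?v) < \<infinity>"
      by (rule pair_finite[OF P prob all g(1) cd(1) g(2) g(3) cd(2) g(4) a(3,4,1,2)])
  qed
qed

end

subsection \<open>Energies of signed measures\<close>

context pdi_kernel
begin

lemma T_hausdorff: "Hausdorff_space T"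
  using hausdorff_PT by simp

lemma cont_J_right: "w \<in> S \<Longrightarrow> continuous_map T euclideanreal (\<lambda>u. J u w)"
  by (rule cont_J_compose) simp_all

lemma mix_full: "x \<in> S \<Longrightarrow> z \<in> S \<Longrightarrow> mix {1..n} x z = x"
  by (auto simp: mix_def fun_eq_iff PiE_iff extensional_def)

lemma nn_integral_abs_J:
  assumes "\<mu> \<in> radon_signed T" "\<And>u. u \<in> S \<Longrightarrow> f u \<in> S" "w \<in> S"
  shows "(\<integral>\<^sup>+u. ennreal \<bar>J (f u) w\<bar> \<partial>variation T \<mu>) = (\<integral>\<^sup>+u. ennreal (J (f u) w) \<partial>variation T \<mu>)"
  using assms J_nonneg by (intro nn_integral_cong) simp

lemma integ_J:
  assumes \<mu>: "\<mu> \<in> radon_signed T" and i: "integ (variation T \<mu>)" and F: "F \<subseteq> {1..n}" and z: "z \<in> S" and w: "w \<in> S"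
  shows "integrable (variation T \<mu>) (\<lambda>u. J (mix F u z) w)"
proof -
  have "continuous_map T euclideanreal (\<lambda>u. J (mix F u z) w)" using w by (intro cont_J_compose cont_mix[OF z]) simp
  from integrable_variation_iff[OF continuous_map_borel_measurable[OF this], of \<mu>]
  show ?thesis using nn_integral_abs_J[OF \<mu> mix_in[OF _ z] w] integD[OF i F z w] by simp
qed

text \<open>The diagonal of \<open>K\<close> is a multiple of \<open>J\<close> with one argument
  fixed, hence integrable. As \<open>sqrt k\<close> is at most \<open>1 + k\<close> and the
  variation is finite, so is its root.\<close>

lemma sqrt_kernel_integrable:
  assumes \<mu>: "\<mu> \<in> radon_signed T" and i: "integ (variation T \<mu>)" and w: "w \<in> S"
  shows "integrable (variation T \<mu>) (\<lambda>x. sqrt (kernel_K n J w x x))"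
proof (rule Bochner_Integration.integrable_bound)
  interpret finite_measure "variation T \<mu>" using radon_signedD(2)[OF T_hausdorff \<mu>] by (rule tight_finite)
  show "integrable (variation T \<mu>) (\<lambda>x. 1 + 2 ^ n * J (mix {1..n} x w) w)"
    by (intro Bochner_Integration.integrable_add integrable_mult_right integrable_const integ_J[OF \<mu> i order_refl w w])
  have "(\<lambda>x. sqrt (kernel_K n J w x x)) \<in> borel_measurable (borel_alg T)"
    using diag_measurable[OF T_hausdorff kernel_K_psd[OF w] kernel_K_cont[OF w]] by simp
  then show "(\<lambda>x. sqrt (kernel_K n J w x x)) \<in> borel_measurable (variation T \<mu>)"
    unfolding measurable_cong_sets[OF sets_variation refl, of T \<mu>] .
  have "norm (sqrt (kernel_K n J w x x)) \<le> norm (1 + 2 ^ n * J (mix {1..n} x w) w)" if "x \<in> space (variation T \<mu>)" for x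
  proof -
    have x: "x \<in> S" using that by simp
    define k where "k = kernel_K n J w x x"
    have k: "k = 2 ^ n * J (mix {1..n} x w) w" unfolding k_def kernel_K_diagonal[OF x w] mix_full[OF x w] ..
    have k0: "0 \<le> k" using J_nonneg[OF mix_in[OF x w] w] unfolding k by simp
    have "k \<le> (1 + k)\<^sup>2" using k0 by (simp add: power2_eq_square algebra_simps)
    then have "sqrt k \<le> sqrt ((1 + k)\<^sup>2)" by (rule real_sqrt_le_mono)
    then have "sqrt k \<le> 1 + k" using k0 by simp
    then show ?thesis using k0 unfolding k_def[symmetric] k[symmetric] by simp
  qed
  then show "AE x in variation T \<mu>. norm (sqrt (kernel_K n J w x x)) \<le> norm (1 + 2 ^ n * J (mix {1..n} x w) w)"
    by (rule AE_I2)
qed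

text \<open>A measure in \<open>radon_Mn\<close> has vanishing proper marginals on boxes, hence everywhere.\<close>

lemma radon_Mn_annihilates:
  assumes \<eta>: "\<eta> \<in> radon_Mn X n" and F: "F \<subset> {1..n}" and z: "z \<in> S" and g: "g \<in> borel_measurable (borel_alg T)"
  shows "signed_integral T \<eta> (\<lambda>v. g (mix F v z)) = 0"
proof -
  let ?\<phi> = "\<lambda>v. mix F v z"
  have \<eta>r: "\<eta> \<in> radon_signed T" using \<eta> by (simp add: radon_Mn_def)
  note tp = tight_pos_part[OF T_hausdorff \<eta>r] and tn = tight_neg_part[OF T_hausdorff \<eta>r]
  have \<phi>: "?\<phi> \<in> measurable (borel_alg T) (borel_alg T)" using cont_mix[OF z] by (rule continuous_map_measurable)
  have \<phi>p: "?\<phi> \<in> measurable (pos_part T \<eta>) (borel_alg T)" and \<phi>n: "?\<phi> \<in> measurable (neg_part T \<eta>) (borel_alg T)"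
    using \<phi> by (simp_all only: measurable_tight[OF tp] measurable_tight[OF tn])
  have "distr (pos_part T \<eta>) (borel_alg T) ?\<phi> = distr (neg_part T \<eta>) (borel_alg T) ?\<phi>"
  proof (rule tight_eqI_boxes[OF order_refl])
    show "tight T (distr (pos_part T \<eta>) (borel_alg T) ?\<phi>)" "tight T (distr (neg_part T \<eta>) (borel_alg T) ?\<phi>)"
      using tight_distr[OF tp cont_mix[OF z] T_hausdorff T_hausdorff] tight_distr[OF tn cont_mix[OF z] T_hausdorff T_hausdorff] .
    fix A assume A: "\<And>i. i \<in> {1..n} \<Longrightarrow> openin (X i) (A i)"
    let ?B = "?\<phi> -` PiE {1..n} A \<inter> S"
    have box: "PiE {1..n} A \<in> sets (borel_alg T)" using box_borel[OF order_refl A] by simp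
    have B: "?B \<in> sets (borel_alg T)" using measurable_sets[OF \<phi> box] by simp
    have AS: "A i \<subseteq> topspace (X i)" if "i \<in> {1..n}" for i using A[OF that] by (rule openin_subset)
    \<comment> \<open>If \<open>z\<close> satisfies the constraints outside \<open>F\<close>, the
      preimage is a box with full factors outside \<open>F\<close>, of which there is at least one;
      otherwise it is empty. Where \<open>\<eta>\<close> vanishes, its positive and negative parts
      agree.\<close>
    have "\<eta> ?B = 0"
    proof (cases "\<forall>i\<in>{1..n} - F. z i \<in> A i")
      case True
      define A' where "A' i = (if i \<in> F then A i else topspace (X i))" for i
      have "?B = PiE {1..n} A'"
      proof (intro set_eqI iffI)
        fix v assume v: "v \<in> ?B"
        then have vS: "v \<in> S" and vA: "\<And>i. i \<in> {1..n} \<Longrightarrow> mix F v z i \<in> A i" by auto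
        show "v \<in> PiE {1..n} A'"
        proof (rule PiE_I)
          fix i assume i: "i \<in> {1..n}"
          show "v i \<in> A' i" using vA[OF i] PiE_mem[OF vS[unfolded topspace_product_topology] i] by (cases "i \<in> F") (simp_all add: A'_def mix_def)
        next
          fix i assume "i \<notin> {1..n}"
          then show "v i = undefined" using S_ext[OF vS] by (simp add: extensional_def)
        qed
      next
        fix v assume v: "v \<in> PiE {1..n} A'"
        have v1: "v i \<in> A' i" if "i \<in> {1..n}" for i using PiE_mem[OF v that] .
        have vS: "v \<in> S"
        proof -
          have "v i \<in> topspace (X i)" if "i \<in> {1..n}" for i
            using v1[OF that] AS[OF that] by (cases "i \<in> F") (auto simp: A'_def)
          then show ?thesis using v by (simp add: PiE_iff)
        qed
        have "mix F v z i \<in> A i" if "i \<in> {1..n}" for i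
          using v1[OF that] True that by (cases "i \<in> F") (auto simp: A'_def mix_def)
        then show "v \<in> ?B" using vS S_ext[OF mix_in[OF vS z]] by (simp add: PiE_iff)
      qed
      moreover have "\<exists>j\<in>{1..n}. A' j = topspace (X j)"
      proof -
        obtain j where "j \<in> {1..n}" "j \<notin> F" using F by blast
        then show ?thesis by (intro bexI[of _ j]) (simp add: A'_def)
      qed
      moreover have "A' i \<in> sets (borel_alg (X i))" if "i \<in> {1..n}" for i
        using A[OF that] by (simp add: A'_def openin_in_borel_alg)
      ultimately show ?thesis using \<eta> unfolding radon_Mn_def by simp
    next
      case False
      then obtain i where i: "i \<in> {1..n}" "i \<notin> F" "z i \<notin> A i" by auto
      have "?B = {}"
      proof (rule ccontr)
        assume "?B \<noteq> {}"
        then obtain v where "mix F v z \<in> PiE {1..n} A" by auto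
        from PiE_mem[OF this i(1)] show False using i by (simp add: mix_def)
      qed
      then show ?thesis using signed_measure_empty[OF radon_signedD(1)[OF T_hausdorff \<eta>r]] by simp
    qed
    then have "emeasure (pos_part T \<eta>) ?B = emeasure (neg_part T \<eta>) ?B"
      using emeasure_pos_part[OF T_hausdorff \<eta>r B] emeasure_neg_part[OF T_hausdorff \<eta>r B] by simp
    then show "emeasure (distr (pos_part T \<eta>) (borel_alg T) ?\<phi>) (PiE {1..n} A) = emeasure (distr (neg_part T \<eta>) (borel_alg T) ?\<phi>) (PiE {1..n} A)"
      unfolding emeasure_distr[OF \<phi>p box] emeasure_distr[OF \<phi>n box] tight_space[OF tp] tight_space[OF tn] .
  qed
  moreover have "(\<integral>v. g (?\<phi> v) \<partial>pos_part T \<eta>) = integral\<^sup>L (distr (pos_part T \<eta>) (borel_alg T) ?\<phi>) g"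
    using integral_distr[OF \<phi>p g] by simp
  moreover have "(\<integral>v. g (?\<phi> v) \<partial>neg_part T \<eta>) = integral\<^sup>L (distr (neg_part T \<eta>) (borel_alg T) ?\<phi>) g"
    using integral_distr[OF \<phi>n g] by simp
  ultimately show ?thesis by (simp add: signed_integral_def)
qed

text \<open>For each \<open>v\<close>, \<open>\<mu>\<close> removes the terms with proper
  \<open>F\<close>. What remains is a sum over \<open>G\<close> of the potential \<open>h\<close> of
  \<open>\<mu>\<close> at \<open>mix G v z\<close>, where \<open>\<eta>\<close> removes the proper
  \<open>G\<close>. The premise \<open>jnt\<close> makes every summand integrable against
  \<open>\<eta>\<close>, so that the outer integral can be split.\<close>

lemma double_integral_J_eq_K:
  assumes \<mu>: "\<mu> \<in> radon_Mn X n" and \<eta>: "\<eta> \<in> radon_Mn X n"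
    and i: "integ (variation T \<mu>)" and z: "z \<in> S"
    and jnt: "\<And>G. G \<subseteq> {1..n} \<Longrightarrow> (\<integral>\<^sup>+v. (\<integral>\<^sup>+u. ennreal \<bar>J u (mix G v z)\<bar> \<partial>variation T \<mu>) \<partial>variation T \<eta>) < \<infinity>"
  shows "double_integral T (\<lambda>u v. (-1) ^ n * J u v) \<mu> \<eta> = double_integral T (kernel_K n J z) \<mu> \<eta>"
proof -
  let ?P = "Pow {1..n}"
  have \<mu>r: "\<mu> \<in> radon_signed T" and \<eta>r: "\<eta> \<in> radon_signed T" using \<mu> \<eta> by (simp_all add: radon_Mn_def)
  note H = T_hausdorff
  define h where "h w = signed_integral T \<mu> (\<lambda>u. J u w)" for w
  have int: "integrable (variation T \<mu>) (\<lambda>u. J (mix F u z) w)" if "F \<subseteq> {1..n}" "w \<in> S" for F w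
    using integ_J[OF \<mu>r i that(1) z that(2)] .
  have inner: "signed_integral T \<mu> (\<lambda>u. kernel_K n J z u v) = (\<Sum>G\<in>?P. sgnF G * (-1) ^ n * h (mix G v z))" if v: "v \<in> S" for v
  proof -
    have "signed_integral T \<mu> (\<lambda>u. kernel_K n J z u v) =
      signed_integral T \<mu> (\<lambda>u. \<Sum>F\<in>?P. \<Sum>G\<in>?P. sgnF F * sgnF G * (-1) ^ n * J (mix F u z) (mix G v z))"
      using kernel_K_expand[OF z _ v] by (intro signed_integral_cong[OF H \<mu>r]) (simp add: mult.assoc)
    also have "\<dots> = (\<Sum>F\<in>?P. signed_integral T \<mu> (\<lambda>u. \<Sum>G\<in>?P. sgnF F * sgnF G * (-1) ^ n * J (mix F u z) (mix G v z)))"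
      using int mix_in[OF v z] by (intro signed_integral_sum[OF H \<mu>r] Bochner_Integration.integrable_sum integrable_mult_right) auto
    also have "\<dots> = (\<Sum>F\<in>?P. \<Sum>G\<in>?P. signed_integral T \<mu> (\<lambda>u. sgnF F * sgnF G * (-1) ^ n * J (mix F u z) (mix G v z)))"
      using int mix_in[OF v z] by (intro sum.cong refl signed_integral_sum[OF H \<mu>r] integrable_mult_right) auto
    also have "\<dots> = (\<Sum>F\<in>?P. \<Sum>G\<in>?P. sgnF F * sgnF G * (-1) ^ n * signed_integral T \<mu> (\<lambda>u. J (mix F u z) (mix G v z)))"
      by (simp only: signed_integral_cmult[OF H])
    also have "\<dots> = (\<Sum>F\<in>{{1..n}}. \<Sum>G\<in>?P. sgnF F * sgnF G * (-1) ^ n * signed_integral T \<mu> (\<lambda>u. J (mix F u z) (mix G v z)))"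
    proof (rule sum.mono_neutral_right)
      show "\<forall>F\<in>?P - {{1..n}}. (\<Sum>G\<in>?P. sgnF F * sgnF G * (-1) ^ n * signed_integral T \<mu> (\<lambda>u. J (mix F u z) (mix G v z))) = 0"
      proof
        fix F assume "F \<in> ?P - {{1..n}}"
        then have F: "F \<subset> {1..n}" by auto
        have "signed_integral T \<mu> (\<lambda>u. J (mix F u z) (mix G v z)) = 0" for G
          by (rule radon_Mn_annihilates[OF \<mu> F z continuous_map_borel_measurable[OF cont_J_right[OF mix_in[OF v z]]]])
        then show "(\<Sum>G\<in>?P. sgnF F * sgnF G * (-1) ^ n * signed_integral T \<mu> (\<lambda>u. J (mix F u z) (mix G v z))) = 0" by simp
      qed
    qed auto
    also have "\<dots> = (\<Sum>G\<in>?P. sgnF G * (-1) ^ n * signed_integral T \<mu> (\<lambda>u. J (mix {1..n} u z) (mix G v z)))" by simp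
    also have "\<dots> = (\<Sum>G\<in>?P. sgnF G * (-1) ^ n * h (mix G v z))"
      unfolding h_def by (intro sum.cong refl arg_cong2[where f="(*)"] signed_integral_cong[OF H \<mu>r]) (simp only: mix_full[OF _ z])
    finally show ?thesis .
  qed
  have fb: "(\<lambda>p. J (fst p) (mix G (snd p) z)) \<in> borel_measurable (borel_alg (prod_topology T T))" for G
  proof -
    have "continuous_map (prod_topology T T) T (\<lambda>p. mix G (snd p) z)"
      using continuous_map_compose[OF continuous_map_snd cont_mix[OF z, of G], of T] by (simp add: o_def)
    then show ?thesis by (intro continuous_map_borel_measurable cont_J_compose continuous_map_fst)
  qed
  have hb: "(\<lambda>v. h (mix G v z)) \<in> borel_measurable (borel_alg T)" for G
    unfolding h_def using borel_measurable_signed_integral[OF H \<mu>r fb[of G]] by simp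
  have hw: "h \<in> borel_measurable (borel_alg T)"
    using borel_measurable_signed_integral[OF H \<mu>r continuous_map_borel_measurable[OF cont_J]]
    unfolding h_def[abs_def] by simp
  have hint: "integrable (variation T \<eta>) (\<lambda>v. h (mix G v z))" if G: "G \<subseteq> {1..n}" for G
  proof -
    have "(\<integral>\<^sup>+v. ennreal \<bar>h (mix G v z)\<bar> \<partial>variation T \<eta>) \<le> (\<integral>\<^sup>+v. (\<integral>\<^sup>+u. ennreal \<bar>J u (mix G v z)\<bar> \<partial>variation T \<mu>) \<partial>variation T \<eta>)"
    proof (rule nn_integral_mono)
      fix v assume "v \<in> space (variation T \<eta>)"
      then have w: "mix G v z \<in> S" using mix_in[OF _ z] by simp
      have ii: "integrable (variation T \<mu>) (\<lambda>u. J u (mix G v z))"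
      proof -
        have "integrable (variation T \<mu>) (\<lambda>u. J (mix {1..n} u z) (mix G v z)) \<longleftrightarrow> integrable (variation T \<mu>) (\<lambda>u. J u (mix G v z))"
          using mix_full[OF _ z] by (intro Bochner_Integration.integrable_cong refl) simp
        then show ?thesis using int[OF order_refl w] by simp
      qed
      have "ennreal \<bar>h (mix G v z)\<bar> \<le> ennreal (\<integral>u. \<bar>J u (mix G v z)\<bar> \<partial>variation T \<mu>)"
        unfolding h_def using signed_integral_abs_le[OF H \<mu>r ii] by (rule ennreal_leI)
      also have "\<dots> = (\<integral>\<^sup>+u. ennreal \<bar>J u (mix G v z)\<bar> \<partial>variation T \<mu>)"
        using ii by (intro nn_integral_eq_integral[symmetric]) auto
      finally show "ennreal \<bar>h (mix G v z)\<bar> \<le> (\<integral>\<^sup>+u. ennreal \<bar>J u (mix G v z)\<bar> \<partial>variation T \<mu>)" .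
    qed
    also have "\<dots> < \<infinity>" using jnt[OF G] .
    finally show ?thesis using integrable_variation_iff[OF hb, of \<eta> G] by simp
  qed
  have "double_integral T (kernel_K n J z) \<mu> \<eta> = signed_integral T \<eta> (\<lambda>v. \<Sum>G\<in>?P. sgnF G * (-1) ^ n * h (mix G v z))"
    unfolding double_integral_def by (rule signed_integral_cong[OF H \<eta>r inner])
  also have "\<dots> = (\<Sum>G\<in>?P. signed_integral T \<eta> (\<lambda>v. sgnF G * (-1) ^ n * h (mix G v z)))"
    using hint by (intro signed_integral_sum[OF H \<eta>r] integrable_mult_right) auto
  also have "\<dots> = (\<Sum>G\<in>?P. sgnF G * (-1) ^ n * signed_integral T \<eta> (\<lambda>v. h (mix G v z)))"
    by (simp only: signed_integral_cmult[OF H])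
  also have "\<dots> = (\<Sum>G\<in>{{1..n}}. sgnF G * (-1) ^ n * signed_integral T \<eta> (\<lambda>v. h (mix G v z)))"
  proof (rule sum.mono_neutral_right)
    show "\<forall>G\<in>?P - {{1..n}}. sgnF G * (-1) ^ n * signed_integral T \<eta> (\<lambda>v. h (mix G v z)) = 0"
    proof
      fix G assume "G \<in> ?P - {{1..n}}"
      then have G: "G \<subset> {1..n}" by auto
      show "sgnF G * (-1) ^ n * signed_integral T \<eta> (\<lambda>v. h (mix G v z)) = 0"
        unfolding radon_Mn_annihilates[OF \<eta> G z hw] by simp
    qed
  qed auto
  also have "\<dots> = (-1) ^ n * signed_integral T \<eta> (\<lambda>v. h (mix {1..n} v z))" by simp
  also have "signed_integral T \<eta> (\<lambda>v. h (mix {1..n} v z)) = signed_integral T \<eta> h"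
    by (rule signed_integral_cong[OF H \<eta>r]) (simp only: mix_full[OF _ z])
  also have "(-1) ^ n * signed_integral T \<eta> h = double_integral T (\<lambda>u v. (-1) ^ n * J u v) \<mu> \<eta>"
    unfolding double_integral_def signed_integral_cmult[OF H] h_def ..
  finally show ?thesis ..
qed

section \<open>Delimited measures and linear combinations\<close>

lemma tame_of_delimited:
  assumes P: "tight T (variation T P)" and d: "marginally_delimited X n P \<mu>"
  shows "\<exists>c. tame c (variation T \<mu>) (variation T P)"
proof -
  obtain M where M: "M \<ge> 1" "\<And>F A. F \<subseteq> {1..n} \<Longrightarrow> card F \<le> n - 1 \<Longrightarrow> A \<in> sets (borel_alg (PT F)) \<Longrightarrow>
      emeasure (marginal X F (variation T \<mu>)) A \<le>
      ennreal M * (\<Sum>\<pi> | partition_on F \<pi>. emeasure (marginal_product X \<pi> (marginal X F (variation T P))) A)"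
    using d unfolding marginally_delimited_def by blast
  have "dominated F (ennreal M) (marginal X F (variation T \<mu>)) (variation T P)" if F: "F \<subset> {1..n}" for F
    unfolding dominated_def
  proof
    fix A assume A: "A \<in> sets (borel_alg (PT F))"
    have "card F < card {1..n}" using F by (intro psubset_card_mono) auto
    then have c: "card F \<le> n - 1" by simp
    have FI: "F \<subseteq> {1..n}" using F by auto
    have "marginal_product X \<pi> (marginal X F (variation T P)) = marginal_product X \<pi> (variation T P)" if "partition_on F \<pi>" for \<pi>
      using that by (intro marginal_product_marginal[OF _ FI P]) (auto simp: partition_on_def)
    then have "(\<Sum>\<pi> | partition_on F \<pi>. emeasure (marginal_product X \<pi> (marginal X F (variation T P))) A) =
       (\<Sum>\<pi> | partition_on F \<pi>. emeasure (marginal_product X \<pi> (variation T P)) A)" by (intro sum.cong refl) simp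
    then show "emeasure (marginal X F (variation T \<mu>)) A \<le> ennreal M * (\<Sum>\<pi> | partition_on F \<pi>. emeasure (marginal_product X \<pi> (variation T P)) A)"
      using M(2)[OF FI c A] by (simp only:)
  qed
  then have "tame (ennreal M) (variation T \<mu>) (variation T P)" unfolding tame_def by simp
  then show ?thesis ..
qed

lemma marginally_delimited_lincomb:
  assumes \<mu>: "\<mu> \<in> radon_signed T" "marginally_delimited X n P \<mu>"
    and \<eta>: "\<eta> \<in> radon_signed T" "marginally_delimited X n P \<eta>"
  shows "marginally_delimited X n P (\<lambda>A. a * \<mu> A + b * \<eta> A)"
proof -
  let ?\<nu> = "\<lambda>A. a * \<mu> A + b * \<eta> A"
  let ?R = "\<lambda>F A. \<Sum>\<pi> | partition_on F \<pi>. emeasure (marginal_product X \<pi> (marginal X F (variation T P))) A"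
  note H = T_hausdorff
  have \<nu>: "?\<nu> \<in> radon_signed T" using radon_signed_lincomb[OF H \<mu>(1) \<eta>(1)] .
  obtain M1 where M1: "M1 \<ge> 1" "\<And>F A. F \<subseteq> {1..n} \<Longrightarrow> card F \<le> n - 1 \<Longrightarrow> A \<in> sets (borel_alg (PT F)) \<Longrightarrow>
      emeasure (marginal X F (variation T \<mu>)) A \<le> ennreal M1 * ?R F A"
    using \<mu>(2) unfolding marginally_delimited_def by blast
  obtain M2 where M2: "M2 \<ge> 1" "\<And>F A. F \<subseteq> {1..n} \<Longrightarrow> card F \<le> n - 1 \<Longrightarrow> A \<in> sets (borel_alg (PT F)) \<Longrightarrow>
      emeasure (marginal X F (variation T \<eta>)) A \<le> ennreal M2 * ?R F A"
    using \<eta>(2) unfolding marginally_delimited_def by blast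
  \<comment> \<open>The added 1 ensures \<open>L \<ge> 1\<close>, as delimitation demands, also when
    \<open>a\<close> and \<open>b\<close> are 0.\<close>
  define L where "L = \<bar>a\<bar> * M1 + \<bar>b\<bar> * M2 + 1"
  have nn: "0 \<le> \<bar>a\<bar> * M1" "0 \<le> \<bar>b\<bar> * M2" using M1(1) M2(1) by auto
  have "emeasure (marginal X F (variation T ?\<nu>)) A \<le> ennreal L * ?R F A"
    if F: "F \<subseteq> {1..n}" "card F \<le> n - 1" and A: "A \<in> sets (borel_alg (PT F))" for F A
  proof -
    let ?A = "{x \<in> S. restrict x F \<in> A}"
    have "(\<lambda>x. restrict x F) -` A \<inter> space (borel_alg T) \<in> sets (borel_alg T)"
      using continuous_map_measurable[OF continuous_map_restrict_product[OF F(1)]] A by (rule measurable_sets)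
    moreover have "?A = (\<lambda>x. restrict x F) -` A \<inter> space (borel_alg T)" by auto
    ultimately have A': "?A \<in> sets (borel_alg T)" by (simp only:)
    note e = emeasure_marginal[OF F(1) radon_signedD(2)[OF H] A]
    have "emeasure (marginal X F (variation T ?\<nu>)) A = emeasure (variation T ?\<nu>) ?A" by (rule e[OF \<nu>])
    also have "\<dots> \<le> ennreal \<bar>a\<bar> * emeasure (variation T \<mu>) ?A + ennreal \<bar>b\<bar> * emeasure (variation T \<eta>) ?A"
      by (rule variation_lincomb_le[OF H radon_signedD(1)[OF H \<mu>(1)] radon_signedD(1)[OF H \<eta>(1)] A'])
    also have "\<dots> = ennreal \<bar>a\<bar> * emeasure (marginal X F (variation T \<mu>)) A + ennreal \<bar>b\<bar> * emeasure (marginal X F (variation T \<eta>)) A"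
      unfolding e[OF \<mu>(1)] e[OF \<eta>(1)] ..
    also have "\<dots> \<le> ennreal \<bar>a\<bar> * (ennreal M1 * ?R F A) + ennreal \<bar>b\<bar> * (ennreal M2 * ?R F A)"
      by (intro add_mono mult_left_mono M1(2)[OF F A] M2(2)[OF F A]) auto
    also have "\<dots> = (ennreal \<bar>a\<bar> * ennreal M1 + ennreal \<bar>b\<bar> * ennreal M2) * ?R F A"
      by (simp only: distrib_right mult.assoc)
    also have "\<dots> = ennreal (\<bar>a\<bar> * M1 + \<bar>b\<bar> * M2) * ?R F A"
      using M1(1) M2(1) nn by (simp add: ennreal_mult)
    also have "\<dots> \<le> ennreal L * ?R F A"
      by (intro mult_right_mono ennreal_leI) (simp_all add: L_def)
    finally show ?thesis .
  qed
  moreover have "1 \<le> L" using nn by (simp add: L_def)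
  ultimately show ?thesis unfolding marginally_delimited_def by blast
qed

lemma integ_lincomb:
  assumes \<mu>: "\<mu> \<in> radon_signed T" "integ (variation T \<mu>)" and \<eta>: "\<eta> \<in> radon_signed T" "integ (variation T \<eta>)"
  shows "integ (variation T (\<lambda>A. a * \<mu> A + b * \<eta> A))"
  unfolding integ_def
proof (intro allI impI ballI)
  fix F z w assume F: "F \<subseteq> {1..n}" and zw: "z \<in> S" "w \<in> S"
  have "continuous_map T euclideanreal (\<lambda>x. J (mix F x z) w)" using zw by (intro cont_J_compose cont_mix) simp_all
  from continuous_map_borel_measurable[OF this]
  have "(\<lambda>x. ennreal (J (mix F x z) w)) \<in> borel_measurable (borel_alg T)" by simp
  from nn_integral_variation_lincomb_le[OF T_hausdorff \<mu>(1) \<eta>(1) this, of a b]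
  have "(\<integral>\<^sup>+x. ennreal (J (mix F x z) w) \<partial>variation T (\<lambda>A. a * \<mu> A + b * \<eta> A)) \<le>
    ennreal (\<bar>a\<bar> + \<bar>b\<bar>) * ((\<integral>\<^sup>+x. ennreal (J (mix F x z) w) \<partial>variation T \<mu>) + (\<integral>\<^sup>+x. ennreal (J (mix F x z) w) \<partial>variation T \<eta>))" .
  also have "\<dots> < \<infinity>"
    using integD[OF \<mu>(2) F zw] integD[OF \<eta>(2) F zw] by (simp add: ennreal_mult_less_top)
  finally show "(\<integral>\<^sup>+x. ennreal (J (mix F x z) w) \<partial>variation T (\<lambda>A. a * \<mu> A + b * \<eta> A)) < \<infinity>" .
qed

lemma radon_Mn_lincomb:
  assumes "\<mu> \<in> radon_Mn X n" "\<eta> \<in> radon_Mn X n" shows "(\<lambda>A. a * \<mu> A + b * \<eta> A) \<in> radon_Mn X n"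
  using assms radon_signed_lincomb[OF T_hausdorff, of \<mu> \<eta> a b] unfolding radon_Mn_def by auto

text \<open>The common core of the statements for one measure and for delimited pairs, which differ
  only in how the joint integrability \<open>jnt\<close> is obtained.\<close>

lemma energy_identities:
  assumes \<mu>: "\<mu> \<in> radon_Mn X n" "integ (variation T \<mu>)" and \<eta>: "\<eta> \<in> radon_Mn X n" "integ (variation T \<eta>)" and z: "z \<in> S"
    and jnt: "\<And>G. G \<subseteq> {1..n} \<Longrightarrow> (\<integral>\<^sup>+v. (\<integral>\<^sup>+u. ennreal \<bar>J u (mix G v z)\<bar> \<partial>variation T \<mu>) \<partial>variation T \<eta>) < \<infinity>"
  shows "double_integrable T J \<mu> \<eta>" "double_integrable T (kernel_K n J z) \<mu> \<eta>"
    "double_integral T (\<lambda>u v. (-1) ^ n * J u v) \<mu> \<eta> = double_integral T (kernel_K n J z) \<mu> \<eta>"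
    "kernel_embedding T (kernel_K n J z) \<mu> \<in> rkhs_space S (kernel_K n J z)"
    "double_integral T (kernel_K n J z) \<mu> \<eta> =
      rkhs_inner S (kernel_K n J z) (kernel_embedding T (kernel_K n J z) \<mu>) (kernel_embedding T (kernel_K n J z) \<eta>)"
proof -
  have \<mu>r: "\<mu> \<in> radon_signed T" and \<eta>r: "\<eta> \<in> radon_signed T" using \<mu> \<eta> by (simp_all add: radon_Mn_def)
  note K = kernel_K_psd[OF z] kernel_K_cont[OF z]
  note s\<mu> = sqrt_kernel_integrable[OF \<mu>r \<mu>(2) z] and s\<eta> = sqrt_kernel_integrable[OF \<eta>r \<eta>(2) z]
  show "double_integrable T J \<mu> \<eta>"
    unfolding double_integrable_def
  proof
    show "(\<lambda>(u, v). J u v) \<in> borel_measurable (borel_alg (prod_topology T T))"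
      using cont_J by (rule continuous_map_borel_measurable)
    have "(\<integral>\<^sup>+v. (\<integral>\<^sup>+u. ennreal \<bar>J u v\<bar> \<partial>variation T \<mu>) \<partial>variation T \<eta>) =
      (\<integral>\<^sup>+v. (\<integral>\<^sup>+u. ennreal \<bar>J u (mix {1..n} v z)\<bar> \<partial>variation T \<mu>) \<partial>variation T \<eta>)"
      by (rule nn_integral_cong) (simp only: space_variation mix_full[OF _ z])
    then show "(\<integral>\<^sup>+v. (\<integral>\<^sup>+u. ennreal \<bar>J u v\<bar> \<partial>variation T \<mu>) \<partial>variation T \<eta>) < \<infinity>" using jnt[OF order_refl] by (simp only:)
  qed
  show "double_integrable T (kernel_K n J z) \<mu> \<eta>" by (rule double_integrable_kernel[OF T_hausdorff K s\<mu> s\<eta>])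
  show "double_integral T (\<lambda>u v. (-1) ^ n * J u v) \<mu> \<eta> = double_integral T (kernel_K n J z) \<mu> \<eta>"
    by (rule double_integral_J_eq_K[OF \<mu>(1) \<eta>(1) \<mu>(2) z jnt])
  show "kernel_embedding T (kernel_K n J z) \<mu> \<in> rkhs_space S (kernel_K n J z)"
    by (rule kernel_embedding_inner(1)[OF T_hausdorff K \<mu>r s\<mu>])
  show "double_integral T (kernel_K n J z) \<mu> \<eta> =
      rkhs_inner S (kernel_K n J z) (kernel_embedding T (kernel_K n J z) \<mu>) (kernel_embedding T (kernel_K n J z) \<eta>)"
    by (rule double_integral_rkhs_inner[OF T_hausdorff K \<mu>r s\<mu> \<eta>r s\<eta>])
qed

end

section \<open>The identities and the semi-inner product\<close>

context pdi_kernel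
begin

lemma Mn_FIPD:
  assumes "\<mu> \<in> Mn_FIP X n J"
  shows "\<mu> \<in> radon_signed T" "\<mu> \<in> radon_Mn X n" "FIP X n J \<mu>" "integ (variation T \<mu>)"
  using assms FIP_integ_variation[of \<mu>] by (simp_all add: Mn_FIP_def M_FIP_def)

text \<open>Supplies \<open>jnt\<close> for a single measure: FIP with one-block partitions and all
  coordinates of the first argument integrated.\<close>

lemma FIP_joint:
  assumes \<mu>: "\<mu> \<in> radon_signed T" and fip: "FIP X n J \<mu>" and z: "z \<in> S" and G: "G \<subseteq> {1..n}"
  shows "(\<integral>\<^sup>+v. (\<integral>\<^sup>+u. ennreal \<bar>J u (mix G v z)\<bar> \<partial>variation T \<mu>) \<partial>variation T \<mu>) < \<infinity>"
proof -
  have ne: "{1..n} \<noteq> {}" using n_pos by simp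
  note triv = marginal_product_trivial[OF radon_signedD(2)[OF T_hausdorff \<mu>] ne]
  have "(\<integral>\<^sup>+v. (\<integral>\<^sup>+u. ennreal \<bar>J (mix {1..n} u z) (mix G v z)\<bar> \<partial>marginal_product X {{1..n}} (variation T \<mu>))
      \<partial>marginal_product X {{1..n}} (variation T \<mu>)) < \<infinity>"
    using fip z G partition_on_space[OF ne] unfolding FIP_def by blast
  moreover have "(\<integral>\<^sup>+u. ennreal \<bar>J (mix {1..n} u z) w\<bar> \<partial>variation T \<mu>) = (\<integral>\<^sup>+u. ennreal \<bar>J u w\<bar> \<partial>variation T \<mu>)" for w
    by (rule nn_integral_cong) (simp only: space_variation mix_full[OF _ z])
  ultimately show ?thesis unfolding triv by (simp only:)
qed

lemma P_FIPD:
  assumes "P \<in> P_FIP X n J"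
  shows "P \<in> radon_signed T" "FIP X n J P" "tight T (variation T P)" "emeasure (variation T P) S = 1"
    "\<And>\<rho>. partition_on {1..n} \<rho> \<Longrightarrow> integ (marginal_product X \<rho> (variation T P))"
proof -
  show P: "P \<in> radon_signed T" "FIP X n J P" using assms by (simp_all add: P_FIP_def M_FIP_def)
  note r = radon_signedD[OF T_hausdorff P(1)]
  show "tight T (variation T P)" by (rule r(2))
  have "\<And>A. 0 \<le> P A" "P S = 1" using assms by (simp_all add: P_FIP_def)
  then show one: "emeasure (variation T P) S = 1"
    using variation_nonneg[OF r(1), of S] topspace_in_borel_alg[of T] by simp
  show "integ (marginal_product X \<rho> (variation T P))" if "partition_on {1..n} \<rho>" for \<rho>
    by (rule FIP_integ[OF P that]) (simp only: one one_neq_zero not_False_eq_True)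
qed

context
  fixes P assumes P: "P \<in> P_FIP X n J"
begin

lemma delimited_joint:
  assumes \<mu>: "\<mu> \<in> Mn_FIP_delimited X n J P" and \<eta>: "\<eta> \<in> Mn_FIP_delimited X n J P" and z: "z \<in> S" and G: "G \<subseteq> {1..n}"
  shows "(\<integral>\<^sup>+v. (\<integral>\<^sup>+u. ennreal \<bar>J u (mix G v z)\<bar> \<partial>variation T \<mu>) \<partial>variation T \<eta>) < \<infinity>"
proof -
  note p = P_FIPD[OF P]
  have m: "\<mu> \<in> Mn_FIP X n J" "marginally_delimited X n P \<mu>" and e: "\<eta> \<in> Mn_FIP X n J" "marginally_delimited X n P \<eta>"
    using \<mu> \<eta> by (simp_all add: Mn_FIP_delimited_def)
  obtain c d where c: "tame c (variation T \<mu>) (variation T P)" and d: "tame d (variation T \<eta>) (variation T P)"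
    using tame_of_delimited[OF p(3) m(2)] tame_of_delimited[OF p(3) e(2)] by blast
  note t\<mu> = radon_signedD(2)[OF T_hausdorff Mn_FIPD(1)[OF m(1)]]
    and t\<eta> = radon_signedD(2)[OF T_hausdorff Mn_FIPD(1)[OF e(1)]]
  have "(\<integral>\<^sup>+v. (\<integral>\<^sup>+u. ennreal \<bar>J (mix {1..n} u z) (mix G v z)\<bar> \<partial>variation T \<mu>) \<partial>variation T \<eta>) < \<infinity>"
    by (rule pair_finite[OF p(3,4,5) t\<mu> c Mn_FIPD(4)[OF m(1)] t\<eta> d Mn_FIPD(4)[OF e(1)] order_refl G z z])
  moreover have "(\<integral>\<^sup>+u. ennreal \<bar>J (mix {1..n} u z) w\<bar> \<partial>variation T \<mu>) = (\<integral>\<^sup>+u. ennreal \<bar>J u w\<bar> \<partial>variation T \<mu>)" for w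
    by (rule nn_integral_cong) (simp only: space_variation mix_full[OF _ z])
  ultimately show ?thesis by (simp only:)
qed

lemma delimited_identities:
  assumes \<mu>: "\<mu> \<in> Mn_FIP_delimited X n J P" and \<eta>: "\<eta> \<in> Mn_FIP_delimited X n J P" and z: "z \<in> S"
  shows "double_integrable T J \<mu> \<eta>" "double_integrable T (kernel_K n J z) \<mu> \<eta>"
    "double_integral T (\<lambda>u v. (-1) ^ n * J u v) \<mu> \<eta> = double_integral T (kernel_K n J z) \<mu> \<eta>"
    "kernel_embedding T (kernel_K n J z) \<mu> \<in> rkhs_space S (kernel_K n J z)"
    "double_integral T (kernel_K n J z) \<mu> \<eta> =
      rkhs_inner S (kernel_K n J z) (kernel_embedding T (kernel_K n J z) \<mu>) (kernel_embedding T (kernel_K n J z) \<eta>)"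
proof -
  have m: "\<mu> \<in> Mn_FIP X n J" and e: "\<eta> \<in> Mn_FIP X n J" using \<mu> \<eta> by (simp_all add: Mn_FIP_delimited_def)
  note * = energy_identities[OF Mn_FIPD(2,4)[OF m] Mn_FIPD(2,4)[OF e] z delimited_joint[OF \<mu> \<eta> z]]
  show "double_integrable T J \<mu> \<eta>" "double_integrable T (kernel_K n J z) \<mu> \<eta>"
    "double_integral T (\<lambda>u v. (-1) ^ n * J u v) \<mu> \<eta> = double_integral T (kernel_K n J z) \<mu> \<eta>"
    "kernel_embedding T (kernel_K n J z) \<mu> \<in> rkhs_space S (kernel_K n J z)"
    "double_integral T (kernel_K n J z) \<mu> \<eta> =
      rkhs_inner S (kernel_K n J z) (kernel_embedding T (kernel_K n J z) \<mu>) (kernel_embedding T (kernel_K n J z) \<eta>)"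
    by (rule *; assumption)+
qed

text \<open>FIP of \<open>\<nu>\<close> follows from delimitation and integrability in one variable.
  Both of these pass to linear combinations by the triangle inequality, whereas FIP contains mixed
  terms.\<close>

lemma delimitedI:
  assumes "\<nu> \<in> radon_Mn X n" "integ (variation T \<nu>)" "marginally_delimited X n P \<nu>"
  shows "\<nu> \<in> Mn_FIP_delimited X n J P"
proof -
  note p = P_FIPD[OF P]
  have r: "\<nu> \<in> radon_signed T" using assms(1) by (simp add: radon_Mn_def)
  obtain c where c: "tame c (variation T \<nu>) (variation T P)" using tame_of_delimited[OF p(3) assms(3)] by blast
  have "FIP X n J \<nu>" by (rule FIP_of_tame[OF p(3,4,5) r c assms(2)])
  then show ?thesis using assms r by (simp add: Mn_FIP_delimited_def Mn_FIP_def M_FIP_def)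
qed

lemma delimited_lincomb:
  assumes \<mu>: "\<mu> \<in> Mn_FIP_delimited X n J P" and \<eta>: "\<eta> \<in> Mn_FIP_delimited X n J P"
  shows "(\<lambda>A. a * \<mu> A + b * \<eta> A) \<in> Mn_FIP_delimited X n J P"
proof (rule delimitedI)
  have m: "\<mu> \<in> Mn_FIP X n J" "marginally_delimited X n P \<mu>" and e: "\<eta> \<in> Mn_FIP X n J" "marginally_delimited X n P \<eta>"
    using \<mu> \<eta> by (simp_all add: Mn_FIP_delimited_def)
  note M = Mn_FIPD[OF m(1)] and E = Mn_FIPD[OF e(1)]
  show "(\<lambda>A. a * \<mu> A + b * \<eta> A) \<in> radon_Mn X n" by (rule radon_Mn_lincomb[OF M(2) E(2)])
  show "integ (variation T (\<lambda>A. a * \<mu> A + b * \<eta> A))" by (rule integ_lincomb[OF M(1,4) E(1,4)])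
  show "marginally_delimited X n P (\<lambda>A. a * \<mu> A + b * \<eta> A)" by (rule marginally_delimited_lincomb[OF M(1) m(2) E(1) e(2)])
qed

text \<open>The zero measure is written as \<open>0 * P + 0 * P\<close>, so that the facts on linear combinations apply.\<close>

lemma delimited_zero: "(\<lambda>A. 0) \<in> Mn_FIP_delimited X n J P"
proof (rule delimitedI)
  note p = P_FIPD[OF P]
  have r: "(\<lambda>A. 0) \<in> radon_signed T" using radon_signed_lincomb[OF T_hausdorff p(1) p(1), of 0 0] by simp
  then show "(\<lambda>A. 0) \<in> radon_Mn X n" by (simp add: radon_Mn_def)
  show "integ (variation T (\<lambda>A. 0))"
    using integ_lincomb[OF p(1) FIP_integ_variation[OF p(1,2)] p(1) FIP_integ_variation[OF p(1,2)], of 0 0] by simp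
  have "emeasure (marginal X F (variation T (\<lambda>A. 0))) A = 0" if F: "F \<subseteq> {1..n}" and A: "A \<in> sets (borel_alg (PT F))" for F A
  proof -
    let ?A = "{x \<in> S. restrict x F \<in> A}"
    have "emeasure (variation T (\<lambda>A. 0)) S = 0"
      using variation_nonneg[OF radon_signedD(1)[OF T_hausdorff r] order_refl topspace_in_borel_alg] by simp
    moreover have "emeasure (variation T (\<lambda>A. 0)) ?A \<le> emeasure (variation T (\<lambda>A. 0)) S"
      by (rule emeasure_mono) (use topspace_in_borel_alg[of T] in auto)
    ultimately show ?thesis
      using emeasure_marginal[OF F radon_signedD(2)[OF T_hausdorff r] A] by simp
  qed
  then show "marginally_delimited X n P (\<lambda>A. 0)"
    unfolding marginally_delimited_def by (intro exI[of _ 1] conjI allI impI ballI) simp_all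
qed

text \<open>Symmetry and positivity are carried over from the Hilbert space at one base point. For
  linearity the form is rewritten as the integral of the fixed function \<open>?e \<eta>\<close>
  against \<open>\<mu>\<close>, which is linear in the measure.\<close>

lemma delimited_semi_inner_product:
  "semi_inner_product_on (Mn_FIP_delimited X n J P) (double_integral T (\<lambda>u v. (-1) ^ n * J u v))"
proof -
  let ?V = "Mn_FIP_delimited X n J P" and ?B = "double_integral T (\<lambda>u v. (-1) ^ n * J u v)"
  \<comment> \<open>The base point exists because \<open>P\<close> has mass 1, which excludes an
    empty product space.\<close>
  have "S \<noteq> {}" using P_FIPD(4)[OF P] by (metis emeasure_empty zero_neq_one)
  then obtain z where z: "z \<in> S" by blast
  let ?K = "kernel_K n J z"
  let ?e = "kernel_embedding T ?K"
  note K = kernel_K_psd[OF z] kernel_K_cont[OF z]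
  note sip = HK_sip[OF T_hausdorff K]
  have V: "\<mu> \<in> radon_signed T" "integ (variation T \<mu>)" if "\<mu> \<in> ?V" for \<mu>
    using that Mn_FIPD[of \<mu>] by (auto simp: Mn_FIP_delimited_def)
  have sq: "integrable (variation T \<mu>) (\<lambda>x. sqrt (?K x x))" if "\<mu> \<in> ?V" for \<mu>
    by (rule sqrt_kernel_integrable[OF V[OF that] z])
  have in_H: "?e \<mu> \<in> rkhs_space S ?K" if "\<mu> \<in> ?V" for \<mu>
    by (rule delimited_identities(4)[OF that that z])
  have B: "?B \<mu> \<eta> = rkhs_inner S ?K (?e \<mu>) (?e \<eta>)" if "\<mu> \<in> ?V" "\<eta> \<in> ?V" for \<mu> \<eta>
    using delimited_identities(3,5)[OF that z] by simp
  have B': "?B \<mu> \<eta> = signed_integral T \<mu> (?e \<eta>)" if "\<mu> \<in> ?V" "\<eta> \<in> ?V" for \<mu> \<eta>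
    unfolding B[OF that] by (rule kernel_embedding_inner(2)[OF T_hausdorff K V(1)[OF that(1)] sq[OF that(1)] in_H[OF that(2)]])
  have int: "integrable (variation T \<mu>) (?e \<eta>)" if "\<mu> \<in> ?V" "\<eta> \<in> ?V" for \<mu> \<eta>
    by (rule HK_integrable[OF T_hausdorff K in_H[OF that(2)] sq[OF that(1)]])
  have lin: "?B (\<lambda>A. a * \<mu> A + b * \<eta> A) \<zeta> = a * ?B \<mu> \<zeta> + b * ?B \<eta> \<zeta>" if m: "\<mu> \<in> ?V" "\<eta> \<in> ?V" "\<zeta> \<in> ?V" for \<mu> \<eta> \<zeta> a b
  proof -
    have c: "(\<lambda>A. a * \<mu> A + b * \<eta> A) \<in> ?V" by (rule delimited_lincomb[OF m(1,2)])
    show ?thesis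
      unfolding B'[OF c m(3)] B'[OF m(1,3)] B'[OF m(2,3)]
      by (rule signed_integral_add_measure[OF T_hausdorff V(1)[OF m(1)] V(1)[OF m(2)] V(1)[OF c] int[OF m(1,3)] int[OF m(2,3)] int[OF c m(3)]])
  qed
  show ?thesis
    unfolding semi_inner_product_on_def function_subspace_def
  proof (intro conjI ballI allI)
    show "(\<lambda>_. 0) \<in> ?V" by (rule delimited_zero)
    fix \<mu> assume m: "\<mu> \<in> ?V"
    show "(\<lambda>A. a * \<mu> A) \<in> ?V" for a using delimited_lincomb[OF m m, of a 0] by simp
    show "0 \<le> ?B \<mu> \<mu>" unfolding B[OF m m] by (rule sip_nonneg[OF sip in_H[OF m]])
    show "?B (\<lambda>A. a * \<mu> A) \<zeta> = a * ?B \<mu> \<zeta>" if "\<zeta> \<in> ?V" for \<zeta> a using lin[OF m m that, of a 0] by simp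
    fix \<eta> assume e: "\<eta> \<in> ?V"
    show "(\<lambda>A. \<mu> A + \<eta> A) \<in> ?V" using delimited_lincomb[OF m e, of 1 1] by simp
    show "?B \<mu> \<eta> = ?B \<eta> \<mu>" unfolding B[OF m e] B[OF e m] by (rule sip_sym[OF sip in_H[OF m] in_H[OF e]])
    show "?B (\<lambda>A. \<mu> A + \<eta> A) \<zeta> = ?B \<mu> \<zeta> + ?B \<eta> \<zeta>" if "\<zeta> \<in> ?V" for \<zeta> using lin[OF m e that, of 1 1] by simp
  qed
qed

end

lemma Mn_FIP_identities:
  assumes \<mu>: "\<mu> \<in> Mn_FIP X n J" and z: "z \<in> S"
  shows "double_integrable T J \<mu> \<mu>" "double_integrable T (kernel_K n J z) \<mu> \<mu>"
    "double_integral T (\<lambda>u v. (-1) ^ n * J u v) \<mu> \<mu> = double_integral T (kernel_K n J z) \<mu> \<mu>"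
    "kernel_embedding T (kernel_K n J z) \<mu> \<in> rkhs_space S (kernel_K n J z)"
    "double_integral T (kernel_K n J z) \<mu> \<mu> =
      rkhs_inner S (kernel_K n J z) (kernel_embedding T (kernel_K n J z) \<mu>) (kernel_embedding T (kernel_K n J z) \<mu>)"
    "rkhs_inner S (kernel_K n J z) (kernel_embedding T (kernel_K n J z) \<mu>) (kernel_embedding T (kernel_K n J z) \<mu>) \<ge> 0"
proof -
  note m = Mn_FIPD[OF \<mu>]
  note * = energy_identities[OF m(2,4) m(2,4) z FIP_joint[OF m(1,3) z]]
  show "double_integrable T J \<mu> \<mu>" "double_integrable T (kernel_K n J z) \<mu> \<mu>"
    "double_integral T (\<lambda>u v. (-1) ^ n * J u v) \<mu> \<mu> = double_integral T (kernel_K n J z) \<mu> \<mu>"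
    "double_integral T (kernel_K n J z) \<mu> \<mu> =
      rkhs_inner S (kernel_K n J z) (kernel_embedding T (kernel_K n J z) \<mu>) (kernel_embedding T (kernel_K n J z) \<mu>)"
    by (rule *; assumption)+
  show e: "kernel_embedding T (kernel_K n J z) \<mu> \<in> rkhs_space S (kernel_K n J z)"
    by (rule *(4); assumption)
  show "rkhs_inner S (kernel_K n J z) (kernel_embedding T (kernel_K n J z) \<mu>) (kernel_embedding T (kernel_K n J z) \<mu>) \<ge> 0"
    by (rule sip_nonneg[OF HK_sip[OF T_hausdorff kernel_K_psd[OF z] kernel_K_cont[OF z]] e])
qed

end

theorem theorem24:
  fixes X :: "nat \<Rightarrow> 'a topology"
    and n :: nat
    and J :: "(nat \<Rightarrow> 'a) \<Rightarrow> (nat \<Rightarrow> 'a) \<Rightarrow> real"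
  assumes n: "n \<ge> 1"
    and nonempty: "\<And>i. i \<in> {1..n} \<Longrightarrow> topspace (X i) \<noteq> {}"
    and hausdorff: "\<And>i. i \<in> {1..n} \<Longrightarrow> Hausdorff_space (X i)"
    and cont: "continuous_map (prod_topology (prod_space X n) (prod_space X n)) euclideanreal
                 (\<lambda>(x, y). J x y)"
    and pdi: "PDI X n J"
    and zero: "\<And>x y. x \<in> topspace (prod_space X n) \<Longrightarrow> y \<in> topspace (prod_space X n) \<Longrightarrow>
                 \<exists>i\<in>{1..n}. x i = y i \<Longrightarrow> J x y = 0"
  shows
    "(\<forall>\<mu>\<in>Mn_FIP X n J. \<forall>x0\<in>topspace (prod_space X n).
        double_integrable (prod_space X n) J \<mu> \<mu> \<and>
        double_integrable (prod_space X n) (kernel_K n J x0) \<mu> \<mu> \<and>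
        double_integral (prod_space X n) (\<lambda>u v. (-1) ^ n * J u v) \<mu> \<mu> =
          double_integral (prod_space X n) (kernel_K n J x0) \<mu> \<mu> \<and>
        kernel_embedding (prod_space X n) (kernel_K n J x0) \<mu>
          \<in> rkhs_space (topspace (prod_space X n)) (kernel_K n J x0) \<and>
        double_integral (prod_space X n) (kernel_K n J x0) \<mu> \<mu> =
          rkhs_inner (topspace (prod_space X n)) (kernel_K n J x0)
            (kernel_embedding (prod_space X n) (kernel_K n J x0) \<mu>)
            (kernel_embedding (prod_space X n) (kernel_K n J x0) \<mu>) \<and>
        rkhs_inner (topspace (prod_space X n)) (kernel_K n J x0)
            (kernel_embedding (prod_space X n) (kernel_K n J x0) \<mu>)
            (kernel_embedding (prod_space X n) (kernel_K n J x0) \<mu>) \<ge> 0) \<and>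
     (\<forall>P\<in>P_FIP X n J.
        (\<forall>\<mu>\<in>Mn_FIP_delimited X n J P. \<forall>\<eta>\<in>Mn_FIP_delimited X n J P.
           double_integrable (prod_space X n) J \<mu> \<eta>) \<and>
        semi_inner_product_on (Mn_FIP_delimited X n J P)
          (double_integral (prod_space X n) (\<lambda>u v. (-1) ^ n * J u v)) \<and>
        (\<forall>\<mu>\<in>Mn_FIP_delimited X n J P. \<forall>\<eta>\<in>Mn_FIP_delimited X n J P.
         \<forall>x0\<in>topspace (prod_space X n).
           double_integrable (prod_space X n) (kernel_K n J x0) \<mu> \<eta> \<and>
           double_integral (prod_space X n) (\<lambda>u v. (-1) ^ n * J u v) \<mu> \<eta> =
             double_integral (prod_space X n) (kernel_K n J x0) \<mu> \<eta> \<and>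
           kernel_embedding (prod_space X n) (kernel_K n J x0) \<mu>
             \<in> rkhs_space (topspace (prod_space X n)) (kernel_K n J x0) \<and>
           kernel_embedding (prod_space X n) (kernel_K n J x0) \<eta>
             \<in> rkhs_space (topspace (prod_space X n)) (kernel_K n J x0) \<and>
           double_integral (prod_space X n) (kernel_K n J x0) \<mu> \<eta> =
             rkhs_inner (topspace (prod_space X n)) (kernel_K n J x0)
               (kernel_embedding (prod_space X n) (kernel_K n J x0) \<mu>)
               (kernel_embedding (prod_space X n) (kernel_K n J x0) \<eta>)))"
proof -
  interpret pdi_kernel X n J
    using n hausdorff cont pdi zero by unfold_locales
  \<comment> \<open>Integrability of \<open>J\<close> mentions no base point, but it is derived
    together with the identities for one, so some point has to be at hand.\<close>
  have S: "topspace (prod_space X n) \<noteq> {}" using nonempty by (auto simp: PiE_eq_empty_iff)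
  show ?thesis
  proof (intro conjI ballI)
    fix \<mu> x0 assume "\<mu> \<in> Mn_FIP X n J" "x0 \<in> topspace (prod_space X n)"
    note * = Mn_FIP_identities[OF this]
    show "double_integrable (prod_space X n) J \<mu> \<mu>"
      "double_integrable (prod_space X n) (kernel_K n J x0) \<mu> \<mu>"
      "double_integral (prod_space X n) (\<lambda>u v. (-1) ^ n * J u v) \<mu> \<mu> = double_integral (prod_space X n) (kernel_K n J x0) \<mu> \<mu>"
      "kernel_embedding (prod_space X n) (kernel_K n J x0) \<mu> \<in> rkhs_space (topspace (prod_space X n)) (kernel_K n J x0)"
      "double_integral (prod_space X n) (kernel_K n J x0) \<mu> \<mu> =
          rkhs_inner (topspace (prod_space X n)) (kernel_K n J x0)
            (kernel_embedding (prod_space X n) (kernel_K n J x0) \<mu>)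
            (kernel_embedding (prod_space X n) (kernel_K n J x0) \<mu>)"
      "rkhs_inner (topspace (prod_space X n)) (kernel_K n J x0)
            (kernel_embedding (prod_space X n) (kernel_K n J x0) \<mu>)
            (kernel_embedding (prod_space X n) (kernel_K n J x0) \<mu>) \<ge> 0"
      by (rule *)+
  next
    fix P \<mu> \<eta> assume "P \<in> P_FIP X n J" "\<mu> \<in> Mn_FIP_delimited X n J P" "\<eta> \<in> Mn_FIP_delimited X n J P"
    then show "double_integrable (prod_space X n) J \<mu> \<eta>"
      using S delimited_identities(1) by blast
  next
    fix P assume "P \<in> P_FIP X n J"
    then show "semi_inner_product_on (Mn_FIP_delimited X n J P) (double_integral (prod_space X n) (\<lambda>u v. (-1) ^ n * J u v))"
      by (rule delimited_semi_inner_product)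
  next
    fix P \<mu> \<eta> x0
    assume a: "P \<in> P_FIP X n J" "\<mu> \<in> Mn_FIP_delimited X n J P" "\<eta> \<in> Mn_FIP_delimited X n J P" "x0 \<in> topspace (prod_space X n)"
    note * = delimited_identities[OF a]
    show "double_integrable (prod_space X n) (kernel_K n J x0) \<mu> \<eta>"
      "double_integral (prod_space X n) (\<lambda>u v. (-1) ^ n * J u v) \<mu> \<eta> = double_integral (prod_space X n) (kernel_K n J x0) \<mu> \<eta>"
      "kernel_embedding (prod_space X n) (kernel_K n J x0) \<mu> \<in> rkhs_space (topspace (prod_space X n)) (kernel_K n J x0)"
      "double_integral (prod_space X n) (kernel_K n J x0) \<mu> \<eta> =
             rkhs_inner (topspace (prod_space X n)) (kernel_K n J x0)
               (kernel_embedding (prod_space X n) (kernel_K n J x0) \<mu>)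
               (kernel_embedding (prod_space X n) (kernel_K n J x0) \<eta>)"
      by (rule *)+
    show "kernel_embedding (prod_space X n) (kernel_K n J x0) \<eta> \<in> rkhs_space (topspace (prod_space X n)) (kernel_K n J x0)"
      by (rule delimited_identities(4)[OF a(1,3,3,4)])
  qed
qed

end
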